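(* Let $(X,\omega)$ be a complex Hermitian manifold with $\dim_{\mathbb C}X=n\ge2$. For any $C^\infty$ function $\eta$ on $X$ such that $\eta>0$ or $\eta<0$ and any $k\in\{0,\dots,2n\}$, the following refined $\eta$-Bochner-Kodaira-Nakano identity holds on the $C^\infty$ $k$-forms on $X$: $$\Delta_\eta=\big[\overline D_{-\eta}+\overline\tau_{-\eta},\ \overline D_{-\eta}^\star+\overline\tau_{-\eta}^\star\big]+T_\omega^{(\eta)}+i\,\big[[D_\eta,\overline D_{-\eta}],\Lambda\big]+n\,\Big[\overline D_{-\eta}+\overline\tau_{-\eta},\ \tfrac1\eta(\overline d_{-\eta}\eta\wedge\cdot)^\star\Big]-n\,\Big[D_\eta,\ \tfrac1\eta(d_\eta\eta\wedge\cdot)^\star\Big],$$ where $T_\omega^{(\eta)}$ is the zero-th order operator $$T_\omega^{(\eta)}:=-\frac i2\,\big[\Lambda,[\Lambda,\,D_\eta\overline D_{-\eta}\omega\wedge\cdot\,]\big]-\big[\overline D_{-\eta}\omega\wedge\cdot\,,\ (\overline D_{-\eta}\omega\wedge\cdot)^\star\big].$$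
   Context: $\eta$ is real-valued and $\eta>0$ (resp. $\eta<0$) means at every point. The Hermitian metric is identified with its positive definite $(1,1)$-form $\omega$, normalized so that $\omega=i\sum_j\zeta_j\wedge\bar\zeta_j$ for a local orthonormal coframe of $(1,0)$-forms. $\star$ denotes the formal adjoint for the $L^2$-inner product induced by $\omega$ (pointwise adjoint for zero-order operators); $\Lambda$ is the adjoint of $L=\omega\wedge\cdot$; $[A,B]=AB-(-1)^{ab}BA$ is the graded commutator of operators of degrees $a,b$. The conjugate of an operator $P$ is $\overline P u=\overline{P\bar u}$. $\theta_\eta$ is the automorphism of forms acting on $(p,q)$-forms as multiplication by $\eta^p$ (extended linearly to $k$-forms), and $D_\eta:=\theta_\eta d\theta_\eta^{-1}$; $D_{-\eta}$ is the same with $\eta$ replaced by $-\eta$, and $\overline D_{-\eta}$ is the conjugate of $D_{-\eta}$. Explicitly, on $(p,q)$-forms, $$D_\eta=\eta\partial+\bar\partial-p\,\partial\eta\wedge\cdot-\tfrac p\eta\,\bar\partial\eta\wedge\cdot,\qquad \overline D_{-\eta}=\partial-\eta\bar\partial-\tfrac q\eta\,\partial\eta\wedge\cdot+q\,\bar\partial\eta\wedge\cdot.$$ Also $d_\eta=\eta\partial+\bar\partial$ and $\overline d_{-\eta}=\partial-\eta\bar\partial$, so $d_\eta\eta=\eta\,\partial\eta+\bar\partial\eta$ and $\overline d_{-\eta}\eta=\partial\eta-\eta\,\bar\partial\eta$. The $\eta$-torsion operator is $\tau_\eta=[\Lambda,D_\eta\omega\wedge\cdot]$, and $\overline\tau_{-\eta}=[\Lambda,\overline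 D_{-\eta}\omega\wedge\cdot]$ is the conjugate of $\tau_{-\eta}$. Finally $\Delta_\eta=D_\eta D_\eta^\star+D_\eta^\star D_\eta$. *)

theory Defs
  imports "HOL-Analysis.Analysis" "HOL-Library.Function_Algebras"
begin

section \<open>Smooth maps\<close>

primrec Ck_on :: "nat \<Rightarrow> ('a::real_normed_vector \<Rightarrow> 'b::real_normed_vector) \<Rightarrow> 'a set \<Rightarrow> bool" where
  "Ck_on 0 f S \<longleftrightarrow> continuous_on S f"
| "Ck_on (Suc k) f S \<longleftrightarrow> (\<forall>x\<in>S. f differentiable (at x)) \<and>
     (\<forall>v. Ck_on k (\<lambda>x. frechet_derivative f (at x) v) S)"

text \<open>Only used for finite-dimensional domains and open sets, where continuity of all iterated
  directional derivatives is the usual notion.\<close>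

definition smooth_on :: "'a::real_normed_vector set \<Rightarrow> ('a \<Rightarrow> 'b::real_normed_vector) \<Rightarrow> bool" where
  "smooth_on S f \<longleftrightarrow> (\<forall>k. Ck_on k f S)"

definition holomorphic_map :: "(complex^'m) set \<Rightarrow> (complex^'m \<Rightarrow> complex^'n) \<Rightarrow> bool" where
  "holomorphic_map S f \<longleftrightarrow>
     (\<forall>z\<in>S. \<exists>f'. (f has_derivative f') (at z) \<and> (\<forall>a v. f' (a *s v) = a *s f' v))"


section \<open>Complex manifolds\<close>

text \<open>The dimension is \<open>CARD('n)\<close>. A chart is a pair of a domain and a coordinate map, which matters
  only on the domain. The manifold is the union of the chart domains, an open subset of a
  second countable Hausdorff space.\<close>

type_synonym ('a, 'n) chart = "'a set \<times> ('a \<Rightarrow> (complex, 'n) vec)"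

abbreviation chart_inv :: "('a, 'n) chart \<Rightarrow> (complex, 'n) vec \<Rightarrow> 'a" where
  "chart_inv c \<equiv> inv_into (fst c) (snd c)"

definition complex_chart :: "('a::topological_space, 'n::finite) chart \<Rightarrow> bool" where
  "complex_chart c \<longleftrightarrow> open (fst c) \<and> open (snd c ` fst c) \<and>
     homeomorphism (fst c) (snd c ` fst c) (snd c) (chart_inv c)"

definition transition ::
    "('a, 'n) chart \<Rightarrow> ('a, 'n) chart \<Rightarrow> (complex, 'n) vec \<Rightarrow> (complex, 'n) vec" where
  "transition c c' = snd c' \<circ> chart_inv c"

definition complex_atlas :: "('a::topological_space, 'n::finite) chart set \<Rightarrow> bool" where
  "complex_atlas A \<longleftrightarrow> (\<forall>c\<in>A. complex_chart c) \<and>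
     (\<forall>c\<in>A. \<forall>c'\<in>A. holomorphic_map (snd c ` (fst c \<inter> fst c')) (transition c c'))"

definition carrier :: "('a, 'n) chart set \<Rightarrow> 'a set" where
  "carrier A = (\<Union>c\<in>A. fst c)"

definition smooth_fun :: "('a::topological_space, 'n::finite) chart set \<Rightarrow> ('a \<Rightarrow> real) \<Rightarrow> bool" where
  "smooth_fun A f \<longleftrightarrow> (\<forall>c\<in>A. smooth_on (snd c ` fst c) (f \<circ> chart_inv c))"


section \<open>Exterior algebra\<close>

text \<open>An element of the full exterior algebra of complex-valued real-alternating forms on
  \<open>\<complex>\<^sup>n\<close> (the real tangent space, with complex structure \<open>v \<mapsto> \<i> *s v\<close>) is a function of argument
  lists; its component of degree \<open>k\<close> is the restriction to lists of length \<open>k\<close>.\<close>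

type_synonym 'n alt = "(complex, 'n) vec list \<Rightarrow> complex"

definition alternating :: "'n::finite alt \<Rightarrow> bool" where
  "alternating \<alpha> \<longleftrightarrow> (\<forall>vs i. i < length vs \<longrightarrow> linear (\<lambda>v. \<alpha> (vs[i := v]))) \<and>
     (\<forall>vs. \<not> distinct vs \<longrightarrow> \<alpha> vs = 0)"

text \<open>A sum over shuffles, without factorials:
  \<open>(\<alpha> \<and> \<beta>)(v, w) = \<alpha> v * \<beta> w - \<alpha> w * \<beta> v\<close> in degree one.\<close>

definition alt_wedge :: "'n::finite alt \<Rightarrow> 'n alt \<Rightarrow> 'n alt" where
  "alt_wedge \<alpha> \<beta> vs = (\<Sum>I\<in>Pow {..<length vs}.
     (-1) ^ card {(i, j). i \<in> I \<and> j \<in> {..<length vs} - I \<and> j < i} *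
     \<alpha> (nths vs I) * \<beta> (nths vs (- I)))"

text \<open>The component of bidegree \<open>(p, q)\<close>: extend \<open>\<alpha>\<close> complex-multilinearly to the complexified
  tangent space, split every argument as \<open>v = (v - \<i> J v) / 2 + (v + \<i> J v) / 2\<close> into parts of type
  \<open>(1,0)\<close> and \<open>(0,1)\<close>, and keep the terms with \<open>(1,0)\<close>-parts in exactly \<open>p\<close> slots \<open>S\<close>. The set
  \<open>T\<close> collects the slots in which the summand containing \<open>J v\<close> is taken.\<close>

definition type_part :: "nat \<Rightarrow> nat \<Rightarrow> 'n::finite alt \<Rightarrow> 'n alt" where
  "type_part p q \<alpha> vs = (if length vs = p + q
     then (\<Sum>S\<in>{S. S \<subseteq> {..<p + q} \<and> card S = p}. \<Sum>T\<in>Pow {..<p + q}.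
       (\<Prod>t\<in>T. if t \<in> S then - \<i> else \<i>) *
       \<alpha> (map (\<lambda>t. if t \<in> T then \<i> *s (vs ! t) else vs ! t) [0..<p + q])) / 2 ^ (p + q)
     else 0)"


section \<open>Differential forms\<close>

text \<open>\<open>u c x vs\<close> is the value of \<open>u\<close> at the point \<open>x\<close> on the tangent vectors whose components in
  the chart \<open>c\<close> are \<open>vs\<close>. Thus a form is a family of local representations compatible under
  pullback by the transition maps, extended by zero outside the atlas. Forms may be inhomogeneous.\<close>

type_synonym ('a, 'n) form = "('a, 'n) chart \<Rightarrow> 'a \<Rightarrow> 'n alt"

definition is_form :: "('a::topological_space, 'n::finite) chart set \<Rightarrow> ('a, 'n) form \<Rightarrow> bool" where
  "is_form A u \<longleftrightarrow>
     (\<forall>c x. \<not> (c \<in> A \<and> x \<in> fst c) \<longrightarrow> u c x = (\<lambda>_. 0)) \<and>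
     (\<forall>c\<in>A. \<forall>x\<in>fst c. alternating (u c x)) \<and>
     (\<forall>c\<in>A. \<forall>c'\<in>A. \<forall>x\<in>fst c \<inter> fst c'. \<forall>vs.
        u c x vs = u c' x (map (frechet_derivative (transition c c') (at (snd c x))) vs))"

definition smooth_form :: "('a::topological_space, 'n::finite) chart set \<Rightarrow> ('a, 'n) form \<Rightarrow> bool" where
  "smooth_form A u \<longleftrightarrow> is_form A u \<and>
     (\<forall>c\<in>A. \<forall>vs. smooth_on (snd c ` fst c) (\<lambda>z. u c (chart_inv c z) vs))"

definition has_degree :: "nat \<Rightarrow> ('a, 'n) form \<Rightarrow> bool" where
  "has_degree k u \<longleftrightarrow> (\<forall>c x vs. length vs \<noteq> k \<longrightarrow> u c x vs = 0)"

definition compact_support ::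
    "('a::topological_space, 'n::finite) chart set \<Rightarrow> ('a, 'n) form \<Rightarrow> bool" where
  "compact_support A u \<longleftrightarrow>
     (\<exists>K. compact K \<and> K \<subseteq> carrier A \<and> (\<forall>c x. x \<notin> K \<longrightarrow> u c x = (\<lambda>_. 0)))"

definition form_of_fun :: "('a, 'n) chart set \<Rightarrow> ('a \<Rightarrow> real) \<Rightarrow> ('a, 'n) form" where
  "form_of_fun A f = (\<lambda>c x vs. if c \<in> A \<and> x \<in> fst c \<and> vs = [] then of_real (f x) else 0)"


section \<open>Operators on forms\<close>

text \<open>Sums and differences of operators are the pointwise ones of function spaces.\<close>

type_synonym ('a, 'n) operator = "('a, 'n) form \<Rightarrow> ('a, 'n) form"

definition scale_op :: "('a \<Rightarrow> complex) \<Rightarrow> ('a, 'n) operator \<Rightarrow> ('a, 'n) operator"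
    (infixr "\<odot>" 75) where
  "f \<odot> P = (\<lambda>u c x vs. f x * P u c x vs)"

text \<open>The graded commutator of operators \<open>P\<close>, \<open>Q\<close> of degrees \<open>a\<close>, \<open>b\<close>.\<close>

definition gcomm :: "int \<Rightarrow> int \<Rightarrow> ('a, 'n) operator \<Rightarrow> ('a, 'n) operator \<Rightarrow> ('a, 'n) operator" where
  "gcomm a b P Q = (P \<circ> Q) - (\<lambda>_. (-1) powi (a * b)) \<odot> (Q \<circ> P)"

definition conj_form :: "('a, 'n) form \<Rightarrow> ('a, 'n) form" where
  "conj_form u = (\<lambda>c x vs. cnj (u c x vs))"

definition conj_op :: "('a, 'n) operator \<Rightarrow> ('a, 'n) operator" where
  "conj_op P u = conj_form (P (conj_form u))"

definition wedge_op :: "('a, 'n::finite) form \<Rightarrow> ('a, 'n) operator" where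
  "wedge_op \<alpha> u = (\<lambda>c x. alt_wedge (\<alpha> c x) (u c x))"

definition form_type_part :: "nat \<Rightarrow> nat \<Rightarrow> ('a, 'n::finite) operator" where
  "form_type_part p q u = (\<lambda>c x. type_part p q (u c x))"

definition ext_d :: "('a, 'n::finite) operator" where
  "ext_d u = (\<lambda>c x vs. if x \<in> fst c
     then \<Sum>i<length vs. (-1) ^ i *
       frechet_derivative (\<lambda>z. u c (chart_inv c z) (take i vs @ drop (Suc i) vs)) (at (snd c x)) (vs ! i)
     else 0)"

text \<open>On \<open>(p, q)\<close>-forms, \<open>\<partial>\<close> and \<open>\<partial>\<close>-bar are the parts of \<open>d\<close> of bidegree \<open>(p + 1, q)\<close> and
  \<open>(p, q + 1)\<close>. Below, \<open>p + q + 1 = length vs\<close>.\<close>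

definition del :: "('a, 'n::finite) operator" where
  "del u = (\<lambda>c x vs. \<Sum>p<length vs. let q = length vs - Suc p in
     form_type_part (Suc p) q (ext_d (form_type_part p q u)) c x vs)"

definition delbar :: "('a, 'n::finite) operator" where
  "delbar u = (\<lambda>c x vs. \<Sum>p<length vs. let q = length vs - Suc p in
     form_type_part p (Suc q) (ext_d (form_type_part p q u)) c x vs)"

definition theta :: "('a \<Rightarrow> real) \<Rightarrow> ('a, 'n::finite) operator" where
  "theta \<eta> u = (\<lambda>c x vs. \<Sum>p\<le>length vs.
     of_real (\<eta> x) ^ p * form_type_part p (length vs - p) u c x vs)"

text \<open>The inverse of \<open>theta \<eta>\<close> is \<open>theta (1 / \<eta>)\<close>.\<close>

definition D_eta :: "('a \<Rightarrow> real) \<Rightarrow> ('a, 'n::finite) operator" where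
  "D_eta \<eta> = theta \<eta> \<circ> ext_d \<circ> theta (\<lambda>x. 1 / \<eta> x)"

definition Dbar_minus_eta :: "('a \<Rightarrow> real) \<Rightarrow> ('a, 'n::finite) operator" where
  "Dbar_minus_eta \<eta> = conj_op (D_eta (\<lambda>x. - \<eta> x))"

definition d_eta :: "('a \<Rightarrow> real) \<Rightarrow> ('a, 'n::finite) operator" where
  "d_eta \<eta> = (\<lambda>x. of_real (\<eta> x)) \<odot> del + delbar"

definition dbar_minus_eta :: "('a \<Rightarrow> real) \<Rightarrow> ('a, 'n::finite) operator" where
  "dbar_minus_eta \<eta> = del - (\<lambda>x. of_real (\<eta> x)) \<odot> delbar"


section \<open>Hermitian metrics and formal adjoints\<close>

text \<open>If \<open>\<omega> = \<i> (\<Sum>j. \<zeta>\<^sub>j \<and> cnj \<zeta>\<^sub>j)\<close> then \<open>\<omega>(v, J v) = 2 (\<Sum>j. |\<zeta>\<^sub>j v|\<^sup>2)\<close>.\<close>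

definition hermitian_manifold ::
    "('a::{t2_space,second_countable_topology}, 'n::finite) chart set \<Rightarrow> ('a, 'n) form \<Rightarrow> bool" where
  "hermitian_manifold A \<omega> \<longleftrightarrow> complex_atlas A \<and> smooth_form A \<omega> \<and>
     form_type_part 1 1 \<omega> = \<omega> \<and> conj_form \<omega> = \<omega> \<and>
     (\<forall>c\<in>A. \<forall>x\<in>fst c. \<forall>v. v \<noteq> 0 \<longrightarrow> 0 < Re (\<omega> c x [v, \<i> *s v]))"

text \<open>A real orthonormal basis for the Riemannian metric \<open>g(v, w) = \<omega>(v, J w)\<close>. If
  \<open>\<zeta>\<^sub>1, \<dots>, \<zeta>\<^sub>n\<close> is a coframe as above, \<open>\<surd>2 Re \<zeta>\<^sub>j, \<surd>2 Im \<zeta>\<^sub>j\<close> is a \<open>g\<close>-orthonormal real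
  coframe, so that the inner product on forms induced by \<open>g\<close> is the one for which the
  \<open>\<zeta>\<^sub>I \<and> cnj \<zeta>\<^sub>J\<close> are orthonormal.\<close>

definition orthonormal_frame ::
    "('a, 'n::finite) form \<Rightarrow> ('a, 'n) chart \<Rightarrow> 'a \<Rightarrow> (complex^'n) list \<Rightarrow> bool" where
  "orthonormal_frame \<omega> c x fs \<longleftrightarrow> length fs = 2 * CARD('n) \<and>
     (\<forall>a<length fs. \<forall>b<length fs. \<omega> c x [fs ! a, \<i> *s (fs ! b)] = (if a = b then 1 else 0))"

definition pointwise_inner :: "('a, 'n::finite) chart set \<Rightarrow> ('a, 'n) form \<Rightarrow>
    ('a, 'n) form \<Rightarrow> ('a, 'n) form \<Rightarrow> 'a \<Rightarrow> complex" where
  "pointwise_inner A \<omega> u v x =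
     (let c = (SOME c. c \<in> A \<and> x \<in> fst c); fs = (SOME fs. orthonormal_frame \<omega> c x fs)
      in \<Sum>I\<in>Pow {..<2 * CARD('n)}. u c x (nths fs I) * cnj (v c x (nths fs I)))"

text \<open>If \<open>\<omega> = \<i> (\<Sum>j k. h\<^sub>j\<^sub>k dz\<^sub>j \<and> cnj dz\<^sub>k)\<close>, the volume form \<open>\<omega>\<^sup>n / n!\<close> is \<open>2\<^sup>n det h\<close> times the
  Lebesgue measure of \<open>\<complex>\<^sup>n\<close>. The matrix below is \<open>2 h\<close>.\<close>

definition volume_density :: "('a, 'n::finite) form \<Rightarrow> ('a, 'n) chart \<Rightarrow> 'a \<Rightarrow> real" where
  "volume_density \<omega> c x = Re (det (\<chi> j k.
     \<omega> c x [axis j 1, axis k \<i>] - \<i> * \<omega> c x [axis j 1, axis k 1]))"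

definition volume_measure ::
    "('a::topological_space, 'n::finite) chart set \<Rightarrow> ('a, 'n) form \<Rightarrow> 'a measure" where
  "volume_measure A \<omega> = (THE \<mu>. sets \<mu> = sets (restrict_space borel (carrier A)) \<and>
     (\<forall>c\<in>A. \<forall>E\<in>sets \<mu>. E \<subseteq> fst c \<longrightarrow>
        emeasure \<mu> E = (\<integral>\<^sup>+ z\<in>snd c ` E. ennreal (volume_density \<omega> c (chart_inv c z)) \<partial>lborel)))"

definition l2_inner :: "('a::topological_space, 'n::finite) chart set \<Rightarrow> ('a, 'n) form \<Rightarrow>
    ('a, 'n) form \<Rightarrow> ('a, 'n) form \<Rightarrow> complex" where
  "l2_inner A \<omega> u v = (LINT x|volume_measure A \<omega>. pointwise_inner A \<omega> u v x)"

definition formal_adjoint :: "('a::topological_space, 'n::finite) chart set \<Rightarrow> ('a, 'n) form \<Rightarrow>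
    ('a, 'n) operator \<Rightarrow> ('a, 'n) operator" where
  "formal_adjoint A \<omega> P v = (THE w. smooth_form A w \<and>
     (\<forall>u. smooth_form A u \<and> compact_support A u \<longrightarrow>
        l2_inner A \<omega> (P u) v = l2_inner A \<omega> u w))"


section \<open>Operators of the Hermitian manifold\<close>

definition Lambda :: "('a::topological_space, 'n::finite) chart set \<Rightarrow> ('a, 'n) form \<Rightarrow>
    ('a, 'n) operator" where
  "Lambda A \<omega> = formal_adjoint A \<omega> (wedge_op \<omega>)"

definition taubar_minus_eta :: "('a::topological_space, 'n::finite) chart set \<Rightarrow> ('a, 'n) form \<Rightarrow>
    ('a \<Rightarrow> real) \<Rightarrow> ('a, 'n) operator" where
  "taubar_minus_eta A \<omega> \<eta> = gcomm (-2) 3 (Lambda A \<omega>) (wedge_op (Dbar_minus_eta \<eta> \<omega>))"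

definition Delta_eta :: "('a::topological_space, 'n::finite) chart set \<Rightarrow> ('a, 'n) form \<Rightarrow>
    ('a \<Rightarrow> real) \<Rightarrow> ('a, 'n) operator" where
  "Delta_eta A \<omega> \<eta> =
     (D_eta \<eta> \<circ> formal_adjoint A \<omega> (D_eta \<eta>)) + (formal_adjoint A \<omega> (D_eta \<eta>) \<circ> D_eta \<eta>)"

definition T_eta :: "('a::topological_space, 'n::finite) chart set \<Rightarrow> ('a, 'n) form \<Rightarrow>
    ('a \<Rightarrow> real) \<Rightarrow> ('a, 'n) operator" where
  "T_eta A \<omega> \<eta> =
     (\<lambda>_. - \<i> / 2) \<odot> gcomm (-2) 2 (Lambda A \<omega>)
        (gcomm (-2) 4 (Lambda A \<omega>) (wedge_op (D_eta \<eta> (Dbar_minus_eta \<eta> \<omega>))))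
     - gcomm 3 (-3) (wedge_op (Dbar_minus_eta \<eta> \<omega>))
        (formal_adjoint A \<omega> (wedge_op (Dbar_minus_eta \<eta> \<omega>)))"

end

theory Submission
 imports Defs "HOL-Complex_Analysis.Cauchy_Integral_Formula"
begin

text \<open>Write \<open>B\<close> for the conjugate of \<open>D\<^sub>-\<^sub>\<eta>\<close>, \<open>\<gamma> = B\<omega>\<close>, \<open>\<gamma>' = D\<^sub>\<eta>\<omega>\<close>, \<open>ad = [\<Lambda>, \<cdot>]\<close> and
\<open>b\<close> for the one-form \<open>(1/\<eta>) conj(d\<^sub>-\<^sub>\<eta>) \<eta>\<close>. In a chart, the divergence of \<open>det(h) \<langle>e\<^sub>j \<and> u, v\<rangle>\<close>, where
\<open>e\<^sub>j\<close> is the conjugate of \<open>d\<^sub>-\<^sub>\<eta>\<close> applied to the \<open>j\<close>-th real coordinate, yields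
\<open>B\<^sup>* = i[\<Lambda>, D\<^sub>\<eta>] + (i/2) ad\<^sup>2(\<gamma>' \<and> \<cdot>) - n (b \<and> \<cdot>)\<^sup>*\<close>; no normal coordinates are needed. Replacing \<open>\<eta>\<close> by
\<open>-\<eta>\<close> and conjugating gives the adjoint of \<open>D\<^sub>\<eta>\<close>. Pointwise \<open>(\<gamma> \<and> \<cdot>)\<^sup>* = (i/6) ad\<^sup>3(\<gamma>' \<and> \<cdot>)\<close>, and
\<open>[\<Lambda>, \<omega> \<and> \<cdot>] = n - degree\<close> turns this into \<open>[\<Lambda>, \<gamma> \<and> \<cdot>]\<^sup>* = -(i/2) ad\<^sup>2(\<gamma>' \<and> \<cdot>)\<close>, which cancels the torsion
term of \<open>B\<^sup>*\<close>. Since \<open>\<gamma> \<and> \<cdot> = [B, \<omega> \<and> \<cdot>]\<close>, one also finds \<open>ad\<^sup>2(D\<^sub>\<eta>) = 2i (\<gamma> \<and> \<cdot>)\<^sup>*\<close>. The identity is then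
an instance of the graded Jacobi identity, with \<open>[D\<^sub>\<eta>, \<gamma> \<and> \<cdot>] = D\<^sub>\<eta>\<gamma> \<and> \<cdot>\<close>.\<close>

section \<open>Calculus of smooth maps\<close>

text \<open>The measure and every adjoint in the statement are definite descriptions. They become
  usable only after the measure is shown to exist and test forms are shown to separate smooth forms,
  so integration on the manifold has to be developed first. Their values away from smooth forms are
  unknown; hence operator identities are always applied to a smooth form. What lets \<Lambda> relate
  D to the adjoint of B is a relation between covectors. Commuting \<Lambda> with multiplication by
  a covector \<open>a\<close> contracts with a o J, and the twisted differentials of a real
  coordinate belonging to D and to B are exchanged, up to -i, by composition with J and conjugation.
  The constant n has a single source, [\<Lambda>, \<omega> \<and> .] = n - (p + q). In the
  contraction with the dual of b, the commutator of \<Lambda> and D leaves p, the \<omega>-part of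
  the torsion term leaves n - (p + q), and the zero-order part of B demands -q; the term with n
  removes the difference.\<close>

abbreviation fder :: "('a::real_normed_vector => 'b::real_normed_vector) => 'a => 'a => 'b" where
 "fder f x v \<equiv> frechet_derivative f (at x) v"

lemma frechet_derivative_cong_open:
 assumes "open S" "x \<in> S" "\<And>y. y \<in> S ==> f y = g y"
 shows "frechet_derivative f (at x) = frechet_derivative g (at x)"
proof -
 have "(f has_derivative D) (at x) \<longleftrightarrow> (g has_derivative D) (at x)" for D
  using assms has_derivative_transform_within_open by (metis (no_types, lifting))
 then show ?thesis
  unfolding frechet_derivative_def by simp
qed

lemma fder_works: "f differentiable (at x) ==> (f has_derivative fder f x) (at x)"
 by (rule frechet_derivative_works[THEN iffD1])

lemma differentiable_cong_open:
 assumes "open S" "x \<in> S" "\<And>y. y \<in> S ==> f y = g y"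
 shows "f differentiable (at x) \<longleftrightarrow> g differentiable (at x)"
 unfolding differentiable_def
 using assms has_derivative_transform_within_open by (metis (no_types, lifting))

lemma Ck_on_cong:
 assumes "open S" "\<And>y. y \<in> S ==> f y = g y"
 shows "Ck_on k f S \<longleftrightarrow> Ck_on k g S"
 using assms(2)
proof (induction k arbitrary: f g)
 case 0
 then show ?case by (simp cong: continuous_on_cong)
next
 case (Suc k)
 have "Ck_on k (\<lambda>x. fder f x v) S \<longleftrightarrow> Ck_on k (\<lambda>x. fder g x v) S" for v
  by (rule Suc.IH) (metis frechet_derivative_cong_open Suc.prems assms(1))
 moreover have "f differentiable (at x) \<longleftrightarrow> g differentiable (at x)" if "x \<in> S" for x
  by (rule differentiable_cong_open[OF assms(1) that Suc.prems])
 ultimately show ?case by simp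
qed

lemma smooth_on_cong:
 assumes "open S" "\<And>y. y \<in> S ==> f y = g y"
 shows "smooth_on S f \<longleftrightarrow> smooth_on S g"
 unfolding smooth_on_def using Ck_on_cong[OF assms] by auto

lemma Ck_on_subset: "Ck_on k f S ==> T \<subseteq> S ==> Ck_on k f T"
 by (induction k arbitrary: f) (auto intro: continuous_on_subset)

lemma smooth_on_subset: "smooth_on S f ==> T \<subseteq> S ==> smooth_on T f"
 unfolding smooth_on_def using Ck_on_subset by blast

text \<open>Bump functions and cutoffs are given by different formulas on overlapping open sets, so
  smoothness has to be checked on neighbourhoods. The directional derivatives inherit the local
  hypothesis, which drives the induction.\<close>

lemma Ck_on_local:
 assumes "\<And>x. x \<in> S ==> \<exists>T. open T \<and> x \<in> T \<and> Ck_on k f (S \<inter> T)"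
 shows "Ck_on k f S"
 using assms
proof (induction k arbitrary: f)
 case 0
 have "continuous (at x within S) f" if x: "x \<in> S" for x
 proof -
  obtain T where T: "open T" "x \<in> T" "continuous_on (S \<inter> T) f"
   using 0 x by auto
  then have "continuous (at x within S \<inter> T) f"
   using x by (simp add: continuous_on_eq_continuous_within)
  moreover have "at x within S \<inter> T = at x within S"
   by (rule at_within_nhd[OF T(2,1)]) auto
  ultimately show ?thesis by simp
 qed
 then show ?case
  by (simp add: continuous_on_eq_continuous_within)
next
 case (Suc k)
 have "Ck_on k (\<lambda>x. fder f x v) S" for v
  by (rule Suc.IH) (use Suc.prems Ck_on.simps(2) in metis)
 moreover have "f differentiable (at x)" if "x \<in> S" for x
  using Suc.prems[OF that] that by auto
 ultimately show ?case by simp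
qed

lemma smooth_on_local:
 assumes "\<And>x. x \<in> S ==> \<exists>T. open T \<and> x \<in> T \<and> smooth_on (S \<inter> T) f"
 shows "smooth_on S f"
 using assms unfolding smooth_on_def by (meson Ck_on_local)

lemma Ck_on_Suc_imp: "Ck_on (Suc k) f S ==> Ck_on k f S"
proof (induction k arbitrary: f)
 case 0
 then show ?case
  by (auto intro!: continuous_at_imp_continuous_on differentiable_imp_continuous_within)
next
 case (Suc k)
 then show ?case by auto
qed

lemma smooth_on_imp_differentiable: "smooth_on S f ==> x \<in> S ==> f differentiable (at x)"
 unfolding smooth_on_def by (metis Ck_on.simps(2))

lemma smooth_on_has_derivative:
 "smooth_on S f ==> x \<in> S ==> (f has_derivative fder f x) (at x)"
 using smooth_on_imp_differentiable fder_works by blast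

lemma smooth_on_imp_continuous_on: "smooth_on S f ==> continuous_on S f"
 unfolding smooth_on_def by (metis Ck_on.simps(1))

lemma smooth_on_fder: "smooth_on S f ==> smooth_on S (\<lambda>x. fder f x v)"
 unfolding smooth_on_def by (metis Ck_on.simps(2))

lemma fder_eqI: "(f has_derivative D) (at x) ==> fder f x v = D v"
 by (metis frechet_derivative_at)

lemma Ck_on_const: "Ck_on k (\<lambda>x. c) S"
proof (induction k arbitrary: c)
 case (Suc k)
 have "fder (\<lambda>x. c) x v = 0" for x :: 'a and v
  by (rule fder_eqI[of _ "\<lambda>_. 0"]) simp
 then show ?case using Suc by simp
qed auto

lemma smooth_on_const [intro, simp]: "smooth_on S (\<lambda>x. c)"
 unfolding smooth_on_def using Ck_on_const by blast

lemma Ck_on_add: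
 assumes "open S" "Ck_on k f S" "Ck_on k g S"
 shows "Ck_on k (\<lambda>x. f x + g x) S"
 using assms(2,3)
proof (induction k arbitrary: f g)
 case 0
 then show ?case by (auto intro: continuous_on_add)
next
 case (Suc k)
 have eq: "fder (\<lambda>x. f x + g x) x v = fder f x v + fder g x v" if "x \<in> S" for x v
  by (rule fder_eqI) (use Suc.prems that in \<open>auto intro!: has_derivative_add fder_works\<close>)
 have "Ck_on k (\<lambda>x. fder (\<lambda>x. f x + g x) x v) S" for v
  by (subst Ck_on_cong[OF assms(1) eq]) (use Suc in auto)
 then show ?case using Suc.prems by auto
qed

lemma smooth_on_add: "open S ==> smooth_on S f ==> smooth_on S g ==> smooth_on S (\<lambda>x. f x + g x)"
 unfolding smooth_on_def using Ck_on_add by blast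

lemma Ck_on_bilinear:
 assumes "bounded_bilinear p" "open S" "Ck_on k f S" "Ck_on k g S"
 shows "Ck_on k (\<lambda>x. p (f x) (g x)) S"
 using assms(3,4)
proof (induction k arbitrary: f g)
 case 0
 then show ?case by (auto intro: bounded_bilinear.continuous_on[OF assms(1)])
next
 case (Suc k)
 have d: "((\<lambda>x. p (f x) (g x)) has_derivative (\<lambda>v. p (f x) (fder g x v) + p (fder f x v) (g x))) (at x)"
  if "x \<in> S" for x
  by (rule bounded_bilinear.FDERIV[OF assms(1)]) (use Suc.prems that in \<open>auto intro!: fder_works\<close>)
 have eq: "fder (\<lambda>x. p (f x) (g x)) x v = p (f x) (fder g x v) + p (fder f x v) (g x)" if "x \<in> S" for x v
  by (rule fder_eqI[OF d[OF that]])
 have "Ck_on k (\<lambda>x. fder (\<lambda>x. p (f x) (g x)) x v) S" for v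
  by (subst Ck_on_cong[OF assms(2) eq])
   (use Suc.prems in \<open>auto intro!: Ck_on_add assms Suc.IH Ck_on_Suc_imp[OF Suc.prems(1)] Ck_on_Suc_imp[OF Suc.prems(2)]\<close>)
 then show ?case using d by (auto intro: differentiableI)
qed

lemma smooth_on_bilinear:
 "bounded_bilinear p ==> open S ==> smooth_on S f ==> smooth_on S g ==> smooth_on S (\<lambda>x. p (f x) (g x))"
 unfolding smooth_on_def using Ck_on_bilinear by blast

lemma smooth_on_mult:
 fixes f :: "'a::real_normed_vector => 'b::real_normed_algebra"
 shows "open S ==> smooth_on S f ==> smooth_on S g ==> smooth_on S (\<lambda>x. f x * g x)"
 by (rule smooth_on_bilinear[OF bounded_bilinear_mult])

lemma smooth_on_scaleR:
 "open S ==> smooth_on S f ==> smooth_on S g ==> smooth_on S (\<lambda>x. f x *\<^sub>R g x)"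
 by (rule smooth_on_bilinear[OF bounded_bilinear_scaleR])

lemma Ck_on_bounded_linear:
 assumes "bounded_linear L" "open S" "Ck_on k f S"
 shows "Ck_on k (\<lambda>x. L (f x)) S"
 using assms(3)
proof (induction k arbitrary: f)
 case 0
 then show ?case by (auto intro: bounded_linear.continuous_on[OF assms(1)])
next
 case (Suc k)
 have d: "((\<lambda>x. L (f x)) has_derivative (\<lambda>v. L (fder f x v))) (at x)" if "x \<in> S" for x
  by (rule bounded_linear.has_derivative[OF assms(1)]) (use Suc.prems that in \<open>auto intro!: fder_works\<close>)
 have "Ck_on k (\<lambda>x. fder (\<lambda>x. L (f x)) x v) S" for v
  by (subst Ck_on_cong[OF assms(2) fder_eqI[OF d]]) (use Suc in auto)
 then show ?case using d by (auto intro: differentiableI)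
qed

lemma smooth_on_bounded_linear:
 "bounded_linear L ==> open S ==> smooth_on S f ==> smooth_on S (\<lambda>x. L (f x))"
 unfolding smooth_on_def using Ck_on_bounded_linear by blast

lemma smooth_on_id: "open S ==> smooth_on S (\<lambda>x. x)"
proof -
 have "Ck_on k (\<lambda>x. x) S" if "open S" for k
 proof (cases k)
  case (Suc j)
  have eq: "fder (\<lambda>x. x) x v = v" for x :: 'a and v
   by (rule fder_eqI[of _ "\<lambda>v. v"]) simp
  then show ?thesis using Suc by (simp add: eq Ck_on_const)
 qed auto
 then show "open S ==> smooth_on S (\<lambda>x. x)" unfolding smooth_on_def by blast
qed

lemma smooth_on_minus:
 "open S ==> smooth_on S f ==> smooth_on S (\<lambda>x. - f x)"
 by (rule smooth_on_bounded_linear[of uminus]) (simp_all add: bounded_linear_minus bounded_linear_ident)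

lemma smooth_on_diff:
 assumes "open S" "smooth_on S f" "smooth_on S g" shows "smooth_on S (\<lambda>x. f x - g x)"
 using smooth_on_add[OF assms(1,2) smooth_on_minus[OF assms(1,3)]] by simp

lemma smooth_on_sum:
 assumes "open S" "\<And>i. i \<in> I ==> smooth_on S (f i)"
 shows "smooth_on S (\<lambda>x. \<Sum>i\<in>I. f i x)"
 using assms(2) by (induction I rule: infinite_finite_induct) (auto intro: smooth_on_add[OF assms(1)])

lemma smooth_on_prod:
 fixes f :: "'i => 'a::real_normed_vector => 'b::{real_normed_algebra,comm_ring_1}"
 assumes "open S" "\<And>i. i \<in> I ==> smooth_on S (f i)"
 shows "smooth_on S (\<lambda>x. \<Prod>i\<in>I. f i x)"
 using assms(2) by (induction I rule: infinite_finite_induct) (auto intro: smooth_on_mult[OF assms(1)])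

lemma smooth_on_power:
 fixes f :: "'a::real_normed_vector => 'b::{real_normed_algebra_1}"
 assumes "open S" "smooth_on S f"
 shows "smooth_on S (\<lambda>x. f x ^ n)"
 by (induction n) (auto intro: smooth_on_mult[OF assms(1)] assms)

lemma smooth_on_cnj: "open S ==> smooth_on S f ==> smooth_on S (\<lambda>x. cnj (f x))"
 by (rule smooth_on_bounded_linear[OF bounded_linear_cnj])

lemma smooth_on_of_real: "open S ==> smooth_on S f ==> smooth_on S (\<lambda>x. complex_of_real (f x))"
 by (rule smooth_on_bounded_linear[OF bounded_linear_of_real])

text \<open>The derivative of 1/f is a polynomial in 1/f and the derivative of \<open>f\<close>. The
  induction therefore keeps \<open>f\<close> fixed and feeds the regularity of 1/f into its own
  derivative.\<close>

lemma smooth_on_inverse: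
 fixes f :: "'a::real_normed_vector => 'b::real_normed_field"
 assumes "open S" "smooth_on S f" "\<And>x. x \<in> S ==> f x \<noteq> 0"
 shows "smooth_on S (\<lambda>x. inverse (f x))"
proof -
 have "Ck_on k (\<lambda>x. inverse (f x)) S" for k
 proof (induction k)
  case 0
  show ?case using continuous_on_inverse[OF smooth_on_imp_continuous_on[OF assms(2)]] assms(3) by simp
 next
  case (Suc k)
  have d: "((\<lambda>x. inverse (f x)) has_derivative (\<lambda>v. - (inverse (f x) * fder f x v * inverse (f x)))) (at x)"
   if "x \<in> S" for x
   by (rule Deriv.has_derivative_inverse) (use assms that in \<open>auto intro: smooth_on_has_derivative\<close>)
  have f': "Ck_on k (\<lambda>x. fder f x v) S" for v
   using smooth_on_fder[OF assms(2)] unfolding smooth_on_def by blast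
  have "Ck_on k (\<lambda>x. - (inverse (f x) * fder f x v * inverse (f x))) S" for v
   by (rule Ck_on_bounded_linear[OF bounded_linear_minus[OF bounded_linear_ident] assms(1)
      Ck_on_bilinear[OF bounded_bilinear_mult assms(1)
       Ck_on_bilinear[OF bounded_bilinear_mult assms(1) Suc f'] Suc]])
  then have "Ck_on k (\<lambda>x. fder (\<lambda>x. inverse (f x)) x v) S" for v
   using Ck_on_cong[OF assms(1), of "\<lambda>x. fder (\<lambda>x. inverse (f x)) x v"
    "\<lambda>x. - (inverse (f x) * fder f x v * inverse (f x))" k] fder_eqI[OF d] by simp
  then show ?case using d by (auto intro: differentiableI)
 qed
 then show ?thesis unfolding smooth_on_def by blast
qed

lemma smooth_on_divide:
 fixes f :: "'a::real_normed_vector => 'b::real_normed_field"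
 assumes "open S" "smooth_on S f" "smooth_on S g" "\<And>x. x \<in> S ==> g x \<noteq> 0"
 shows "smooth_on S (\<lambda>x. f x / g x)"
 unfolding divide_inverse by (intro smooth_on_mult smooth_on_inverse assms)

text \<open>A directional derivative of the composite is a sum over \<open>Basis\<close> of a
  coordinate of the derivative of \<open>T\<close> times a directional derivative of
  \<open>f\<close> at \<open>T x\<close>. The latter is again a composite with \<open>T\<close>, so
  the induction generalises \<open>f\<close>; the finite sum is the reason for a Euclidean middle
  space.\<close>

lemma smooth_on_compose:
 fixes T :: "'a::real_normed_vector => 'b::euclidean_space"
 assumes "open S" "open U" "smooth_on S T" "smooth_on U f" "T ` S \<subseteq> U"
 shows "smooth_on S (\<lambda>x. f (T x))"
proof -
 have "Ck_on k (\<lambda>x. f (T x)) S" if "smooth_on U f" for k and f :: "'b => 'c"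
  using that
 proof (induction k arbitrary: f)
  case 0
  show ?case using continuous_on_compose2[OF smooth_on_imp_continuous_on[OF 0]
     smooth_on_imp_continuous_on[OF assms(3)] assms(5)] by simp
 next
  case (Suc k)
  have d: "((\<lambda>x. f (T x)) has_derivative (\<lambda>v. fder f (T x) (fder T x v))) (at x)" if "x \<in> S" for x
   by (rule has_derivative_compose[of T]) (use assms Suc.prems that smooth_on_has_derivative in blast)+
  have eq: "fder f (T x) (fder T x v) = (\<Sum>b\<in>Basis. (fder T x v \<bullet> b) *\<^sub>R fder f (T x) b)" if "x \<in> S" for x v
  proof -
   have "linear (fder f (T x))"
    using smooth_on_imp_differentiable[OF Suc.prems] linear_frechet_derivative assms that by blast
   then have "fder f (T x) (\<Sum>b\<in>Basis. (fder T x v \<bullet> b) *\<^sub>R b) = (\<Sum>b\<in>Basis. (fder T x v \<bullet> b) *\<^sub>R fder f (T x) b)"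
    by (simp add: linear_sum linear_cmul)
   then show ?thesis by (simp add: euclidean_representation)
  qed
  have 1: "Ck_on k (\<lambda>x. (fder T x v \<bullet> b) *\<^sub>R fder f (T x) b) S" for v b
  proof (rule Ck_on_bilinear[OF bounded_bilinear_scaleR assms(1)])
   show "Ck_on k (\<lambda>x. fder T x v \<bullet> b) S"
    using Ck_on_bounded_linear[OF bounded_linear_inner_left assms(1)] smooth_on_fder[OF assms(3)]
    unfolding smooth_on_def by blast
   show "Ck_on k (\<lambda>x. fder f (T x) b) S"
    by (rule Suc.IH[OF smooth_on_fder[OF Suc.prems]])
  qed
  have "Ck_on k (\<lambda>x. \<Sum>b\<in>B. (fder T x v \<bullet> b) *\<^sub>R fder f (T x) b) S" for v B
   by (induction B rule: infinite_finite_induct) (auto intro!: Ck_on_add Ck_on_const 1 assms)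
  then have "Ck_on k (\<lambda>x. fder (\<lambda>x. f (T x)) x v) S" for v
   using Ck_on_cong[OF assms(1), of "\<lambda>x. fder (\<lambda>x. f (T x)) x v"
    "\<lambda>x. \<Sum>b\<in>Basis. (fder T x v \<bullet> b) *\<^sub>R fder f (T x) b" k]
    trans[OF fder_eqI[OF d] eq] by simp
  then show ?case using d by (auto intro: differentiableI)
 qed
 then show ?thesis using assms(4) unfolding smooth_on_def by blast
qed

lemma smooth_on_euclideanI:
 fixes f :: "'a::real_normed_vector => 'b::euclidean_space"
 assumes "open S" "\<And>b. b \<in> Basis ==> smooth_on S (\<lambda>x. f x \<bullet> b)"
 shows "smooth_on S f"
proof -
 have "smooth_on S (\<lambda>x. \<Sum>b\<in>Basis. (f x \<bullet> b) *\<^sub>R b)"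
  by (intro smooth_on_sum smooth_on_scaleR assms smooth_on_const)
 then show ?thesis by (simp add: euclidean_representation)
qed

lemma smooth_on_vec_nth:
 "open S ==> smooth_on S f ==> smooth_on S (\<lambda>x. f x $ i)"
 by (rule smooth_on_bounded_linear[OF bounded_linear_vec_nth])

lemma smooth_on_complex_vecI:
 fixes f :: "'a::real_normed_vector => complex^'n"
 assumes "open S" "\<And>i. smooth_on S (\<lambda>x. f x $ i)"
 shows "smooth_on S f"
proof (rule smooth_on_euclideanI[OF assms(1)])
 fix b :: "complex^'n" assume "b \<in> Basis"
 then obtain i c where b: "b = axis i c" by (auto simp: Basis_vec_def)
 show "smooth_on S (\<lambda>x. f x \<bullet> b)"
  unfolding b inner_axis by (rule smooth_on_bounded_linear[OF bounded_linear_inner_left assms])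
qed

lemma smooth_on_det:
 fixes M :: "'a::real_normed_vector => complex^'n^'n"
 assumes "open S" "\<And>i j. smooth_on S (\<lambda>x. M x $ i $ j)"
 shows "smooth_on S (\<lambda>x. det (M x))"
 unfolding det_def
proof (rule smooth_on_sum[OF assms(1)])
 fix p
 show "smooth_on S (\<lambda>x. of_int (sign p) * (\<Prod>i\<in>UNIV. M x $ i $ p i))"
  by (rule smooth_on_mult[OF assms(1) smooth_on_const smooth_on_prod[OF assms(1) assms(2)]])
qed

section \<open>Holomorphic maps are smooth\<close>

text \<open>\<open>holomorphic_map\<close> asks for a complex-linear derivative at each point but
  not for its continuity. Continuity and smoothness must come from Cauchy's formula, which is
  applied to complex-valued components.\<close>

definition holo :: "(complex^'m) set => (complex^'m => complex) => bool" where
 "holo S f \<longleftrightarrow> (\<forall>z\<in>S. f differentiable (at z) \<and> (\<forall>a v. fder f z (a *s v) = a * fder f z v))"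

lemma norm_vector_smult: "norm (a *s (v::complex^'m)) = norm a * norm v"
 by (simp add: norm_vec_def L2_set_def norm_mult power_mult_distrib real_sqrt_mult flip: sum_distrib_left)

lemma bounded_linear_smult_left: "bounded_linear (\<lambda>a. a *s (v::complex^'m))"
 by (rule bounded_linear_intro[where K="norm v"])
  (simp_all add: vector_sadd_rdistrib norm_vector_smult vec_eq_iff algebra_simps)

lemma bounded_linear_smult_right: "bounded_linear (\<lambda>v. a *s (v::complex^'m))"
 by (rule bounded_linear_intro[where K="norm a"])
  (simp_all add: vector_add_ldistrib norm_vector_smult vec_eq_iff algebra_simps)

lemma holo_imp_has_derivative: "holo S f ==> z \<in> S ==> (f has_derivative fder f z) (at z)"
 unfolding holo_def using fder_works by blast

lemma holo_imp_continuous_on: "holo S f ==> continuous_on S f"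
 unfolding holo_def by (auto intro!: continuous_at_imp_continuous_on differentiable_imp_continuous_within)

text \<open>The parametrisation of \<open>circlepath 0 \<rho>\<close> over the unit interval, so
  that contour integrals become integrals over \<open>{0..1}\<close>.\<close>

definition circ :: "real => real => complex" where
 "circ \<rho> t = of_real \<rho> * exp (2 * of_real pi * \<i> * of_real t)"

lemma norm_circ [simp]: "norm (circ \<rho> t) = \<bar>\<rho>\<bar>"
proof -
 have "circ \<rho> t = \<rho> * exp (\<i> * of_real (2 * pi * t))"
  by (simp add: circ_def algebra_simps)
 then show ?thesis by (simp add: norm_mult)
qed

lemma circ_eq_0_iff [simp]: "circ \<rho> t = 0 \<longleftrightarrow> \<rho> = 0"
 by (simp add: circ_def)

lemma continuous_on_circ: "continuous_on T (circ \<rho>)"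
 unfolding circ_def by (intro continuous_intros)

text \<open>Cauchy's formula for the first derivative of \<zeta> -> f(z + \<zeta> v) at 0. It
  expresses a directional derivative through values of \<open>f\<close> alone, so that regularity of
  \<open>f\<close> passes to its derivatives through the parameter \<open>z\<close>.\<close>

lemma has_integral_fder:
 assumes "holo S f" "0 < \<rho>" "\<And>\<zeta>. norm \<zeta> \<le> \<rho> ==> z + \<zeta> *s v \<in> S"
 shows "((\<lambda>t. f (z + circ \<rho> t *s v) / circ \<rho> t) has_integral fder f z v) {0..1}"
proof -
 define g where "g = (\<lambda>\<zeta>. f (z + \<zeta> *s v))"
 have d: "(g has_field_derivative fder f (z + \<zeta> *s v) v) (at \<zeta>)" if "norm \<zeta> \<le> \<rho>" for \<zeta>
 proof -
  have "((\<lambda>\<zeta>. z + \<zeta> *s v) has_derivative (\<lambda>h. h *s v)) (at \<zeta>)"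
   using has_derivative_add[OF has_derivative_const[of z] bounded_linear.has_derivative[OF bounded_linear_smult_left has_derivative_ident], of v "at \<zeta>"]
   by simp
  from has_derivative_compose[OF this holo_imp_has_derivative[OF assms(1) assms(3)[OF that]]]
  have "(g has_derivative (\<lambda>h. fder f (z + \<zeta> *s v) (h *s v))) (at \<zeta>)"
   unfolding g_def .
  moreover have "fder f (z + \<zeta> *s v) (h *s v) = fder f (z + \<zeta> *s v) v * h" for h
   using assms(1) assms(3)[OF that] unfolding holo_def by (simp add: mult.commute)
  ultimately show ?thesis
   by (simp add: has_field_derivative_def)
 qed
 have "continuous_on (cball 0 \<rho>) g"
  by (intro continuous_at_imp_continuous_on ballI DERIV_isCont[OF d]) simp
 moreover have "g holomorphic_on ball 0 \<rho>"
  using d by (auto simp: holomorphic_on_open) (meson less_imp_le)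
 ultimately have "continuous_on (cball 0 \<rho>) g" "g holomorphic_on ball 0 \<rho>" by auto
 \<comment> \<open>The kernel 1/u^2 of the first-derivative formula loses one power to the velocity
   2 pi i u of the circle; the constant 2 pi i is divided out below.\<close>
 from Cauchy_has_contour_integral_higher_derivative_circlepath[OF this, of 0 1] assms(2)
 have "((\<lambda>u. g u / u\<^sup>2) has_contour_integral 2 * pi * \<i> * deriv g 0) (circlepath 0 \<rho>)"
  by (simp add: numeral_2_eq_2)
 then have "((\<lambda>t. g (circ \<rho> t) / (circ \<rho> t)\<^sup>2 * (2 * pi * \<i> * circ \<rho> t)) has_integral 2 * pi * \<i> * deriv g 0) {0..1}"
  unfolding has_contour_integral_def
 proof (rule has_integral_eq[rotated])
  fix t :: real assume "t \<in> {0..1}"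
  then have "vector_derivative (circlepath 0 \<rho>) (at t within {0..1}) = 2 * pi * \<i> * circ \<rho> t"
   by (simp add: vector_derivative_circlepath01 circ_def)
  moreover have "circlepath 0 \<rho> t = circ \<rho> t"
   by (simp add: circlepath circ_def)
  ultimately show "g (circlepath 0 \<rho> t) / (circlepath 0 \<rho> t)\<^sup>2 * vector_derivative (circlepath 0 \<rho>) (at t within {0..1}) =
    g (circ \<rho> t) / (circ \<rho> t)\<^sup>2 * (2 * pi * \<i> * circ \<rho> t)" by simp
 qed
 then have "((\<lambda>t. 1 / (2 * pi * \<i>) * (g (circ \<rho> t) / (circ \<rho> t)\<^sup>2 * (2 * pi * \<i> * circ \<rho> t)))
   has_integral 1 / (2 * pi * \<i>) * (2 * pi * \<i> * deriv g 0)) {0..1}"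
  by (rule has_integral_mult_right)
 moreover have "1 / (2 * pi * \<i>) * (g (circ \<rho> t) / (circ \<rho> t)\<^sup>2 * (2 * pi * \<i> * circ \<rho> t)) = g (circ \<rho> t) / circ \<rho> t" for t
  using assms(2) by (simp add: power2_eq_square)
 moreover have "1 / (2 * pi * \<i>) * (2 * pi * \<i> * deriv g 0) = fder f z v"
  using d[of 0] assms(2) by (simp add: DERIV_imp_deriv)
 ultimately show ?thesis by (simp add: g_def)
qed

lemma exists_polydisc_radius:
 fixes S :: "(complex^'m) set"
 assumes "open S" "z0 \<in> S"
 obtains R \<rho> where "0 < R" "0 < \<rho>" "\<And>z \<zeta>::complex. z \<in> ball z0 R ==> norm \<zeta> \<le> \<rho> ==> z + \<zeta> *s v \<in> S"
proof -
 obtain e where e: "e > 0" "ball z0 e \<subseteq> S" using assms openE by blast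
 show thesis
 \<comment> \<open>The summand 1 in the denominator covers v = 0.\<close>
 proof (rule that[of "e/2" "e / (2 * (norm v + 1))"])
  show "0 < e/2" "0 < e / (2 * (norm v + 1))" using e by (auto intro!: divide_pos_pos add_nonneg_pos)
  fix z and \<zeta> :: complex assume *: "z \<in> ball z0 (e/2)" "norm \<zeta> \<le> e / (2 * (norm v + 1))"
  have "norm (\<zeta> *s v) \<le> e / (2 * (norm v + 1)) * norm v"
   unfolding norm_vector_smult by (rule mult_right_mono) (use * in auto)
  also have "\<dots> \<le> e / 2"
  proof -
   have "norm v + 1 > 0" by (intro add_nonneg_pos) auto
   then show ?thesis using e by (simp add: field_simps)
  qed
  finally have "dist z0 (z + \<zeta> *s v) < e"
   using *(1) norm_triangle_ineq4[of "z0 - z" "\<zeta> *s v"] by (auto simp: dist_norm algebra_simps)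
  then show "z + \<zeta> *s v \<in> S" using e by auto
 qed
qed

lemma holo_fder_continuous:
 assumes "open S" "holo S f"
 shows "continuous_on S (\<lambda>z. fder f z v)"
proof (rule continuous_at_imp_continuous_on, rule ballI)
 fix z0 assume "z0 \<in> S"
 from exists_polydisc_radius[OF assms(1) this, of v] obtain R \<rho> where
  R: "0 < R" "0 < \<rho>" "\<And>z \<zeta>. z \<in> ball z0 R ==> norm \<zeta> \<le> \<rho> ==> z + \<zeta> *s v \<in> S" by metis
 have "continuous_on (ball z0 R \<times> cbox 0 1) (\<lambda>(z, t). f (z + circ \<rho> t *s v) / circ \<rho> t)"
  unfolding split_beta
  by (intro continuous_on_divide continuous_on_compose2[OF holo_imp_continuous_on[OF assms(2)]]
    continuous_on_add continuous_on_fst continuous_on_id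
    bounded_linear.continuous_on[OF bounded_linear_smult_left]
    continuous_on_compose2[OF continuous_on_circ continuous_on_snd])
   (use R in auto)
 from integral_continuous_on_param[OF this]
 have "continuous_on (ball z0 R) (\<lambda>z. integral (cbox 0 1) (\<lambda>t. f (z + circ \<rho> t *s v) / circ \<rho> t))" .
 moreover have "integral (cbox 0 1) (\<lambda>t. f (z + circ \<rho> t *s v) / circ \<rho> t) = fder f z v" if "z \<in> ball z0 R" for z
  using has_integral_fder[OF assms(2) R(2) R(3)[OF that]] by (simp add: integral_unique)
 ultimately have "continuous_on (ball z0 R) (\<lambda>z. fder f z v)"
  by (rule continuous_on_eq)
 then show "isCont (\<lambda>z. fder f z v) z0"
  using R(1) by (simp add: continuous_on_eq_continuous_at)
qed

lemma holo_fder_has_derivative: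
 assumes "open S" "holo S f" "z0 \<in> S" "0 < R" "0 < \<rho>"
  and R: "\<And>z \<zeta>. z \<in> ball z0 R ==> norm \<zeta> \<le> \<rho> ==> z + \<zeta> *s v \<in> S"
 shows "((\<lambda>z. fder f z v) has_derivative (\<lambda>w. integral {0..1} (\<lambda>t. fder f (z0 + circ \<rho> t *s v) w / circ \<rho> t))) (at z0)"
  and "\<And>w. (\<lambda>t. fder f (z0 + circ \<rho> t *s v) w / circ \<rho> t) integrable_on {0..1}"
proof -
 \<comment> \<open>Differentiation under the integral sign wants the derivative as a continuous
   function with values in bounded linear maps. \<open>Blinfun\<close> packages it, and its
   continuity is checked direction by direction with \<open>holo_fder_continuous\<close>.\<close>
 define fx where "fx = (\<lambda>z t. Blinfun (\<lambda>w. fder f (z + circ \<rho> t *s v) w / circ \<rho> t))"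
 have inS: "z + circ \<rho> t *s v \<in> S" if "z \<in> ball z0 R" for z t
  using R[OF that, of "circ \<rho> t"] assms(5) by simp
 have bl: "bounded_linear (\<lambda>w. fder f (z + circ \<rho> t *s v) w / circ \<rho> t)" if "z \<in> ball z0 R" for z t
  by (rule bounded_linear_compose[OF bounded_linear_divide
     has_derivative_bounded_linear[OF holo_imp_has_derivative[OF assms(2) inS[OF that]]]])
 have fx: "blinfun_apply (fx z t) = (\<lambda>w. fder f (z + circ \<rho> t *s v) w / circ \<rho> t)" if "z \<in> ball z0 R" for z t
  unfolding fx_def by (rule bounded_linear_Blinfun_apply[OF bl[OF that]])
 have cont: "continuous_on (ball z0 R \<times> cbox 0 1) (\<lambda>(z, t). F (z + circ \<rho> t *s v) / circ \<rho> t)"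
  if "continuous_on S F" for F :: "complex^'a => complex"
  unfolding split_beta
  by (intro continuous_on_divide continuous_on_compose2[OF that]
    continuous_on_add continuous_on_fst continuous_on_id
    bounded_linear.continuous_on[OF bounded_linear_smult_left]
    continuous_on_compose2[OF continuous_on_circ continuous_on_snd])
   (use assms inS in auto)
 have contfx: "continuous_on (ball z0 R \<times> cbox 0 1) (\<lambda>(z, t). fx z t)"
  unfolding split_beta
 proof (rule continuous_on_blinfun_componentwise)
  fix i :: "complex^'a"
  have "continuous_on (ball z0 R \<times> cbox 0 1) (\<lambda>(z, t). fder f (z + circ \<rho> t *s v) i / circ \<rho> t)"
   by (rule cont[OF holo_fder_continuous[OF assms(1,2)]])
  then show "continuous_on (ball z0 R \<times> cbox 0 1) (\<lambda>p. blinfun_apply (fx (fst p) (snd p)) i)"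
   by (rule continuous_on_eq) (auto simp: fx)
 qed
 have z0: "z0 \<in> ball z0 R" using assms(4) by simp
 have slice: "G z integrable_on cbox 0 1" if "continuous_on (ball z0 R \<times> cbox 0 1) (\<lambda>(z, t). G z t)" "z \<in> ball z0 R"
  for G :: "complex^'a => real => 'x::banach" and z
 proof -
  have "continuous_on (cbox 0 1) (\<lambda>t. (\<lambda>(z, t). G z t) (z, t))"
   by (rule continuous_on_compose2[OF that(1)]) (use that in \<open>auto intro!: continuous_intros\<close>)
  then show ?thesis by (intro integrable_continuous) auto
 qed
 have "((\<lambda>z. integral (cbox 0 1) (\<lambda>t. f (z + circ \<rho> t *s v) / circ \<rho> t)) has_derivative
   blinfun_apply (integral (cbox 0 1) (fx z0))) (at z0 within ball z0 R)"
 proof (rule leibniz_rule[OF _ _ contfx z0])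
  fix z t assume z: "z \<in> ball z0 R"
  have "((\<lambda>z. z + circ \<rho> t *s v) has_derivative (\<lambda>h. h)) (at z within ball z0 R)"
   by (auto intro!: derivative_eq_intros)
  from has_derivative_compose[OF this holo_imp_has_derivative[OF assms(2) inS[OF z]]]
  have "((\<lambda>z. f (z + circ \<rho> t *s v)) has_derivative (\<lambda>w. fder f (z + circ \<rho> t *s v) w)) (at z within ball z0 R)" .
  from bounded_linear.has_derivative[OF bounded_linear_divide this]
  show "((\<lambda>z. f (z + circ \<rho> t *s v) / circ \<rho> t) has_derivative blinfun_apply (fx z t)) (at z within ball z0 R)"
   unfolding fx[OF z] .
 next
  fix z assume "z \<in> ball z0 R"
  then show "(\<lambda>t. f (z + circ \<rho> t *s v) / circ \<rho> t) integrable_on cbox 0 1"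
   by (rule slice[OF cont[OF holo_imp_continuous_on[OF assms(2)]]])
 qed auto
 then have "((\<lambda>z. integral (cbox 0 1) (\<lambda>t. f (z + circ \<rho> t *s v) / circ \<rho> t)) has_derivative
   blinfun_apply (integral (cbox 0 1) (fx z0))) (at z0)"
  using at_within_open[OF z0] by simp
 moreover have "integral (cbox 0 1) (\<lambda>t. f (z + circ \<rho> t *s v) / circ \<rho> t) = fder f z v" if "z \<in> ball z0 R" for z
  using has_integral_fder[OF assms(2,5) R[OF that]] by (simp add: integral_unique)
 ultimately have "((\<lambda>z. fder f z v) has_derivative blinfun_apply (integral (cbox 0 1) (fx z0))) (at z0)"
  using has_derivative_transform_within_open[OF _ open_ball z0] by fastforce
 moreover have "blinfun_apply (integral (cbox 0 1) (fx z0)) = (\<lambda>w. integral {0..1} (\<lambda>t. fder f (z0 + circ \<rho> t *s v) w / circ \<rho> t))"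
  by (rule ext, subst blinfun_apply_integral[OF slice[OF contfx z0]]) (simp add: fx[OF z0])
 ultimately show "((\<lambda>z. fder f z v) has_derivative (\<lambda>w. integral {0..1} (\<lambda>t. fder f (z0 + circ \<rho> t *s v) w / circ \<rho> t))) (at z0)"
  by simp
 show "(\<lambda>t. fder f (z0 + circ \<rho> t *s v) w / circ \<rho> t) integrable_on {0..1}" for w
  using slice[OF cont[OF holo_fder_continuous[OF assms(1,2)]] z0] by simp
qed

text \<open>The derivative found under the integral sign is a mean of complex-linear maps, hence
  complex linear. So the property passes to directional derivatives and can be iterated.\<close>

lemma holo_fder:
 assumes "open S" "holo S f"
 shows "holo S (\<lambda>z. fder f z v)"
 unfolding holo_def
proof (intro ballI conjI allI)
 fix z0 assume z0: "z0 \<in> S"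
 from exists_polydisc_radius[OF assms(1) this, of v] obtain R \<rho> where
  R: "0 < R" "0 < \<rho>" "\<And>z \<zeta>. z \<in> ball z0 R ==> norm \<zeta> \<le> \<rho> ==> z + \<zeta> *s v \<in> S" by metis
 note D = holo_fder_has_derivative[OF assms z0 R]
 show "(\<lambda>z. fder f z v) differentiable at z0" using D(1) by (rule differentiableI)
 fix a w
 have "fder f (z0 + circ \<rho> t *s v) (a *s w) = a * fder f (z0 + circ \<rho> t *s v) w" for t
  using R(3)[of z0 "circ \<rho> t"] R(1,2) assms(2) unfolding holo_def by simp
 then have "integral {0..1} (\<lambda>t. fder f (z0 + circ \<rho> t *s v) (a *s w) / circ \<rho> t) =
   integral {0..1} (\<lambda>t. a * (fder f (z0 + circ \<rho> t *s v) w / circ \<rho> t))"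
  by simp
 also have "\<dots> = a * integral {0..1} (\<lambda>t. fder f (z0 + circ \<rho> t *s v) w / circ \<rho> t)"
  by (rule integral_mult_right)
 finally show "fder (\<lambda>z. fder f z v) z0 (a *s w) = a * fder (\<lambda>z. fder f z v) z0 w"
  using fder_eqI[OF D(1), of "a *s w"] fder_eqI[OF D(1), of w] by simp
qed

text \<open>Both sides are the circle mean, along direction \<open>v\<close>, of the derivative of
  \<open>f\<close> in direction \<open>w\<close>: one by differentiating under the integral, the
  other by Cauchy's formula for the derivative itself. This symmetry is what makes d commute with
  pullback.\<close>

lemma holo_fder_commute:
 assumes "open S" "holo S f" "z0 \<in> S"
 shows "fder (\<lambda>z. fder f z v) z0 w = fder (\<lambda>z. fder f z w) z0 v"
proof -
 from exists_polydisc_radius[OF assms(1,3), of v] obtain R \<rho> where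
  R: "0 < R" "0 < \<rho>" "\<And>z \<zeta>. z \<in> ball z0 R ==> norm \<zeta> \<le> \<rho> ==> z + \<zeta> *s v \<in> S" by metis
 have "fder (\<lambda>z. fder f z v) z0 w = integral {0..1} (\<lambda>t. fder f (z0 + circ \<rho> t *s v) w / circ \<rho> t)"
  by (rule fder_eqI[OF holo_fder_has_derivative(1)[OF assms R]])
 also have "\<dots> = fder (\<lambda>z. fder f z w) z0 v"
  using has_integral_fder[OF holo_fder[OF assms(1,2)] R(2), of z0 v w] R by (intro integral_unique) auto
 finally show ?thesis .
qed

lemma holo_imp_smooth_on:
 assumes "open S" "holo S f"
 shows "smooth_on S f"
proof -
 have "Ck_on k f S" if "holo S f" for k and f :: "complex^'a => complex"
  using that
 proof (induction k arbitrary: f)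
  case 0
  then show ?case by (simp add: holo_imp_continuous_on)
 next
  case (Suc k)
  then show ?case using holo_fder[OF assms(1)] by (auto simp: holo_def)
 qed
 then show ?thesis using assms(2) unfolding smooth_on_def by blast
qed

lemma holomorphic_map_fder:
 assumes "holomorphic_map S T" "z \<in> S"
 shows "(T has_derivative fder T z) (at z)" "fder T z (a *s v) = a *s fder T z v" "linear (fder T z)"
proof -
 obtain D where D: "(T has_derivative D) (at z)" "\<forall>a v. D (a *s v) = a *s D v"
  using assms unfolding holomorphic_map_def by blast
 moreover have "fder T z = D" using frechet_derivative_at[OF D(1)] by simp
 ultimately show "(T has_derivative fder T z) (at z)" "fder T z (a *s v) = a *s fder T z v" "linear (fder T z)"
  using has_derivative_linear by auto
qed

lemma holomorphic_map_nth:
 assumes "holomorphic_map S T" "z \<in> S"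
 shows "fder (\<lambda>z. T z $ i) z v = fder T z v $ i"
 by (rule fder_eqI[OF bounded_linear.has_derivative[OF bounded_linear_vec_nth holomorphic_map_fder(1)[OF assms]]])

lemma holo_nth:
 assumes "holomorphic_map S T"
 shows "holo S (\<lambda>z. T z $ i)"
 unfolding holo_def
proof (intro ballI conjI allI)
 fix z assume z: "z \<in> S"
 show "(\<lambda>z. T z $ i) differentiable at z"
  by (rule differentiableI[OF bounded_linear.has_derivative[OF bounded_linear_vec_nth holomorphic_map_fder(1)[OF assms z]]])
 show "fder (\<lambda>z. T z $ i) z (a *s v) = a * fder (\<lambda>z. T z $ i) z v" for a v
  by (simp add: holomorphic_map_nth[OF assms z] holomorphic_map_fder[OF assms z])
qed

lemma holomorphic_map_smooth_on:
 assumes "open S" "holomorphic_map S T"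
 shows "smooth_on S T"
 by (rule smooth_on_complex_vecI[OF assms(1) holo_imp_smooth_on[OF assms(1) holo_nth[OF assms(2)]]])

lemma holomorphic_map_fder_commute:
 assumes "open S" "holomorphic_map S T" "z \<in> S"
 shows "fder (\<lambda>z. fder T z v) z w = fder (\<lambda>z. fder T z w) z v"
proof -
 have "fder (\<lambda>z. fder T z v) z w $ i = fder (\<lambda>z. fder (\<lambda>z. T z $ i) z v) z w" for v w i
 proof -
  have "fder (\<lambda>z. fder T z v) z w $ i = fder (\<lambda>z. fder T z v $ i) z w"
   by (rule fder_eqI[symmetric, OF bounded_linear.has_derivative[OF bounded_linear_vec_nth
      smooth_on_has_derivative[OF smooth_on_fder[OF holomorphic_map_smooth_on[OF assms(1,2)]] assms(3)]]])
  also have "\<dots> = fder (\<lambda>z. fder (\<lambda>z. T z $ i) z v) z w"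
   by (rule fun_cong[OF frechet_derivative_cong_open[OF assms(1,3)]]) (simp add: holomorphic_map_nth[OF assms(2)])
  finally show ?thesis .
 qed
 then show ?thesis
  by (simp add: vec_eq_iff holo_fder_commute[OF assms(1) holo_nth[OF assms(2)] assms(3)])
qed

section \<open>A smooth bump function\<close>

text \<open>The extra power of 1/t closes the family under differentiation up to linear
  combinations, which makes smoothness of exp(-1/t) a plain induction over all \<open>k\<close> at
  once.\<close>

definition flat :: "nat => real => real" where
 "flat k t = (if 0 < t then exp (- (1 / t)) * (1 / t) ^ k else 0)"

lemma flat_tendsto: "(flat k \<longlongrightarrow> 0) (at 0)"
proof -
 have "((\<lambda>t. (inverse t) ^ k / exp (inverse t)) \<longlongrightarrow> (0::real)) (at_right 0)"
  by (rule filterlim_compose[OF tendsto_power_div_exp_0 filterlim_inverse_at_top_right])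
 then have "(flat k \<longlongrightarrow> 0) (at_right 0)"
  by (rule Lim_transform_eventually)
   (auto simp: eventually_at_filter flat_def exp_minus field_simps)
 moreover have "(flat k \<longlongrightarrow> 0) (at_left 0)"
  by (rule Lim_transform_eventually[OF tendsto_const]) (auto simp: eventually_at_filter flat_def)
 ultimately show ?thesis by (simp add: filterlim_split_at)
qed

lemma DERIV_flat: "(flat k has_field_derivative flat (k + 2) t - real k * flat (k + 1) t) (at t)"
proof -
 consider "t > 0" | "t < 0" | "t = 0" by linarith
 then show ?thesis
 proof cases
  case 1
  have "((\<lambda>t. exp (- (1 / t)) * (1 / t) ^ k) has_field_derivative
    exp (- (1 / t)) * (1 / t) ^ (k + 2) - real k * (exp (- (1 / t)) * (1 / t) ^ (k + 1))) (at t)"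
  proof -
   have i: "((\<lambda>t. 1 / t) has_field_derivative - ((1 / t) * (1 / t))) (at t)"
    using 1 by (auto intro!: derivative_eq_intros simp: field_simps power2_eq_square)
   have "((\<lambda>t. (1 / t) ^ k) has_field_derivative - (real k * (1 / t) ^ (k + 1))) (at t)"
   proof (induction k)
    case (Suc k)
    show ?case
     using DERIV_mult[OF i Suc.IH] by (simp add: algebra_simps add_divide_distrib)
   qed simp
   from DERIV_mult[OF DERIV_chain'[OF DERIV_minus[OF i] DERIV_exp] this] show ?thesis
    by (simp add: algebra_simps)
  qed
  then have "(flat k has_field_derivative exp (- (1 / t)) * (1 / t) ^ (k + 2) - real k * (exp (- (1 / t)) * (1 / t) ^ (k + 1))) (at t)"
   by (rule has_field_derivative_transform_within_open[of _ _ _ "{0<..}"]) (use 1 in \<open>auto simp: flat_def\<close>)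
  then show ?thesis using 1 by (simp add: flat_def)
 next
  case 2
  have "((\<lambda>t. 0) has_field_derivative 0) (at t)" by simp
  then have "(flat k has_field_derivative 0) (at t)"
   by (rule has_field_derivative_transform_within_open[of _ _ _ "{..<0}"]) (use 2 in \<open>auto simp: flat_def\<close>)
  then show ?thesis using 2 by (simp add: flat_def)
 next
  case 3
  \<comment> \<open>At the origin the difference quotient of \<open>flat k\<close> is
    \<open>flat (k + 1)\<close> itself.\<close>
  have "((\<lambda>y. (flat k y - flat k 0) / (y - 0)) \<longlongrightarrow> 0) (at 0)"
   by (rule Lim_transform_eventually[OF flat_tendsto[of "k+1"]])
    (auto simp: eventually_at_filter flat_def field_simps)
  then show ?thesis using 3 by (simp add: has_field_derivative_iff flat_def)
 qed
qed

lemma Ck_on_flat: "Ck_on m (flat k) UNIV"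
proof (induction m arbitrary: k)
 case 0
 show ?case unfolding Ck_on.simps by (intro continuous_at_imp_continuous_on ballI DERIV_isCont[OF DERIV_flat])
next
 case (Suc m)
 have d: "(flat k has_derivative (*) (flat (k + 2) t - real k * flat (k + 1) t)) (at t)" for t
  using DERIV_flat unfolding has_field_derivative_def by blast
 have c: "Ck_on m (\<lambda>t. c * flat j t) UNIV" for c j
  by (rule Ck_on_bilinear[OF bounded_bilinear_mult open_UNIV Ck_on_const Suc])
 have "Ck_on m (\<lambda>t. v * flat (k + 2) t + (- v * real k) * flat (k + 1) t) UNIV" for v
  by (rule Ck_on_add[OF open_UNIV c c])
 then have "Ck_on m (\<lambda>t. fder (flat k) t v) UNIV" for v
  by (simp add: fder_eqI[OF d] algebra_simps)
 then show ?case using d by (auto intro: differentiableI)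
qed

definition bump :: "'a::euclidean_space => real => 'a => real" where
 "bump z r x = flat 0 (r\<^sup>2 - (norm (x - z))\<^sup>2)"

lemma bump_nonneg: "0 \<le> bump z r x"
 by (simp add: bump_def flat_def)

lemma bump_pos_iff: "0 < r ==> 0 < bump z r x \<longleftrightarrow> dist x z < r"
 by (auto simp: bump_def flat_def dist_norm intro: power2_less_imp_less power_strict_mono)

lemma bump_eq_0_iff: "0 < r ==> bump z r x = 0 \<longleftrightarrow> r \<le> dist x z"
 using bump_pos_iff[of r z x] bump_nonneg[of z r x] by linarith

lemma smooth_on_bump: "open S ==> smooth_on S (bump z r)"
proof -
 assume S: "open S"
 have "smooth_on S (\<lambda>x. flat 0 (r\<^sup>2 - (x - z) \<bullet> (x - z)))"
  by (rule smooth_on_compose[OF S open_UNIV])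
   (use Ck_on_flat in \<open>auto simp: smooth_on_def[of UNIV] intro!: smooth_on_diff smooth_on_const smooth_on_id
    smooth_on_bilinear[OF bounded_bilinear_inner] S\<close>)
 then show ?thesis by (simp add: bump_def[abs_def] power2_norm_eq_inner)
qed

section \<open>Exterior algebra by recursion on the argument list\<close>

text \<open>The recursion on the first argument is interior multiplication: \<open>\<lambda>ws. q (v # ws)\<close> is the
 contraction of \<open>q\<close> with \<open>v\<close>, and an operator is determined by its graded commutator with
 contractions.\<close>

abbreviation cJ :: "(complex, 'n) vec => (complex, 'n::finite) vec" where
 "cJ v \<equiv> \<i> *s v"

lemma cJ_cJ [simp]: "cJ (cJ v) = - v"
 by (simp add: vec_eq_iff)

lemma linear_cJ: "linear cJ"
 by (rule bounded_linear.linear[OF bounded_linear_smult_right])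

lemma smult_neg [simp]: "a *s (- v) = - (a *s (v::complex^'n))"
 by (simp add: vec_eq_iff)

lemma scaleR_complex: "r *\<^sub>R (z::complex) = of_real r * z"
 by (rule scaleR_conv_of_real)

subsection \<open>Alternating functions\<close>

text \<open>Linearity and vanishing are tested in the first slots only; stability of
  \<open>P\<close> under contraction carries them to the later slots. For this reason
  \<open>P\<close> is later instantiated with classes closed under contraction, such as all sums p +
  a \<and> q, rather than with the single function of interest.\<close>

lemma alternatingI_coinduct:
 fixes q :: "'n::finite alt"
 assumes "P q"
  and "\<And>q v. P q ==> P (\<lambda>ws. q (v # ws))"
  and lin: "\<And>q vs. P q ==> linear (\<lambda>v. q (v # vs))"
  and diag: "\<And>q v vs. P q ==> q (v # v # vs) = 0"
 shows "alternating q"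
proof -
 have 1: "linear (\<lambda>v. q (vs[i := v]))" if "P q" "i < length vs" for i vs and q :: "'n alt"
  using that
 proof (induction i arbitrary: vs q)
  case 0
  then show ?case using lin by (cases vs) auto
 next
  case (Suc i)
  then obtain w ws where vs: "vs = w # ws" by (cases vs) auto
  show ?case using Suc.IH[OF assms(2)[OF Suc.prems(1)], of ws w] Suc.prems(2) vs by auto
 qed
 have swap: "q (v # w # vs) = - q (w # v # vs)" if "P q" for v w vs and q :: "'n alt"
 proof -
  have 1: "linear (\<lambda>v. q (v # w # vs))" for w by (rule lin[OF that])
  have 2: "linear (\<lambda>w. q (v # w # vs))" for v by (rule lin[OF assms(2)[OF that]])
  have "q ((v + w) # (v + w) # vs) = 0" by (rule diag[OF that])
  then have "q (v # v # vs) + q (v # w # vs) + (q (w # v # vs) + q (w # w # vs)) = 0"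
   by (simp add: linear_add[OF 1] linear_add[OF 2] ac_simps)
  then show ?thesis using diag[OF that] by (simp add: eq_neg_iff_add_eq_0)
 qed
 have 2: "q vs = 0" if "P q" "\<not> distinct vs" for vs and q :: "'n alt"
  using that
 proof (induction "length vs" arbitrary: vs q rule: less_induct)
  case less
  then obtain w ws where vs: "vs = w # ws" by (cases vs) auto
  show ?case
  proof (cases "distinct ws")
   case False
   then show ?thesis using less.hyps[of ws "\<lambda>ws. q (w # ws)"] less.prems assms(2) vs by auto
  next
   case True
   then have "w \<in> set ws" using less.prems vs by auto
   \<comment> \<open>The repetition of \<open>w\<close> is found by swapping the first two
     arguments: behind \<open>y\<close> stands the shorter list \<open>w # ys\<close>, which has a
     repetition unless \<open>w = y\<close>.\<close>
   then obtain y ys where ws: "ws = y # ys" by (cases ws) auto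
   show ?thesis
   proof (cases "w = y")
    case True
    then show ?thesis using diag[OF less.prems(1)] vs ws by auto
   next
    case False
    then have "\<not> distinct (w # ys)" using \<open>w \<in> set ws\<close> ws by auto
    then have "q (y # w # ys) = 0"
     using less.hyps[of "w # ys" "\<lambda>ws. q (y # ws)"] less.prems assms(2) vs ws by auto
    then show ?thesis using swap[OF less.prems(1), of w y ys] vs ws by simp
   qed
  qed
 qed
 show ?thesis using 1 2 assms(1) unfolding alternating_def by blast
qed

lemma alt_contr: "alternating q ==> alternating (\<lambda>ws. q (v # ws))"
 unfolding alternating_def
proof (intro conjI allI impI)
 assume *: "(\<forall>vs i. i < length vs --> linear (\<lambda>v. q (vs[i := v]))) \<and> (\<forall>vs. \<not> distinct vs --> q vs = 0)"
 show "linear (\<lambda>va. q (v # vs[i := va]))" if "i < length vs" for vs i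
 proof -
  have "linear (\<lambda>va. q ((v # vs)[Suc i := va]))"
   using *[THEN conjunct1, rule_format, of "Suc i" "v # vs"] that by simp
  then show ?thesis by simp
 qed
 show "q (v # vs) = 0" if "\<not> distinct vs" for vs
  using * that by simp
qed

lemma alt_linear:
 assumes "alternating q" shows "linear (\<lambda>v. q (v # vs))"
 using assms[unfolded alternating_def, THEN conjunct1, rule_format, of 0 "0 # vs"] by simp

lemma alt_linear2: "alternating q ==> linear (\<lambda>v. q (u # v # vs))"
 by (rule alt_linear[OF alt_contr])

lemma alt_diag: "alternating q ==> q (v # v # vs) = 0"
 unfolding alternating_def by simp

lemma alt_swap:
 assumes "alternating q"
 shows "q (v # w # vs) = - q (w # v # vs)"
proof -
 have "q ((v + w) # (v + w) # vs) = 0" by (rule alt_diag[OF assms])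
 then have "q (v # v # vs) + q (v # w # vs) + (q (w # v # vs) + q (w # w # vs)) = 0"
  by (simp add: linear_add[OF alt_linear[OF assms]] linear_add[OF alt_linear2[OF assms]] ac_simps)
 then show ?thesis using alt_diag[OF assms] by (simp add: eq_neg_iff_add_eq_0)
qed

lemma alt_lincomb:
 fixes A :: "'i => 'n::finite alt"
 assumes "\<And>i. i \<in> I ==> alternating (A i)"
 shows "alternating (\<lambda>vs. \<Sum>i\<in>I. c i * A i vs)"
 unfolding alternating_def
proof (intro conjI allI impI)
 fix vs :: "(complex^'n) list" and i assume i: "i < length vs"
 show "linear (\<lambda>v. \<Sum>j\<in>I. c j * A j (vs[i := v]))"
 proof (rule linear_compose_sum, rule ballI)
  fix j assume "j \<in> I"
  then have "linear (\<lambda>v. A j (vs[i := v]))" using assms i unfolding alternating_def by blast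
  then show "linear (\<lambda>v. c j * A j (vs[i := v]))"
   by (rule linear_compose[of _ "(*) (c j)", unfolded o_def]) (simp add: linear_times)
 qed
qed (use assms in \<open>auto simp: alternating_def\<close>)

lemma alt_add: "alternating q ==> alternating p ==> alternating (\<lambda>vs. q vs + p vs)"
 using alt_lincomb[of "{False, True}" "\<lambda>b. if b then p else q" "\<lambda>_. 1"] by simp

lemma alt_scale: "alternating q ==> alternating (\<lambda>vs. c * q vs)"
 using alt_lincomb[of "{()}" "\<lambda>_. q" "\<lambda>_. c"] by simp

lemma alt_diff: "alternating q ==> alternating p ==> alternating (\<lambda>vs. q vs - p vs)"
 using alt_add[OF _ alt_scale[of p "-1"]] by simp

lemma alt_zero: "alternating (\<lambda>_. 0)"
 using alt_lincomb[of "{}"] by simp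

lemma alt_cnj: "alternating q ==> alternating (\<lambda>vs. cnj (q vs))"
 unfolding alternating_def
 by (auto intro: linear_compose[of _ cnj, unfolded o_def] simp: bounded_linear.linear[OF bounded_linear_cnj])

lemma alt_degree:
 fixes q :: "'n::finite alt"
 assumes "alternating q" shows "alternating (\<lambda>vs. c (length vs) * q vs)"
 unfolding alternating_def
proof (intro conjI allI impI)
 fix vs :: "(complex^'n) list" and i assume i: "i < length vs"
 have "linear (\<lambda>v. q (vs[i := v]))" using assms i unfolding alternating_def by blast
 then show "linear (\<lambda>v. c (length (vs[i := v])) * q (vs[i := v]))"
  by (simp add: linear_compose[of _ "(*) (c (length vs))", unfolded o_def] linear_times)
qed (use assms in \<open>auto simp: alternating_def\<close>)

lemma alt_map:
 fixes q :: "'n::finite alt" and G :: "complex^'m::finite => complex^'n"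
 assumes "alternating q" "linear G"
 shows "alternating (\<lambda>vs. q (map G vs))"
 unfolding alternating_def
proof (intro conjI allI impI)
 fix vs :: "(complex^'m) list" and i assume i: "i < length vs"
 then have "linear (\<lambda>v. q ((map G vs)[i := v]))" using assms unfolding alternating_def by simp
 then show "linear (\<lambda>v. q (map G (vs[i := v])))"
  using linear_compose[OF assms(2)] by (simp add: map_update o_def)
qed (use assms in \<open>auto simp: alternating_def distinct_map\<close>)

lemma alt_head:
 assumes "alternating q"
 shows "q ((u + v) # vs) = q (u # vs) + q (v # vs)" "q ((r *\<^sub>R u) # vs) = r * q (u # vs)"
  "q ((- u) # vs) = - q (u # vs)" "q ((u - v) # vs) = q (u # vs) - q (v # vs)" "q (0 # vs) = 0"
  "q ((\<Sum>i\<in>I. U i) # vs) = (\<Sum>i\<in>I. q (U i # vs))"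
 using linear_add[OF alt_linear[OF assms]] linear_cmul[OF alt_linear[OF assms]]
  linear_neg[OF alt_linear[OF assms]] linear_diff[OF alt_linear[OF assms]]
  linear_0[OF alt_linear[OF assms]] linear_sum[OF alt_linear[OF assms]]
 by (simp_all add: scaleR_complex)

subsection \<open>Exterior multiplication by a covector\<close>

text \<open>The equation is the antiderivation rule for contractions. It changes the form together
  with the list, so the inductions below generalise over \<open>q\<close>.\<close>

fun ext :: "((complex, 'n) vec => complex) => 'n::finite alt => 'n alt" where
 "ext a q [] = 0"
| "ext a q (v # vs) = a v * q vs - ext a (\<lambda>ws. q (v # ws)) vs"

lemma ext_lincomb: "ext a (\<lambda>vs. \<Sum>i\<in>I. c i * A i vs) vs = (\<Sum>i\<in>I. c i * ext a (A i) vs)"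
 by (induction vs arbitrary: A) (simp_all add: sum_distrib_left sum_subtractf algebra_simps)

lemma ext_add: "ext a (\<lambda>vs. q vs + p vs) vs = ext a q vs + ext a p vs"
 by (induction vs arbitrary: q p) (simp_all add: algebra_simps)

lemma ext_diff: "ext a (\<lambda>vs. q vs - p vs) vs = ext a q vs - ext a p vs"
 by (induction vs arbitrary: q p) (simp_all add: algebra_simps)

lemma ext_minus: "ext a (\<lambda>vs. - q vs) vs = - ext a q vs"
 by (induction vs arbitrary: q) (simp_all add: algebra_simps)

lemma ext_zero: "ext a (\<lambda>vs. 0) vs = 0"
 by (induction vs) simp_all

lemma ext_scale: "ext a (\<lambda>vs. c * q vs) vs = c * ext a q vs"
 by (induction vs arbitrary: q) (simp_all add: algebra_simps)

lemma ext_cov_lincomb: "ext (\<lambda>v. \<Sum>i\<in>I. c i * a i v) q vs = (\<Sum>i\<in>I. c i * ext (a i) q vs)"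
 by (induction vs arbitrary: q) (simp_all add: sum_distrib_left sum_distrib_right sum_subtractf algebra_simps)

lemma ext_cov_add: "ext (\<lambda>v. a v + b v) q vs = ext a q vs + ext b q vs"
 by (induction vs arbitrary: q) (simp_all add: algebra_simps)

lemma ext_cov_scale: "ext (\<lambda>v. c * a v) q vs = c * ext a q vs"
 by (induction vs arbitrary: q) (simp_all add: algebra_simps)

lemma ext_cnj: "cnj (ext a q vs) = ext (\<lambda>v. cnj (a v)) (\<lambda>vs. cnj (q vs)) vs"
 by (induction vs arbitrary: q) simp_all

lemma ext_map: "ext a q (map G vs) = ext (\<lambda>v. a (G v)) (\<lambda>vs. q (map G vs)) vs"
 by (induction vs arbitrary: q) simp_all

lemma ext_degree: "ext a (\<lambda>vs. c (length vs) * q vs) vs = c (length vs - 1) * ext a q vs"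
proof (induction vs arbitrary: q c)
 case (Cons v vs)
 show ?case
  using Cons[of "\<lambda>k. c (Suc k)" "\<lambda>ws. q (v # ws)"]
  by (cases vs) (simp_all add: algebra_simps)
qed simp

lemma alt_ext:
 fixes q :: "'n::finite alt"
 assumes "alternating q" "linear a"
 shows "alternating (ext a q)"
\<comment> \<open>Contracting a \<and> q gives a multiple of q minus a \<and> (contraction of q);
  the summand \<open>p\<close> of the class absorbs the first term.\<close>
proof (rule alternatingI_coinduct[where P="\<lambda>\<gamma>. \<exists>q p. alternating q \<and> alternating p \<and> \<gamma> = (\<lambda>vs. p vs + ext a q vs)"])
 show "\<exists>q' p. alternating q' \<and> alternating p \<and> ext a q = (\<lambda>vs. p vs + ext a q' vs)"
  by (rule exI[of _ q], rule exI[of _ "\<lambda>_. 0"]) (simp add: assms alt_zero)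
next
 fix \<gamma> :: "'n alt" and v
 assume "\<exists>q p. alternating q \<and> alternating p \<and> \<gamma> = (\<lambda>vs. p vs + ext a q vs)"
 then obtain q p where *: "alternating q" "alternating p" "\<gamma> = (\<lambda>vs. p vs + ext a q vs)" by blast
 show "\<exists>q p. alternating q \<and> alternating p \<and> (\<lambda>ws. \<gamma> (v # ws)) = (\<lambda>vs. p vs + ext a q vs)"
  by (rule exI[of _ "\<lambda>ws. - 1 * q (v # ws)"], rule exI[of _ "\<lambda>ws. p (v # ws) + a v * q ws"])
   (auto intro!: alt_add alt_contr alt_scale * simp only: *(3) ext.simps ext_scale fun_eq_iff,
    auto simp: algebra_simps ext_minus)
 have lin: "linear (\<lambda>v. a v * q vs - ext a (\<lambda>ws. q (v # ws)) vs)" if "alternating q" for q vs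
 proof (rule linearI)
  fix x y r
  show "a (x + y) * q vs - ext a (\<lambda>ws. q ((x + y) # ws)) vs =
   a x * q vs - ext a (\<lambda>ws. q (x # ws)) vs + (a y * q vs - ext a (\<lambda>ws. q (y # ws)) vs)"
   by (simp add: alt_head[OF that] linear_add[OF assms(2)] ext_add algebra_simps)
  show "a (r *\<^sub>R x) * q vs - ext a (\<lambda>ws. q ((r *\<^sub>R x) # ws)) vs =
   r *\<^sub>R (a x * q vs - ext a (\<lambda>ws. q (x # ws)) vs)"
   by (simp add: alt_head[OF that] linear_cmul[OF assms(2), unfolded scaleR_complex] ext_scale scaleR_complex algebra_simps del: scaleR_conv_of_real)
 qed
 show "linear (\<lambda>v. \<gamma> (v # vs))" for vs
  unfolding *(3) ext.simps by (rule linear_compose_add[OF alt_linear[OF *(2)] lin[OF *(1)]])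
 show "\<gamma> (v # v # vs) = 0" for vs
  unfolding *(3) ext.simps using alt_diag[OF *(1)] alt_diag[OF *(2)]
  by (simp add: ext_zero)
qed

subsection \<open>The wedge product\<close>

lemma sum_Pow_lessThan_Suc:
 "(\<Sum>I\<in>Pow {..<Suc m}. f I) = (\<Sum>I\<in>Pow {..<m}. f (Suc ` I)) + (\<Sum>I\<in>Pow {..<m}. f (insert 0 (Suc ` I)))"
 for f :: "nat set => 'b::comm_monoid_add"
proof -
 have un: "Pow {..<Suc m} = (`) Suc ` Pow {..<m} \<union> (\<lambda>I. insert 0 (Suc ` I)) ` Pow {..<m}"
  unfolding lessThan_Suc_eq_insert_0 Pow_insert by (simp add: image_Pow_surj[OF refl, symmetric] image_image)
 have i1: "inj_on ((`) Suc) (Pow {..<m})"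
  by (rule inj_onI) (simp add: inj_image_eq_iff)
 have i2: "inj_on (\<lambda>I. insert 0 (Suc ` I)) (Pow {..<m})"
 proof (rule inj_onI)
  fix I I' :: "nat set" assume "insert 0 (Suc ` I) = insert 0 (Suc ` I')"
  then have "Suc ` I = Suc ` I'" by (metis Diff_insert_absorb imageE nat.distinct(1))
  then show "I = I'" by (simp add: inj_image_eq_iff)
 qed
 show ?thesis
  unfolding un
  by (subst sum.union_disjoint) (auto simp: sum.reindex[OF i1] sum.reindex[OF i2] o_def)
qed

lemma alt_wedge_Nil: "alt_wedge q p [] = q [] * p []"
 by (simp add: alt_wedge_def)

text \<open>A first argument handed to \<open>q\<close> creates no inversion. Handed to
  \<open>p\<close>, it is inverted against every index used by \<open>q\<close>, and their number is
  the length of the argument list of \<open>q\<close>; this is the sign in the second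
  summand.\<close>

lemma alt_wedge_Cons:
 "alt_wedge q p (v # vs) = alt_wedge (\<lambda>ws. q (v # ws)) p vs
   + alt_wedge (\<lambda>ws. (- 1) ^ length ws * q ws) (\<lambda>ws. p (v # ws)) vs"
proof -
 define inv where "inv = (\<lambda>m (I::nat set). {(i, j). i \<in> I \<and> j \<in> {..<m} - I \<and> j < i})"
 have w: "alt_wedge q p vs = (\<Sum>I\<in>Pow {..<length vs}.
   (- 1) ^ card (inv (length vs) I) * q (nths vs I) * p (nths vs (- I)))" for q p vs
  by (simp add: alt_wedge_def inv_def)
 have cm: "card (map_prod Suc Suc ` X) = card X" for X :: "(nat \<times> nat) set"
  by (rule card_image) (auto simp: inj_on_def)
 have c1: "card (inv (Suc m) (Suc ` I)) = card (inv m I) + card I" if "I \<subseteq> {..<m}" for m I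
 proof -
  have fin: "finite I" using that finite_subset by blast
  have f: "finite (inv m I)"
   by (rule finite_subset[of _ "I \<times> {..<m}"]) (use fin in \<open>auto simp: inv_def\<close>)
  have "inv (Suc m) (Suc ` I) = map_prod Suc Suc ` inv m I \<union> (\<lambda>i. (Suc i, 0)) ` I"
  proof (rule set_eqI, clarify)
   fix i j
   show "(i, j) \<in> inv (Suc m) (Suc ` I) \<longleftrightarrow> (i, j) \<in> map_prod Suc Suc ` inv m I \<union> (\<lambda>i. (Suc i, 0)) ` I"
    by (cases j; cases i) (auto simp: inv_def image_iff)
  qed
  moreover have "card (map_prod Suc Suc ` inv m I \<union> (\<lambda>i. (Suc i, 0)) ` I) = card (inv m I) + card I"
   by (subst card_Un_disjoint) (auto simp: f fin cm card_image inj_on_def)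
  ultimately show ?thesis by simp
 qed
 have c2: "card (inv (Suc m) (insert 0 (Suc ` I))) = card (inv m I)" if "I \<subseteq> {..<m}" for m I
 proof -
  have "inv (Suc m) (insert 0 (Suc ` I)) = map_prod Suc Suc ` inv m I"
  proof (rule set_eqI, clarify)
   fix i j
   show "(i, j) \<in> inv (Suc m) (insert 0 (Suc ` I)) \<longleftrightarrow> (i, j) \<in> map_prod Suc Suc ` inv m I"
    by (cases j; cases i) (auto simp: inv_def image_iff)
  qed
  moreover have "card (map_prod Suc Suc ` inv m I) = card (inv m I)"
   by (intro card_image) (auto simp: inj_on_def)
  ultimately show ?thesis by simp
 qed
 have l: "length (nths vs I) = card I" if "I \<subseteq> {..<length vs}" for I
  using that by (simp add: length_nths) (metis Collect_mem_eq inf.absorb2 Collect_conj_eq lessThan_def)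
 have s: "{j. Suc j \<in> Suc ` I} = I" "{j. Suc j \<in> - Suc ` I} = - I"
  "{j. Suc j \<in> insert 0 (Suc ` I)} = I" "{j. Suc j \<in> - insert 0 (Suc ` I)} = - I" for I
  by auto
 show ?thesis
  unfolding w length_Cons sum_Pow_lessThan_Suc nths_Cons s
  by (subst add.commute) (auto intro!: arg_cong2[where f="(+)"] sum.cong simp: c1 c2 l power_add mult_ac)
qed

lemma alt_wedge_lincomb_left:
 "alt_wedge (\<lambda>vs. \<Sum>i\<in>I. c i * A i vs) p vs = (\<Sum>i\<in>I. c i * alt_wedge (A i) p vs)"
 unfolding alt_wedge_def
 by (simp add: sum_distrib_left sum_distrib_right mult_ac) (rule sum.swap)

lemma alt_wedge_lincomb_right:
 "alt_wedge q (\<lambda>vs. \<Sum>i\<in>I. c i * B i vs) vs = (\<Sum>i\<in>I. c i * alt_wedge q (B i) vs)"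
 unfolding alt_wedge_def
 by (simp add: sum_distrib_left sum_distrib_right mult_ac) (rule sum.swap)

lemma alt_wedge_add_left: "alt_wedge (\<lambda>vs. q vs + q' vs) p vs = alt_wedge q p vs + alt_wedge q' p vs"
 unfolding alt_wedge_def by (simp add: sum.distrib algebra_simps)

lemma alt_wedge_diff_left: "alt_wedge (\<lambda>vs. q vs - q' vs) p vs = alt_wedge q p vs - alt_wedge q' p vs"
 unfolding alt_wedge_def by (simp add: sum_subtractf algebra_simps)

lemma alt_wedge_add_right: "alt_wedge q (\<lambda>vs. p vs + p' vs) vs = alt_wedge q p vs + alt_wedge q p' vs"
 unfolding alt_wedge_def by (simp add: sum.distrib algebra_simps)

lemma alt_wedge_diff_right: "alt_wedge q (\<lambda>vs. p vs - p' vs) vs = alt_wedge q p vs - alt_wedge q p' vs"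
 unfolding alt_wedge_def by (simp add: sum_subtractf algebra_simps)

lemma alt_wedge_scale_left: "alt_wedge (\<lambda>vs. c * q vs) p vs = c * alt_wedge q p vs"
 unfolding alt_wedge_def by (simp add: sum_distrib_left mult_ac)

lemma alt_wedge_scale_right: "alt_wedge q (\<lambda>vs. c * p vs) vs = c * alt_wedge q p vs"
 unfolding alt_wedge_def by (simp add: sum_distrib_left mult_ac)

lemma alt_wedge_cnj: "cnj (alt_wedge q p vs) = alt_wedge (\<lambda>vs. cnj (q vs)) (\<lambda>vs. cnj (p vs)) vs"
 unfolding alt_wedge_def by simp

lemma alt_wedge_zero_left: "alt_wedge (\<lambda>_. 0) p vs = 0"
 unfolding alt_wedge_def by simp

lemma alt_wedge_zero_right: "alt_wedge q (\<lambda>_. 0) vs = 0"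
 unfolding alt_wedge_def by simp

lemma alt_wedge_map: "alt_wedge q p (map G vs) = alt_wedge (\<lambda>vs. q (map G vs)) (\<lambda>vs. p (map G vs)) vs"
 unfolding alt_wedge_def by (simp add: nths_map)

lemma sign_ext: "(- 1) ^ length vs * ext a q vs = - ext a (\<lambda>ws. (- 1) ^ length ws * q ws) vs"
 unfolding ext_degree[of a "\<lambda>k. (- 1) ^ k"] by (cases vs) auto

lemma alt_wedge_ext_left: "alt_wedge (ext a q) p vs = ext a (alt_wedge q p) vs"
proof (induction vs arbitrary: q p)
 case (Cons v vs)
 have e: "(\<lambda>ws. (- 1) ^ length ws * ext a q ws) = (\<lambda>ws. - 1 * ext a (\<lambda>ws. (- 1) ^ length ws * q ws) ws)"
  by (simp add: sign_ext)
 show ?case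
  unfolding alt_wedge_Cons ext.simps e alt_wedge_scale_left alt_wedge_diff_left ext_add Cons by simp
qed (simp add: alt_wedge_Nil)

lemma alt_wedge_ext_right:
 "alt_wedge q (ext a p) vs = ext a (alt_wedge (\<lambda>ws. (- 1) ^ length ws * q ws) p) vs"
proof (induction vs arbitrary: q p)
 case (Cons v vs)
 have e: "(\<lambda>ws. (- 1) ^ length ws * ((- 1) ^ length ws * q ws)) = q"
  by (simp flip: mult.assoc power_add)
 have e': "alt_wedge (\<lambda>ws. (- 1) ^ length (v # ws) * q (v # ws)) p =
   (\<lambda>vs. - 1 * alt_wedge (\<lambda>ws. (- 1) ^ length ws * q (v # ws)) p vs)"
  by (rule ext) (simp flip: alt_wedge_scale_left)
 show ?case
  unfolding alt_wedge_Cons ext.simps e e' ext_scale alt_wedge_scale_right alt_wedge_diff_right ext_add Cons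
  by (simp add: algebra_simps)
qed (simp add: alt_wedge_Nil)

lemma alt_sign: "alternating q ==> alternating (\<lambda>ws. (- 1) ^ length ws * q ws)"
 by (rule alt_degree)

lemma alt_alt_wedge:
 fixes q p :: "'n::finite alt"
 assumes "alternating q" "alternating p"
 shows "alternating (alt_wedge q p)"
proof -
 define P where "P = (\<lambda>\<gamma>::'n alt. \<exists>(I::nat set) A B. finite I \<and> (\<forall>i\<in>I. alternating (A i) \<and> alternating (B i)) \<and>
   \<gamma> = (\<lambda>vs. \<Sum>i\<in>I. alt_wedge (A i) (B i) vs))"
 have lin: "linear (\<lambda>v. alt_wedge q p (v # vs))" if "alternating q" "alternating p" for q p :: "'n alt" and vs
  unfolding alt_wedge_Cons
  by (rule linearI) (simp_all add: alt_head[OF that(1)] alt_head[OF that(2)] alt_wedge_add_left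
    alt_wedge_add_right alt_wedge_scale_left alt_wedge_scale_right distrib_left scaleR_complex)
 have diag: "alt_wedge q p (v # v # vs) = 0" if "alternating q" "alternating p" for q p :: "'n alt" and v vs
 proof -
  have e: "(\<lambda>ws. (- 1) ^ length (v # ws) * q (v # ws)) = (\<lambda>ws. - 1 * ((- 1) ^ length ws * q (v # ws)))"
   by simp
  show ?thesis
   unfolding alt_wedge_Cons e alt_wedge_scale_left alt_diag[OF that(1)] alt_diag[OF that(2)]
    alt_wedge_zero_left alt_wedge_zero_right by simp
 qed
 show ?thesis
 proof (rule alternatingI_coinduct[where P=P])
  show "P (alt_wedge q p)"
   unfolding P_def by (rule exI[of _ "{0}"], rule exI[of _ "\<lambda>_. q"], rule exI[of _ "\<lambda>_. p"]) (simp add: assms)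
 next
  fix \<gamma> v assume "P \<gamma>"
  then obtain I :: "nat set" and A B where *: "finite I" "\<And>i. i \<in> I ==> alternating (A i)" "\<And>i. i \<in> I ==> alternating (B i)"
   "\<gamma> = (\<lambda>vs. \<Sum>i\<in>I. alt_wedge (A i) (B i) vs)" unfolding P_def by blast
  \<comment> \<open>Each product contracts to two products. Even and odd indices hold the two
    families, so that the result is again a finite sum indexed by naturals.\<close>
  define h where "h = (\<lambda>(i::nat). if even i then (\<lambda>ws. A (i div 2) (v # ws)) else (\<lambda>ws. (- 1) ^ length ws * A (i div 2) ws))"
  define k where "k = (\<lambda>(i::nat). if even i then B (i div 2) else (\<lambda>ws. B (i div 2) (v # ws)))"
  have hk: "h (2 * i) = (\<lambda>ws. A i (v # ws))" "h (Suc (2 * i)) = (\<lambda>ws. (- 1) ^ length ws * A i ws)"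
   "k (2 * i) = B i" "k (Suc (2 * i)) = (\<lambda>ws. B i (v # ws))" for i
   by (auto simp: h_def k_def)
  have inj: "inj_on ((*) 2) I" "inj_on (\<lambda>i. Suc (2 * i)) I" by (auto simp: inj_on_def)
  have dj: "(*) 2 ` I \<inter> (\<lambda>i. Suc (2 * i)) ` I = {}" by (auto) presburger
  have "(\<lambda>ws. \<gamma> (v # ws)) = (\<lambda>vs. \<Sum>j\<in>(*) 2 ` I \<union> (\<lambda>i. Suc (2 * i)) ` I. alt_wedge (h j) (k j) vs)"
   unfolding *(4) alt_wedge_Cons using *(1) dj
   by (simp add: sum.union_disjoint sum.reindex[OF inj(1)] sum.reindex[OF inj(2)] hk sum.distrib)
  moreover have "alternating (h j)" "alternating (k j)" if "j \<in> (*) 2 ` I \<union> (\<lambda>i. Suc (2 * i)) ` I" for j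
   using that by (auto simp: hk intro!: alt_contr[OF *(2)] alt_contr[OF *(3)] alt_sign *(2,3))
  ultimately show "P (\<lambda>ws. \<gamma> (v # ws))"
   unfolding P_def using *(1) by (intro exI[of _ "(*) 2 ` I \<union> (\<lambda>i. Suc (2 * i)) ` I"] exI[of _ h] exI[of _ k]) simp
  show "linear (\<lambda>v. \<gamma> (v # vs))" for vs
   unfolding *(4) by (rule linear_compose_sum) (use lin * in auto)
  show "\<gamma> (v # v # vs) = 0" for vs
   unfolding *(4) by (rule sum.neutral) (use diag * in auto)
 qed
qed

section \<open>Dual bases and inner products of alternating functions\<close>

text \<open>Contraction with the complexified vector whose coefficients in \<open>F\<close> are the
  values of \<open>a\<close>. For an orthonormal \<open>F\<close> this vector is the metric dual of
  \<open>a\<close>, and the contraction is, up to conjugating \<open>a\<close>, the adjoint of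
  exterior multiplication.\<close>

definition cov :: "(complex, 'n) vec set => ((complex, 'n) vec => complex) => 'n::finite alt => 'n alt" where
 "cov F a q = (\<lambda>vs. \<Sum>f\<in>F. a f * q (f # vs))"

definition dual_basis :: "(complex, 'n::finite) vec set => ((complex, 'n) vec => (complex, 'n) vec => real) => bool" where
 "dual_basis F \<phi> \<longleftrightarrow> finite F \<and> (\<forall>f\<in>F. \<forall>h\<in>F. \<phi> f h = (if f = h then 1 else 0)) \<and>
   (\<forall>v. (\<Sum>f\<in>F. \<phi> f v *\<^sub>R f) = v)"

lemma dual_basis_Basis: "dual_basis Basis (\<lambda>b v. v \<bullet> b)"
 unfolding dual_basis_def by (auto simp: inner_Basis euclidean_representation)

lemma dual_basis_expand:
 fixes X :: "(complex, 'n::finite) vec => complex"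
 assumes "dual_basis F \<phi>" "linear X"
 shows "(\<Sum>f\<in>F. \<phi> f v * X f) = X v"
proof -
 have "X (\<Sum>f\<in>F. \<phi> f v *\<^sub>R f) = (\<Sum>f\<in>F. \<phi> f v * X f)"
  by (simp add: linear_sum[OF assms(2)] linear_cmul[OF assms(2), unfolded scaleR_complex])
 then show ?thesis using assms(1) unfolding dual_basis_def by simp
qed

lemma cov_dual:
 assumes "dual_basis F \<phi>" "f \<in> F"
 shows "cov F (\<lambda>v. of_real (\<phi> f v)) q vs = q (f # vs)"
proof -
 have "cov F (\<lambda>v. of_real (\<phi> f v)) q vs = (\<Sum>h\<in>F. if f = h then q (h # vs) else 0)"
  unfolding cov_def using assms unfolding dual_basis_def by (intro sum.cong) auto
 then show ?thesis using assms unfolding dual_basis_def by simp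
qed

lemma alt_cov: "alternating q ==> alternating (cov F a q)"
 unfolding cov_def by (intro alt_lincomb alt_contr)

lemma cov_scale: "cov F a (\<lambda>vs. c * q vs) vs = c * cov F a q vs"
 unfolding cov_def by (simp add: sum_distrib_left mult_ac)

lemma cov_add: "cov F a (\<lambda>vs. q vs + p vs) vs = cov F a q vs + cov F a p vs"
 unfolding cov_def by (simp add: sum.distrib algebra_simps)

lemma cov_diff: "cov F a (\<lambda>vs. q vs - p vs) vs = cov F a q vs - cov F a p vs"
 unfolding cov_def by (simp add: sum_subtractf algebra_simps)

lemma cov_cov_scale: "cov F (\<lambda>v. c * a v) q vs = c * cov F a q vs"
 unfolding cov_def by (simp add: sum_distrib_left mult_ac)

text \<open>Wedging each contraction back with its dual covector counts the slots. It recovers a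
  form of positive degree from its contractions, which drives the inductions on degree.\<close>

lemma euler:
 assumes "dual_basis F \<phi>" "alternating q"
 shows "(\<Sum>f\<in>F. ext (\<lambda>v. of_real (\<phi> f v)) (\<lambda>ws. q (f # ws)) vs) = of_nat (length vs) * q vs"
 using assms(2)
proof (induction vs arbitrary: q)
 case (Cons v vs)
 have "(\<lambda>ws. q (f # v # ws)) = (\<lambda>ws. - q (v # f # ws))" for f
  using alt_swap[OF Cons.prems] by blast
 then have "(\<Sum>f\<in>F. ext (\<lambda>v. of_real (\<phi> f v)) (\<lambda>ws. q (f # ws)) (v # vs)) =
  (\<Sum>f\<in>F. \<phi> f v * q (f # vs)) + (\<Sum>f\<in>F. ext (\<lambda>v. of_real (\<phi> f v)) (\<lambda>ws. q (v # f # ws)) vs)"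
  by (simp add: ext_minus sum.distrib)
 then show ?case
  by (simp add: dual_basis_expand[OF assms(1) alt_linear[OF Cons.prems]]
    Cons.IH[OF alt_contr[OF Cons.prems]] algebra_simps)
qed simp

section \<open>Inner products of alternating functions relative to a list of vectors\<close>

definition inn :: "(complex, 'n::finite) vec list => 'n alt => 'n alt => complex" where
 "inn fs u v = (\<Sum>I\<in>Pow {..<length fs}. u (nths fs I) * cnj (v (nths fs I)))"

lemma inn_Nil [simp]: "inn [] u v = u [] * cnj (v [])"
 by (simp add: inn_def)

lemma inn_Cons [simp]: "inn (f # fs) u v = inn fs u v + inn fs (\<lambda>ws. u (f # ws)) (\<lambda>ws. v (f # ws))"
proof -
 have "{j. Suc j \<in> Suc ` I} = I" for I by auto
 then show ?thesis
  unfolding inn_def length_Cons sum_Pow_lessThan_Suc nths_Cons by simp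
qed

lemma inn_lincomb_left: "inn fs (\<lambda>vs. \<Sum>i\<in>I. c i * U i vs) v = (\<Sum>i\<in>I. c i * inn fs (U i) v)"
 unfolding inn_def by (simp add: sum_distrib_left sum_distrib_right mult_ac) (rule sum.swap)

lemma inn_lincomb_right: "inn fs u (\<lambda>vs. \<Sum>i\<in>I. c i * V i vs) = (\<Sum>i\<in>I. cnj (c i) * inn fs u (V i))"
 unfolding inn_def by (simp add: sum_distrib_left sum_distrib_right mult_ac) (rule sum.swap)

lemma inn_sum_left: "inn fs (\<lambda>vs. \<Sum>i\<in>I. U i vs) v = (\<Sum>i\<in>I. inn fs (U i) v)"
 using inn_lincomb_left[where c="\<lambda>_. 1"] by simp

lemma inn_sum_right: "inn fs u (\<lambda>vs. \<Sum>i\<in>I. V i vs) = (\<Sum>i\<in>I. inn fs u (V i))"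
 using inn_lincomb_right[where c="\<lambda>_. 1"] by simp

lemma inn_add_left: "inn fs (\<lambda>vs. u vs + u' vs) v = inn fs u v + inn fs u' v"
 unfolding inn_def by (simp add: sum.distrib algebra_simps)

lemma inn_add_right: "inn fs u (\<lambda>vs. v vs + v' vs) = inn fs u v + inn fs u v'"
 unfolding inn_def by (simp add: sum.distrib algebra_simps)

lemma inn_diff_left: "inn fs (\<lambda>vs. u vs - u' vs) v = inn fs u v - inn fs u' v"
 unfolding inn_def by (simp add: sum_subtractf algebra_simps)

lemma inn_diff_right: "inn fs u (\<lambda>vs. v vs - v' vs) = inn fs u v - inn fs u v'"
 unfolding inn_def by (simp add: sum_subtractf algebra_simps)

lemma inn_scale_left: "inn fs (\<lambda>vs. c * u vs) v = c * inn fs u v"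
 unfolding inn_def by (simp add: sum_distrib_left mult_ac)

lemma inn_scale_right: "inn fs u (\<lambda>vs. c * v vs) = cnj c * inn fs u v"
 unfolding inn_def by (simp add: sum_distrib_left mult_ac)

lemma inn_cnj: "cnj (inn fs u v) = inn fs v u"
 unfolding inn_def by (simp add: mult_ac)

lemma inn_cnj_cnj: "inn fs (\<lambda>vs. cnj (u vs)) (\<lambda>vs. cnj (v vs)) = cnj (inn fs u v)"
 unfolding inn_def by simp

text \<open>Both recursions split off \<open>f\<close>; the sign of the antiderivation rule on the
  left is met on the right by the sign of swapping \<open>f\<close> with the contracting
  vector.\<close>

lemma inn_ext:
 assumes "alternating v" "distinct fs"
 shows "inn fs (ext a u) v = inn fs u (cov (set fs) (\<lambda>v. cnj (a v)) v)"
 using assms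
proof (induction fs arbitrary: u v)
 case Nil
 then show ?case by (simp add: cov_def)
next
 case (Cons f fs)
 have 1: "cov (set (f # fs)) (\<lambda>v. cnj (a v)) v = (\<lambda>vs. cnj (a f) * v (f # vs) + cov (set fs) (\<lambda>v. cnj (a v)) v vs)"
  using Cons.prems by (simp add: cov_def)
 have 2: "(\<lambda>ws. cov (set fs) (\<lambda>v. cnj (a v)) v (f # ws)) = (\<lambda>ws. - 1 * cov (set fs) (\<lambda>v. cnj (a v)) (\<lambda>ws. v (f # ws)) ws)"
  unfolding cov_def by (subst alt_swap[OF Cons.prems(1)]) (simp add: sum_negf)
 show ?case
  unfolding inn_Cons 1 ext.simps inn_add_right inn_diff_left inn_scale_left inn_scale_right 2
   alt_diag[OF Cons.prems(1)]
  using Cons.IH[OF Cons.prems(1), of u] Cons.IH[OF alt_contr[OF Cons.prems(1)], of "\<lambda>ws. u (f # ws)" f] Cons.prems(2)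
  by (simp add: inn_scale_right[of _ _ 0, simplified])
qed

definition part :: "nat => 'n::finite alt => 'n alt" where
 "part k q = (\<lambda>vs. if length vs = k then q vs else 0)"

lemma alt_part: "alternating q ==> alternating (part k q)"
 using alt_degree[of q "\<lambda>j. if j = k then 1 else 0"] by (simp add: part_def if_distrib[of "\<lambda>x. x * _"] cong: if_cong)

lemma part_contr: "(\<lambda>ws. part (Suc k) q (f # ws)) = part k (\<lambda>ws. q (f # ws))"
 by (auto simp: part_def)

lemma inn_eq_sum_part:
 assumes "length fs \<le> N"
 shows "inn fs u v = (\<Sum>k\<le>N. inn fs (part k u) v)"
proof -
 have "u (nths fs I) = (\<Sum>k\<le>N. part k u (nths fs I))" for I
 proof -
  have "length (nths fs I) \<le> length fs"
   unfolding length_nths using card_mono[of "{..<length fs}" "{i. i < length fs \<and> i \<in> I}"] by auto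
  then have "length (nths fs I) \<le> N" using assms by simp
  then show ?thesis by (simp add: part_def)
 qed
 then show ?thesis
  unfolding inn_def by (simp add: sum_distrib_right) (rule sum.swap)
qed

lemma inn_part_0: "inn fs (part 0 u) v = u [] * cnj (v [])"
proof (induction fs)
 case (Cons f fs)
 have "inn fs (\<lambda>ws. part 0 u (f # ws)) (\<lambda>ws. v (f # ws)) = 0"
  by (simp add: part_def inn_def)
 then show ?case using Cons by simp
qed (simp add: part_def)

text \<open>Euler's identity writes the component as a sum of dual covectors times contractions, and
  the adjoint of multiplying by a dual covector is contraction again. Hence degree
  \<open>k + 1\<close> depends on the frame only through the tensor \<Sum> f \<otimes> f and the
  inner product in degree \<open>k\<close>.\<close>

lemma inn_part_Suc:
 assumes "dual_basis (set fs) \<phi>" "distinct fs" "alternating u" "alternating v"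
 shows "of_nat (Suc k) * inn fs (part (Suc k) u) v = (\<Sum>f\<in>set fs. inn fs (part k (\<lambda>ws. u (f # ws))) (\<lambda>ws. v (f # ws)))"
proof -
 have "of_nat (Suc k) * inn fs (part (Suc k) u) v = inn fs (\<lambda>vs. of_nat (Suc k) * part (Suc k) u vs) v"
  by (simp only: inn_scale_left)
 also have "(\<lambda>vs. of_nat (Suc k) * part (Suc k) u vs) =
  (\<lambda>vs. \<Sum>f\<in>set fs. ext (\<lambda>v. of_real (\<phi> f v)) (\<lambda>ws. part (Suc k) u (f # ws)) vs)"
  unfolding euler[OF assms(1) alt_part[OF assms(3)]] by (auto simp: part_def)
 also have "inn fs \<dots> v = (\<Sum>f\<in>set fs. inn fs (ext (\<lambda>v. of_real (\<phi> f v)) (part k (\<lambda>ws. u (f # ws)))) v)"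
  unfolding inn_sum_left part_contr ..
 also have "\<dots> = (\<Sum>f\<in>set fs. inn fs (part k (\<lambda>ws. u (f # ws))) (\<lambda>ws. v (f # ws)))"
 proof (rule sum.cong)
  fix f assume "f \<in> set fs"
  then have "cov (set fs) (\<lambda>v. cnj (of_real (\<phi> f v))) v = (\<lambda>ws. v (f # ws))"
   using cov_dual[OF assms(1)] by auto
  then show "inn fs (ext (\<lambda>v. of_real (\<phi> f v)) (part k (\<lambda>ws. u (f # ws)))) v =
   inn fs (part k (\<lambda>ws. u (f # ws))) (\<lambda>ws. v (f # ws))"
   by (simp add: inn_ext[OF assms(4,2)])
 qed simp
 finally show ?thesis .
qed

text \<open>The second order tensor of a basis, written as a functional of bilinear maps.\<close>

definition same_tensor :: "(complex, 'n::finite) vec set => (complex, 'n) vec set => ((complex, 'n) vec => (complex, 'n) vec) => bool" where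
 "same_tensor F E G \<longleftrightarrow> (\<forall>X::(complex,'n) vec => (complex,'n) vec => complex.
   (\<forall>u. linear (X u)) --> (\<forall>v. linear (\<lambda>u. X u v)) --> (\<Sum>f\<in>F. X f f) = (\<Sum>e\<in>E. X e (G e)))"

lemma linear_inn_left:
 assumes "alternating u" shows "linear (\<lambda>f. inn fs (part k (\<lambda>ws. u (f # ws))) v)"
proof (rule linearI)
 fix x y r
 have "part k (\<lambda>ws. u ((x + y) # ws)) = (\<lambda>ws. part k (\<lambda>ws. u (x # ws)) ws + part k (\<lambda>ws. u (y # ws)) ws)"
  by (auto simp: part_def alt_head[OF assms])
 then show "inn fs (part k (\<lambda>ws. u ((x + y) # ws))) v = inn fs (part k (\<lambda>ws. u (x # ws))) v + inn fs (part k (\<lambda>ws. u (y # ws))) v"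
  by (simp add: inn_add_left)
 have "part k (\<lambda>ws. u ((r *\<^sub>R x) # ws)) = (\<lambda>ws. of_real r * part k (\<lambda>ws. u (x # ws)) ws)"
  unfolding alt_head[OF assms] by (auto simp: part_def)
 then show "inn fs (part k (\<lambda>ws. u ((r *\<^sub>R x) # ws))) v = r *\<^sub>R inn fs (part k (\<lambda>ws. u (x # ws))) v"
  by (simp only: inn_scale_left scaleR_complex)
qed

lemma linear_inn_right:
 assumes "alternating v" shows "linear (\<lambda>f. inn fs u (\<lambda>vs. v (f # G vs)))"
 by (rule linearI) (simp_all only: alt_head[OF assms] inn_add_right inn_scale_right complex_cnj_complex_of_real scaleR_complex)

text \<open>In degree \<open>k + 1\<close> the tensor of the first basis is replaced by that of the
  second; what is left is degree \<open>k\<close> for the contracted forms. The map \<open>G\<close>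
  accounts for a second basis that is not orthonormal.\<close>

lemma inn_change_basis:
 assumes fs: "dual_basis (set fs) \<phi>" "distinct fs" and es: "dual_basis (set es) \<psi>" "distinct es"
  and G: "linear G" "same_tensor (set fs) (set es) G" and uv: "alternating u" "alternating v"
 shows "inn fs u v = inn es u (\<lambda>vs. v (map G vs))"
proof -
 have *: "inn fs (part k u) v = inn es (part k u) (\<lambda>vs. v (map G vs))" if "alternating u" "alternating v" for k u v
  using that
 proof (induction k arbitrary: u v)
  case 0
  then show ?case by (simp add: inn_part_0)
 next
  case (Suc k)
  have "of_nat (Suc k) * inn fs (part (Suc k) u) v =
   (\<Sum>f\<in>set fs. inn es (part k (\<lambda>ws. u (f # ws))) (\<lambda>vs. v (f # map G vs)))"
   unfolding inn_part_Suc[OF fs Suc.prems] using Suc.IH[OF alt_contr alt_contr] Suc.prems by simp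
  also have "\<dots> = (\<Sum>e\<in>set es. inn es (part k (\<lambda>ws. u (e # ws))) (\<lambda>vs. v (G e # map G vs)))"
   using G(2) linear_inn_left[OF Suc.prems(1), of es k] linear_inn_right[OF Suc.prems(2), of es _ "map G"]
   unfolding same_tensor_def by (elim allE[of _ "\<lambda>f h. inn es (part k (\<lambda>ws. u (f # ws))) (\<lambda>vs. v (h # map G vs))"]) blast
  also have "\<dots> = of_nat (Suc k) * inn es (part (Suc k) u) (\<lambda>vs. v (map G vs))"
   unfolding inn_part_Suc[OF es Suc.prems(1) alt_map[OF Suc.prems(2) G(1)]] by simp
  finally show ?case by (simp del: of_nat_Suc)
 qed
 show ?thesis
  using inn_eq_sum_part[of fs "max (length fs) (length es)" u v]
   inn_eq_sum_part[of es "max (length fs) (length es)" u "\<lambda>vs. v (map G vs)"] *[OF uv] by simp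
qed

lemma inn_self: "inn fs u u = of_real (\<Sum>I\<in>Pow {..<length fs}. (norm (u (nths fs I)))\<^sup>2)"
 unfolding inn_def by (simp add: complex_norm_square del: of_real_power)

lemma inn_self_nonneg: "0 \<le> Re (inn fs u u)" "Im (inn fs u u) = 0"
 unfolding inn_self by (auto intro: sum_nonneg)

text \<open>By positivity and \<open>inn_part_Suc\<close> a vanishing norm kills all contractions in
  each degree; the dual basis then reaches arbitrary vectors, not only members of the list.\<close>

lemma inn_self_eq_0:
 assumes fs: "dual_basis (set fs) \<phi>" "distinct fs" and u: "alternating u" "inn fs u u = 0"
 shows "u vs = 0"
proof -
 have pp: "inn fs (part k u) u = inn fs (part k u) (part k u)" for k u
  unfolding inn_def by (rule sum.cong) (auto simp: part_def)
 have *: "part k u vs = 0" if "alternating u" "inn fs (part k u) u = 0" for k u vs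
  using that
 proof (induction k arbitrary: u vs)
  case 0
  then show ?case by (auto simp: inn_part_0) (simp add: part_def)
 next
  case (Suc k)
  have "(\<Sum>f\<in>set fs. inn fs (part k (\<lambda>ws. u (f # ws))) (part k (\<lambda>ws. u (f # ws)))) = 0"
   using inn_part_Suc[OF fs Suc.prems(1,1), of k] Suc.prems(2) by (simp add: pp)
  then have "(\<Sum>f\<in>set fs. Re (inn fs (part k (\<lambda>ws. u (f # ws))) (part k (\<lambda>ws. u (f # ws))))) = 0"
   by (metis Re_sum zero_complex.simps(1))
  then have "Re (inn fs (part k (\<lambda>ws. u (f # ws))) (part k (\<lambda>ws. u (f # ws)))) = 0" if "f \<in> set fs" for f
   using that by (subst (asm) sum_nonneg_eq_0_iff) (auto simp: inn_self_nonneg)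
  then have "inn fs (part k (\<lambda>ws. u (f # ws))) (\<lambda>ws. u (f # ws)) = 0" if "f \<in> set fs" for f
   using that by (simp add: pp complex_eq_iff inn_self_nonneg)
  then have 0: "part (Suc k) u (f # vs) = 0" if "f \<in> set fs" for f vs
   using Suc.IH[OF alt_contr[OF Suc.prems(1)]] that part_contr by metis
  show ?case
  proof (cases vs)
   case Nil
   then show ?thesis by (simp add: part_def)
  next
   case (Cons w ws)
   then show ?thesis
    using dual_basis_expand[OF fs(1) alt_linear[OF alt_part[OF Suc.prems(1), of "Suc k"]], of w ws] 0 by simp
  qed
 qed
 have "(\<Sum>I\<in>Pow {..<length fs}. (norm (u (nths fs I)))\<^sup>2) = 0"
  using u(2) unfolding inn_self by (simp only: of_real_eq_0_iff)
 then have "u (nths fs I) = 0" if "I \<in> Pow {..<length fs}" for I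
  using that by (subst (asm) sum_nonneg_eq_0_iff) auto
 then have "inn fs (part k u) u = 0" for k
  unfolding inn_def by (intro sum.neutral) auto
 from *[OF u(1) this, of "length vs" vs] show ?thesis by (simp add: part_def)
qed

section \<open>Hermitian linear algebra at a point\<close>

text \<open>Shown in \<open>adj_w\<close> to be the adjoint of \<omega> \<and> . for an orthonormal
  real frame. The 2n real vectors count each complex direction twice, hence the 1/2.\<close>

definition Lam :: "(complex, 'n) vec set => 'n::finite alt => 'n alt" where
 "Lam F q = (\<lambda>vs. (\<Sum>f\<in>F. q (f # cJ f # vs)) / 2)"

text \<open>The ungraded commutator agrees with the graded one because \<Lambda> has even
  degree.\<close>

definition adL :: "(complex, 'n) vec set => ('n::finite alt => 'n alt) => 'n alt => 'n alt" where
 "adL F P q = (\<lambda>vs. Lam F (P q) vs - P (Lam F q) vs)"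

lemma Lam_add: "Lam F (\<lambda>vs. q vs + p vs) = (\<lambda>vs. Lam F q vs + Lam F p vs)"
 unfolding Lam_def by (simp add: sum.distrib add_divide_distrib)

lemma Lam_diff: "Lam F (\<lambda>vs. q vs - p vs) = (\<lambda>vs. Lam F q vs - Lam F p vs)"
 unfolding Lam_def by (simp add: sum_subtractf diff_divide_distrib)

lemma Lam_scale: "Lam F (\<lambda>vs. c * q vs) = (\<lambda>vs. c * Lam F q vs)"
 unfolding Lam_def by (simp add: sum_distrib_left)

lemma Lam_zero: "Lam F (\<lambda>vs. 0) = (\<lambda>vs. 0)"
 unfolding Lam_def by simp

lemma Lam_sum: "Lam F (\<lambda>vs. \<Sum>i\<in>I. A i vs) = (\<lambda>vs. \<Sum>i\<in>I. Lam F (A i) vs)"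
 by (induction I rule: infinite_finite_induct) (simp_all add: Lam_zero Lam_add)

lemma alt_Lam: "alternating q ==> alternating (Lam F q)"
 unfolding Lam_def sum_divide_distrib
 using alt_lincomb[of F "\<lambda>f ws. q (f # cJ f # ws)" "\<lambda>_. 1/2"]
 by (simp add: alt_contr[OF alt_contr])

lemma linear_mult_left: "linear X ==> linear (\<lambda>v. c * X v)" for X :: "'x::real_vector => complex" and c
 by (rule linear_compose[of _ "\<lambda>x. c * x", unfolded o_def]) (simp_all add: linear_times)

lemma linear_mult_right: "linear X ==> linear (\<lambda>v. X v * c)" for X :: "'x::real_vector => complex" and c
 using linear_mult_left[of X c] by (simp add: mult.commute)

text \<open>\<open>w\<close> is the value at a point of the fundamental form of a Hermitian metric \<open>g\<close>.\<close>

locale hpoint =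
 fixes w :: "'n::finite alt"
 assumes w_alt: "alternating w"
  and w_deg: "length vs \<noteq> 2 ==> w vs = 0"
  and w_J: "w [cJ u, cJ v] = w [u, v]"
  and w_real: "cnj (w vs) = w vs"
  and w_pos: "v \<noteq> 0 ==> 0 < Re (w [v, cJ v])"
begin

definition g :: "(complex, 'n) vec => (complex, 'n) vec => real" where
 "g u v = Re (w [u, cJ v])"

lemma w_eq: "w [u, cJ v] = of_real (g u v)"
 using w_real[of "[u, cJ v]"] by (simp add: g_def complex_eq_iff)

lemma w_neg: "w [- u, v] = - w [u, v]" "w [u, - v] = - w [u, v]"
 using linear_neg[OF alt_linear[OF w_alt]] linear_neg[OF alt_linear2[OF w_alt]] by auto

lemma w_swap: "w [u, v] = - w [v, u]"
 by (rule alt_swap[OF w_alt])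

lemma w_J_left: "w [cJ u, v] = - w [u, cJ v]"
 using w_J[of u "cJ v"] by (simp add: w_neg minus_equation_iff[of "w [cJ u, v]"] eq_commute)

lemma g_sym: "g u v = g v u"
 using w_swap[of u "cJ v"] w_J_left[of v u] by (simp add: g_def)

lemma g_J_left: "g (cJ u) v = - g u (cJ v)"
 using w_J_left[of u "cJ v"] by (simp add: g_def)

lemma g_J_swap: "g u (cJ v) = - g v (cJ u)"
 using g_sym[of u "cJ v"] g_J_left[of v u] by simp

lemma g_linear: "linear (\<lambda>u. g u v)" "linear (\<lambda>v. g u v)"
proof -
 show 1: "linear (\<lambda>u. g u v)" for v
  unfolding g_def using linear_compose[OF alt_linear[OF w_alt] bounded_linear.linear[OF bounded_linear_Re]]
  by (simp add: o_def)
 show "linear (\<lambda>v. g u v)"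
  using 1[of u] by (simp add: g_sym[of u])
qed

lemmas g_simps = linear_add[OF g_linear(1)] linear_add[OF g_linear(2)] linear_cmul[OF g_linear(1)]
 linear_cmul[OF g_linear(2)] linear_neg[OF g_linear(1)] linear_neg[OF g_linear(2)] linear_diff[OF g_linear(1)]
 linear_diff[OF g_linear(2)] linear_0[OF g_linear(1)] linear_0[OF g_linear(2)]
 linear_sum[OF g_linear(1)] linear_sum[OF g_linear(2)]

lemma g_pos: "v \<noteq> 0 ==> 0 < g v v"
 unfolding g_def by (rule w_pos)

definition orth :: "(complex, 'n) vec set => bool" where
 "orth F \<longleftrightarrow> (\<forall>f\<in>F. \<forall>h\<in>F. g f h = (if f = h then 1 else 0))"

lemma orth_coeff:
 assumes "orth F" "finite F" "h \<in> F"
 shows "g h (\<Sum>f\<in>F. c f *\<^sub>R f) = c h"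
proof -
 have "g h (\<Sum>f\<in>F. c f *\<^sub>R f) = (\<Sum>f\<in>F. if f = h then c f else 0)"
  using assms unfolding g_simps orth_def by (intro sum.cong) auto
 then show ?thesis using assms by simp
qed

lemma orth_independent:
 assumes "orth F" "finite F" shows "independent F"
proof (rule independent_if_scalars_zero[OF assms(2)])
 fix c x assume "(\<Sum>f\<in>F. c f *\<^sub>R f) = 0" "x \<in> F"
 then show "c x = 0" using orth_coeff[OF assms, of x c] by (simp add: g_simps)
qed

lemma orth_card_imp_dual_basis:
 assumes "orth F" "finite F" "card F = 2 * CARD('n)"
 shows "dual_basis F g"
proof -
 have "span F = UNIV"
  using card_ge_dim_independent[of F UNIV] orth_independent[OF assms(1,2)] assms(3) by auto
 then have "(\<Sum>f\<in>F. g f v *\<^sub>R f) = v" for v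
 proof -
  have "v \<in> range (\<lambda>u. \<Sum>f\<in>F. u f *\<^sub>R f)"
   using span_finite[OF assms(2)] \<open>span F = UNIV\<close> by auto
  then obtain c where "v = (\<Sum>f\<in>F. c f *\<^sub>R f)" by auto
  moreover then have "g f v = c f" if "f \<in> F" for f
   using orth_coeff[OF assms(1,2) that] by simp
  ultimately show ?thesis by simp
 qed
 then show ?thesis
  using assms unfolding dual_basis_def orth_def by auto
qed

text \<open>An orthonormal set of maximal size spans: otherwise the normalised defect of an
  orthogonal projection enlarges it.\<close>

lemma ex_orth: "\<exists>F. orth F \<and> finite F \<and> card F = 2 * CARD('n)"
proof -
 define P where "P = (\<lambda>k. \<exists>F. orth F \<and> finite F \<and> card F = k)"
 have bound: "k \<le> DIM((complex,'n) vec)" if "P k" for k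
  using that independent_card_le[OF orth_independent] unfolding P_def by blast
 have "P 0" unfolding P_def orth_def by (rule exI[of _ "{}"]) auto
 then obtain k where k: "P k" "\<And>j. P j ==> j \<le> k"
  using GreatestI_nat[of P 0 "DIM((complex,'n) vec)"] Greatest_le_nat[of P _ "DIM((complex,'n) vec)"] bound by metis
 then obtain F where F: "orth F" "finite F" "card F = k" unfolding P_def by blast
 have "(\<Sum>f\<in>F. g f v *\<^sub>R f) = v" for v
 proof (rule ccontr)
  assume ne: "(\<Sum>f\<in>F. g f v *\<^sub>R f) \<noteq> v"
  define u where "u = v - (\<Sum>f\<in>F. g f v *\<^sub>R f)"
  define e where "e = (1 / sqrt (g u u)) *\<^sub>R u"
  have "u \<noteq> 0" using ne by (simp add: u_def)
  then have pos: "g u u > 0" by (rule g_pos)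
  have fu: "g f u = 0" if "f \<in> F" for f
   using orth_coeff[OF F(1,2) that, of "\<lambda>f. g f v"] unfolding u_def by (simp add: g_simps)
  have fe: "g f e = 0" "g e f = 0" if "f \<in> F" for f
   using fu[OF that] g_sym[of u f] unfolding e_def by (simp_all add: g_simps)
  have ee: "g e e = 1"
   unfolding e_def using pos by (simp add: g_simps)
  have "e \<notin> F" using fe ee by force
  have "orth (insert e F)"
   using F(1) fe ee \<open>e \<notin> F\<close> unfolding orth_def by auto
  then have "P (Suc k)" unfolding P_def using F \<open>e \<notin> F\<close> by (intro exI[of _ "insert e F"]) auto
  then show False using k(2) by fastforce
 qed
 then have "v \<in> span F" for v
  using span_sum[of F "\<lambda>f. g f v *\<^sub>R f" F] by (metis span_base span_scale)
 then have "span F = UNIV" by auto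
 then have "card F = DIM((complex,'n) vec)"
  using dim_span_eq_card_independent[OF orth_independent[OF F(1,2)]] by (simp add: dim_UNIV)
 then show ?thesis using F by auto
qed

end

locale hframe = hpoint +
 fixes F
 assumes F_orth: "orth F" and F_fin: "finite F" and F_card: "card F = 2 * CARD('a)"
begin

lemma F_dual: "dual_basis F g"
 by (rule orth_card_imp_dual_basis[OF F_orth F_fin F_card])

lemma expand: "linear X ==> (\<Sum>f\<in>F. g f v * X f) = X v" for X :: "_ => complex"
 by (rule dual_basis_expand[OF F_dual])

text \<open>J is skew for \<open>g\<close>; expanding \<open>J f\<close> in the frame and exchanging
  the two sums moves J to the other argument at the cost of a sign.\<close>

lemma sum_skew:
 fixes X :: "(complex, 'a) vec => (complex, 'a) vec => complex"
 assumes "\<And>u. linear (X u)" "\<And>v. linear (\<lambda>u. X u v)"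
 shows "(\<Sum>f\<in>F. X (cJ f) f) = - (\<Sum>f\<in>F. X f (cJ f))"
proof -
 have "(\<Sum>f\<in>F. X (cJ f) f) = (\<Sum>f\<in>F. \<Sum>h\<in>F. g h (cJ f) * X h f)"
  by (simp add: expand[OF assms(2)])
 also have "\<dots> = (\<Sum>h\<in>F. \<Sum>f\<in>F. g h (cJ f) * X h f)" by (rule sum.swap)
 also have "\<dots> = (\<Sum>h\<in>F. - (\<Sum>f\<in>F. g f (cJ h) * X h f))"
 proof (rule sum.cong[OF refl])
  fix h
  have "of_real (g h (cJ f)) * X h f = - (of_real (g f (cJ h)) * X h f)" for f
   by (subst g_J_swap) simp
  then show "(\<Sum>f\<in>F. g h (cJ f) * X h f) = - (\<Sum>f\<in>F. g f (cJ h) * X h f)"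
   by (simp add: sum_negf)
 qed
 also have "\<dots> = - (\<Sum>f\<in>F. X f (cJ f))"
  by (simp add: expand[OF assms(1)] sum_negf)
 finally show ?thesis .
qed

text \<open>Contracting a \<and> q with \<open>f\<close> and \<open>J f\<close> leaves one term with
  a(f) and one with a(J f). After summation the skewness of J makes them equal, which uses up the
  1/2.\<close>

lemma Lam_ext:
 assumes "alternating q" "linear a"
 shows "Lam F (ext a q) = (\<lambda>vs. ext a (Lam F q) vs - cov F (\<lambda>v. a (cJ v)) q vs)"
proof
 fix vs
 have "(\<Sum>f\<in>F. a (cJ f) * q (f # vs)) = - (\<Sum>f\<in>F. a f * q (cJ f # vs))"
  by (rule sum_skew[where X="\<lambda>u v. a u * q (v # vs)"])
   (intro linear_mult_left linear_mult_right alt_linear assms)+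
 moreover have "Lam F (ext a q) vs = (\<Sum>f\<in>F. a f * q (cJ f # vs) - (a (cJ f) * q (f # vs) - ext a (\<lambda>ws. q (f # cJ f # ws)) vs)) / 2"
  by (simp add: Lam_def)
 moreover have "ext a (Lam F q) vs = (\<Sum>f\<in>F. ext a (\<lambda>ws. q (f # cJ f # ws)) vs) / 2"
  using ext_lincomb[where c="\<lambda>_. 1/2" and A="\<lambda>f ws. q (f # cJ f # ws)"]
  by (simp add: Lam_def sum_divide_distrib)
 ultimately show "Lam F (ext a q) vs = ext a (Lam F q) vs - cov F (\<lambda>v. a (cJ v)) q vs"
  by (simp add: cov_def sum_subtractf sum.distrib add_divide_distrib diff_divide_distrib)
qed

lemma Lam_contr: "alternating q ==> Lam F q (v # vs) = Lam F (\<lambda>ws. q (v # ws)) vs"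
proof -
 assume a: "alternating q"
 have "q (f # h # v # vs) = q (v # f # h # vs)" for f h
  using alt_swap[OF alt_contr[OF a, of f], of h v vs] alt_swap[OF a, of f v "h # vs"] by simp
 then show ?thesis by (simp add: Lam_def)
qed

lemma Lam_cov: "alternating q ==> Lam F (cov F a q) = cov F a (Lam F q)"
 unfolding cov_def Lam_sum Lam_scale by (simp add: Lam_contr)

text \<open>Euler's identity in degree two: a two-form is half the sum of dual covectors wedge its
  contractions, and each contraction is a covector. Multiplication by a two-form thus reduces to
  \<open>ext\<close> applied twice.\<close>

lemma wedge_two:
 assumes "alternating \<psi>" "\<And>vs. length vs \<noteq> 2 ==> \<psi> vs = 0"
 shows "alt_wedge \<psi> q = (\<lambda>vs. (\<Sum>f\<in>F. ext (\<lambda>v. of_real (g f v)) (ext (\<lambda>v. \<psi> [f, v]) q) vs) / 2)"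
proof -
 define one :: "'a alt" where "one = (\<lambda>ws. if ws = [] then 1 else 0)"
 have one: "alt_wedge one q vs = q vs" for q vs
 proof (induction vs arbitrary: q)
  case (Cons v vs)
  have "(\<lambda>ws. (- 1) ^ length ws * one ws) = one" by (auto simp: one_def)
  then show ?case using Cons by (simp add: alt_wedge_Cons) (simp add: one_def alt_wedge_zero_left)
 qed (simp add: alt_wedge_Nil one_def)
 have ext1: "ext a one ws = (case ws of [v] => a v | _ => 0)" for a ws
  by (cases ws; cases "tl ws") (auto simp: one_def ext_zero)
 have c: "(\<lambda>ws. \<psi> (f # ws)) = ext (\<lambda>v. \<psi> [f, v]) one" for f
  using assms(2) by (auto simp: ext1 split: list.split)
 have "\<psi> vs = (\<Sum>f\<in>F. 1/2 * ext (\<lambda>v. of_real (g f v)) (\<lambda>ws. \<psi> (f # ws)) vs)" for vs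
  unfolding sum_distrib_left[symmetric] euler[OF F_dual assms(1)] using assms(2)[of vs] by (cases "length vs = 2") auto
 then have eq: "\<psi> = (\<lambda>vs. \<Sum>f\<in>F. 1/2 * ext (\<lambda>v. of_real (g f v)) (ext (\<lambda>v. \<psi> [f, v]) one) vs)"
  unfolding c by (rule HOL.ext)
 have "alt_wedge \<psi> q vs = (\<Sum>f\<in>F. 1/2 * alt_wedge (ext (\<lambda>v. of_real (g f v)) (ext (\<lambda>v. \<psi> [f, v]) one)) q vs)" for vs
  by (rule trans[OF arg_cong[OF eq, where f="\<lambda>\<psi>. alt_wedge \<psi> q vs"] alt_wedge_lincomb_left])
 moreover have "alt_wedge (ext a (ext b one)) q vs = ext a (ext b q) vs" for a b vs
 proof -
  have "alt_wedge one q = q" by (rule HOL.ext) (rule one)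
  then have "alt_wedge (ext b one) q = ext b q" by (intro HOL.ext) (simp add: alt_wedge_ext_left)
  then show ?thesis using alt_wedge_ext_left[of a "ext b one" q vs] by simp
 qed
 ultimately show ?thesis by (intro HOL.ext) (simp add: sum_divide_distrib)
qed

end

text \<open>Type (1,1) as J-invariance. Positivity and reality are left out because the notion is
  applied to the derivatives of the metric form as well as to the form itself.\<close>

definition two_form11 :: "'n::finite alt => bool" where
 "two_form11 \<psi> \<longleftrightarrow> alternating \<psi> \<and> (\<forall>vs. length vs \<noteq> 2 --> \<psi> vs = 0) \<and> (\<forall>u v. \<psi> [cJ u, cJ v] = \<psi> [u, v])"

lemma (in hpoint) two_form11_w: "two_form11 w"
 unfolding two_form11_def using w_alt w_deg w_J by auto

context hframe
begin

lemma
 assumes "two_form11 \<psi>"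
 shows two_form11_alt: "alternating \<psi>"
  and two_form11_linear: "linear (\<lambda>v. \<psi> [u, v])" "linear (\<lambda>u. \<psi> [u, v])"
  and two_form11_J_left: "\<psi> [cJ u, v] = - \<psi> [u, cJ v]"
proof -
 show a: "alternating \<psi>" and l: "linear (\<lambda>v. \<psi> [u, v])" "linear (\<lambda>u. \<psi> [u, v])"
  using assms alt_linear alt_linear2 unfolding two_form11_def by blast+
 have n: "\<psi> [u, - v] = - \<psi> [u, v]" for u v using linear_neg[OF alt_linear2[OF a]] by blast
 have "\<psi> [cJ u, cJ (- cJ v)] = \<psi> [u, - cJ v]" using assms unfolding two_form11_def by blast
 then show "\<psi> [cJ u, v] = - \<psi> [u, cJ v]" by (simp add: n)
qed

lemma linear_g: "linear (\<lambda>v. complex_of_real (g u v))"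
 using linear_compose[OF g_linear(2) bounded_linear.linear[OF bounded_linear_of_real]] by (simp add: o_def)

lemma linear_ext_contr:
 assumes "alternating q"
 shows "linear (\<lambda>u. ext a (\<lambda>ws. q (u # ws)) vs)"
 by (rule linearI) (simp_all only: alt_head[OF assms] scaleR_complex ext_add ext_scale)

text \<open>Applying \<open>Lam_ext\<close> to both factors in \<open>wedge_two\<close> leaves a
  scalar, half the trace of \<psi>, and two equal copies of the derivation induced by \<psi>. For
  the metric form that derivation is the degree.\<close>

lemma ad_two:
 assumes \<psi>: "two_form11 \<psi>" and "alternating q"
 shows "adL F (alt_wedge \<psi>) q = (\<lambda>vs. (\<Sum>f\<in>F. \<psi> [f, cJ f]) / 2 * q vs -
  (\<Sum>h\<in>F. ext (\<lambda>v. of_real (g h v)) (cov F (\<lambda>v. \<psi> [h, cJ v]) q) vs))"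
proof
 fix vs
 note l = two_form11_linear[OF \<psi>]
 have lJ: "linear (\<lambda>v. \<psi> [h, cJ v])" for h
  using linear_compose[OF linear_cJ l(1)] by (simp add: o_def)
 have w2: "alt_wedge \<psi> q = (\<lambda>vs. (\<Sum>f\<in>F. ext (\<lambda>v. of_real (g f v)) (ext (\<lambda>v. \<psi> [f, v]) q) vs) / 2)" for q
  by (rule wedge_two) (use \<psi> in \<open>auto simp: two_form11_def\<close>)
 have half: "Lam F (\<lambda>vs. A vs / 2) = (\<lambda>vs. Lam F A vs / 2)" for A
  using Lam_scale[of F "1/2" A] by simp
 have covg: "cov F (\<lambda>v. of_real (g f (cJ v))) p us = - p (cJ f # us)" if "alternating p" for f p us
 proof -
  have "cov F (\<lambda>v. of_real (g f (cJ v))) p us = - (\<Sum>v\<in>F. g v (cJ f) * p (v # us))"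
   unfolding cov_def sum_negf[symmetric] by (intro sum.cong refl, subst g_J_swap) simp
  then show ?thesis using expand[OF alt_linear[OF that]] by simp
 qed
 have 1: "Lam F (ext (\<lambda>v. of_real (g f v)) (ext (\<lambda>v. \<psi> [f, v]) q)) vs =
   ext (\<lambda>v. of_real (g f v)) (ext (\<lambda>v. \<psi> [f, v]) (Lam F q)) vs
   - ext (\<lambda>v. of_real (g f v)) (cov F (\<lambda>v. \<psi> [f, cJ v]) q) vs
   + (\<psi> [f, cJ f] * q vs - ext (\<lambda>v. \<psi> [f, v]) (\<lambda>ws. q (cJ f # ws)) vs)" for f
  using Lam_ext[OF alt_ext[OF assms(2) l(1)[of f]] linear_g[of f]]
   Lam_ext[OF assms(2) l(1)[of f]] covg[OF alt_ext[OF assms(2) l(1)[of f]]]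
  by (simp add: ext_diff)
 have 2: "(\<Sum>f\<in>F. ext (\<lambda>v. \<psi> [f, v]) (\<lambda>ws. q (cJ f # ws)) vs) =
   (\<Sum>h\<in>F. ext (\<lambda>v. of_real (g h v)) (cov F (\<lambda>v. \<psi> [h, cJ v]) q) vs)"
 proof -
  have e: "ext (\<lambda>v. \<psi> [f, v]) p us = (\<Sum>h\<in>F. \<psi> [f, h] * ext (\<lambda>v. of_real (g h v)) p us)" for f p us
  proof -
   have "(\<lambda>v. \<psi> [f, v]) = (\<lambda>v. \<Sum>h\<in>F. \<psi> [f, h] * of_real (g h v))"
    using expand[OF l(1)[of f]] by (simp add: mult.commute)
   from arg_cong[OF this, where f="\<lambda>a. ext a p us"] show ?thesis
    unfolding ext_cov_lincomb .
  qed
  have "(\<Sum>f\<in>F. ext (\<lambda>v. \<psi> [f, v]) (\<lambda>ws. q (cJ f # ws)) vs) =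
    (\<Sum>h\<in>F. \<Sum>f\<in>F. \<psi> [f, h] * ext (\<lambda>v. of_real (g h v)) (\<lambda>ws. q (cJ f # ws)) vs)"
   unfolding e by (rule sum.swap)
  also have "\<dots> = (\<Sum>h\<in>F. - (\<Sum>f\<in>F. \<psi> [cJ f, h] * ext (\<lambda>v. of_real (g h v)) (\<lambda>ws. q (f # ws)) vs))"
  proof (rule sum.cong[OF refl])
   fix h
   show "(\<Sum>f\<in>F. \<psi> [f, h] * ext (\<lambda>v. of_real (g h v)) (\<lambda>ws. q (cJ f # ws)) vs) =
    - (\<Sum>f\<in>F. \<psi> [cJ f, h] * ext (\<lambda>v. of_real (g h v)) (\<lambda>ws. q (f # ws)) vs)"
    using sum_skew[where X="\<lambda>u v. \<psi> [u, h] * ext (\<lambda>v. of_real (g h v)) (\<lambda>ws. q (v # ws)) vs"]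
     linear_mult_left[OF linear_ext_contr[OF assms(2)]] linear_mult_right[OF l(2)] by simp
  qed
  also have "\<dots> = (\<Sum>h\<in>F. ext (\<lambda>v. of_real (g h v)) (cov F (\<lambda>v. \<psi> [h, cJ v]) q) vs)"
  proof (rule sum.cong[OF refl])
   fix h
   have "- \<psi> [cJ f, h] = \<psi> [f, cJ h]" for f using two_form11_J_left[OF \<psi>] by simp
   moreover have "\<psi> [f, cJ h] = - \<psi> [cJ h, f]" for f by (rule alt_swap[OF two_form11_alt[OF \<psi>]])
   ultimately have "- \<psi> [cJ f, h] = \<psi> [h, cJ f]" for f using two_form11_J_left[OF \<psi>] by simp
   then have "- (\<Sum>f\<in>F. \<psi> [cJ f, h] * ext (\<lambda>v. of_real (g h v)) (\<lambda>ws. q (f # ws)) vs) =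
    (\<Sum>f\<in>F. \<psi> [h, cJ f] * ext (\<lambda>v. of_real (g h v)) (\<lambda>ws. q (f # ws)) vs)"
    unfolding sum_negf[symmetric] minus_mult_left by simp
   then show "- (\<Sum>f\<in>F. \<psi> [cJ f, h] * ext (\<lambda>v. of_real (g h v)) (\<lambda>ws. q (f # ws)) vs) =
    ext (\<lambda>v. of_real (g h v)) (cov F (\<lambda>v. \<psi> [h, cJ v]) q) vs"
    unfolding cov_def ext_lincomb .
  qed
  finally show ?thesis .
 qed
 show "adL F (alt_wedge \<psi>) q vs = (\<Sum>f\<in>F. \<psi> [f, cJ f]) / 2 * q vs -
   (\<Sum>h\<in>F. ext (\<lambda>v. of_real (g h v)) (cov F (\<lambda>v. \<psi> [h, cJ v]) q) vs)"
  unfolding adL_def w2 half Lam_sum 1 using 2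
  by (simp add: sum.distrib sum_subtractf sum_distrib_left field_simps)
qed

lemma ad_w:
 assumes "alternating q"
 shows "adL F (alt_wedge w) q vs = (of_nat CARD('a) - of_nat (length vs)) * q vs"
proof -
 have "(\<Sum>f\<in>F. w [f, cJ f]) = (\<Sum>f\<in>F. 1)"
  using F_orth unfolding orth_def by (intro sum.cong) (auto simp: w_eq)
 then have 1: "(\<Sum>f\<in>F. w [f, cJ f]) / 2 = of_nat CARD('a)" by (simp add: F_card)
 have "(\<Sum>h\<in>F. ext (\<lambda>v. of_real (g h v)) (cov F (\<lambda>v. w [h, cJ v]) q) vs) =
   (\<Sum>h\<in>F. ext (\<lambda>v. of_real (g h v)) (\<lambda>ws. q (h # ws)) vs)"
 proof (intro sum.cong refl)
  fix h assume "h \<in> F"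
  then have "cov F (\<lambda>v. w [h, cJ v]) q = (\<lambda>ws. q (h # ws))"
   unfolding w_eq using cov_dual[OF F_dual] by blast
  then show "ext (\<lambda>v. of_real (g h v)) (cov F (\<lambda>v. w [h, cJ v]) q) vs = ext (\<lambda>v. of_real (g h v)) (\<lambda>ws. q (h # ws)) vs"
   by simp
 qed
 then show ?thesis
  unfolding ad_two[OF two_form11_w assms] 1 euler[OF F_dual assms] by (simp add: algebra_simps)
qed

text \<open>Up to the factor -1/2 the adjoint of multiplication by a real \<psi>, and at the same
  time what remains of that multiplication after two commutators with \<Lambda>.\<close>

definition cov2 :: "'a alt => 'a alt => 'a alt" where
 "cov2 \<psi> q = (\<lambda>vs. \<Sum>h\<in>F. cov F (\<lambda>v. \<psi> [h, v]) q (h # vs))"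

lemma alt_alt_wedge_two: "two_form11 \<psi> ==> alternating q ==> alternating (alt_wedge \<psi> q)"
 by (rule alt_alt_wedge[OF two_form11_alt])

lemma alt_adL: "(\<And>q. alternating q ==> alternating (P q)) ==> alternating q ==> alternating (adL F P q)"
 unfolding adL_def by (intro alt_diff alt_Lam) (simp_all add: alt_Lam)

lemma ad2_two:
 assumes \<psi>: "two_form11 \<psi>" and "alternating q"
 shows "adL F (adL F (alt_wedge \<psi>)) q = cov2 \<psi> q"
proof
 fix vs
 note l = two_form11_linear[OF \<psi>]
 have lJ: "linear (\<lambda>v. \<psi> [h, cJ v])" for h
  using linear_compose[OF linear_cJ l(1)] by (simp add: o_def)
 have covg: "cov F (\<lambda>v. of_real (g f (cJ v))) p us = - p (cJ f # us)" if "alternating p" for f p us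
 proof -
  have "cov F (\<lambda>v. of_real (g f (cJ v))) p us = - (\<Sum>v\<in>F. g v (cJ f) * p (v # us))"
   unfolding cov_def sum_negf[symmetric] by (intro sum.cong refl, subst g_J_swap) simp
  then show ?thesis using expand[OF alt_linear[OF that]] by simp
 qed
 have "adL F (adL F (alt_wedge \<psi>)) q vs = Lam F (adL F (alt_wedge \<psi>) q) vs - adL F (alt_wedge \<psi>) (Lam F q) vs"
  by (simp add: adL_def)
 also have "\<dots> = (\<Sum>h\<in>F. - cov F (\<lambda>v. \<psi> [h, cJ v]) q (cJ h # vs))"
  unfolding ad_two[OF assms] ad_two[OF \<psi> alt_Lam[OF assms(2)]] Lam_diff Lam_scale Lam_sum
   Lam_ext[OF alt_cov[OF assms(2)] linear_g] Lam_cov[OF assms(2)] covg[OF alt_cov[OF assms(2)]]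
  by (simp add: sum_subtractf sum_negf sum.distrib)
 also have "\<dots> = (\<Sum>h\<in>F. cov F (\<lambda>v. \<psi> [cJ h, cJ v]) q (h # vs))"
 proof -
  have 1: "linear (\<lambda>v. cov F (\<lambda>v. \<psi> [u, cJ v]) q (v # vs))" for u
   by (rule alt_linear[OF alt_cov[OF assms(2)]])
  have 2: "linear (\<lambda>u. cov F (\<lambda>v. \<psi> [u, cJ v]) q us)" for us
   unfolding cov_def by (intro linear_compose_sum ballI linear_mult_right l)
  show ?thesis
   using sum_skew[where X="\<lambda>u v. cov F (\<lambda>v. \<psi> [u, cJ v]) q (v # vs)", OF 1 2] by (simp add: sum_negf)
 qed
 also have "\<dots> = cov2 \<psi> q vs"
  using \<psi> unfolding cov2_def two_form11_def by simp
 finally show "adL F (adL F (alt_wedge \<psi>)) q vs = cov2 \<psi> q vs" .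
qed

text \<open>Moving one contraction past two others costs no sign. Consequently the third commutator
  of \<psi> \<and> . with \<Lambda> vanishes.\<close>

lemma ad2_two_commute:
 assumes "two_form11 \<psi>" "alternating q"
 shows "cov2 \<psi> (cov F a q) = cov F a (cov2 \<psi> q)" "Lam F (cov2 \<psi> q) = cov2 \<psi> (Lam F q)"
proof -
 have s: "q (u # v # x # vs) = q (x # u # v # vs)" for u v x vs
  using alt_swap[OF alt_contr[OF assms(2), of u], of v x vs] alt_swap[OF assms(2), of u x "v # vs"] by simp
 show "cov2 \<psi> (cov F a q) = cov F a (cov2 \<psi> q)"
 proof
  fix vs
  have "cov2 \<psi> (cov F a q) vs = (\<Sum>h\<in>F. \<Sum>f\<in>F. \<Sum>x\<in>F. \<psi> [h, f] * (a x * q (x # f # h # vs)))"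
   by (simp add: cov2_def cov_def sum_distrib_left)
  also have "\<dots> = (\<Sum>h\<in>F. \<Sum>f\<in>F. \<Sum>x\<in>F. \<psi> [h, f] * (a x * q (f # h # x # vs)))"
   by (intro sum.cong refl arg_cong2[where f="(*)"]) (rule s[symmetric])
  also have "\<dots> = (\<Sum>h\<in>F. \<Sum>x\<in>F. \<Sum>f\<in>F. \<psi> [h, f] * (a x * q (f # h # x # vs)))"
   by (intro sum.cong refl sum.swap)
  also have "\<dots> = (\<Sum>x\<in>F. \<Sum>h\<in>F. \<Sum>f\<in>F. \<psi> [h, f] * (a x * q (f # h # x # vs)))"
   by (rule sum.swap)
  also have "\<dots> = cov F a (cov2 \<psi> q) vs"
   by (simp add: cov2_def cov_def sum_distrib_left mult_ac)
  finally show "cov2 \<psi> (cov F a q) vs = cov F a (cov2 \<psi> q) vs" .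
 qed
 show "Lam F (cov2 \<psi> q) = cov2 \<psi> (Lam F q)"
  unfolding cov2_def Lam_sum
  by (rule HOL.ext, rule sum.cong[OF refl])
   (simp add: Lam_contr[OF alt_cov[OF assms(2)], symmetric] Lam_cov[OF assms(2)])
qed

end

subsection \<open>Pointwise adjoints\<close>

context hframe
begin

lemma adj_ext:
 assumes "set fs = F" "distinct fs" "alternating v"
 shows "inn fs (ext a u) v = inn fs u (cov F (\<lambda>v. cnj (a v)) v)"
 using inn_ext[OF assms(3,2)] assms(1) by simp

lemma adj_two:
 assumes fs: "set fs = F" "distinct fs" and \<psi>: "two_form11 \<psi>" "\<And>vs. cnj (\<psi> vs) = \<psi> vs" and v: "alternating v"
 shows "inn fs (alt_wedge \<psi> u) v = inn fs u (\<lambda>vs. - 1 / 2 * cov2 \<psi> v vs)"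
proof -
 have "inn fs (alt_wedge \<psi> u) v = inn fs (\<lambda>vs. \<Sum>f\<in>F. 1 / 2 * ext (\<lambda>v. of_real (g f v)) (ext (\<lambda>v. \<psi> [f, v]) u) vs) v"
  using wedge_two[of \<psi> u] \<psi>(1) by (simp add: two_form11_def sum_divide_distrib)
 also have "\<dots> = (\<Sum>f\<in>F. 1 / 2 * inn fs (ext (\<lambda>v. of_real (g f v)) (ext (\<lambda>v. \<psi> [f, v]) u)) v)"
  by (rule inn_lincomb_left)
 also have "\<dots> = (\<Sum>f\<in>F. 1 / 2 * inn fs u (cov F (\<lambda>v. \<psi> [f, v]) (\<lambda>ws. v (f # ws))))"
 proof (intro sum.cong refl)
  fix f assume "f \<in> F"
  then have "cov F (\<lambda>u. of_real (g f u)) v = (\<lambda>ws. v (f # ws))" using cov_dual[OF F_dual] by blast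
  then show "1 / 2 * inn fs (ext (\<lambda>v. of_real (g f v)) (ext (\<lambda>v. \<psi> [f, v]) u)) v =
    1 / 2 * inn fs u (cov F (\<lambda>v. \<psi> [f, v]) (\<lambda>ws. v (f # ws)))"
   by (simp add: adj_ext[OF fs v] adj_ext[OF fs alt_contr[OF v]] \<psi>(2))
 qed
 also have "\<dots> = inn fs u (\<lambda>vs. \<Sum>f\<in>F. 1 / 2 * cov F (\<lambda>v. \<psi> [f, v]) (\<lambda>ws. v (f # ws)) vs)"
  unfolding inn_lincomb_right by simp
 also have "(\<lambda>vs. \<Sum>f\<in>F. 1 / 2 * cov F (\<lambda>v. \<psi> [f, v]) (\<lambda>ws. v (f # ws)) vs) = (\<lambda>vs. - 1 / 2 * cov2 \<psi> v vs)"
 proof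
  fix vs
  have "cov F (\<lambda>v. \<psi> [f, v]) (\<lambda>ws. v (f # ws)) vs = - cov F (\<lambda>v. \<psi> [f, v]) v (f # vs)" for f
   unfolding cov_def sum_negf[symmetric] by (intro sum.cong refl, subst alt_swap[OF v]) simp
  then show "(\<Sum>f\<in>F. 1 / 2 * cov F (\<lambda>v. \<psi> [f, v]) (\<lambda>ws. v (f # ws)) vs) = - 1 / 2 * cov2 \<psi> v vs"
   by (simp add: cov2_def sum_negf sum_distrib_left)
 qed
 finally show ?thesis .
qed

text \<open>For the metric form the first commutator is n minus the degree, and \<Lambda> lowers the
  degree by two; that is the factor.\<close>

lemma cov2_w: "alternating q ==> cov2 w q = (\<lambda>vs. - 2 * Lam F q vs)"
proof
 fix vs assume a: "alternating q"
 have "adL F (alt_wedge w) q = (\<lambda>vs. (of_nat CARD('a) - of_nat (length vs)) * q vs)"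
  using ad_w[OF a] by blast
 then have "cov2 w q vs = Lam F (\<lambda>vs. (of_nat CARD('a) - of_nat (length vs)) * q vs) vs
   - (of_nat CARD('a) - of_nat (length vs)) * Lam F q vs"
  using ad2_two[OF two_form11_w a] ad_w[OF alt_Lam[OF a]] by (simp add: adL_def fun_eq_iff)
 also have "Lam F (\<lambda>vs. (of_nat CARD('a) - of_nat (length vs)) * q vs) vs =
   (of_nat CARD('a) - of_nat (length vs) - 2) * Lam F q vs"
  by (simp add: Lam_def sum_distrib_left algebra_simps)
 finally show "cov2 w q vs = - 2 * Lam F q vs"
  by (simp add: algebra_simps)
qed

lemma adj_w:
 assumes "set fs = F" "distinct fs" "alternating v"
 shows "inn fs (alt_wedge w u) v = inn fs u (Lam F v)"
 using adj_two[OF assms(1,2) two_form11_w w_real assms(3)] cov2_w[OF assms(3)] by simp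

lemma adL_ext:
 assumes "linear s" "\<And>q. alternating q ==> alternating (P q)" "alternating q"
 shows "adL F (\<lambda>q. ext s (P q)) q = (\<lambda>vs. ext s (adL F P q) vs - cov F (\<lambda>v. s (cJ v)) (P q) vs)"
 unfolding adL_def Lam_ext[OF assms(2)[OF assms(3)] assms(1)] ext_diff by (rule HOL.ext) simp

lemma adL_cong: "(\<And>q. alternating q ==> P q = Q q) ==> alternating q ==> adL F P q = adL F Q q"
 unfolding adL_def by (simp add: alt_Lam)

lemma adL_diff: "adL F (\<lambda>q vs. P q vs - Q q vs) q = (\<lambda>vs. adL F P q vs - adL F Q q vs)"
 unfolding adL_def Lam_diff by auto

lemma adL_sum: "adL F (\<lambda>q vs. \<Sum>i\<in>I. P i q vs) q = (\<lambda>vs. \<Sum>i\<in>I. adL F (P i) q vs)"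
 unfolding adL_def Lam_sum by (auto simp: sum_subtractf)

lemma adL_scale: "adL F (\<lambda>q vs. c * P q vs) q = (\<lambda>vs. c * adL F P q vs)"
 unfolding adL_def Lam_scale by (auto simp: algebra_simps)

lemma adL_cov:
 assumes "\<And>q. alternating q ==> alternating (P q)" "alternating q"
 shows "adL F (\<lambda>q. cov F a (P q)) q = cov F a (adL F P q)"
 unfolding adL_def Lam_cov[OF assms(1)[OF assms(2)]] cov_diff by simp

lemma ad2_ext:
 assumes s: "linear s" and \<psi>: "two_form11 \<psi>" and "alternating q"
 shows "adL F (adL F (\<lambda>q. ext s (alt_wedge \<psi> q))) q =
  (\<lambda>vs. ext s (cov2 \<psi> q) vs - 2 * cov F (\<lambda>v. s (cJ v)) (adL F (alt_wedge \<psi>) q) vs)"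
proof -
 note a\<psi> = alt_alt_wedge_two[OF \<psi>] and aad = alt_adL[OF alt_alt_wedge_two[OF \<psi>]]
 have "adL F (adL F (\<lambda>q. ext s (alt_wedge \<psi> q))) q =
  adL F (\<lambda>q vs. ext s (adL F (alt_wedge \<psi>) q) vs - cov F (\<lambda>v. s (cJ v)) (alt_wedge \<psi> q) vs) q"
  by (rule adL_cong[OF _ assms(3)]) (rule adL_ext[OF s a\<psi>])
 also have "\<dots> = (\<lambda>vs. ext s (cov2 \<psi> q) vs - 2 * cov F (\<lambda>v. s (cJ v)) (adL F (alt_wedge \<psi>) q) vs)"
 proof -
  have "adL F (\<lambda>q. ext s (adL F (alt_wedge \<psi>) q)) q =
    (\<lambda>vs. ext s (cov2 \<psi> q) vs - cov F (\<lambda>v. s (cJ v)) (adL F (alt_wedge \<psi>) q) vs)"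
   unfolding ad2_two[OF \<psi> assms(3), symmetric] by (rule adL_ext[OF s _ assms(3)]) (rule aad)
  moreover have "adL F (\<lambda>q. cov F (\<lambda>v. s (cJ v)) (alt_wedge \<psi> q)) q = cov F (\<lambda>v. s (cJ v)) (adL F (alt_wedge \<psi>) q)"
   by (rule adL_cov[OF _ assms(3)]) (rule a\<psi>)
  ultimately show ?thesis unfolding adL_diff by auto
 qed
 finally show ?thesis .
qed

lemma alt_cov2: "alternating q ==> alternating (cov2 \<psi> q)"
 unfolding cov2_def using alt_lincomb[of F "\<lambda>h ws. cov F (\<lambda>v. \<psi> [h, v]) q (h # ws)" "\<lambda>_. 1"]
 by (simp add: alt_contr[OF alt_cov])

text \<open>Leibniz rule for ad = [\<Lambda>, .]: ad^2 of a covector multiplication and ad^3 of a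
  (1,1)-form multiplication vanish, so only the mixed term with binomial coefficient 3 survives. The
  sign is that of \<open>Lam_ext\<close>.\<close>

lemma ad3_ext:
 assumes s: "linear s" and \<psi>: "two_form11 \<psi>" and "alternating q"
 shows "adL F (adL F (adL F (\<lambda>q. ext s (alt_wedge \<psi> q)))) q =
  (\<lambda>vs. - 3 * cov F (\<lambda>v. s (cJ v)) (cov2 \<psi> q) vs)"
proof -
 note aad = alt_adL[OF alt_alt_wedge_two[OF \<psi>]]
 have 1: "adL F (cov2 \<psi>) q = (\<lambda>vs. 0)"
  using ad2_two_commute[OF \<psi> assms(3)] by (simp add: adL_def)
 have "adL F (adL F (adL F (\<lambda>q. ext s (alt_wedge \<psi> q)))) q =
  adL F (\<lambda>q vs. ext s (cov2 \<psi> q) vs - 2 * cov F (\<lambda>v. s (cJ v)) (adL F (alt_wedge \<psi>) q) vs) q"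
  by (rule adL_cong[OF _ assms(3)]) (rule ad2_ext[OF s \<psi>])
 also have "\<dots> = (\<lambda>vs. - 3 * cov F (\<lambda>v. s (cJ v)) (cov2 \<psi> q) vs)"
 proof -
  have "adL F (\<lambda>q. ext s (cov2 \<psi> q)) q = (\<lambda>vs. - cov F (\<lambda>v. s (cJ v)) (cov2 \<psi> q) vs)"
   using adL_ext[OF s alt_cov2 assms(3)] by (simp add: 1 ext_zero)
  moreover have "adL F (\<lambda>q. cov F (\<lambda>v. s (cJ v)) (adL F (alt_wedge \<psi>) q)) q = cov F (\<lambda>v. s (cJ v)) (cov2 \<psi> q)"
   unfolding ad2_two[OF \<psi> assms(3), symmetric] by (rule adL_cov[OF _ assms(3)]) (rule aad)
  ultimately show ?thesis unfolding adL_diff adL_scale by auto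
 qed
 finally show ?thesis .
qed

text \<open>Origin of i/6: the triple commutator is -3 times contraction with s o J and
  \<open>cov2\<close>, and s o J is -i times the conjugate of s', so it carries 3 i. The adjoint
  carries -1/2, and (i/6)(3 i) = -1/2.\<close>

lemma adj_ext_two:
 assumes fs: "set fs = F" "distinct fs" and s: "linear s" "\<And>v. s (cJ v) = - \<i> * cnj (s' v)"
  and \<psi>: "two_form11 \<psi>" "\<And>vs. cnj (\<psi> vs) = \<psi> vs" and v: "alternating v"
 shows "inn fs (ext s' (alt_wedge \<psi> u)) v =
  inn fs u (\<lambda>vs. \<i> / 6 * adL F (adL F (adL F (\<lambda>q. ext s (alt_wedge \<psi> q)))) v vs)"
 unfolding adj_ext[OF fs v] adj_two[OF fs \<psi> alt_cov[OF v]] ad3_ext[OF s(1) \<psi>(1) v] s(2)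
  ad2_two_commute(1)[OF \<psi>(1) v] cov_cov_scale
 by (rule arg_cong[where f="inn fs u"]) auto

lemma same_tensorI:
 assumes E: "dual_basis E \<phi>" and G: "\<And>v e. e \<in> E ==> g v (G e) = \<phi> e v"
 shows "same_tensor F E G"
 unfolding same_tensor_def
proof (intro allI impI)
 fix X :: "(complex, 'a) vec => (complex, 'a) vec => complex"
 assume X: "\<forall>u. linear (X u)" "\<forall>v. linear (\<lambda>u. X u v)"
 have "(\<Sum>f\<in>F. X f f) = (\<Sum>f\<in>F. \<Sum>e\<in>E. \<phi> e f * X e f)"
  using dual_basis_expand[OF E] X by (intro sum.cong refl) metis
 also have "\<dots> = (\<Sum>e\<in>E. \<Sum>f\<in>F. \<phi> e f * X e f)" by (rule sum.swap)
 also have "\<dots> = (\<Sum>e\<in>E. X e (G e))"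
 proof (intro sum.cong refl)
  fix e assume e: "e \<in> E"
  show "(\<Sum>f\<in>F. \<phi> e f * X e f) = X e (G e)"
   using expand[of "X e" "G e"] X by (simp add: G[OF e])
 qed
 finally show "(\<Sum>f\<in>F. X f f) = (\<Sum>e\<in>E. X e (G e))" .
qed

end

lemma same_tensor_Lam:
 assumes "same_tensor F E G" "alternating q"
 shows "Lam F q vs = (\<Sum>e\<in>E. q (e # cJ (G e) # vs)) / 2"
proof -
 have "linear (\<lambda>v. q (u # cJ v # vs))" for u
  using linear_compose[OF linear_cJ alt_linear2[OF assms(2)]] by (simp add: o_def)
 moreover have "linear (\<lambda>u. q (u # cJ v # vs))" for v
  by (rule alt_linear[OF assms(2)])
 ultimately have "(\<Sum>f\<in>F. q (f # cJ f # vs)) = (\<Sum>e\<in>E. q (e # cJ (G e) # vs))"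
  using assms(1)[unfolded same_tensor_def, rule_format, of "\<lambda>u v. q (u # cJ v # vs)"] by simp
 then show ?thesis by (simp add: Lam_def)
qed

subsection \<open>The inverse metric in coordinates\<close>

definition hmat :: "'n::finite alt => complex^'n^'n" where
 "hmat w = (\<chi> j k. w [axis j 1, axis k \<i>] - \<i> * w [axis j 1, axis k 1])"

text \<open>The inverse metric relative to the Euclidean inner product, see \<open>g_Ginv\<close>.
  Cramer's rule displays it as a quotient of polynomials in the metric coefficients and their
  conjugates, hence smooth in the base point, in contrast to an arbitrarily chosen orthonormal
  frame.\<close>

definition Ginv :: "'n::finite alt => complex^'n => complex^'n" where
 "Ginv w v = (\<chi> k. det (\<chi> i j. if j = k then v $ i else cnj (hmat w $ i $ j)) / det (\<chi> i j. cnj (hmat w $ i $ j)))"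

text \<open>For a form of type (1,1) this is complex linear in \<open>u\<close> and conjugate linear
  in \<open>v\<close>, with matrix \<open>hmat\<close>; for the metric form its real part is
  \<open>g\<close>.\<close>

definition sesq :: "'n::finite alt => complex^'n => complex^'n => complex" where
 "sesq w u v = w [u, cJ v] - \<i> * w [u, v]"

lemma smult_as_real: "a *s (v::complex^'n) = Re a *\<^sub>R v + Im a *\<^sub>R cJ v"
 by (simp add: vec_eq_iff complex_eq_iff scaleR_complex)

lemma cJ_axis: "cJ (axis k a) = axis k (\<i> * a)"
 by (simp add: vec_eq_iff axis_def)

lemma inner_eq_sum: "(u::complex^'n) \<bullet> v = Re (\<Sum>j\<in>UNIV. u $ j * cnj (v $ j))"
 by (simp add: inner_vec_def inner_complex_def)

lemma sesq_expand:
 fixes \<psi> :: "'n::finite alt"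
 assumes \<psi>: "two_form11 \<psi>"
 shows "sesq \<psi> u v = (\<Sum>j\<in>UNIV. \<Sum>k\<in>UNIV. u $ j * cnj (v $ k) * hmat \<psi> $ j $ k)"
proof -
 have alt: "alternating \<psi>" using \<psi> by (simp add: two_form11_def)
 note l1 = linear_add[OF alt_linear[OF alt]] linear_add[OF alt_linear2[OF alt]]
  linear_cmul[OF alt_linear[OF alt], unfolded scaleR_complex] linear_cmul[OF alt_linear2[OF alt], unfolded scaleR_complex]
 have n: "\<psi> [u, - v] = - \<psi> [u, v]" for u v
  using linear_neg[OF alt_linear2[OF alt]] by blast
 have "\<psi> [cJ u, cJ (- cJ v)] = \<psi> [u, - cJ v]" for u v using \<psi> unfolding two_form11_def by blast
 then have J: "\<psi> [cJ u, v] = - \<psi> [u, cJ v]" for u v by (simp add: n)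
 have add: "sesq \<psi> (u + u') v = sesq \<psi> u v + sesq \<psi> u' v" "sesq \<psi> u (v + v') = sesq \<psi> u v + sesq \<psi> u v'" for u u' v v'
  unfolding sesq_def by (simp_all add: l1 vector_add_ldistrib algebra_simps)
 have realscale: "sesq \<psi> (r *\<^sub>R u) v = of_real r * sesq \<psi> u v" "sesq \<psi> u (r *\<^sub>R v) = of_real r * sesq \<psi> u v" for r u v
 proof -
  have "cJ (r *\<^sub>R v) = r *\<^sub>R cJ v" by (simp add: vec_eq_iff)
  then show "sesq \<psi> (r *\<^sub>R u) v = of_real r * sesq \<psi> u v" "sesq \<psi> u (r *\<^sub>R v) = of_real r * sesq \<psi> u v"
   unfolding sesq_def by (simp_all only: l1 right_diff_distrib mult.left_commute)
 qed
 have Jscale: "sesq \<psi> (cJ u) v = \<i> * sesq \<psi> u v" "sesq \<psi> u (cJ v) = - \<i> * sesq \<psi> u v" for u v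
  unfolding sesq_def by (simp_all add: J n algebra_simps)
 have scale: "sesq \<psi> (a *s u) v = a * sesq \<psi> u v" "sesq \<psi> u (a *s v) = cnj a * sesq \<psi> u v" for a u v
  unfolding smult_as_real[of a] add realscale Jscale by (simp_all add: complex_eq_iff)
 have z: "sesq \<psi> 0 v = 0" "sesq \<psi> u 0 = 0" for u v
  using realscale(1)[of 0 0 v] realscale(2)[of u 0 0] by simp_all
 have s1: "sesq \<psi> (\<Sum>i\<in>I. U i) v = (\<Sum>i\<in>I. sesq \<psi> (U i) v)" for I :: "'n set" and U v
  by (induction I rule: infinite_finite_induct) (simp_all add: z add)
 have s2: "sesq \<psi> u (\<Sum>i\<in>I. U i) = (\<Sum>i\<in>I. sesq \<psi> u (U i))" for I :: "'n set" and U u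
  by (induction I rule: infinite_finite_induct) (simp_all add: z add)
 have "sesq \<psi> u v = sesq \<psi> (\<Sum>j\<in>UNIV. u $ j *s axis j 1) (\<Sum>k\<in>UNIV. v $ k *s axis k 1)"
  by (simp only: basis_expansion)
 also have "\<dots> = (\<Sum>j\<in>UNIV. \<Sum>k\<in>UNIV. u $ j * cnj (v $ k) * hmat \<psi> $ j $ k)"
  unfolding s1 s2 scale sum_distrib_left by (subst sum.swap) (simp add: sesq_def hmat_def cJ_axis mult_ac)
 finally show ?thesis .
qed

context hpoint
begin

lemma Re_sesq: "Re (sesq w u v) = g u v"
 unfolding sesq_def g_def using w_real[of "[u, v]"] by (simp add: complex_eq_iff)

lemma det_cnj_hmat: "det (\<chi> i j. cnj (hmat w $ i $ j)) \<noteq> 0"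
proof -
 let ?A = "\<chi> i j. cnj (hmat w $ i $ j)"
 have "z = 0" if "?A *v z = 0" for z
 proof (rule ccontr)
  assume "z \<noteq> 0"
  have "(\<Sum>k\<in>UNIV. cnj (z $ k) * hmat w $ j $ k) = 0" for j
  proof -
   have "cnj ((?A *v z) $ j) = 0" using that by simp
   then show ?thesis by (simp add: matrix_vector_mult_def mult.commute)
  qed
  moreover have "sesq w z z = (\<Sum>j\<in>UNIV. z $ j * (\<Sum>k\<in>UNIV. cnj (z $ k) * hmat w $ j $ k))"
   unfolding sesq_expand[OF two_form11_w] by (simp add: sum_distrib_left mult_ac)
  ultimately have "sesq w z z = 0" by simp
  then show False using g_pos[OF \<open>z \<noteq> 0\<close>] Re_sesq[of z z] by simp
 qed
 then have "\<exists>B. B ** ?A = mat 1" unfolding matrix_left_invertible_ker by blast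
 then have "invertible ?A" unfolding invertible_left_inverse .
 then show ?thesis by (simp add: invertible_det_nz)
qed

lemma Ginv_solves: "(\<Sum>k\<in>UNIV. cnj (hmat w $ j $ k) * Ginv w v $ k) = v $ j"
proof -
 let ?A = "\<chi> i j. cnj (hmat w $ i $ j)"
 have "?A *v Ginv w v = v"
  using cramer[OF det_cnj_hmat, of "Ginv w v" v] unfolding Ginv_def by (simp cong: if_cong)
 then have "(?A *v Ginv w v) $ j = v $ j" by simp
 then show ?thesis by (simp add: matrix_vector_mult_def)
qed

lemma sesq_Ginv: "sesq w u (Ginv w v) = (\<Sum>j\<in>UNIV. u $ j * cnj (v $ j))"
proof -
 have "(\<Sum>k\<in>UNIV. cnj (Ginv w v $ k) * hmat w $ j $ k) = cnj (v $ j)" for j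
  using arg_cong[OF Ginv_solves[of j v], of cnj] by (simp add: mult.commute)
 then have "u $ j * (\<Sum>k\<in>UNIV. cnj (Ginv w v $ k) * hmat w $ j $ k) = u $ j * cnj (v $ j)" for j
  by simp
 then show ?thesis
  unfolding sesq_expand[OF two_form11_w] by (simp add: sum_distrib_left mult_ac)
qed

lemma g_Ginv: "g u (Ginv w v) = u \<bullet> v"
 by (simp add: Re_sesq[symmetric] sesq_Ginv inner_eq_sum)

lemma g_eqI: "(\<And>u. g u v = g u v') ==> v = v'"
 using g_pos[of "v - v'"] g_simps by (metis diff_self eq_iff_diff_eq_0 less_irrefl)

lemma linear_Ginv: "linear (Ginv w)"
 by (rule linearI; rule g_eqI) (simp_all add: g_Ginv g_simps inner_add_right)

lemma inner_cJ: "u \<bullet> cJ v = - (cJ u \<bullet> (v::complex^'m))"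
 by (simp add: inner_vec_def inner_complex_def sum_negf[symmetric])

lemma Ginv_cJ: "Ginv w (cJ v) = cJ (Ginv w v)"
 by (rule g_eqI) (metis g_Ginv g_J_left inner_cJ minus_minus)

end

lemma (in hframe) same_tensor_Basis: "same_tensor F Basis (Ginv w)"
 by (rule same_tensorI[OF dual_basis_Basis]) (simp add: g_Ginv)

lemma hpoint_ex_frame:
 assumes "hpoint (w::'n::finite alt)"
 shows "\<exists>fs. hframe w (set fs) \<and> distinct fs"
proof -
 interpret hpoint w by fact
 obtain F where "orth F \<and> finite F \<and> card F = 2 * CARD('n)" using ex_orth by blast
 moreover then obtain fs where "set fs = F" "distinct fs" using finite_distinct_list by metis
 ultimately have "hframe w (set fs)" by unfold_locales auto
 then show ?thesis using \<open>distinct fs\<close> by blast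
qed

section \<open>The twist \<open>\<theta>\<^sub>\<eta>\<close> and the number operators\<close>

text \<open>The twist at one point. The parameter is a free complex number, so that the dependence
  on \<eta> can be differentiated by the chain rule.\<close>

definition thp :: "complex => 'n::finite alt => 'n alt" where
 "thp s q = (\<lambda>vs. \<Sum>p\<le>length vs. s ^ p * type_part p (length vs - p) q vs)"

text \<open>\<open>tw1 s\<close> and \<open>tw2 s\<close> act on one-forms by \<open>s\<close>, \<open>1\<close>, respectively \<open>1\<close>, \<open>-s\<close>, on types
\<open>(1,0)\<close>, \<open>(0,1)\<close>: they send \<open>df\<close> to \<open>d\<^sub>\<eta>f\<close> and to the conjugate of \<open>d\<^sub>-\<^sub>\<eta>f\<close> for \<open>s = \<eta>\<close>.\<close>

definition tw1 :: "complex => ((complex, 'n::finite) vec => complex) => (complex, 'n) vec => complex" where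
 "tw1 s a v = ((s + 1) * a v + \<i> * (1 - s) * a (cJ v)) / 2"

text \<open>Choosing \<open>p\<close> and then \<open>p\<close> slots is choosing any set
  \<open>S\<close> of slots, with weight s^|S|. This removes the bidegree from the formula and opens
  it to recursion on the argument list.\<close>

lemma thp_eq_sum_Pow:
 "thp s q vs = (\<Sum>S\<in>Pow {..<length vs}. s ^ card S * (\<Sum>T\<in>Pow {..<length vs}.
   (\<Prod>t\<in>T. if t \<in> S then - \<i> else \<i>) *
   q (map (\<lambda>t. if t \<in> T then cJ (vs ! t) else vs ! t) [0..<length vs]))) / 2 ^ length vs"
proof -
 let ?m = "length vs"
 define c where "c = (\<lambda>S. \<Sum>T\<in>Pow {..<?m}. (\<Prod>t\<in>T. if t \<in> S then - \<i> else \<i>) *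
   q (map (\<lambda>t. if t \<in> T then cJ (vs ! t) else vs ! t) [0..<?m]))"
 have fin: "finite (Pow {..<?m})" by simp
 have sub: "card ` Pow {..<?m} \<subseteq> {..?m}"
  using card_mono[of "{..<?m}"] by fastforce
 have "(\<Sum>S\<in>Pow {..<?m}. s ^ card S * c S) =
   (\<Sum>p\<le>?m. \<Sum>S\<in>{S \<in> Pow {..<?m}. card S = p}. s ^ card S * c S)"
  by (rule sum.group[OF fin finite_atMost sub, symmetric])
 also have "\<dots> = (\<Sum>p\<le>?m. s ^ p * (\<Sum>S\<in>{S. S \<subseteq> {..<?m} \<and> card S = p}. c S))"
  by (simp add: sum_distrib_left Pow_def)
 also have "\<dots> = (\<Sum>p\<le>?m. s ^ p * (type_part p (?m - p) q vs * 2 ^ ?m))"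
  by (intro sum.cong refl) (simp add: type_part_def c_def)
 also have "\<dots> = thp s q vs * 2 ^ ?m"
  by (simp add: thp_def sum_distrib_left mult_ac)
 finally show ?thesis by (simp add: c_def)
qed

lemma thp_Nil: "thp s q [] = q []"
 by (simp add: thp_eq_sum_Pow)

text \<open>The twist acts slot by slot through one endomorphism, the projector on type (0,1) plus
  \<open>s\<close> times the projector on type (1,0). Splitting \<open>S\<close> and
  \<open>T\<close> by membership of slot 0 isolates it.\<close>

lemma thp_Cons:
 "thp s q (v # vs) = thp s (\<lambda>ws. ((s + 1) * q (v # ws) + \<i> * (1 - s) * q (cJ v # ws)) / 2) vs"
proof -
 let ?m = "length vs"
 define M where "M = (\<lambda>T. map (\<lambda>t. if t \<in> T then cJ (vs ! t) else vs ! t) [0..<?m])"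
 define c where "c = (\<lambda>(S::nat set) T. \<Prod>t\<in>T. if t \<in> S then - \<i> else \<i>)"
 have w: "thp s q ws = (\<Sum>S\<in>Pow {..<length ws}. s ^ card S * (\<Sum>T\<in>Pow {..<length ws}. c S T *
   q (map (\<lambda>t. if t \<in> T then cJ (ws ! t) else ws ! t) [0..<length ws]))) / 2 ^ length ws" for q ws
  by (simp add: thp_eq_sum_Pow c_def)
 have up: "[0..<Suc ?m] = 0 # map Suc [0..<?m]"
  by (simp add: upt_conv_Cons map_Suc_upt del: upt_Suc)
 have M1: "map (\<lambda>t. if t \<in> Suc ` T then cJ ((v # vs) ! t) else (v # vs) ! t) [0..<Suc ?m] = v # M T" for T
  unfolding up M_def by (auto simp: inj_image_mem_iff)
 have M2: "map (\<lambda>t. if t \<in> insert 0 (Suc ` T) then cJ ((v # vs) ! t) else (v # vs) ! t) [0..<Suc ?m] = cJ v # M T" for T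
  unfolding up M_def by (auto simp: inj_image_mem_iff)
 have c1: "c (Suc ` S) (Suc ` T) = c S T" "c (insert 0 (Suc ` S)) (Suc ` T) = c S T" for S T
  unfolding c_def by (subst prod.reindex; auto simp: inj_image_mem_iff)+
 have c2: "c (Suc ` S) (insert 0 (Suc ` T)) = \<i> * c S T" "c (insert 0 (Suc ` S)) (insert 0 (Suc ` T)) = - \<i> * c S T"
  if "T \<in> Pow {..<?m}" for S T
 proof -
  have fin: "finite (Suc ` T)" using that finite_subset by auto
  show "c (Suc ` S) (insert 0 (Suc ` T)) = \<i> * c S T"
   using fin c1(1)[of S T] unfolding c_def by (subst prod.insert) auto
  show "c (insert 0 (Suc ` S)) (insert 0 (Suc ` T)) = - \<i> * c S T"
   using fin c1(2)[of S T] unfolding c_def by (subst prod.insert) auto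
 qed
 have cd: "card (Suc ` S) = card S" "card (insert 0 (Suc ` S)) = Suc (card S)" if "S \<in> Pow {..<?m}" for S
 proof -
  have fin: "finite S" using that finite_subset by auto
  show "card (Suc ` S) = card S" by (simp add: card_image)
  with fin show "card (insert 0 (Suc ` S)) = Suc (card S)" by (simp add: card_insert_if)
 qed
 have "thp s q (v # vs) = (\<Sum>S\<in>Pow {..<?m}. s ^ card S * (\<Sum>T\<in>Pow {..<?m}. c S T * (q (v # M T) + \<i> * q (cJ v # M T)))
   + s ^ Suc (card S) * (\<Sum>T\<in>Pow {..<?m}. c S T * (q (v # M T) - \<i> * q (cJ v # M T)))) / 2 ^ Suc ?m"
 proof -
  have 1: "(\<Sum>T\<in>Pow {..<?m}. c (Suc ` S) (Suc ` T) * q (v # M T)) + (\<Sum>T\<in>Pow {..<?m}. c (Suc ` S) (insert 0 (Suc ` T)) * q (cJ v # M T))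
   = (\<Sum>T\<in>Pow {..<?m}. c S T * (q (v # M T) + \<i> * q (cJ v # M T)))" for S
   unfolding sum.distrib[symmetric] by (rule sum.cong) (simp_all add: c1 c2 algebra_simps)
  have 2: "(\<Sum>T\<in>Pow {..<?m}. c (insert 0 (Suc ` S)) (Suc ` T) * q (v # M T)) + (\<Sum>T\<in>Pow {..<?m}. c (insert 0 (Suc ` S)) (insert 0 (Suc ` T)) * q (cJ v # M T))
   = (\<Sum>T\<in>Pow {..<?m}. c S T * (q (v # M T) - \<i> * q (cJ v # M T)))" for S
   unfolding sum.distrib[symmetric] by (rule sum.cong) (simp_all add: c1 c2 algebra_simps)
  have 3: "(\<Sum>S\<in>Pow {..<?m}. s ^ card (Suc ` S) * X S) = (\<Sum>S\<in>Pow {..<?m}. s ^ card S * X S)"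
   "(\<Sum>S\<in>Pow {..<?m}. s ^ card (insert 0 (Suc ` S)) * X S) = (\<Sum>S\<in>Pow {..<?m}. s ^ Suc (card S) * X S)" for X
   by (auto intro!: sum.cong simp: cd)
  show ?thesis
   unfolding w length_Cons sum_Pow_lessThan_Suc M1 M2 distrib_left[symmetric] 1 2 3 sum.distrib ..
 qed
 also have "\<dots> = (\<Sum>S\<in>Pow {..<?m}. s ^ card S * (\<Sum>T\<in>Pow {..<?m}. c S T *
   (((s + 1) * q (v # M T) + \<i> * (1 - s) * q (cJ v # M T)) / 2))) / 2 ^ ?m"
 proof -
  have "s ^ card S * (\<Sum>T\<in>Pow {..<?m}. c S T * (q (v # M T) + \<i> * q (cJ v # M T)))
   + s ^ Suc (card S) * (\<Sum>T\<in>Pow {..<?m}. c S T * (q (v # M T) - \<i> * q (cJ v # M T)))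
   = 2 * (s ^ card S * (\<Sum>T\<in>Pow {..<?m}. c S T * (((s + 1) * q (v # M T) + \<i> * (1 - s) * q (cJ v # M T)) / 2)))" for S
   unfolding sum_distrib_left sum.distrib[symmetric]
   by (rule sum.cong) (simp_all add: field_simps)
  then show ?thesis by (simp add: sum_distrib_left[symmetric])
 qed
 also have "\<dots> = thp s (\<lambda>ws. ((s + 1) * q (v # ws) + \<i> * (1 - s) * q (cJ v # ws)) / 2) vs"
  unfolding w M_def ..
 finally show ?thesis .
qed

lemma thp_add: "thp s (\<lambda>vs. q vs + p vs) vs = thp s q vs + thp s p vs"
 by (simp add: thp_eq_sum_Pow sum.distrib algebra_simps add_divide_distrib)

lemma thp_diff: "thp s (\<lambda>vs. q vs - p vs) vs = thp s q vs - thp s p vs"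
 by (simp add: thp_eq_sum_Pow sum_subtractf algebra_simps diff_divide_distrib)

lemma thp_scale: "thp s (\<lambda>vs. c * q vs) vs = c * thp s q vs"
 by (simp add: thp_eq_sum_Pow sum_distrib_left mult_ac)

lemma thp_zero: "thp s (\<lambda>vs. 0) vs = 0"
 by (simp add: thp_eq_sum_Pow)

lemma thp_sum: "thp s (\<lambda>vs. \<Sum>i\<in>I. A i vs) vs = (\<Sum>i\<in>I. thp s (A i) vs)"
 by (induction I rule: infinite_finite_induct) (simp_all add: thp_zero thp_add)

lemma thp_degree: "thp s (\<lambda>vs. c (length vs) * q vs) vs = c (length vs) * thp s q vs"
 by (simp add: thp_eq_sum_Pow sum_distrib_left mult_ac)

lemma thp_half: "thp s (\<lambda>vs. q vs / 2) vs = thp s q vs / 2"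
 using thp_scale[of s "1/2" q] by simp

lemma thp_Cons': "thp s q (v # vs) = ((s + 1) * thp s (\<lambda>ws. q (v # ws)) vs + \<i> * (1 - s) * thp s (\<lambda>ws. q (cJ v # ws)) vs) / 2"
 by (simp only: thp_Cons thp_half thp_add thp_scale)

lemma thp_ext: "thp s (ext a q) vs = ext (tw1 s a) (thp s q) vs"
proof (induction vs arbitrary: q)
 case (Cons v vs)
 have e: "(\<lambda>ws. thp s q (v # ws)) = (\<lambda>ws. 1/2 * ((s + 1) * thp s (\<lambda>ws. q (v # ws)) ws + \<i> * (1 - s) * thp s (\<lambda>ws. q (cJ v # ws)) ws))"
  by (simp add: thp_Cons')
 show ?case
  unfolding thp_Cons'[of s "ext a q"] ext.simps thp_diff thp_scale Cons e ext_scale ext_add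
  by (simp add: tw1_def field_simps)
qed (simp add: thp_Nil)

text \<open>An endomorphism acting on every slot is multiplicative. This is why conjugating d with
  the twist yields an antiderivation.\<close>

lemma thp_alt_wedge: "thp s (alt_wedge q p) vs = alt_wedge (thp s q) (thp s p) vs"
proof (induction vs arbitrary: q p)
 case (Cons v vs)
 have e: "(\<lambda>ws. thp s q (v # ws)) = (\<lambda>ws. 1/2 * ((s + 1) * thp s (\<lambda>ws. q (v # ws)) ws + \<i> * (1 - s) * thp s (\<lambda>ws. q (cJ v # ws)) ws))" for q
  by (simp add: thp_Cons')
 have d: "(\<lambda>ws. (- 1) ^ length ws * thp s q ws) = thp s (\<lambda>ws. (- 1) ^ length ws * q ws)"
  by (rule HOL.ext) (rule thp_degree[of s "\<lambda>k. (- 1) ^ k", symmetric])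
 show ?case
  unfolding thp_Cons'[of s "alt_wedge q p"] alt_wedge_Cons thp_add Cons e d
   alt_wedge_scale_left alt_wedge_add_left alt_wedge_scale_right alt_wedge_add_right
  by (simp add: field_simps)
qed (simp add: thp_Nil alt_wedge_Nil)

lemma thp_map:
 assumes "\<And>v. G (cJ v) = cJ (G v)"
 shows "thp s q (map G vs) = thp s (\<lambda>vs. q (map G vs)) vs"
 by (induction vs arbitrary: q) (simp_all add: thp_Nil thp_Cons' assms)

lemma thp_1: "thp 1 q vs = q vs"
 by (induction vs arbitrary: q) (simp_all add: thp_Nil thp_Cons')

lemma alt_J_head: "alternating q ==> q (cJ (cJ v) # vs) = - q (v # vs)"
 by (simp add: alt_head)

lemma thp_thp: "alternating q ==> thp s (thp t q) vs = thp (s * t) q vs"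
proof (induction vs arbitrary: q)
 case (Cons v vs)
 have e: "(\<lambda>ws. thp t q (v # ws)) = (\<lambda>ws. 1/2 * ((t + 1) * thp t (\<lambda>ws. q (v # ws)) ws + \<i> * (1 - t) * thp t (\<lambda>ws. q (cJ v # ws)) ws))" for v
  by (simp add: thp_Cons')
 have J: "(\<lambda>ws. q (cJ (cJ v) # ws)) = (\<lambda>ws. - 1 * q (v # ws))"
  using alt_J_head[OF Cons.prems] by auto
 show ?case
  unfolding thp_Cons'[of s "thp t q"] thp_Cons'[of "s * t" q] e thp_scale thp_add J
   Cons.IH[OF alt_contr[OF Cons.prems]]
  by (simp add: field_simps)
qed (simp add: thp_Nil)

lemma alt_thp:
 fixes q :: "'n::finite alt"
 assumes "alternating q"
 shows "alternating (thp s q)"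
proof (rule alternatingI_coinduct[where P="\<lambda>\<gamma>. \<exists>q. alternating q \<and> \<gamma> = thp s q"])
 fix \<gamma> :: "'n alt" and v
 assume "\<exists>q. alternating q \<and> \<gamma> = thp s q"
 then obtain q where q: "alternating q" "\<gamma> = thp s q" by blast
 show "\<exists>q. alternating q \<and> (\<lambda>ws. \<gamma> (v # ws)) = thp s q"
 proof (intro exI conjI)
  show "(\<lambda>ws. \<gamma> (v # ws)) = thp s (\<lambda>ws. 1/2 * ((s + 1) * q (v # ws) + \<i> * (1 - s) * q (cJ v # ws)))"
   unfolding q by (auto simp: thp_Cons)
  show "alternating (\<lambda>ws. 1/2 * ((s + 1) * q (v # ws) + \<i> * (1 - s) * q (cJ v # ws)))"
   by (intro alt_scale alt_add alt_contr q)
 qed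
 show "linear (\<lambda>v. \<gamma> (v # vs))" for vs
 proof (rule linearI)
  fix x y :: "complex^'n" and r :: real
  have "cJ (r *\<^sub>R x) = r *\<^sub>R cJ x" by (simp add: vec_eq_iff)
  then show "\<gamma> ((r *\<^sub>R x) # vs) = r *\<^sub>R \<gamma> (x # vs)"
   unfolding q thp_Cons' by (simp only: alt_head[OF q(1)] scaleR_complex thp_scale) (simp add: algebra_simps)
  show "\<gamma> ((x + y) # vs) = \<gamma> (x # vs) + \<gamma> (y # vs)"
   unfolding q thp_Cons' by (simp add: alt_head[OF q(1)] thp_add vector_add_ldistrib field_simps)
 qed
 show "\<gamma> (v # v # vs) = 0" for v vs
 proof -
  have J: "(\<lambda>ws. q (v # v # ws)) = (\<lambda>ws. 0)" "(\<lambda>ws. q (cJ v # cJ v # ws)) = (\<lambda>ws. 0)"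
   "(\<lambda>ws. q (cJ v # v # ws)) = (\<lambda>ws. - 1 * q (v # cJ v # ws))"
   using alt_diag[OF q(1)] alt_swap[OF q(1), of "cJ v" v] by auto
  show ?thesis
   unfolding q thp_Cons' J thp_zero thp_scale by (simp add: field_simps)
 qed
qed (use assms in blast)

lemma ext_half: "ext a (\<lambda>vs. q vs / 2) vs = ext a q vs / 2"
 using ext_scale[of a "1/2" q] by simp

text \<open>The operator multiplying \<open>(p,q)\<close>-forms by \<open>p\<close>.\<close>

fun Np :: "'n::finite alt => 'n alt" where
 "Np q [] = 0"
| "Np q (v # vs) = Np (\<lambda>ws. q (v # ws)) vs + (q (v # vs) - \<i> * q (cJ v # vs)) / 2"

definition Nq :: "'n::finite alt => 'n alt" where
 "Nq q = (\<lambda>vs. cnj (Np (\<lambda>vs. cnj (q vs)) vs))"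

lemma Np_add: "Np (\<lambda>vs. q vs + p vs) vs = Np q vs + Np p vs"
 by (induction vs arbitrary: q p) (simp_all add: field_simps)

lemma Np_scale: "Np (\<lambda>vs. c * q vs) vs = c * Np q vs"
 by (induction vs arbitrary: q) (simp_all add: field_simps)

lemma Np_zero: "Np (\<lambda>vs. 0) vs = 0"
 by (induction vs) simp_all

lemma Np_diff: "Np (\<lambda>vs. q vs - p vs) vs = Np q vs - Np p vs"
 using Np_add[of q "\<lambda>vs. - 1 * p vs"] Np_scale[of "- 1" p] by simp

lemma Np_sum: "Np (\<lambda>vs. \<Sum>i\<in>I. A i vs) vs = (\<Sum>i\<in>I. Np (A i) vs)"
 by (induction I rule: infinite_finite_induct) (simp_all add: Np_zero Np_add)

lemma Np_half: "Np (\<lambda>vs. q vs / 2) vs = Np q vs / 2"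
 using Np_scale[of "1/2" q] by simp

lemma Np_plus_Nq: "Np q vs + Nq q vs = of_nat (length vs) * q vs"
 unfolding Nq_def
proof (induction vs arbitrary: q)
 case (Cons v vs)
 have alg: "A + (a - \<i> * b) / 2 + (c + (a + \<i> * b) / 2) = a + N" if "A + c = N" for A a b c N :: complex
  using that by (auto simp: field_simps)
 show ?case
  using alg[OF Cons[of "\<lambda>ws. q (v # ws)"], of "q (v # vs)" "q (cJ v # vs)"]
  by (simp add: distrib_right)
qed simp

lemma Np_ext: "Np (ext a q) vs = ext a (Np q) vs + ext (\<lambda>v. (a v - \<i> * a (cJ v)) / 2) q vs"
proof (induction vs arbitrary: q)
 case (Cons v vs)
 show ?case
  unfolding Np.simps ext.simps Np_diff Np_scale Cons ext_add ext_half ext_diff ext_scale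
  by (simp add: field_simps)
qed simp

lemma Nq_ext: "Nq (ext a q) vs = ext a (Nq q) vs + ext (\<lambda>v. (a v + \<i> * a (cJ v)) / 2) q vs"
 unfolding Nq_def by (simp add: ext_cnj Np_ext)

lemma alt_Np:
 fixes q :: "'n::finite alt"
 assumes "alternating q"
 shows "alternating (Np q)"
proof (rule alternatingI_coinduct[where P="\<lambda>\<gamma>. \<exists>q p. alternating q \<and> alternating p \<and> \<gamma> = (\<lambda>vs. Np q vs + p vs)"])
 show "\<exists>q' p. alternating q' \<and> alternating p \<and> Np q = (\<lambda>vs. Np q' vs + p vs)"
  by (rule exI[of _ q], rule exI[of _ "\<lambda>_. 0"]) (simp add: assms alt_zero)
next
 fix \<gamma> :: "'n alt" and v
 assume "\<exists>q p. alternating q \<and> alternating p \<and> \<gamma> = (\<lambda>vs. Np q vs + p vs)"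
 then obtain q p where *: "alternating q" "alternating p" "\<gamma> = (\<lambda>vs. Np q vs + p vs)" by blast
 show "\<exists>q p. alternating q \<and> alternating p \<and> (\<lambda>ws. \<gamma> (v # ws)) = (\<lambda>vs. Np q vs + p vs)"
 proof (intro exI conjI)
  show "(\<lambda>ws. \<gamma> (v # ws)) = (\<lambda>vs. Np (\<lambda>ws. q (v # ws)) vs + (1/2 * (q (v # vs) - \<i> * q (cJ v # vs)) + p (v # vs)))"
   unfolding *(3) by auto
  show "alternating (\<lambda>vs. 1/2 * (q (v # vs) - \<i> * q (cJ v # vs)) + p (v # vs))"
   by (intro alt_add alt_scale alt_diff alt_contr *)
 qed (rule alt_contr[OF *(1)])
 have lin: "linear (\<lambda>v. Np (\<lambda>ws. q (v # ws)) vs + (q (v # vs) - \<i> * q (cJ v # vs)) / 2)" for vs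
 proof (rule linearI)
  fix x y :: "complex^'n" and r :: real
  have "cJ (r *\<^sub>R x) = r *\<^sub>R cJ x" by (simp add: vec_eq_iff)
  then show "Np (\<lambda>ws. q ((r *\<^sub>R x) # ws)) vs + (q ((r *\<^sub>R x) # vs) - \<i> * q (cJ (r *\<^sub>R x) # vs)) / 2
   = r *\<^sub>R (Np (\<lambda>ws. q (x # ws)) vs + (q (x # vs) - \<i> * q (cJ x # vs)) / 2)"
   by (simp only: alt_head[OF *(1)] scaleR_complex Np_scale) (simp add: field_simps)
  show "Np (\<lambda>ws. q ((x + y) # ws)) vs + (q ((x + y) # vs) - \<i> * q (cJ (x + y) # vs)) / 2
   = Np (\<lambda>ws. q (x # ws)) vs + (q (x # vs) - \<i> * q (cJ x # vs)) / 2
   + (Np (\<lambda>ws. q (y # ws)) vs + (q (y # vs) - \<i> * q (cJ y # vs)) / 2)"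
   by (simp add: alt_head[OF *(1)] Np_add vector_add_ldistrib field_simps)
 qed
 show "linear (\<lambda>v. \<gamma> (v # vs))" for vs
  unfolding *(3) Np.simps by (rule linear_compose_add[OF lin alt_linear[OF *(2)]])
 show "\<gamma> (v # v # vs) = 0" for vs
  unfolding *(3) Np.simps using alt_diag[OF *(1)] alt_diag[OF *(2)] alt_swap[OF *(1), of v "cJ v" vs]
  by (simp add: Np_zero)
qed

lemma alt_Nq: "alternating q ==> alternating (Nq q)"
 unfolding Nq_def by (intro alt_cnj alt_Np)

text \<open>Derivative of \<open>\<theta>\<^sub>s\<close> in \<open>s\<close>, multiplied by \<open>s\<close> to avoid a division.\<close>

lemma thp_has_derivative:
 assumes "alternating q"
 shows "\<exists>D. ((\<lambda>s. thp s q vs) has_field_derivative D) (at s) \<and> s * D = thp s (Np q) vs"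
 using assms
proof (induction vs arbitrary: q)
 case Nil
 show ?case by (rule exI[of _ 0]) (simp add: thp_Nil)
next
 case (Cons v vs)
 obtain D1 where D1: "((\<lambda>s. thp s (\<lambda>ws. q (v # ws)) vs) has_field_derivative D1) (at s)"
  "s * D1 = thp s (Np (\<lambda>ws. q (v # ws))) vs"
  using Cons.IH[OF alt_contr[OF Cons.prems]] by blast
 obtain D2 where D2: "((\<lambda>s. thp s (\<lambda>ws. q (cJ v # ws)) vs) has_field_derivative D2) (at s)"
  "s * D2 = thp s (Np (\<lambda>ws. q (cJ v # ws))) vs"
  using Cons.IH[OF alt_contr[OF Cons.prems]] by blast
 define A where "A = thp s (\<lambda>ws. q (v # ws)) vs"
 define B where "B = thp s (\<lambda>ws. q (cJ v # ws)) vs"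
 have d: "((\<lambda>s. thp s q (v # vs)) has_field_derivative ((s + 1) * D1 + A + (\<i> * (1 - s) * D2 - \<i> * B)) / 2) (at s)"
  unfolding thp_Cons' A_def B_def
  by (rule derivative_eq_intros D1(1) D2(1) refl | simp)+
 have e: "(\<lambda>ws. Np q (v # ws)) = (\<lambda>ws. Np (\<lambda>ws. q (v # ws)) ws + 1/2 * (q (v # ws) - \<i> * q (cJ v # ws)))"
  "(\<lambda>ws. Np q (cJ v # ws)) = (\<lambda>ws. Np (\<lambda>ws. q (cJ v # ws)) ws + 1/2 * (q (cJ v # ws) + \<i> * q (v # ws)))"
  using alt_J_head[OF Cons.prems] by auto
 have "s * (((s + 1) * D1 + A + (\<i> * (1 - s) * D2 - \<i> * B)) / 2) = ((s + 1) * (s * D1) + s * A + (\<i> * (1 - s) * (s * D2) - \<i> * s * B)) / 2"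
  by (simp add: algebra_simps)
 also have "\<dots> = thp s (Np q) (v # vs)"
  unfolding D1(2) D2(2) thp_Cons'[of s "Np q"] e thp_add thp_scale thp_diff A_def B_def
  by (simp add: field_simps)
 finally show ?case using d by blast
qed

context hframe
begin

text \<open>\<Lambda> has bidegree (-1,-1). In the recursion the corrections with \<open>f\<close>
  or \<open>J f\<close> repeated vanish by alternation, and the other two add up to the shift by
  one.\<close>

lemma Np_Lam:
 assumes "alternating q"
 shows "Np (Lam F q) vs = Lam F (Np q) vs - Lam F q vs"
proof -
 have *: "Np (\<lambda>ws. q (f # cJ f # ws)) vs = Np q (f # cJ f # vs) - q (f # cJ f # vs)" for f
  by (simp add: alt_diag[OF assms] alt_head(3)[OF alt_contr[OF assms]])
 show ?thesis
  unfolding Lam_def Np_half Np_sum * sum_subtractf diff_divide_distrib ..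
qed

lemma Np_eq_sum: "alternating q ==>
 Np q vs = (\<Sum>f\<in>F. ext (\<lambda>v. of_real (g f v)) (\<lambda>ws. 1/2 * (q (f # ws) - \<i> * q (cJ f # ws))) vs)"
proof (induction vs arbitrary: q)
 case (Cons v vs)
 have sw: "(\<lambda>ws. 1/2 * (q (f # v # ws) - \<i> * q (cJ f # v # ws))) = (\<lambda>ws. - 1 * (1/2 * (q (v # f # ws) - \<i> * q (v # cJ f # ws))))" for f
  using alt_swap[OF Cons.prems, of f v] alt_swap[OF Cons.prems, of "cJ f" v] by (auto simp: algebra_simps)
 have "linear (\<lambda>f. q (cJ f # vs))"
  using linear_compose[OF linear_cJ alt_linear[OF Cons.prems]] by (simp add: o_def)
 then have "(\<Sum>f\<in>F. g f v * (1/2 * (q (f # vs) - \<i> * q (cJ f # vs)))) = 1/2 * (q (v # vs) - \<i> * q (cJ v # vs))"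
  by (intro expand linear_mult_left linear_compose_sub alt_linear[OF Cons.prems])
 moreover have "(\<Sum>f\<in>F. ext (\<lambda>v. of_real (g f v)) (\<lambda>ws. 1/2 * (q (f # ws) - \<i> * q (cJ f # ws))) (v # vs)) =
   (\<Sum>f\<in>F. g f v * (1/2 * (q (f # vs) - \<i> * q (cJ f # vs)))) +
   (\<Sum>f\<in>F. ext (\<lambda>v. of_real (g f v)) (\<lambda>ws. 1/2 * (q (v # f # ws) - \<i> * q (v # cJ f # ws))) vs)"
  unfolding ext.simps sw ext_scale[of _ "- 1"] sum_subtractf by (simp only: mult_minus1 sum_negf diff_minus_eq_add)
 ultimately show ?case
  unfolding Cons.IH[OF alt_contr[OF Cons.prems], symmetric] by simp
qed simp

text \<open>\<open>Np\<close> is half of the degree minus i times the derivation induced by J. J is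
  skew for the metric, so the factor i makes that part symmetric for the Hermitian inner
  product.\<close>

lemma adj_Np:
 assumes fs: "set fs = F" "distinct fs" and uv: "alternating u" "alternating v"
 shows "inn fs (Np u) v = inn fs u (Np v)"
proof -
 define X where "X = (\<lambda>x y. inn fs (\<lambda>ws. u (x # ws)) (\<lambda>ws. v (y # ws)))"
 have c: "cov F (\<lambda>v. cnj (of_real (g f v))) v = (\<lambda>ws. v (f # ws))" if "f \<in> F" "alternating v" for f v
  using cov_dual[OF F_dual that(1)] by auto
 have 1: "inn fs (Np u) v = (\<Sum>f\<in>F. 1/2 * (inn fs (\<lambda>ws. u (f # ws)) (\<lambda>ws. v (f # ws)) - \<i> * inn fs (\<lambda>ws. u (cJ f # ws)) (\<lambda>ws. v (f # ws))))"
  if "alternating u" "alternating v" for u v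
 proof -
  have "Np u = (\<lambda>vs. \<Sum>f\<in>F. ext (\<lambda>v. of_real (g f v)) (\<lambda>ws. 1/2 * (u (f # ws) - \<i> * u (cJ f # ws))) vs)"
   using Np_eq_sum[OF that(1)] by blast
  then have "inn fs (Np u) v = (\<Sum>f\<in>F. inn fs (ext (\<lambda>v. of_real (g f v)) (\<lambda>ws. 1/2 * (u (f # ws) - \<i> * u (cJ f # ws)))) v)"
   by (simp only: inn_sum_left)
  also have "\<dots> = (\<Sum>f\<in>F. 1/2 * (inn fs (\<lambda>ws. u (f # ws)) (\<lambda>ws. v (f # ws)) - \<i> * inn fs (\<lambda>ws. u (cJ f # ws)) (\<lambda>ws. v (f # ws))))"
   by (rule sum.cong) (simp_all only: adj_ext[OF fs that(2)] c[OF _ that(2)] inn_scale_left inn_diff_left)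
  finally show ?thesis .
 qed
 have u: "linear (\<lambda>x. X x y)" for y
  unfolding X_def by (rule linearI) (simp_all only: alt_head[OF uv(1)] inn_add_left inn_scale_left scaleR_complex)
 have v: "linear (X x)" for x
  unfolding X_def by (rule linearI) (simp_all only: alt_head[OF uv(2)] inn_add_right inn_scale_right scaleR_complex complex_cnj_complex_of_real)
 have "inn fs u (Np v) = cnj (inn fs (Np v) u)" by (simp add: inn_cnj)
 also have "\<dots> = (\<Sum>f\<in>F. 1/2 * (X f f + \<i> * X f (cJ f)))"
  unfolding 1[OF uv(2,1)] X_def by (simp add: inn_cnj)
 also have "\<dots> = (\<Sum>f\<in>F. 1/2 * (X f f - \<i> * X (cJ f) f))"
  using sum_skew[of X, OF v u] unfolding sum_distrib_left[symmetric] sum.distrib sum_subtractf by simp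
 finally show ?thesis unfolding 1[OF uv] X_def by simp
qed

lemma adj_Nq:
 assumes fs: "set fs = F" "distinct fs" and uv: "alternating u" "alternating v"
 shows "inn fs (Nq u) v = inn fs u (Nq v)"
 unfolding Nq_def
 using adj_Np[OF fs alt_cnj[OF uv(1)] alt_cnj[OF uv(2)]]
  inn_cnj_cnj[of fs "Np (\<lambda>vs. cnj (u vs))" "\<lambda>vs. cnj (v vs)"] inn_cnj_cnj[of fs "\<lambda>vs. cnj (u vs)" "Np (\<lambda>vs. cnj (v vs))"]
 by simp

end

section \<open>Local differential calculus of forms\<close>

definition pd :: "(complex^'m::finite => 'n::finite alt) => complex^'m => complex^'m => 'n alt" where
 "pd W z b = (\<lambda>vs. fder (\<lambda>y. W y vs) z b)"

definition dl :: "(complex^'n::finite => 'n alt) => complex^'n => 'n alt" where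
 "dl W z = (\<lambda>vs. \<Sum>i<length vs. (-1) ^ i * fder (\<lambda>y. W y (take i vs @ drop (Suc i) vs)) z (vs ! i))"

abbreviation dfield :: "(complex^'m::finite => 'n::finite alt) => complex^'m => bool" where
 "dfield W z \<equiv> (\<forall>vs. (\<lambda>y. W y vs) differentiable (at z))"

abbreviation xb :: "(complex, 'n::finite) vec => (complex, 'n) vec => complex" where
 "xb b \<equiv> (\<lambda>v. of_real (v \<bullet> b))"

lemma linear_xb: "linear (xb b)"
 by (rule linearI) (simp_all add: inner_add_left scaleR_complex)

lemma xb_expand: "linear X ==> (\<Sum>b\<in>Basis. xb b v * X b) = X v" for X :: "(complex, 'n::finite) vec => complex"
 by (rule dual_basis_expand[OF dual_basis_Basis])

lemma fder_linear: "f differentiable (at z) ==> linear (fder f z)"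
 by (rule linear_frechet_derivative)

lemma fder_expand:
 fixes f :: "complex^'n::finite => complex"
 shows "f differentiable (at z) ==> fder f z v = (\<Sum>b\<in>Basis. xb b v * fder f z b)"
 using xb_expand[OF fder_linear, of f z v] by simp

lemma fder_has: "f differentiable (at z) ==> (f has_derivative fder f z) (at z)"
 by (rule fder_works)

lemma dl_Nil: "dl W z [] = 0"
 by (simp add: dl_def)

lemma dl_Cons: "dl W z (v # vs) = fder (\<lambda>y. W y vs) z v - dl (\<lambda>y ws. W y (v # ws)) z vs"
 unfolding dl_def length_Cons sum.lessThan_Suc_shift by (simp add: sum_negf)

text \<open>The form d = \<Sum> dx^b \<and> (derivative in direction b) over real coordinates; the
  first-order operators below arise from it by twisting dx^b.\<close>

lemma dl_ext:
 assumes "dfield W z"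
 shows "dl W z vs = (\<Sum>b\<in>Basis. ext (xb b) (pd W z b) vs)"
 using assms
proof (induction vs arbitrary: W)
 case (Cons v vs)
 have "pd (\<lambda>y ws. W y (v # ws)) z b = (\<lambda>ws. pd W z b (v # ws))" for b
  by (simp add: pd_def)
 then show ?case
  using Cons.IH[of "\<lambda>y ws. W y (v # ws)"] Cons.prems
  by (simp add: dl_Cons sum_subtractf fder_expand[of _ z v] pd_def)
qed (simp add: dl_Nil)

lemma alt_pd:
 fixes W :: "complex^'m::finite => 'n::finite alt"
 assumes "open U" "z \<in> U" "\<And>y. y \<in> U ==> alternating (W y)" "dfield W z"
 shows "alternating (pd W z b)"
 unfolding alternating_def
proof (intro conjI allI impI)
 fix vs :: "(complex^'n) list" and i assume i: "i < length vs"
 have l: "linear (\<lambda>v. W y (vs[i := v]))" if "y \<in> U" for y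
  using assms(3)[OF that] i unfolding alternating_def by blast
 have d: "((\<lambda>y. W y ws) has_derivative fder (\<lambda>y. W y ws) z) (at z)" for ws
  using assms(4) fder_works by blast
 show "linear (\<lambda>v. pd W z b (vs[i := v]))"
 proof (rule linearI)
  fix x y r
  have "((\<lambda>u. W u (vs[i := x]) + W u (vs[i := y])) has_derivative
    (\<lambda>h. fder (\<lambda>u. W u (vs[i := x])) z h + fder (\<lambda>u. W u (vs[i := y])) z h)) (at z)"
   by (intro has_derivative_add d)
  then have "((\<lambda>u. W u (vs[i := x + y])) has_derivative
    (\<lambda>h. fder (\<lambda>u. W u (vs[i := x])) z h + fder (\<lambda>u. W u (vs[i := y])) z h)) (at z)"
   by (rule has_derivative_transform_within_open[OF _ assms(1,2)]) (simp add: linear_add[OF l])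
  then show "pd W z b (vs[i := x + y]) = pd W z b (vs[i := x]) + pd W z b (vs[i := y])"
   unfolding pd_def by (rule fder_eqI)
  have "((\<lambda>u. r *\<^sub>R W u (vs[i := x])) has_derivative (\<lambda>h. r *\<^sub>R fder (\<lambda>u. W u (vs[i := x])) z h)) (at z)"
   by (intro has_derivative_scaleR_right d)
  then have "((\<lambda>u. W u (vs[i := r *\<^sub>R x])) has_derivative (\<lambda>h. r *\<^sub>R fder (\<lambda>u. W u (vs[i := x])) z h)) (at z)"
   by (rule has_derivative_transform_within_open[OF _ assms(1,2)]) (simp add: linear_cmul[OF l])
  then show "pd W z b (vs[i := r *\<^sub>R x]) = r *\<^sub>R pd W z b (vs[i := x])"
   unfolding pd_def by (rule fder_eqI)
 qed
next
 fix vs :: "(complex^'n) list" assume "\<not> distinct vs"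
 then have "W y vs = 0" if "y \<in> U" for y using assms(3)[OF that] unfolding alternating_def by blast
 then have "((\<lambda>y. W y vs) has_derivative (\<lambda>_. 0)) (at z)"
  by (intro has_derivative_transform_within_open[OF has_derivative_const[of 0] assms(1,2)]) simp
 then show "pd W z b vs = 0" unfolding pd_def by (rule fder_eqI)
qed

lemma linear_pd:
 fixes W :: "complex^'m::finite => 'n::finite alt"
 assumes "dfield W z" shows "linear (\<lambda>b. pd W z b vs)"
 unfolding pd_def using assms by (intro fder_linear) blast

subsection \<open>Pullback by maps depending on a parameter\<close>

text \<open>Derivative of the pullback of \<open>q\<close> along \<open>L\<close> when
  \<open>L\<close> varies in direction \<open>B\<close>: in one slot at a time \<open>L\<close> is
  replaced by \<open>B\<close>.\<close>

fun dpull :: "((complex,'m::finite) vec => (complex,'n::finite) vec) => ((complex,'m) vec => (complex,'n) vec) => 'n alt => 'm alt" where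
 "dpull L B q [] = 0"
| "dpull L B q (v # vs) = q (B v # map L vs) + dpull L B (\<lambda>ws. q (L v # ws)) vs"

lemma dpull_lincomb: "dpull L B (\<lambda>vs. \<Sum>i\<in>I. c i * A i vs) vs = (\<Sum>i\<in>I. c i * dpull L B (A i) vs)"
 by (induction vs arbitrary: A) (simp_all add: sum.distrib algebra_simps)

lemma alt_expand: "alternating q ==> q (v # vs) = (\<Sum>b\<in>Basis. xb b v * q (b # vs))"
 by (rule xb_expand[OF alt_linear, symmetric])

text \<open>The arguments move with the point. Expanding the first one in the fixed basis turns the
  value into a finite sum of products of a coordinate and a contracted form on the shorter
  list.\<close>

lemma pull_has_derivative:
 fixes W :: "complex^'m::finite => 'n::finite alt" and L :: "complex^'m => complex^'k::finite => complex^'n"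
 assumes U: "open U" "z \<in> U" and W: "\<And>y. y \<in> U ==> alternating (W y)" "dfield W z"
  and L: "\<And>v. ((\<lambda>y. L y v) has_derivative (\<lambda>h. L' h v)) (at z)"
 shows "((\<lambda>y. W y (map (L y) vs)) has_derivative (\<lambda>h. pd W z h (map (L z) vs) + dpull (L z) (L' h) (W z) vs)) (at z)"
 using W
proof (induction vs arbitrary: W)
 case Nil
 then show ?case by (simp add: pd_def fder_has)
next
 case (Cons v vs)
 define Wb where "Wb = (\<lambda>b y ws. W y (b # ws))"
 have Wb: "alternating (Wb b y)" if "y \<in> U" for b y
  unfolding Wb_def by (rule alt_contr[OF Cons.prems(1)[OF that]])
 have Wbd: "dfield (Wb b) z" for b unfolding Wb_def using Cons.prems(2) by blast
 have IH: "((\<lambda>y. Wb b y (map (L y) vs)) has_derivative (\<lambda>h. pd (Wb b) z h (map (L z) vs) + dpull (L z) (L' h) (Wb b z) vs)) (at z)" for b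
  by (rule Cons.IH[OF Wb Wbd])
 have "((\<lambda>y. \<Sum>b\<in>Basis. xb b (L y v) * Wb b y (map (L y) vs)) has_derivative
   (\<lambda>h. \<Sum>b\<in>Basis. xb b (L z v) * (pd (Wb b) z h (map (L z) vs) + dpull (L z) (L' h) (Wb b z) vs)
    + xb b (L' h v) * Wb b z (map (L z) vs))) (at z)"
  by (intro has_derivative_sum has_derivative_mult IH has_derivative_of_real has_derivative_inner_left L)
 then have "((\<lambda>y. W y (map (L y) (v # vs))) has_derivative
   (\<lambda>h. \<Sum>b\<in>Basis. xb b (L z v) * (pd (Wb b) z h (map (L z) vs) + dpull (L z) (L' h) (Wb b z) vs)
    + xb b (L' h v) * Wb b z (map (L z) vs))) (at z)"
 proof (rule has_derivative_transform_within_open[OF _ U])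
  fix y assume "y \<in> U"
  then show "(\<Sum>b\<in>Basis. xb b (L y v) * Wb b y (map (L y) vs)) = W y (map (L y) (v # vs))"
   using alt_expand[OF Cons.prems(1), of y "L y v" "map (L y) vs"] by (simp add: Wb_def)
 qed
 moreover have "(\<Sum>b\<in>Basis. xb b (L z v) * (pd (Wb b) z h (map (L z) vs) + dpull (L z) (L' h) (Wb b z) vs)
    + xb b (L' h v) * Wb b z (map (L z) vs)) = pd W z h (map (L z) (v # vs)) + dpull (L z) (L' h) (W z) (v # vs)" for h
 proof -
  have a: "alternating (pd W z h)" by (rule alt_pd[OF U Cons.prems])
  have "pd W z h (L z v # map (L z) vs) = (\<Sum>b\<in>Basis. xb b (L z v) * pd (Wb b) z h (map (L z) vs))"
   using alt_expand[OF a, of "L z v" "map (L z) vs"] by (simp add: pd_def Wb_def)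
  moreover have "W z (L' h v # map (L z) vs) = (\<Sum>b\<in>Basis. xb b (L' h v) * Wb b z (map (L z) vs))"
   using alt_expand[OF Cons.prems(1)[OF U(2)], of "L' h v" "map (L z) vs"] by (simp add: Wb_def)
  moreover have "dpull (L z) (L' h) (\<lambda>ws. W z (L z v # ws)) vs = (\<Sum>b\<in>Basis. xb b (L z v) * dpull (L z) (L' h) (Wb b z) vs)"
  proof -
   have "(\<lambda>ws. W z (L z v # ws)) = (\<lambda>ws. \<Sum>b\<in>Basis. xb b (L z v) * Wb b z ws)"
    using alt_expand[OF Cons.prems(1)[OF U(2)], of "L z v"] by (auto simp: Wb_def)
   then show ?thesis by (simp only: dpull_lincomb)
  qed
  ultimately show ?thesis by (simp add: sum.distrib distrib_left)
 qed
 ultimately show ?case by simp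
qed

lemma sum_ext_dpull:
 assumes "alternating q" "linear B"
 shows "(\<Sum>b\<in>Basis. ext (xb b) (\<lambda>ws. q (B b # map L ws)) vs) = dpull L B q vs"
 using assms(1)
proof (induction vs arbitrary: q)
 case (Cons v vs)
 have l: "linear (\<lambda>b. q (B b # map L vs))"
  using linear_compose[OF assms(2) alt_linear[OF Cons.prems]] by (simp add: o_def)
 have sw: "(\<lambda>ws. q (B b # L v # map L ws)) = (\<lambda>ws. - q (L v # B b # map L ws))" for b
  using alt_swap[OF Cons.prems] by blast
 show ?case
  using Cons.IH[OF alt_contr[OF Cons.prems], of "L v"] xb_expand[OF l, of v]
  by (simp add: sum_subtractf sw ext_minus sum_negf sum.distrib)
qed simp

text \<open>In the application \<open>B b v\<close> is the second derivative of a coordinate change.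
  Antisymmetrising over the symmetric pair \<open>b\<close>, \<open>v\<close> kills it, which leaves
  d natural under pullback.\<close>

lemma sum_ext_dpull_sym:
 assumes "alternating q" "\<And>b v. B b v = B v b" "\<And>b. linear (B b)"
 shows "(\<Sum>b\<in>Basis. ext (xb b) (dpull L (B b) q) vs) = 0"
 using assms(1)
proof (induction vs arbitrary: q)
 case (Cons v vs)
 have l: "linear (\<lambda>b. dpull L (B b) q vs)" for vs
  using Cons.prems
 proof (induction vs arbitrary: q)
  case Nil
  then show ?case by (simp add: linear_zero)
 next
  case (Cons x xs)
  have "linear (\<lambda>b. B b x)" using assms(3)[of x] by (simp add: assms(2)[of _ x])
  then have "linear (\<lambda>b. q (B b x # map L xs))"
   using linear_compose[OF _ alt_linear[OF Cons.prems]] by (fastforce simp: o_def)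
  then show ?case
   unfolding dpull.simps by (intro linear_compose_add Cons.IH alt_contr Cons.prems)
 qed
 have "(\<Sum>b\<in>Basis. ext (xb b) (\<lambda>ws. q (B b v # map L ws)) vs) = dpull L (\<lambda>b. B b v) q vs"
  using assms(3)[of v] by (intro sum_ext_dpull Cons.prems) (simp add: assms(2)[of _ v])
 moreover have "(\<lambda>b. B b v) = B v" using assms(2) by auto
 ultimately show ?case
  using Cons.IH[OF alt_contr[OF Cons.prems], of "L v"] xb_expand[OF l, of v vs]
  by (simp add: sum_subtractf ext_add sum.distrib)
qed simp

lemma dl_pull:
 fixes W :: "complex^'n::finite => 'n alt" and T :: "complex^'n => complex^'n"
 assumes T: "open V" "holomorphic_map V T" "z \<in> V" and U: "open U" "T z \<in> U"
  and W: "\<And>y. y \<in> U ==> alternating (W y)" "dfield W (T z)"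
 shows "dl (\<lambda>y vs. W (T y) (map (fder T y) vs)) z vs = dl W (T z) (map (fder T z) vs)"
proof -
 let ?L = "fder T z"
 define B where "B = (\<lambda>b v. fder (\<lambda>y. fder T y v) z b)"
 note Ts = holomorphic_map_smooth_on[OF T(1,2)]
 have dT: "(T has_derivative ?L) (at z)" by (rule holomorphic_map_fder(1)[OF T(2,3)])
 have contT: "continuous_on V T" by (rule smooth_on_imp_continuous_on[OF Ts])
 define V' where "V' = T -` U \<inter> V"
 have V': "open V'" "z \<in> V'"
  unfolding V'_def using continuous_open_preimage[OF contT T(1) U(1)] T(3) U(2) by (auto simp: Int_commute)
 have WT: "((\<lambda>y. W (T y) ws) has_derivative (\<lambda>h. pd W (T z) (?L h) ws)) (at z)" for ws
  unfolding pd_def by (rule has_derivative_compose[OF dT fder_has]) (use W(2) in blast)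
 have altWT: "alternating (W (T y))" if "y \<in> V'" for y
  using that W(1) unfolding V'_def by auto
 have dWT: "dfield (\<lambda>y. W (T y)) z" using WT by (auto intro: differentiableI)
 have pdWT: "pd (\<lambda>y. W (T y)) z h = pd W (T z) (?L h)" for h
  unfolding pd_def[of "\<lambda>y. W (T y)"] using fder_eqI[OF WT] by blast
 have dL: "((\<lambda>y. fder T y v) has_derivative (\<lambda>h. B h v)) (at z)" for v
  unfolding B_def by (rule smooth_on_has_derivative[OF smooth_on_fder[OF Ts] T(3)])
 note D = pull_has_derivative[where W="\<lambda>y. W (T y)" and L="fder T" and L'=B, OF V' altWT dWT dL]
 have dpullW: "dfield (\<lambda>y vs. W (T y) (map (fder T y) vs)) z"
  using D by (auto intro: differentiableI)
 have pdp: "pd (\<lambda>y vs. W (T y) (map (fder T y) vs)) z b = (\<lambda>vs. pd W (T z) (?L b) (map ?L vs) + dpull ?L (B b) (W (T z)) vs)" for b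
  unfolding pd_def[of "\<lambda>y vs. W (T y) (map (fder T y) vs)"] using fder_eqI[OF D] pdWT by auto
 have Bsym: "B b v = B v b" for b v
  unfolding B_def by (rule holomorphic_map_fder_commute[OF T])
 have Blin: "linear (B b)" for b
 proof -
  have "B b = (\<lambda>v. B v b)" using Bsym by blast
  moreover have "linear (\<lambda>v. B v b)" using has_derivative_linear[OF dL[of b]] .
  ultimately show ?thesis by simp
 qed
 have linL: "linear ?L" by (rule holomorphic_map_fder(3)[OF T(2,3)])
 have "dl (\<lambda>y vs. W (T y) (map (fder T y) vs)) z vs =
   (\<Sum>b\<in>Basis. ext (xb b) (\<lambda>vs. pd W (T z) (?L b) (map ?L vs)) vs) + (\<Sum>b\<in>Basis. ext (xb b) (dpull ?L (B b) (W (T z))) vs)"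
  unfolding dl_ext[OF dpullW] pdp ext_add sum.distrib ..
 also have "(\<Sum>b\<in>Basis. ext (xb b) (dpull ?L (B b) (W (T z))) vs) = 0"
  by (rule sum_ext_dpull_sym[OF W(1)[OF U(2)] Bsym Blin])
 also have "(\<Sum>b\<in>Basis. ext (xb b) (\<lambda>vs. pd W (T z) (?L b) (map ?L vs)) vs) =
   (\<Sum>b\<in>Basis. \<Sum>c\<in>Basis. xb c (?L b) * ext (xb b) (\<lambda>vs. pd W (T z) c (map ?L vs)) vs)"
 proof (rule sum.cong[OF refl])
  fix b
  have "(\<lambda>vs. pd W (T z) (?L b) (map ?L vs)) = (\<lambda>vs. \<Sum>c\<in>Basis. xb c (?L b) * pd W (T z) c (map ?L vs))"
   using xb_expand[OF linear_pd[OF W(2)]] by auto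
  then show "ext (xb b) (\<lambda>vs. pd W (T z) (?L b) (map ?L vs)) vs = (\<Sum>c\<in>Basis. xb c (?L b) * ext (xb b) (\<lambda>vs. pd W (T z) c (map ?L vs)) vs)"
   by (simp only: ext_lincomb)
 qed
 also have "\<dots> = (\<Sum>c\<in>Basis. ext (\<lambda>v. \<Sum>b\<in>Basis. xb c (?L b) * xb b v) (\<lambda>vs. pd W (T z) c (map ?L vs)) vs)"
  unfolding ext_cov_lincomb by (rule sum.swap)
 also have "\<dots> = dl W (T z) (map ?L vs)"
 proof -
  have "(\<Sum>b\<in>Basis. xb c (?L b) * xb b v) = xb c (?L v)" for c v
   using xb_expand[OF linear_compose[OF linL linear_xb[of c]], of v] by (simp add: o_def mult.commute)
  then show ?thesis unfolding dl_ext[OF W(2)] ext_map by simp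
 qed
 finally show ?thesis by simp
qed

subsection \<open>The operator \<open>D\<^sub>\<eta>\<close> in coordinates\<close>

definition Dl :: "(complex^'n::finite => real) => (complex^'n => 'n alt) => complex^'n => 'n alt" where
 "Dl \<eta> W z = thp (of_real (\<eta> z)) (dl (\<lambda>y. thp (of_real (1 / \<eta> y)) (W y)) z)"

definition Dbl :: "(complex^'n::finite => real) => (complex^'n => 'n alt) => complex^'n => 'n alt" where
 "Dbl \<eta> W z = (\<lambda>vs. cnj (Dl (\<lambda>y. - \<eta> y) (\<lambda>y vs. cnj (W y vs)) z vs))"

definition tw2 :: "complex => ((complex, 'n::finite) vec => complex) => (complex, 'n) vec => complex" where
 "tw2 s a v = ((1 - s) * a v - \<i> * (1 + s) * a (cJ v)) / 2"

text \<open>The one-forms \<open>(1/\<eta>) d\<^sub>\<eta>\<eta>\<close> and \<open>(1/\<eta>) conj(d\<^sub>-\<^sub>\<eta>) \<eta>\<close>.\<close>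

definition alc :: "(complex^'n::finite => real) => complex^'n => complex^'n => complex" where
 "alc \<eta> z v = (\<Sum>b\<in>Basis. of_real (fder \<eta> z b / \<eta> z) * tw1 (of_real (\<eta> z)) (xb b) v)"

definition bec :: "(complex^'n::finite => real) => complex^'n => complex^'n => complex" where
 "bec \<eta> z v = (\<Sum>b\<in>Basis. of_real (fder \<eta> z b / \<eta> z) * tw2 (of_real (\<eta> z)) (xb b) v)"

text \<open>The twist is a polynomial in \<sigma> with coefficients linear in the form. The
  derivative of the polynomial is identified with \<open>thp_has_derivative\<close> through
  uniqueness of derivatives instead of being simplified.\<close>

lemma thp_field_has_derivative:
 fixes W :: "complex^'n::finite => 'n alt" and \<sigma> :: "complex^'n => complex"
 assumes "alternating (W z)" "dfield W z" "(\<sigma> has_derivative \<sigma>') (at z)" "\<sigma> z \<noteq> 0"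
 shows "((\<lambda>y. thp (\<sigma> y) (W y) vs) has_derivative (\<lambda>h. thp (\<sigma> z) (\<lambda>vs. pd W z h vs + \<sigma>' h / \<sigma> z * Np (W z) vs) vs)) (at z)"
proof -
 let ?m = "length vs"
 define A where "A = (\<lambda>S q. \<Sum>T\<in>Pow {..<?m}. (\<Prod>t\<in>T. if t \<in> S then - \<i> else \<i>) *
   (q::'n alt) (map (\<lambda>t. if t \<in> T then cJ (vs ! t) else vs ! t) [0..<?m]) / 2 ^ ?m)"
 have th: "thp s q vs = (\<Sum>S\<in>Pow {..<?m}. s ^ card S * A S q)" for s q
  unfolding thp_eq_sum_Pow A_def by (simp add: sum_divide_distrib sum_distrib_left)
 have dA: "((\<lambda>y. A S (W y)) has_derivative (\<lambda>h. A S (pd W z h))) (at z)" for S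
  unfolding A_def pd_def
  by (intro has_derivative_sum bounded_linear.has_derivative[OF bounded_linear_divide]
    bounded_linear.has_derivative[OF bounded_linear_mult_right] fder_has) (use assms(2) in blast)
 have 1: "((\<lambda>y. thp (\<sigma> y) (W y) vs) has_derivative
   (\<lambda>h. \<Sum>S\<in>Pow {..<?m}. \<sigma> z ^ card S * A S (pd W z h) + of_nat (card S) * \<sigma>' h * \<sigma> z ^ (card S - 1) * A S (W z))) (at z)"
  unfolding th by (intro has_derivative_sum has_derivative_mult dA has_derivative_power assms(3))
 obtain D where D: "((\<lambda>s. thp s (W z) vs) has_field_derivative D) (at (\<sigma> z))" "\<sigma> z * D = thp (\<sigma> z) (Np (W z)) vs"
  using thp_has_derivative[OF assms(1)] by blast
 have "((\<lambda>s. thp s (W z) vs) has_field_derivative (\<Sum>S\<in>Pow {..<?m}. of_nat (card S) * \<sigma> z ^ (card S - 1) * A S (W z))) (at (\<sigma> z))"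
  unfolding th by (intro DERIV_sum DERIV_cmult_right) (rule derivative_eq_intros refl | simp)+
 then have "D = (\<Sum>S\<in>Pow {..<?m}. of_nat (card S) * \<sigma> z ^ (card S - 1) * A S (W z))"
  using D(1) DERIV_unique by blast
 then have "(\<Sum>S\<in>Pow {..<?m}. \<sigma> z ^ card S * A S (pd W z h) + of_nat (card S) * \<sigma>' h * \<sigma> z ^ (card S - 1) * A S (W z)) =
   thp (\<sigma> z) (pd W z h) vs + \<sigma>' h * D" for h
  by (simp add: th sum.distrib sum_distrib_left mult_ac)
 also have "thp (\<sigma> z) (pd W z h) vs + \<sigma>' h * D = thp (\<sigma> z) (\<lambda>vs. pd W z h vs + \<sigma>' h / \<sigma> z * Np (W z) vs) vs" for h
  unfolding thp_add thp_scale D(2)[symmetric] using assms(4) by simp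
 finally show ?thesis using 1 by simp
qed

text \<open>Conjugation with the twist rescales each dx^b, and differentiating 1/\<eta> inside the
  inner twist contributes -(d\<eta>/\<eta>) times multiplication by p. This is the explicit formula
  for \<open>D_eta\<close>, written in real coordinate directions.\<close>

lemma Dl_formula:
 fixes W :: "complex^'n::finite => 'n alt"
 assumes U: "open U" "z \<in> U" and W: "\<And>y. y \<in> U ==> alternating (W y)" "dfield W z"
  and \<eta>: "\<eta> differentiable (at z)" "\<eta> z \<noteq> 0"
 shows "Dl \<eta> W z vs = (\<Sum>b\<in>Basis. ext (tw1 (of_real (\<eta> z)) (xb b)) (pd W z b) vs) - ext (alc \<eta> z) (Np (W z)) vs"
proof -
 define \<sigma> where "\<sigma> = (\<lambda>y. complex_of_real (1 / \<eta> y))"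
 have d: "((\<lambda>y. 1 / \<eta> y) has_derivative (\<lambda>h. - (fder \<eta> z h / (\<eta> z)\<^sup>2))) (at z)"
  using has_derivative_divide[OF has_derivative_const fder_works[OF \<eta>(1)] \<eta>(2), of 1]
  by (simp add: field_simps power2_eq_square)
 have d\<sigma>: "(\<sigma> has_derivative (\<lambda>h. of_real (- (fder \<eta> z h / (\<eta> z)\<^sup>2)))) (at z)"
  unfolding \<sigma>_def by (rule has_derivative_of_real[OF d])
 have \<sigma>0: "\<sigma> z \<noteq> 0" using \<eta>(2) by (simp add: \<sigma>_def)
 have q: "complex_of_real (- (fder \<eta> z h / (\<eta> z)\<^sup>2)) / \<sigma> z = - of_real (fder \<eta> z h / \<eta> z)" for h
  using \<eta>(2) by (simp add: \<sigma>_def power2_eq_square)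
 note D = thp_field_has_derivative[OF W(1)[OF U(2)] W(2) d\<sigma> \<sigma>0, unfolded q]
 define Y where "Y = (\<lambda>b vs. pd W z b vs + - of_real (fder \<eta> z b / \<eta> z) * Np (W z) vs)"
 have altY: "alternating (Y b)" for b
  unfolding Y_def by (intro alt_add alt_scale alt_Np W(1)[OF U(2)] alt_pd[OF U W])
 have pd: "pd (\<lambda>y. thp (\<sigma> y) (W y)) z b = thp (\<sigma> z) (Y b)" for b
  unfolding pd_def[of "\<lambda>y. thp (\<sigma> y) (W y)"] Y_def using fder_eqI[OF D] by auto
 have df: "dfield (\<lambda>y. thp (\<sigma> y) (W y)) z" using D by (auto intro: differentiableI)
 have inv: "thp (of_real (\<eta> z)) (thp (\<sigma> z) (Y b)) = Y b" for b
 proof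
  fix vs
  have "of_real (\<eta> z) * \<sigma> z = 1" using \<eta>(2) by (simp add: \<sigma>_def)
  then show "thp (of_real (\<eta> z)) (thp (\<sigma> z) (Y b)) vs = Y b vs"
   by (simp add: thp_thp[OF altY] thp_1)
 qed
 have "dl (\<lambda>y. thp (\<sigma> y) (W y)) z = (\<lambda>vs. \<Sum>b\<in>Basis. ext (xb b) (thp (\<sigma> z) (Y b)) vs)"
  using dl_ext[OF df] pd by auto
 then have "Dl \<eta> W z vs = (\<Sum>b\<in>Basis. ext (tw1 (of_real (\<eta> z)) (xb b)) (Y b) vs)"
  using inv by (simp only: Dl_def \<sigma>_def thp_sum thp_ext)
 also have "\<dots> = (\<Sum>b\<in>Basis. ext (tw1 (of_real (\<eta> z)) (xb b)) (pd W z b) vs) - ext (alc \<eta> z) (Np (W z)) vs"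
 proof -
  have "alc \<eta> z = (\<lambda>v. \<Sum>b\<in>Basis. of_real (fder \<eta> z b / \<eta> z) * tw1 (of_real (\<eta> z)) (xb b) v)"
   by (auto simp: alc_def)
  then have "ext (alc \<eta> z) (Np (W z)) vs = (\<Sum>b\<in>Basis. of_real (fder \<eta> z b / \<eta> z) * ext (tw1 (of_real (\<eta> z)) (xb b)) (Np (W z)) vs)"
   by (simp only: ext_cov_lincomb)
  then show ?thesis
   unfolding Y_def ext_add ext_scale by (simp add: sum.distrib sum_negf sum_subtractf)
 qed
 finally show ?thesis .
qed

lemma Dbl_formula:
 fixes W :: "complex^'n::finite => 'n alt"
 assumes U: "open U" "z \<in> U" and W: "\<And>y. y \<in> U ==> alternating (W y)" "dfield W z"
  and \<eta>: "\<eta> differentiable (at z)" "\<eta> z \<noteq> 0"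
 shows "Dbl \<eta> W z vs = (\<Sum>b\<in>Basis. ext (tw2 (of_real (\<eta> z)) (xb b)) (pd W z b) vs) - ext (bec \<eta> z) (Nq (W z)) vs"
proof -
 have d: "((\<lambda>y. cnj (W y vs)) has_derivative (\<lambda>h. cnj (pd W z h vs))) (at z)" for vs
  unfolding pd_def by (rule has_derivative_cnj, rule fder_has) (use W(2) in blast)
 have df: "dfield (\<lambda>y vs. cnj (W y vs)) z" using d by (auto intro: differentiableI)
 have pdc: "pd (\<lambda>y vs. cnj (W y vs)) z b = (\<lambda>vs. cnj (pd W z b vs))" for b
  unfolding pd_def[of "\<lambda>y vs. cnj (W y vs)"] using fder_eqI[OF d] by auto
 have \<eta>': "((\<lambda>y. - \<eta> y) has_derivative (\<lambda>h. - fder \<eta> z h)) (at z)"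
  by (intro has_derivative_minus fder_works \<eta>)
 have \<eta>'': "(\<lambda>y. - \<eta> y) differentiable (at z)" "- \<eta> z \<noteq> 0" using \<eta>' \<eta> by (auto intro: differentiableI)
 have t: "(\<lambda>v. cnj (tw1 (of_real (- \<eta> z)) (xb b) v)) = tw2 (of_real (\<eta> z)) (xb b)" for b
  by (auto simp: tw1_def tw2_def algebra_simps)
 have a: "(\<lambda>v. cnj (alc (\<lambda>y. - \<eta> y) z v)) = bec \<eta> z"
 proof
  fix v
  show "cnj (alc (\<lambda>y. - \<eta> y) z v) = bec \<eta> z v"
   unfolding alc_def bec_def cnj_sum
   by (intro sum.cong refl) (simp add: fder_eqI[OF \<eta>'] fun_cong[OF t, unfolded of_real_minus])
 qed
 have alt: "alternating (\<lambda>vs. cnj (W y vs))" if "y \<in> U" for y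
  by (rule alt_cnj[OF W(1)[OF that]])
 have "Dl (\<lambda>y. - \<eta> y) (\<lambda>y vs. cnj (W y vs)) z vs =
   (\<Sum>b\<in>Basis. ext (tw1 (of_real (- \<eta> z)) (xb b)) (\<lambda>vs. cnj (pd W z b vs)) vs) - ext (alc (\<lambda>y. - \<eta> y) z) (Np (\<lambda>vs. cnj (W z vs))) vs"
  unfolding pdc[symmetric] by (rule Dl_formula[OF U _ df \<eta>'']) (rule alt)
 then show ?thesis
  unfolding Dbl_def complex_cnj_diff cnj_sum ext_cnj by (simp only: complex_cnj_diff cnj_sum ext_cnj complex_cnj_cnj t a Nq_def)
qed

subsection \<open>Leibniz rule and smoothness\<close>

lemma alt_wedge_sum_left: "alt_wedge (\<lambda>vs. \<Sum>i\<in>I. A i vs) p vs = (\<Sum>i\<in>I. alt_wedge (A i) p vs)"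
 using alt_wedge_lincomb_left[where c="\<lambda>_. 1"] by simp

lemma alt_wedge_sum_right: "alt_wedge q (\<lambda>vs. \<Sum>i\<in>I. B i vs) vs = (\<Sum>i\<in>I. alt_wedge q (B i) vs)"
 using alt_wedge_lincomb_right[where c="\<lambda>_. 1"] by simp

abbreviation sg :: "'n::finite alt => 'n alt" where
 "sg q \<equiv> (\<lambda>ws. (- 1) ^ length ws * q ws)"

lemma alt_wedge_field_has_derivative:
 assumes "dfield q z" "dfield p z"
 shows "((\<lambda>y. alt_wedge (q y) (p y) vs) has_derivative (\<lambda>h. alt_wedge (pd q z h) (p z) vs + alt_wedge (q z) (pd p z h) vs)) (at z)"
proof -
 have "((\<lambda>y. \<Sum>I\<in>Pow {..<length vs}. (- 1) ^ card {(i, j). i \<in> I \<and> j \<in> {..<length vs} - I \<and> j < i} * (q y (nths vs I) * p y (nths vs (- I)))) has_derivative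
  (\<lambda>h. \<Sum>I\<in>Pow {..<length vs}. (- 1) ^ card {(i, j). i \<in> I \<and> j \<in> {..<length vs} - I \<and> j < i} *
   (q z (nths vs I) * pd p z h (nths vs (- I)) + pd q z h (nths vs I) * p z (nths vs (- I))))) (at z)"
  unfolding pd_def
  by (intro has_derivative_sum bounded_linear.has_derivative[OF bounded_linear_mult_right] has_derivative_mult fder_has)
   (use assms in auto)
 moreover have "(\<Sum>I\<in>Pow {..<length vs}. (- 1) ^ card {(i, j). i \<in> I \<and> j \<in> {..<length vs} - I \<and> j < i} *
   (q z (nths vs I) * pd p z h (nths vs (- I)) + pd q z h (nths vs I) * p z (nths vs (- I)))) =
   alt_wedge (pd q z h) (p z) vs + alt_wedge (q z) (pd p z h) vs" for h
  unfolding alt_wedge_def sum.distrib[symmetric] by (intro sum.cong refl) (simp add: algebra_simps)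
 ultimately show ?thesis unfolding alt_wedge_def[of "q _"] by (simp add: mult.assoc)
qed

lemma dl_alt_wedge:
 assumes "dfield q z" "dfield p z"
 shows "dl (\<lambda>y. alt_wedge (q y) (p y)) z vs = alt_wedge (dl q z) (p z) vs + alt_wedge (sg (q z)) (dl p z) vs"
proof -
 note D = alt_wedge_field_has_derivative[OF assms]
 have df: "dfield (\<lambda>y. alt_wedge (q y) (p y)) z" using D by (auto intro: differentiableI)
 have pd: "pd (\<lambda>y. alt_wedge (q y) (p y)) z b = (\<lambda>vs. alt_wedge (pd q z b) (p z) vs + alt_wedge (q z) (pd p z b) vs)" for b
  unfolding pd_def[of "\<lambda>y. alt_wedge (q y) (p y)"] using fder_eqI[OF D] by auto
 have s: "sg (sg (q z)) = q z" by (simp flip: mult.assoc power_add)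
 have da: "dl q z = (\<lambda>vs. \<Sum>b\<in>Basis. ext (xb b) (pd q z b) vs)" using dl_ext[OF assms(1)] by blast
 have db: "dl p z = (\<lambda>vs. \<Sum>b\<in>Basis. ext (xb b) (pd p z b) vs)" using dl_ext[OF assms(2)] by blast
 show ?thesis
  unfolding dl_ext[OF df] pd ext_add da db alt_wedge_sum_left alt_wedge_sum_right alt_wedge_ext_left alt_wedge_ext_right s sum.distrib ..
qed

lemma dfield_thp_inverse:
 fixes W :: "complex^'n::finite => 'n alt"
 assumes "alternating (W z)" "dfield W z" "\<eta> differentiable (at z)" "\<eta> z \<noteq> 0"
 shows "dfield (\<lambda>y. thp (of_real (1 / \<eta> y)) (W y)) z"
proof -
 have "(\<lambda>y. 1 / \<eta> y) differentiable (at z)"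
  using assms by (intro differentiable_divide) auto
 then have "((\<lambda>y. complex_of_real (1 / \<eta> y)) has_derivative (\<lambda>h. of_real (fder (\<lambda>y. 1 / \<eta> y) z h))) (at z)"
  by (intro has_derivative_of_real fder_works)
 from thp_field_has_derivative[OF assms(1,2) this] assms(4) show ?thesis
  by (auto intro: differentiableI)
qed

lemma Dl_alt_wedge:
 fixes q :: "complex^'n::finite => 'n alt"
 assumes "alternating (q z)" "dfield q z" "alternating (p z)" "dfield p z" "\<eta> differentiable (at z)" "\<eta> z \<noteq> 0"
 shows "Dl \<eta> (\<lambda>y. alt_wedge (q y) (p y)) z vs = alt_wedge (Dl \<eta> q z) (p z) vs + alt_wedge (sg (q z)) (Dl \<eta> p z) vs"
proof -
 have inv: "thp (of_real (\<eta> z)) (thp (of_real (1 / \<eta> z)) \<gamma>) = \<gamma>" if "alternating \<gamma>" for \<gamma>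
 proof
  fix vs
  have "complex_of_real (\<eta> z) * of_real (1 / \<eta> z) = 1" using assms(6) by simp
  then show "thp (of_real (\<eta> z)) (thp (of_real (1 / \<eta> z)) \<gamma>) vs = \<gamma> vs"
   by (simp only: thp_thp[OF that] thp_1)
 qed
 have w: "(\<lambda>y. thp (of_real (1 / \<eta> y)) (alt_wedge (q y) (p y))) =
   (\<lambda>y. alt_wedge (thp (of_real (1 / \<eta> y)) (q y)) (thp (of_real (1 / \<eta> y)) (p y)))"
  by (intro HOL.ext) (rule thp_alt_wedge)
 have s: "sg (thp (of_real (1 / \<eta> z)) (q z)) = thp (of_real (1 / \<eta> z)) (sg (q z))"
  by (rule HOL.ext) (rule thp_degree[symmetric])
 have d: "dl (\<lambda>y. alt_wedge (thp (of_real (1 / \<eta> y)) (q y)) (thp (of_real (1 / \<eta> y)) (p y))) z =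
  (\<lambda>vs. alt_wedge (dl (\<lambda>y. thp (of_real (1 / \<eta> y)) (q y)) z) (thp (of_real (1 / \<eta> z)) (p z)) vs +
   alt_wedge (sg (thp (of_real (1 / \<eta> z)) (q z))) (dl (\<lambda>y. thp (of_real (1 / \<eta> y)) (p y)) z) vs)"
  by (rule HOL.ext, rule dl_alt_wedge) (rule dfield_thp_inverse; use assms in blast)+
 show ?thesis
  unfolding Dl_def w d thp_add thp_alt_wedge s inv[OF assms(3)] inv[OF alt_sign[OF assms(1)]] ..
qed

definition sfield :: "(complex^'m::finite) set => (complex^'m => 'n::finite alt) => bool" where
 "sfield U W \<longleftrightarrow> (\<forall>vs. smooth_on U (\<lambda>y. W y vs))"

lemma sfield_dfield: "sfield U W ==> z \<in> U ==> dfield W z"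
 unfolding sfield_def using smooth_on_imp_differentiable by blast

lemma sfield_dl: "open U ==> sfield U W ==> sfield U (dl W)"
 unfolding sfield_def dl_def
 by (intro allI smooth_on_sum smooth_on_mult smooth_on_const smooth_on_fder) auto

lemma sfield_alt_wedge: "open U ==> sfield U A ==> sfield U B ==> sfield U (\<lambda>z. alt_wedge (A z) (B z))"
 unfolding sfield_def alt_wedge_def
 by (intro allI smooth_on_sum smooth_on_mult smooth_on_const) auto

lemma sfield_thp:
 assumes "open U" "smooth_on U \<sigma>" "sfield U W"
 shows "sfield U (\<lambda>z. thp (\<sigma> z) (W z))"
proof -
 have "smooth_on U (\<lambda>z. 1 / 2 ^ length vs * (\<Sum>S\<in>Pow {..<length vs}. \<sigma> z ^ card S * (\<Sum>T\<in>Pow {..<length vs}.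
   (\<Prod>t\<in>T. if t \<in> S then - \<i> else \<i>) * W z (map (\<lambda>t. if t \<in> T then cJ (vs ! t) else vs ! t) [0..<length vs]))))" for vs
  by (intro smooth_on_mult smooth_on_const smooth_on_sum smooth_on_power assms) (use assms(3) sfield_def in blast)
 then show ?thesis
  unfolding sfield_def thp_eq_sum_Pow by simp
qed

lemma sfield_cnj: "open U ==> sfield U W ==> sfield U (\<lambda>z vs. cnj (W z vs))"
 unfolding sfield_def using smooth_on_cnj by blast

lemma alt_dl:
 fixes W :: "complex^'n::finite => 'n alt"
 assumes "open U" "z \<in> U" "\<And>y. y \<in> U ==> alternating (W y)" "dfield W z"
 shows "alternating (dl W z)"
proof -
 have "dl W z = (\<lambda>vs. \<Sum>b\<in>Basis. 1 * ext (xb b) (pd W z b) vs)" using dl_ext[OF assms(4)] by auto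
 moreover have "alternating (ext (xb b) (pd W z b))" for b
  by (rule alt_ext[OF alt_pd[OF assms] linear_xb])
 ultimately show ?thesis using alt_lincomb[of Basis "\<lambda>b. ext (xb b) (pd W z b)" "\<lambda>_. 1"] by simp
qed

subsection \<open>First derivatives of the metric\<close>

lemma dpull_comp:
 assumes "dual_basis F \<phi>" "alternating q" "linear A" "\<And>v. B v = A (L v)"
 shows "dpull L B q vs = (\<Sum>f\<in>F. ext (\<lambda>v. of_real (\<phi> f v)) (\<lambda>ws. q (A f # ws)) (map L vs))"
 using assms(2)
proof (induction vs arbitrary: q)
 case (Cons v vs)
 have l: "linear (\<lambda>b. q (A b # map L vs))"
  using linear_compose[OF assms(3) alt_linear[OF Cons.prems]] by (simp add: o_def)
 have sw: "(\<lambda>ws. q (A f # L v # ws)) = (\<lambda>ws. - q (L v # A f # ws))" for f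
  using alt_swap[OF Cons.prems] by blast
 show ?case
  using Cons.IH[OF alt_contr[OF Cons.prems], of "L v"] dual_basis_expand[OF assms(1) l, of "L v"]
  by (simp add: sum_subtractf sw ext_minus sum_negf sum.distrib assms(4))
qed simp

definition blist :: "(complex^'n::finite) list" where
 "blist = (SOME l. set l = Basis \<and> distinct l)"

lemma blist: "set (blist :: (complex^'n::finite) list) = Basis" "distinct (blist :: (complex^'n::finite) list)"
proof -
 have "\<exists>l. set l = (Basis :: (complex^'n) set) \<and> distinct l"
  by (rule finite_distinct_list) simp
 then have "set (blist :: (complex^'n) list) = Basis \<and> distinct (blist :: (complex^'n) list)"
  unfolding blist_def by (rule someI_ex)
 then show "set (blist :: (complex^'n::finite) list) = Basis" "distinct (blist :: (complex^'n::finite) list)" by auto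
qed

text \<open>The metric inner product and \<open>\<Lambda>\<close> in terms of the inverse metric, without a choice of frame.\<close>

definition innG :: "'n::finite alt => 'n alt => 'n alt => complex" where
 "innG w u v = inn blist u (\<lambda>vs. v (map (Ginv w) vs))"

definition LamG :: "'n::finite alt => 'n alt => 'n alt" where
 "LamG w q = (\<lambda>vs. (\<Sum>b\<in>Basis. q (b # cJ (Ginv w b) # vs)) / 2)"

definition rho :: "'n::finite alt => real" where
 "rho w = Re (det (hmat w))"

text \<open>The tensor of an orthonormal frame equals that of the Euclidean basis with
  \<open>Ginv\<close> on the second factor, so \<open>inn_change_basis\<close> applies.\<close>

lemma inn_eq_innG:
 assumes "hframe w (set fs)" "distinct fs" "alternating u" "alternating v"
 shows "inn fs u v = innG w u v"
proof -
 interpret hframe w "set fs" by fact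
 have b: "dual_basis (set (blist :: (complex^'a) list)) (\<lambda>b v. v \<bullet> b)"
  unfolding blist(1) by (rule dual_basis_Basis)
 have t: "same_tensor (set fs) (set blist) (Ginv w)"
  unfolding blist(1) by (rule same_tensor_Basis)
 show ?thesis
  unfolding innG_def by (rule inn_change_basis[OF F_dual assms(2) b blist(2) linear_Ginv t assms(3,4)])
qed

lemma Lam_eq_LamG:
 assumes "hframe w F" "alternating q"
 shows "Lam F q = LamG w q"
 using same_tensor_Lam[OF hframe.same_tensor_Basis[OF assms(1)] assms(2)] by (auto simp: LamG_def)

lemma alt_LamG:
 assumes "hpoint w" "alternating q" shows "alternating (LamG w q)"
 using hpoint_ex_frame[OF assms(1)] Lam_eq_LamG[OF _ assms(2)] alt_Lam[OF assms(2)] by metis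

locale metric_field =
 fixes U :: "(complex^'n::finite) set" and \<Omega> :: "complex^'n => 'n alt"
 assumes U_open: "open U" and \<Omega>_smooth: "sfield U \<Omega>" and \<Omega>_hp: "\<And>z. z \<in> U ==> hpoint (\<Omega> z)"
begin

lemma smooth_hmat: "smooth_on U (\<lambda>z. hmat (\<Omega> z) $ i $ j)"
 unfolding hmat_def using \<Omega>_smooth
 by (simp add: sfield_def) (intro smooth_on_diff smooth_on_mult smooth_on_const U_open; blast)

lemma smooth_Ginv: "smooth_on U (\<lambda>z. Ginv (\<Omega> z) v)"
proof (rule smooth_on_complex_vecI[OF U_open])
 fix k
 have c: "smooth_on U (\<lambda>z. cnj (hmat (\<Omega> z) $ i $ j))" for i j
  by (rule smooth_on_cnj[OF U_open smooth_hmat])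
 have "smooth_on U (\<lambda>z. det (\<chi> i j. if j = k then v $ i else cnj (hmat (\<Omega> z) $ i $ j)) / det (\<chi> i j. cnj (hmat (\<Omega> z) $ i $ j)))"
 proof (intro smooth_on_divide smooth_on_det U_open)
  show "smooth_on U (\<lambda>z. (\<chi> i j. if j = k then v $ i else cnj (hmat (\<Omega> z) $ i $ j)) $ i $ j)" for i j
   using c by (cases "j = k") simp_all
  show "smooth_on U (\<lambda>z. (\<chi> i j. cnj (hmat (\<Omega> z) $ i $ j)) $ i $ j)" for i j
   using c by simp
  show "det (\<chi> i j. cnj (hmat (\<Omega> z) $ i $ j)) \<noteq> 0" if "z \<in> U" for z
   by (rule hpoint.det_cnj_hmat[OF \<Omega>_hp[OF that]])
 qed
 then show "smooth_on U (\<lambda>z. Ginv (\<Omega> z) v $ k)" by (simp add: Ginv_def)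
qed

lemma smooth_rho: "smooth_on U (\<lambda>z. rho (\<Omega> z))"
 unfolding rho_def
 by (rule smooth_on_bounded_linear[OF bounded_linear_Re U_open smooth_on_det[OF U_open smooth_hmat]])

lemma \<Omega>_alt: "z \<in> U ==> alternating (\<Omega> z)"
 using \<Omega>_hp hpoint.w_alt by blast

lemma \<Omega>_d: "z \<in> U ==> dfield \<Omega> z"
 by (rule sfield_dfield[OF \<Omega>_smooth])

lemma pd_\<Omega>:
 assumes "z \<in> U"
 shows "two_form11 (pd \<Omega> z h)" "cnj (pd \<Omega> z h vs) = pd \<Omega> z h vs"
proof -
 have D: "((\<lambda>y. \<Omega> y vs) has_derivative (\<lambda>h. pd \<Omega> z h vs)) (at z)" for vs
  unfolding pd_def using \<Omega>_d[OF assms] fder_works by blast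
 have "pd \<Omega> z h vs = 0" if "length vs \<noteq> 2" for vs
 proof -
  have "((\<lambda>y. \<Omega> y vs) has_derivative (\<lambda>h. 0)) (at z)"
   by (rule has_derivative_transform_within_open[OF has_derivative_const[of 0] U_open assms])
    (use \<Omega>_hp hpoint.w_deg that in metis)
  then show ?thesis unfolding pd_def by (rule fder_eqI)
 qed
 moreover have "pd \<Omega> z h [cJ u, cJ v] = pd \<Omega> z h [u, v]" for u v
 proof -
  have "((\<lambda>y. \<Omega> y [cJ u, cJ v]) has_derivative (\<lambda>h. pd \<Omega> z h [u, v])) (at z)"
   by (rule has_derivative_transform_within_open[OF D U_open assms]) (use \<Omega>_hp hpoint.w_J in metis)
  then show ?thesis unfolding pd_def by (rule fder_eqI)
 qed
 ultimately show "two_form11 (pd \<Omega> z h)"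
  unfolding two_form11_def using alt_pd[OF U_open assms \<Omega>_alt \<Omega>_d[OF assms]] by blast
 have "((\<lambda>y. \<Omega> y vs) has_derivative (\<lambda>h. cnj (pd \<Omega> z h vs))) (at z)"
  by (rule has_derivative_transform_within_open[OF has_derivative_cnj[OF D] U_open assms]) (use \<Omega>_hp hpoint.w_real in metis)
 then show "cnj (pd \<Omega> z h vs) = pd \<Omega> z h vs"
  unfolding pd_def by (rule fder_eqI[symmetric])
qed

definition G' :: "complex^'n => complex^'n => complex^'n => complex^'n" where
 "G' z h v = fder (\<lambda>y. Ginv (\<Omega> y) v) z h"

lemma G'_has: "z \<in> U ==> ((\<lambda>y. Ginv (\<Omega> y) v) has_derivative (\<lambda>h. G' z h v)) (at z)"
 unfolding G'_def by (rule smooth_on_has_derivative[OF smooth_Ginv])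

text \<open>Differentiating the constant g(u, \<open>Ginv\<close> v) = u . v expresses the
  derivative of the inverse metric by minus the derivative of the metric; the frame then reads off
  the vector.\<close>

lemma G'_eq:
 assumes z: "z \<in> U" and F: "hframe (\<Omega> z) F"
 shows "G' z h v = - (\<Sum>f\<in>F. Re (pd \<Omega> z h [f, cJ (Ginv (\<Omega> z) v)]) *\<^sub>R f)"
proof -
 interpret hframe "\<Omega> z" F by fact
 have "g u (G' z h v) = - Re (pd \<Omega> z h [u, cJ (Ginv (\<Omega> z) v)])" for u
 proof -
  have L: "((\<lambda>y. cJ (Ginv (\<Omega> y) x)) has_derivative (\<lambda>h. cJ (G' z h x))) (at z)" for x
   by (rule bounded_linear.has_derivative[OF bounded_linear_smult_right G'_has[OF z]])
  have a: "alternating (\<lambda>ws. \<Omega> y (u # ws))" if "y \<in> U" for y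
   by (rule alt_contr[OF \<Omega>_alt[OF that]])
  have d: "dfield (\<lambda>y ws. \<Omega> y (u # ws)) z" using \<Omega>_d[OF z] by blast
  have p: "pd (\<lambda>y ws. \<Omega> y (u # ws)) z h [w] = pd \<Omega> z h [u, w]" for w
   by (simp add: pd_def)
  have "((\<lambda>y. \<Omega> y (u # map (\<lambda>x. cJ (Ginv (\<Omega> y) x)) [v])) has_derivative
    (\<lambda>h. pd (\<lambda>y ws. \<Omega> y (u # ws)) z h (map (\<lambda>x. cJ (Ginv (\<Omega> z) x)) [v])
     + dpull (\<lambda>x. cJ (Ginv (\<Omega> z) x)) (\<lambda>x. cJ (G' z h x)) (\<lambda>ws. \<Omega> z (u # ws)) [v])) (at z)"
   by (rule pull_has_derivative[OF U_open z a d L])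
  then have "((\<lambda>y. Re (\<Omega> y [u, cJ (Ginv (\<Omega> y) v)])) has_derivative
    (\<lambda>h. Re (pd \<Omega> z h [u, cJ (Ginv (\<Omega> z) v)] + \<Omega> z [u, cJ (G' z h v)]))) (at z)"
   using p by (intro has_derivative_Re) (simp add: pd_def)
  then have "((\<lambda>y. u \<bullet> v) has_derivative
    (\<lambda>h. Re (pd \<Omega> z h [u, cJ (Ginv (\<Omega> z) v)] + \<Omega> z [u, cJ (G' z h v)]))) (at z)"
   by (rule has_derivative_transform_within_open[OF _ U_open z])
    (use \<Omega>_hp hpoint.g_Ginv hpoint.g_def in metis)
  from fder_eqI[OF this, of h] fder_eqI[OF has_derivative_const[of "u \<bullet> v"], of z h]
  have "Re (pd \<Omega> z h [u, cJ (Ginv (\<Omega> z) v)] + \<Omega> z [u, cJ (G' z h v)]) = 0" by simp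
  then show ?thesis by (simp add: g_def)
 qed
 moreover have "(\<Sum>f\<in>F. g f (G' z h v) *\<^sub>R f) = G' z h v"
  using F_dual unfolding dual_basis_def by blast
 ultimately show ?thesis by (simp add: sum_negf)
qed

text \<open>Minus the inverse metric times the derivative of the metric, as an endomorphism. The
  derivative of \<open>Ginv\<close> is this map after \<open>Ginv\<close>; splitting it so allows
  passage from the Euclidean basis to a frame.\<close>

definition A' :: "(complex^'n) set => complex^'n => complex^'n => complex^'n => complex^'n" where
 "A' F z h y = - (\<Sum>f\<in>F. Re (pd \<Omega> z h [f, cJ y]) *\<^sub>R f)"

lemma linear_A':
 assumes "z \<in> U" shows "linear (A' F z h)"
proof -
 have l: "linear (\<lambda>y. Re (pd \<Omega> z h [f, cJ y]))" for f
 proof -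
  have "alternating (pd \<Omega> z h)" using pd_\<Omega>(1)[OF assms] unfolding two_form11_def by blast
  then have "linear (\<lambda>y. pd \<Omega> z h [f, cJ y])"
   using linear_compose[OF linear_cJ alt_linear2] by (fastforce simp: o_def)
  then show ?thesis using linear_compose[OF _ bounded_linear.linear[OF bounded_linear_Re]] by (fastforce simp: o_def)
 qed
 have "linear (\<lambda>y. - (\<Sum>f\<in>F. Re (pd \<Omega> z h [f, cJ y]) *\<^sub>R f))"
  by (intro linear_compose_neg linear_compose_sum ballI)
   (rule linear_compose[OF l linear_scaleR_left, unfolded o_def])
 then show ?thesis by (simp add: A'_def[abs_def])
qed

lemma A'_value:
 assumes z: "z \<in> U" and F: "finite F" and q: "alternating q"
 shows "q (A' F z h f # vs) = - cov F (\<lambda>v. pd \<Omega> z h [f, cJ v]) q vs"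
proof -
 note \<psi> = pd_\<Omega>[OF z, of h]
 have a: "alternating (pd \<Omega> z h)" using \<psi> by (simp add: two_form11_def)
 have J: "pd \<Omega> z h [cJ u, cJ v] = pd \<Omega> z h [u, v]" for u v
  using \<psi>(1) unfolding two_form11_def by blast
 have "pd \<Omega> z h [x, cJ f] = pd \<Omega> z h [f, cJ x]" for x
 proof -
  have "pd \<Omega> z h [x, cJ f] = pd \<Omega> z h [cJ x, - f]" using J[of x "cJ f"] by simp
  also have "\<dots> = - pd \<Omega> z h [cJ x, f]" using linear_neg[OF alt_linear2[OF a]] by blast
  also have "\<dots> = pd \<Omega> z h [f, cJ x]" using alt_swap[OF a, of "cJ x" f "[]"] by simp
  finally show ?thesis .
 qed
 moreover have "complex_of_real (Re (pd \<Omega> z h ws)) = pd \<Omega> z h ws" for ws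
  using \<psi>(2)[of ws] by (simp add: complex_eq_iff)
 ultimately show ?thesis
  unfolding A'_def cov_def by (simp add: alt_head[OF q] scaleR_complex)
qed

text \<open>Moving the inverse metric under a fixed basis costs minus the derivation induced by the
  derivative of the metric form, the same derivation as in \<open>ad_two\<close>.\<close>

lemma innG_has_derivative:
 assumes z: "z \<in> U" and F: "hframe (\<Omega> z) F"
  and u: "\<And>y. y \<in> U ==> alternating (u y)" "dfield u z" and v: "\<And>y. y \<in> U ==> alternating (v y)" "dfield v z"
 shows "((\<lambda>y. innG (\<Omega> y) (u y) (v y)) has_derivative (\<lambda>h. innG (\<Omega> z) (pd u z h) (v z) +
   innG (\<Omega> z) (u z) (\<lambda>vs. pd v z h vs - (\<Sum>f\<in>F. ext (\<lambda>x. of_real (hpoint.g (\<Omega> z) f x)) (cov F (\<lambda>x. pd \<Omega> z h [f, cJ x]) (v z)) vs)))) (at z)"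
proof -
 interpret hframe "\<Omega> z" F by fact
 let ?N = "\<lambda>h vs. \<Sum>f\<in>F. ext (\<lambda>x. of_real (g f x)) (cov F (\<lambda>x. pd \<Omega> z h [f, cJ x]) (v z)) vs"
 have D1: "((\<lambda>y. v y (map (Ginv (\<Omega> y)) vs)) has_derivative
   (\<lambda>h. pd v z h (map (Ginv (\<Omega> z)) vs) + dpull (Ginv (\<Omega> z)) (G' z h) (v z) vs)) (at z)" for vs
  by (rule pull_has_derivative[OF U_open z v(1) v(2) G'_has[OF z]])
 have dp: "dpull (Ginv (\<Omega> z)) (G' z h) (v z) vs = - ?N h (map (Ginv (\<Omega> z)) vs)" for h vs
 proof -
  have B: "G' z h x = A' F z h (Ginv (\<Omega> z) x)" for x
   unfolding G'_eq[OF z F] A'_def ..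
  have e: "(\<lambda>ws. v z (A' F z h f # ws)) = (\<lambda>ws. - cov F (\<lambda>x. pd \<Omega> z h [f, cJ x]) (v z) ws)" for f
   using A'_value[OF z F_fin v(1)[OF z]] by blast
  show ?thesis
   unfolding dpull_comp[OF F_dual v(1)[OF z] linear_A'[OF z] B] e ext_minus by (simp add: sum_negf)
 qed
 have D2: "((\<lambda>y. u y ws) has_derivative (\<lambda>h. pd u z h ws)) (at z)" for ws
  unfolding pd_def using u(2) fder_works by blast
 have "((\<lambda>y. innG (\<Omega> y) (u y) (v y)) has_derivative
   (\<lambda>h. \<Sum>I\<in>Pow {..<length (blist::(complex^'n) list)}. u z (nths blist I) * cnj (pd v z h (map (Ginv (\<Omega> z)) (nths blist I)) + dpull (Ginv (\<Omega> z)) (G' z h) (v z) (nths blist I))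
    + pd u z h (nths blist I) * cnj (v z (map (Ginv (\<Omega> z)) (nths blist I))))) (at z)"
  unfolding innG_def inn_def by (intro has_derivative_sum has_derivative_mult has_derivative_cnj D1 D2)
 then show ?thesis
  unfolding dp innG_def inn_def by (simp add: sum.distrib sum_subtractf algebra_simps)
qed

lemma LamG_has_derivative:
 assumes z: "z \<in> U" and F: "hframe (\<Omega> z) F"
  and v: "\<And>y. y \<in> U ==> alternating (v y)" "dfield v z"
 shows "((\<lambda>y. LamG (\<Omega> y) (v y) vs) has_derivative (\<lambda>h. LamG (\<Omega> z) (pd v z h) vs + 1/2 * hframe.cov2 F (pd \<Omega> z h) (v z) vs)) (at z)"
proof -
 interpret hframe "\<Omega> z" F by fact
 have L: "((\<lambda>y. cJ (Ginv (\<Omega> y) x)) has_derivative (\<lambda>h. cJ (G' z h x))) (at z)" for x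
  by (rule bounded_linear.has_derivative[OF bounded_linear_smult_right G'_has[OF z]])
 have D: "((\<lambda>y. v y (b # cJ (Ginv (\<Omega> y) b) # vs)) has_derivative
   (\<lambda>h. pd v z h (b # cJ (Ginv (\<Omega> z) b) # vs) + v z (b # cJ (G' z h b) # vs))) (at z)" for b
 proof -
  \<comment> \<open>\<open>pull_has_derivative\<close> moves every argument, whereas
    \<open>b\<close> and \<open>vs\<close> must stay fixed here. The one moving slot is isolated as
    an artificial form of degree one.\<close>
  define W where "W = (\<lambda>y ws. if length ws = 1 then v y (b # ws @ vs) else 0)"
  have a: "alternating (W y)" if "y \<in> U" for y
   unfolding alternating_def
  proof (intro conjI allI impI)
   fix ws :: "(complex^'n) list" and i assume i: "i < length ws"
   show "linear (\<lambda>x. W y (ws[i := x]))"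
   proof (cases "length ws = 1")
    case True
    then obtain x where "ws = [x]" by (cases ws) auto
    then show ?thesis using i alt_linear2[OF v(1)[OF that], of b vs] by (simp add: W_def)
   qed (simp add: W_def linear_zero)
  next
   fix ws :: "(complex^'n) list" assume "\<not> distinct ws"
   then have "length ws \<noteq> 1" by (cases ws) auto
   then show "W y ws = 0" by (simp add: W_def)
  qed
  have d: "dfield W z"
  proof
   fix ws
   show "(\<lambda>y. W y ws) differentiable (at z)"
    using v(2) by (cases "length ws = 1") (simp_all add: W_def)
  qed
  have p: "pd W z h [x] = pd v z h (b # x # vs)" for h x
   by (simp add: pd_def W_def)
  have "((\<lambda>y. W y (map (\<lambda>x. cJ (Ginv (\<Omega> y) x)) [b])) has_derivative
    (\<lambda>h. pd W z h (map (\<lambda>x. cJ (Ginv (\<Omega> z) x)) [b])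
     + dpull (\<lambda>x. cJ (Ginv (\<Omega> z) x)) (\<lambda>x. cJ (G' z h x)) (W z) [b])) (at z)"
   by (rule pull_has_derivative[OF U_open z a d L])
  then show ?thesis by (simp add: p) (simp add: W_def)
 qed
 have "((\<lambda>y. LamG (\<Omega> y) (v y) vs) has_derivative
   (\<lambda>h. (\<Sum>b\<in>Basis. pd v z h (b # cJ (Ginv (\<Omega> z) b) # vs) + v z (b # cJ (G' z h b) # vs)) / 2)) (at z)"
  unfolding LamG_def by (intro bounded_linear.has_derivative[OF bounded_linear_divide] has_derivative_sum D)
 moreover have "(\<Sum>b\<in>Basis. v z (b # cJ (G' z h b) # vs)) = cov2 (pd \<Omega> z h) (v z) vs" for h
 proof -
  note \<psi> = pd_\<Omega>[OF z, of h]
  note av = v(1)[OF z]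
  have "linear (\<lambda>y. v z (x # cJ (A' F z h y) # vs))" for x
   using linear_compose[OF linear_A'[OF z] linear_compose[OF linear_cJ alt_linear2[OF av]]] by (simp add: o_def)
  moreover have "linear (\<lambda>x. v z (x # cJ (A' F z h y) # vs))" for y
   by (rule alt_linear[OF av])
  ultimately have "(\<Sum>f\<in>F. v z (f # cJ (A' F z h f) # vs)) = (\<Sum>b\<in>Basis. v z (b # cJ (A' F z h (Ginv (\<Omega> z) b)) # vs))"
   using same_tensor_Basis[unfolded same_tensor_def, rule_format, of "\<lambda>x y. v z (x # cJ (A' F z h y) # vs)"] by blast
  moreover have "A' F z h (Ginv (\<Omega> z) b) = G' z h b" for b
   unfolding G'_eq[OF z F] A'_def ..
  moreover have "(\<Sum>f\<in>F. v z (f # cJ (A' F z h f) # vs)) = cov2 (pd \<Omega> z h) (v z) vs"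
  proof -
   have 1: "v z (f # cJ (A' F z h f) # vs) = - (\<Sum>x\<in>F. pd \<Omega> z h [x, cJ f] * v z (f # cJ x # vs))" for f
   proof -
    have l: "linear (\<lambda>y. v z (f # cJ y # vs))"
     using linear_compose[OF linear_cJ alt_linear2[OF av]] by (simp add: o_def)
    have "complex_of_real (Re (pd \<Omega> z h ws)) = pd \<Omega> z h ws" for ws
     using \<psi>(2)[of ws] by (simp add: complex_eq_iff)
    then show ?thesis
     unfolding A'_def by (simp only: linear_neg[OF l] linear_sum[OF l] linear_cmul[OF l] scaleR_complex)
   qed
   have 2: "(\<Sum>x\<in>F. cov F (\<lambda>y. \<psi> [x, cJ y]) q (cJ x # vs)) = - cov2 \<psi> q vs" if "two_form11 \<psi>" "alternating q" for \<psi> q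
   proof -
    note l = two_form11_linear[OF that(1)]
    have a1: "linear (\<lambda>y. cov F (\<lambda>y. \<psi> [x, cJ y]) q (y # vs))" for x
     by (rule alt_linear[OF alt_cov[OF that(2)]])
    have a2: "linear (\<lambda>x. cov F (\<lambda>y. \<psi> [x, cJ y]) q us)" for us
     unfolding cov_def by (intro linear_compose_sum ballI linear_mult_right l)
    have "cov2 \<psi> q vs = (\<Sum>x\<in>F. cov F (\<lambda>y. \<psi> [cJ x, cJ y]) q (x # vs))"
     using that unfolding cov2_def two_form11_def by simp
    also have "\<dots> = - (\<Sum>x\<in>F. cov F (\<lambda>y. \<psi> [x, cJ y]) q (cJ x # vs))"
     by (rule sum_skew[where X="\<lambda>x v. cov F (\<lambda>y. \<psi> [x, cJ y]) q (v # vs)", OF a1 a2])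
    finally show ?thesis by simp
   qed
   have "(\<Sum>f\<in>F. v z (f # cJ (A' F z h f) # vs)) = - (\<Sum>x\<in>F. \<Sum>f\<in>F. pd \<Omega> z h [x, cJ f] * v z (f # cJ x # vs))"
    unfolding 1 sum_negf by (subst sum.swap) simp
   also have "\<dots> = cov2 (pd \<Omega> z h) (v z) vs"
    using 2[OF \<psi>(1) av] by (simp add: cov_def)
   finally show ?thesis .
  qed
  ultimately show ?thesis by simp
 qed
 ultimately show ?thesis by (simp add: sum.distrib LamG_def add_divide_distrib)
qed

end

subsection \<open>The volume density\<close>

lemma det_has_derivative:
 fixes M :: "'a::real_normed_vector => complex^'n::finite^'n"
 assumes "\<And>i j. ((\<lambda>y. M y $ i $ j) has_derivative (\<lambda>h. M' h $ i $ j)) (at z)"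
 shows "((\<lambda>y. det (M y)) has_derivative (\<lambda>h. \<Sum>i\<in>UNIV. det (\<chi> k. if k = i then M' h $ i else M z $ k))) (at z)"
proof -
 have d: "((\<lambda>y. det (M y)) has_derivative (\<lambda>h. \<Sum>p | p permutes UNIV. of_int (sign p) *
   (\<Sum>i\<in>UNIV. M' h $ i $ p i * (\<Prod>j\<in>UNIV - {i}. M z $ j $ p j)))) (at z)"
  unfolding det_def
  by (intro has_derivative_sum bounded_linear.has_derivative[OF bounded_linear_mult_right] has_derivative_prod assms)
 have e: "det (\<chi> k. if k = i then M' h $ i else M z $ k) =
   (\<Sum>p | p permutes UNIV. of_int (sign p) * (M' h $ i $ p i * (\<Prod>j\<in>UNIV - {i}. M z $ j $ p j)))" for i h
  unfolding det_def
 proof (intro sum.cong refl arg_cong2[where f="(*)"])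
  fix p
  have "(\<Prod>k\<in>UNIV. (\<chi> k. if k = i then M' h $ i else M z $ k) $ k $ p k) =
   (\<chi> k. if k = i then M' h $ i else M z $ k) $ i $ p i * (\<Prod>k\<in>UNIV - {i}. (\<chi> k. if k = i then M' h $ i else M z $ k) $ k $ p k)"
   by (rule prod.remove) auto
  also have "(\<Prod>k\<in>UNIV - {i}. (\<chi> k. if k = i then M' h $ i else M z $ k) $ k $ p k) = (\<Prod>j\<in>UNIV - {i}. M z $ j $ p j)"
   by (rule prod.cong) auto
  finally show "(\<Prod>k\<in>UNIV. (\<chi> k. if k = i then M' h $ i else M z $ k) $ k $ p k) = M' h $ i $ p i * (\<Prod>j\<in>UNIV - {i}. M z $ j $ p j)"
   by simp
 qed
 have "(\<Sum>p | p permutes UNIV. of_int (sign p) * (\<Sum>i\<in>UNIV. M' h $ i $ p i * (\<Prod>j\<in>UNIV - {i}. M z $ j $ p j))) =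
  (\<Sum>i\<in>UNIV. det (\<chi> k. if k = i then M' h $ i else M z $ k))" for h
  unfolding e sum_distrib_left by (rule sum.swap)
 then show ?thesis using d by simp
qed

lemma sum_Basis_complex_vec:
 "(\<Sum>b\<in>(Basis::(complex^'n::finite) set). X b) = (\<Sum>j\<in>UNIV. X (axis j 1) + X (axis j \<i>))"
proof -
 have B: "(Basis::(complex^'n) set) = (\<lambda>j. axis j 1) ` UNIV \<union> (\<lambda>j. axis j \<i>) ` UNIV"
  by (auto simp: Basis_vec_def Basis_complex_def)
 have "inj (\<lambda>j::'n. axis j (1::complex))" "inj (\<lambda>j::'n. axis j \<i>)"
  by (auto simp: inj_on_def axis_eq_axis)
 moreover have "(\<lambda>j::'n. axis j (1::complex)) ` UNIV \<inter> (\<lambda>j. axis j \<i>) ` UNIV = {}"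
  by (auto simp: axis_eq_axis)
 ultimately show ?thesis
  unfolding B by (subst sum.union_disjoint) (auto simp: sum.reindex sum.distrib)
qed

lemma det_hermitian_real:
 fixes A :: "complex^'n::finite^'n"
 assumes "\<And>j k. cnj (A $ j $ k) = A $ k $ j"
 shows "Im (det A) = 0"
proof -
 have "cnj (det A) = det (\<chi> j k. cnj (A $ j $ k))"
  unfolding det_def by simp
 also have "(\<chi> j k. cnj (A $ j $ k)) = transpose A"
  by (simp add: vec_eq_iff transpose_def assms)
 finally have "cnj (det A) = det A" by (simp add: det_transpose)
 then show ?thesis by (simp add: complex_eq_iff)
qed

text \<open>On the segment from the identity to \<open>A\<close> all matrices are Hermitian and
  positive definite, so their determinants are real and nonzero; starting at 1 they stay
  positive.\<close>

lemma det_pos_def: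
 fixes A :: "complex^'n::finite^'n"
 assumes herm: "\<And>j k. cnj (A $ j $ k) = A $ k $ j"
  and pos: "\<And>z. z \<noteq> 0 ==> 0 < Re (\<Sum>j\<in>UNIV. \<Sum>k\<in>UNIV. z $ j * cnj (z $ k) * A $ j $ k)"
 shows "0 < Re (det A)"
proof -
 define B :: "real => complex^'n^'n" where "B = (\<lambda>t. \<chi> j k. of_real (1 - t) * (if j = k then 1 else 0) + of_real t * A $ j $ k)"
 have Bh: "cnj (B t $ j $ k) = B t $ k $ j" for t j k
  by (simp add: B_def herm)
 have Bpos: "0 < Re (\<Sum>j\<in>UNIV. \<Sum>k\<in>UNIV. z $ j * cnj (z $ k) * B t $ j $ k)" if "z \<noteq> 0" "t \<in> {0..1}" for z t
 proof -
  have "(\<Sum>j\<in>UNIV. \<Sum>k\<in>UNIV. z $ j * cnj (z $ k) * B t $ j $ k) =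
   of_real (1 - t) * (\<Sum>j\<in>UNIV. z $ j * cnj (z $ j)) + of_real t * (\<Sum>j\<in>UNIV. \<Sum>k\<in>UNIV. z $ j * cnj (z $ k) * A $ j $ k)"
  proof -
   have "(\<Sum>j\<in>UNIV. \<Sum>k\<in>UNIV. z $ j * cnj (z $ k) * B t $ j $ k) =
    (\<Sum>j\<in>UNIV. \<Sum>k\<in>UNIV. (if j = k then of_real (1 - t) * (z $ j * cnj (z $ k)) else 0) + of_real t * (z $ j * cnj (z $ k) * A $ j $ k))"
    by (intro sum.cong refl) (simp add: B_def algebra_simps)
   then show ?thesis by (simp add: sum.distrib sum_distrib_left)
  qed
  moreover have "Re (\<Sum>j\<in>UNIV. z $ j * cnj (z $ j)) = z \<bullet> z"
   by (simp add: inner_eq_sum)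
  ultimately have "Re (\<Sum>j\<in>UNIV. \<Sum>k\<in>UNIV. z $ j * cnj (z $ k) * B t $ j $ k) =
   (1 - t) * (z \<bullet> z) + t * Re (\<Sum>j\<in>UNIV. \<Sum>k\<in>UNIV. z $ j * cnj (z $ k) * A $ j $ k)"
   by (simp only: plus_complex.simps Re_complex_of_real Im_complex_of_real times_complex.simps mult_zero_left diff_zero)
  moreover have "0 < z \<bullet> z" using that(1) by simp
  ultimately show ?thesis
   using pos[OF that(1)] that(2)
   by (cases "t = 0") (auto intro!: add_nonneg_pos mult_nonneg_nonneg mult_pos_pos)
 qed
 have nz: "det (B t) \<noteq> 0" if t: "t \<in> {0..1}" for t
 proof -
  let ?C = "\<chi> i j. cnj (B t $ i $ j)"
  have "z = 0" if z: "?C *v z = 0" for z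
  proof (rule ccontr)
   assume "z \<noteq> 0"
   have "(\<Sum>k\<in>UNIV. cnj (z $ k) * B t $ j $ k) = 0" for j
   proof -
    have "cnj ((?C *v z) $ j) = 0" using z by simp
    then show ?thesis by (simp add: matrix_vector_mult_def mult.commute)
   qed
   moreover have "(\<Sum>j\<in>UNIV. \<Sum>k\<in>UNIV. z $ j * cnj (z $ k) * B t $ j $ k) =
     (\<Sum>j\<in>UNIV. z $ j * (\<Sum>k\<in>UNIV. cnj (z $ k) * B t $ j $ k))"
    by (simp add: sum_distrib_left mult_ac)
   ultimately show False using Bpos[OF \<open>z \<noteq> 0\<close> t] by simp
  qed
  then have "\<exists>D. D ** ?C = mat 1" unfolding matrix_left_invertible_ker by blast
  then have "invertible ?C" unfolding invertible_left_inverse .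
  then have "det ?C \<noteq> 0" by (simp add: invertible_det_nz)
  moreover have "?C = transpose (B t)" by (simp add: vec_eq_iff transpose_def Bh)
  ultimately show ?thesis by (simp add: det_transpose)
 qed
 have nz': "Re (det (B t)) \<noteq> 0" if "t \<in> {0..1}" for t
  using nz[OF that] det_hermitian_real[of "B t", OF Bh] by (auto simp: complex_eq_iff)
 have cont: "continuous_on {0..1} (\<lambda>t. Re (det (B t)))"
  unfolding det_def B_def by (simp only: vec_lambda_beta) (intro continuous_intros)
 have "B 0 = mat 1" by (simp add: B_def mat_def vec_eq_iff)
 then have 0: "Re (det (B 0)) = 1" by simp
 have 1: "B 1 = A" by (simp add: B_def vec_eq_iff)
 show ?thesis
 proof (rule ccontr)
  assume "\<not> 0 < Re (det A)"
  then have "\<exists>t\<ge>0. t \<le> 1 \<and> Re (det (B t)) = 0"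
   using IVT2'[of "\<lambda>t. Re (det (B t))" 1 0 0] cont 0 1 by auto
  then show False using nz' by auto
 qed
qed

context hpoint
begin

lemma hmat_herm: "cnj (hmat w $ j $ k) = hmat w $ k $ j"
proof -
 have 1: "w [axis j 1, axis k \<i>] = w [axis k 1, axis j \<i>]"
  using g_sym[of "axis j 1" "axis k 1"] by (simp add: w_eq[symmetric] cJ_axis flip: of_real_eq_iff[where 'a=complex])
 have 2: "w [axis k 1, axis j 1] = - w [axis j 1, axis k 1]" by (rule w_swap)
 show ?thesis unfolding hmat_def by (simp add: w_real 1 2)
qed

lemma rho_pos: "0 < rho w"
 unfolding rho_def
proof (rule det_pos_def[OF hmat_herm])
 fix z :: "complex^'n" assume "z \<noteq> 0"
 then show "0 < Re (\<Sum>j\<in>UNIV. \<Sum>k\<in>UNIV. z $ j * cnj (z $ k) * hmat w $ j $ k)"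
  using g_pos[of z] Re_sesq[of z z] by (simp add: sesq_expand[OF two_form11_w])
qed

lemma Im_det_hmat: "Im (det (hmat w)) = 0"
 by (rule det_hermitian_real[OF hmat_herm])

text \<open>Logarithmic derivative of the determinant: the rows of \<open>hmat \<psi>\<close> are expanded in those of
 \<open>hmat w\<close>, and only the diagonal coefficients survive.\<close>

lemma det_hmat_row:
 fixes \<psi> :: "'n alt"
 assumes \<psi>: "two_form11 \<psi>"
 shows "det (\<chi> k. if k = i then hmat \<psi> $ i else hmat w $ k) = sesq \<psi> (axis i 1) (Ginv w (axis i 1)) * det (hmat w)"
proof -
 define N where "N = (\<chi> j k. Ginv w (axis k 1) $ j)"
 define C where "C = (\<chi> k. sesq \<psi> (axis i 1) (Ginv w (axis k 1)))"
 have "(\<chi> i j. cnj (hmat w $ i $ j)) ** N = mat 1"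
  using Ginv_solves by (simp add: matrix_matrix_mult_def N_def mat_def vec_eq_iff axis_def)
 then have "N ** (\<chi> i j. cnj (hmat w $ i $ j)) = mat 1"
  by (simp add: matrix_left_right_inverse)
 then have NM: "(\<Sum>k\<in>UNIV. Ginv w (axis k 1) $ j * cnj (hmat w $ k $ l)) = (if j = l then 1 else 0)" for j l
  by (simp add: matrix_matrix_mult_def N_def mat_def vec_eq_iff)
 have C: "C $ k = (\<Sum>j\<in>UNIV. hmat \<psi> $ i $ j * cnj (Ginv w (axis k 1) $ j))" for k
 proof -
  have "C $ k = (\<Sum>a\<in>UNIV. if a = i then (\<Sum>j\<in>UNIV. cnj (Ginv w (axis k 1) $ j) * hmat \<psi> $ a $ j) else 0)"
   unfolding C_def vec_lambda_beta sesq_expand[OF \<psi>] by (intro sum.cong refl) (simp add: axis_def)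
  then show ?thesis by (simp add: mult.commute)
 qed
 have "hmat \<psi> $ i $ l = (\<Sum>k\<in>UNIV. C $ k * hmat w $ k $ l)" for l
 proof -
  have "(\<Sum>k\<in>UNIV. C $ k * hmat w $ k $ l) = (\<Sum>j\<in>UNIV. \<Sum>k\<in>UNIV. hmat \<psi> $ i $ j * (cnj (Ginv w (axis k 1) $ j) * hmat w $ k $ l))"
   unfolding C sum_distrib_right by (subst sum.swap) (simp add: mult_ac)
  also have "\<dots> = (\<Sum>j\<in>UNIV. hmat \<psi> $ i $ j * (if j = l then 1 else 0))"
  proof (intro sum.cong refl)
   fix j
   have "cnj (\<Sum>k\<in>UNIV. Ginv w (axis k 1) $ j * cnj (hmat w $ k $ l)) = (if j = l then 1 else 0)"
    unfolding NM by simp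
   then have "(\<Sum>k\<in>UNIV. cnj (Ginv w (axis k 1) $ j) * hmat w $ k $ l) = (if j = l then 1 else 0)"
    by simp
   then show "(\<Sum>k\<in>UNIV. hmat \<psi> $ i $ j * (cnj (Ginv w (axis k 1) $ j) * hmat w $ k $ l)) = hmat \<psi> $ i $ j * (if j = l then 1 else 0)"
    by (simp only: sum_distrib_left[symmetric])
  qed
  also have "\<dots> = (\<Sum>j\<in>UNIV. if j = l then hmat \<psi> $ i $ j else 0)" by (intro sum.cong) auto
  also have "\<dots> = hmat \<psi> $ i $ l" by simp
  finally show ?thesis by simp
 qed
 then have row: "hmat \<psi> $ i = (\<Sum>k\<in>UNIV. C $ k *s row k (hmat w))"
  by (simp add: vec_eq_iff row_def)
 have "(\<chi> k. if k = i then hmat \<psi> $ i else hmat w $ k) =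
   (\<chi> k. if k = i then (\<Sum>k\<in>UNIV. C $ k *s row k (hmat w)) else row k (hmat w))"
  unfolding row by (simp add: vec_eq_iff row_def)
 then show ?thesis
  using cramer_lemma_transpose[of i C "hmat w"] by (simp add: C_def)
qed

end

context metric_field
begin

text \<open>The logarithmic derivative is half the real trace of the derivative of the metric form.
  It is the scalar of \<open>ad_two\<close>, to be joined with the derivation from
  \<open>innG_has_derivative\<close>.\<close>

lemma rho_has_derivative:
 assumes z: "z \<in> U" and F: "hframe (\<Omega> z) F"
 shows "((\<lambda>y. rho (\<Omega> y)) has_derivative (\<lambda>h. rho (\<Omega> z) * Re ((\<Sum>f\<in>F. pd \<Omega> z h [f, cJ f]) / 2))) (at z)"
proof -
 interpret hframe "\<Omega> z" F by fact
 have D: "((\<lambda>y. \<Omega> y vs) has_derivative (\<lambda>h. pd \<Omega> z h vs)) (at z)" for vs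
  unfolding pd_def using \<Omega>_d[OF z] fder_works by blast
 have "((\<lambda>y. hmat (\<Omega> y) $ i $ j) has_derivative (\<lambda>h. hmat (pd \<Omega> z h) $ i $ j)) (at z)" for i j
  unfolding hmat_def vec_lambda_beta
  by (intro has_derivative_diff bounded_linear.has_derivative[OF bounded_linear_mult_right] D)
 from has_derivative_Re[OF det_has_derivative[of "\<lambda>y. hmat (\<Omega> y)" "\<lambda>h. hmat (pd \<Omega> z h)", OF this]]
 have 1: "((\<lambda>y. rho (\<Omega> y)) has_derivative
   (\<lambda>h. Re (\<Sum>i\<in>UNIV. sesq (pd \<Omega> z h) (axis i 1) (Ginv (\<Omega> z) (axis i 1)) * det (hmat (\<Omega> z))))) (at z)"
  unfolding rho_def det_hmat_row[OF pd_\<Omega>(1)[OF z]] .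
 have key: "Re (\<Sum>i\<in>UNIV. sesq \<psi> (axis i 1) (Ginv (\<Omega> z) (axis i 1)) * det (hmat (\<Omega> z))) =
   rho (\<Omega> z) * Re ((\<Sum>f\<in>F. \<psi> [f, cJ f]) / 2)"
  if \<psi>: "two_form11 \<psi>" "\<And>vs. cnj (\<psi> vs) = \<psi> vs" for \<psi>
 proof -
  note a = two_form11_alt[OF \<psi>(1)]
  have l: "linear (\<lambda>v. \<psi> [u, cJ v])" "linear (\<lambda>u. \<psi> [u, cJ v])" for u v
   using linear_compose[OF linear_cJ two_form11_linear(1)[OF \<psi>(1)]] two_form11_linear(2)[OF \<psi>(1)] by (simp_all add: o_def)
  have "(\<Sum>f\<in>F. \<psi> [f, cJ f]) = (\<Sum>b\<in>Basis. \<psi> [b, cJ (Ginv (\<Omega> z) b)])"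
   using same_tensor_Basis[unfolded same_tensor_def, rule_format, of "\<lambda>u v. \<psi> [u, cJ v]", OF l] .
  also have "\<dots> = (\<Sum>j\<in>UNIV. \<psi> [axis j 1, cJ (Ginv (\<Omega> z) (axis j 1))] + \<psi> [axis j \<i>, cJ (Ginv (\<Omega> z) (axis j \<i>))])"
   by (rule sum_Basis_complex_vec)
  also have "\<dots> = (\<Sum>j\<in>UNIV. 2 * \<psi> [axis j 1, cJ (Ginv (\<Omega> z) (axis j 1))])"
  \<comment> \<open>The vectors \<open>axis j 1\<close> and \<open>axis j \<i>\<close> differ by J,
    so J-invariance of \<psi> makes both summands equal and absorbs the 1/2.\<close>
  proof (intro sum.cong refl)
   fix j :: 'n
   have "axis j \<i> = cJ (axis j 1)" by (simp add: cJ_axis)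
   then have "\<psi> [axis j \<i>, cJ (Ginv (\<Omega> z) (axis j \<i>))] = \<psi> [cJ (axis j 1), cJ (cJ (Ginv (\<Omega> z) (axis j 1)))]"
    by (simp only: Ginv_cJ)
   also have "\<dots> = \<psi> [axis j 1, cJ (Ginv (\<Omega> z) (axis j 1))]"
    using \<psi>(1) unfolding two_form11_def by blast
   finally show "\<psi> [axis j 1, cJ (Ginv (\<Omega> z) (axis j 1))] + \<psi> [axis j \<i>, cJ (Ginv (\<Omega> z) (axis j \<i>))] =
    2 * \<psi> [axis j 1, cJ (Ginv (\<Omega> z) (axis j 1))]" by simp
  qed
  finally have t: "(\<Sum>f\<in>F. \<psi> [f, cJ f]) / 2 = (\<Sum>j\<in>UNIV. \<psi> [axis j 1, cJ (Ginv (\<Omega> z) (axis j 1))])"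
   by (simp add: sum_distrib_left[symmetric])
  have "Im (\<psi> ws) = 0" for ws using \<psi>(2)[of ws] by (simp add: complex_eq_iff)
  then have "Re (sesq \<psi> u v) = Re (\<psi> [u, cJ v])" for u v
   by (simp add: sesq_def)
  then show ?thesis
   unfolding t using Im_det_hmat
   by (simp add: rho_def sum_distrib_right[symmetric] sum_distrib_left mult.commute)
 qed
 show ?thesis using 1 unfolding key[OF pd_\<Omega>[OF z]] .
qed

subsection \<open>The divergence identity\<close>

lemma ext_field_has_derivative:
 fixes W :: "complex^'n => 'n alt"
 assumes "dfield W z"
 shows "((\<lambda>y. ext a (W y) vs) has_derivative (\<lambda>h. ext a (pd W z h) vs)) (at z)"
 using assms
proof (induction vs arbitrary: W)
 case (Cons v vs)
 have "pd (\<lambda>y ws. W y (v # ws)) z h = (\<lambda>ws. pd W z h (v # ws))" for h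
  by (simp add: pd_def)
 then have "((\<lambda>y. ext a (\<lambda>ws. W y (v # ws)) vs) has_derivative (\<lambda>h. ext a (\<lambda>ws. pd W z h (v # ws)) vs)) (at z)"
  using Cons.IH[of "\<lambda>y ws. W y (v # ws)"] Cons.prems by simp
 moreover have "((\<lambda>y. W y vs) has_derivative (\<lambda>h. pd W z h vs)) (at z)"
  unfolding pd_def using Cons.prems fder_works by blast
 ultimately show ?case
  unfolding ext.simps by (intro has_derivative_diff bounded_linear.has_derivative[OF bounded_linear_mult_right])
qed simp

lemma linear_tw:
 fixes a :: "complex^'n => complex"
 assumes "linear a" shows "linear (tw1 s a)" "linear (tw2 s a)"
proof -
 note l = linear_add[OF assms] linear_cmul[OF assms, unfolded scaleR_complex]
 have J: "cJ (x + y) = cJ x + cJ y" "cJ (r *\<^sub>R x) = r *\<^sub>R cJ x" for x y :: "complex^'n" and r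
  by (simp_all add: vec_eq_iff)
 show "linear (tw1 s a)"
  unfolding tw1_def[abs_def] by (rule linearI; simp only: J l scaleR_complex; simp add: field_simps)
 show "linear (tw2 s a)"
  unfolding tw2_def[abs_def] by (rule linearI; simp only: J l scaleR_complex; simp add: field_simps)
qed

text \<open>Checked on types: J multiplies the (1,0)-part of a covector by i and the (0,1)-part by
  -i, and conjugation exchanges the two parts of a real covector. The minus sign in front of \<eta>
  in B is what makes both parts fit one factor -i.\<close>

lemma tw1_J: "tw1 (of_real s) (xb b) (cJ v) = - \<i> * cnj (tw2 (of_real s) (xb b) v)"
 unfolding tw1_def tw2_def by (simp add: algebra_simps)

lemma alc_J: "alc \<eta> z (cJ v) = - \<i> * cnj (bec \<eta> z v)"
 unfolding alc_def bec_def cnj_sum sum_distrib_left by (intro sum.cong refl) (simp add: tw1_J)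

lemma linear_alc:
 fixes \<eta> :: "complex^'n => real" shows "linear (alc \<eta> z)"
 unfolding alc_def[abs_def] by (intro linear_compose_sum ballI linear_mult_left linear_tw linear_xb)

lemma linear_bec:
 fixes \<eta> :: "complex^'n => real" shows "linear (bec \<eta> z)"
 unfolding bec_def[abs_def] by (intro linear_compose_sum ballI linear_mult_left linear_tw linear_xb)

text \<open>The divergence identity below shows that this is the formal adjoint of \<open>Dbl \<eta>\<close>.\<close>

definition MM :: "(complex^'n => real) => (complex^'n) set => (complex^'n => 'n alt) => complex^'n => 'n alt" where
 "MM \<eta> F v z = (\<lambda>vs. \<i> * (Lam F (Dl \<eta> v z) vs - Dl \<eta> (\<lambda>y. LamG (\<Omega> y) (v y)) z vs)
   + \<i> / 2 * adL F (adL F (alt_wedge (Dl \<eta> \<Omega> z))) (v z) vs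
   - of_nat CARD('n) * cov F (\<lambda>x. cnj (bec \<eta> z x)) (v z) vs)"

lemma Np_\<Omega>: "z \<in> U ==> Np (\<Omega> z) = \<Omega> z"
proof
 fix vs :: "(complex^'n) list" assume z: "z \<in> U"
 interpret hpoint "\<Omega> z" by (rule \<Omega>_hp[OF z])
 consider "vs = []" | v where "vs = [v]" | v w where "vs = [v, w]" | v w x xs where "vs = v # w # x # xs"
  by (metis neq_Nil_conv)
 then show "Np (\<Omega> z) vs = \<Omega> z vs"
 proof cases
  case 1
  then show ?thesis using w_deg[of "[]"] by simp
 next
  case 2
  then show ?thesis using w_deg[of "[_]"] by simp
 next
  case (3 v w)
  then show ?thesis by (simp add: w_J_left field_simps)
 next
  case (4 v w x xs)
  have "Np q ws = 0" if "\<And>vs. length vs = length ws ==> q vs = 0" for q :: "'n alt" and ws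
   using that
  proof (induction ws arbitrary: q)
   case (Cons y ys)
   show ?case using Cons.IH[of "\<lambda>ws. q (y # ws)"] Cons.prems by simp
  qed simp
  then have "Np (\<Omega> z) vs = 0" using w_deg 4 by auto
  then show ?thesis using w_deg[of vs] 4 by simp
 qed
qed

lemma Nq_\<Omega>:
 assumes "z \<in> U" shows "Nq (\<Omega> z) = \<Omega> z"
proof -
 interpret hpoint "\<Omega> z" by (rule \<Omega>_hp[OF assms])
 have "(\<lambda>vs. cnj (\<Omega> z vs)) = \<Omega> z" using w_real by blast
 then show ?thesis unfolding Nq_def using Np_\<Omega>[OF assms] w_real by simp
qed

lemma wedge_Dl_\<Omega>:
 assumes z: "z \<in> U" and \<eta>: "\<eta> differentiable (at z)" "\<eta> z \<noteq> 0"
 shows "alt_wedge (Dl \<eta> \<Omega> z) q = (\<lambda>vs. (\<Sum>b\<in>Basis. ext (tw1 (of_real (\<eta> z)) (xb b)) (alt_wedge (pd \<Omega> z b) q) vs) -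
   ext (alc \<eta> z) (alt_wedge (\<Omega> z) q) vs)"
  and "alt_wedge (Dbl \<eta> \<Omega> z) q = (\<lambda>vs. (\<Sum>b\<in>Basis. ext (tw2 (of_real (\<eta> z)) (xb b)) (alt_wedge (pd \<Omega> z b) q) vs) -
   ext (bec \<eta> z) (alt_wedge (\<Omega> z) q) vs)"
proof -
 have "Dl \<eta> \<Omega> z = (\<lambda>vs. (\<Sum>b\<in>Basis. ext (tw1 (of_real (\<eta> z)) (xb b)) (pd \<Omega> z b) vs) - ext (alc \<eta> z) (\<Omega> z) vs)"
  by (rule HOL.ext) (subst Dl_formula[OF U_open z \<Omega>_alt \<Omega>_d[OF z] \<eta>], simp_all add: Np_\<Omega>[OF z])
 then show "alt_wedge (Dl \<eta> \<Omega> z) q = (\<lambda>vs. (\<Sum>b\<in>Basis. ext (tw1 (of_real (\<eta> z)) (xb b)) (alt_wedge (pd \<Omega> z b) q) vs) -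
   ext (alc \<eta> z) (alt_wedge (\<Omega> z) q) vs)"
  by (intro HOL.ext) (simp only: alt_wedge_diff_left alt_wedge_sum_left alt_wedge_ext_left)
 have "Dbl \<eta> \<Omega> z = (\<lambda>vs. (\<Sum>b\<in>Basis. ext (tw2 (of_real (\<eta> z)) (xb b)) (pd \<Omega> z b) vs) - ext (bec \<eta> z) (\<Omega> z) vs)"
  by (rule HOL.ext) (subst Dbl_formula[OF U_open z \<Omega>_alt \<Omega>_d[OF z] \<eta>], simp_all add: Nq_\<Omega>[OF z])
 then show "alt_wedge (Dbl \<eta> \<Omega> z) q = (\<lambda>vs. (\<Sum>b\<in>Basis. ext (tw2 (of_real (\<eta> z)) (xb b)) (alt_wedge (pd \<Omega> z b) q) vs) -
   ext (bec \<eta> z) (alt_wedge (\<Omega> z) q) vs)"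
  by (intro HOL.ext) (simp only: alt_wedge_diff_left alt_wedge_sum_left alt_wedge_ext_left)
qed

text \<open>Both three-forms are sums of covectors wedge the same (1,1)-forms, with covectors
  matched by \<open>tw1_J\<close> and \<open>alc_J\<close>; so \<open>adj_ext_two\<close> applies
  summand by summand.\<close>

lemma adj_Dbl_\<Omega>:
 assumes z: "z \<in> U" and \<eta>: "\<eta> differentiable (at z)" "\<eta> z \<noteq> 0" and fs: "hframe (\<Omega> z) (set fs)" "distinct fs" and v: "alternating v"
 shows "inn fs (alt_wedge (Dbl \<eta> \<Omega> z) u) v =
  inn fs u (\<lambda>vs. \<i> / 6 * adL (set fs) (adL (set fs) (adL (set fs) (alt_wedge (Dl \<eta> \<Omega> z)))) v vs)"
proof -
 interpret hframe "\<Omega> z" "set fs" by fact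
 let ?F = "set fs"
 let ?X = "\<lambda>s \<psi> vs. \<i> / 6 * adL ?F (adL ?F (adL ?F (\<lambda>q. ext s (alt_wedge \<psi> q)))) v vs"
 have 1: "inn fs (ext (tw2 (of_real (\<eta> z)) (xb b)) (alt_wedge (pd \<Omega> z b) u)) v = inn fs u (?X (tw1 (of_real (\<eta> z)) (xb b)) (pd \<Omega> z b))" for b
  by (rule adj_ext_two[OF refl fs(2) linear_tw(1)[OF linear_xb] tw1_J pd_\<Omega>[OF z] v])
 have 2: "inn fs (ext (bec \<eta> z) (alt_wedge (\<Omega> z) u)) v = inn fs u (?X (alc \<eta> z) (\<Omega> z))"
  by (rule adj_ext_two[OF refl fs(2) linear_alc alc_J two_form11_w w_real v])
 have e: "alt_wedge (Dl \<eta> \<Omega> z) = (\<lambda>q vs. (\<Sum>b\<in>Basis. ext (tw1 (of_real (\<eta> z)) (xb b)) (alt_wedge (pd \<Omega> z b) q) vs) -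
   ext (alc \<eta> z) (alt_wedge (\<Omega> z) q) vs)"
  using wedge_Dl_\<Omega>(1)[OF z \<eta>] by blast
 have f: "adL ?F (\<lambda>q vs. (\<Sum>b\<in>Basis. P b q vs) - Q q vs) = (\<lambda>q vs. (\<Sum>b\<in>Basis. adL ?F (P b) q vs) - adL ?F Q q vs)" for P Q
  by (rule HOL.ext) (simp add: adL_diff adL_sum)
 show ?thesis
  unfolding wedge_Dl_\<Omega>(2)[OF z \<eta>] e f inn_diff_left inn_sum_left 1 2 right_diff_distrib sum_distrib_left inn_diff_right inn_sum_right ..
qed

text \<open>Three effects meet: commuting with the symbols gives contractions of derivatives,
  \<Lambda> lowers p by one, and \<Lambda> itself depends on the point, with derivative half of
  \<open>cov2\<close> of the derivative of the metric form.\<close>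

lemma adL_Dl:
 assumes z: "z \<in> U" and F: "hframe (\<Omega> z) F" and v: "\<And>y. y \<in> U ==> alternating (v y)" "dfield v z"
  and \<eta>: "\<eta> differentiable (at z)" "\<eta> z \<noteq> 0"
 shows "Lam F (Dl \<eta> v z) vs - Dl \<eta> (\<lambda>y. LamG (\<Omega> y) (v y)) z vs =
  \<i> * (\<Sum>b\<in>Basis. cov F (\<lambda>x. cnj (tw2 (of_real (\<eta> z)) (xb b) x)) (pd v z b) vs)
  - \<i> * cov F (\<lambda>x. cnj (bec \<eta> z x)) (Np (v z)) vs
  - 1/2 * (\<Sum>b\<in>Basis. ext (tw1 (of_real (\<eta> z)) (xb b)) (hframe.cov2 F (pd \<Omega> z b) (v z)) vs)
  - ext (alc \<eta> z) (Lam F (v z)) vs"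
proof -
 interpret hframe "\<Omega> z" F by fact
 let ?s = "\<lambda>b. tw1 (of_real (\<eta> z)) (xb b)"
 note av = v(1)[OF z]
 have apd: "alternating (pd v z b)" for b by (rule alt_pd[OF U_open z v])
 have altL: "alternating (LamG (\<Omega> y) (v y))" if "y \<in> U" for y
  by (rule alt_LamG[OF \<Omega>_hp[OF that] v(1)[OF that]])
 note DL = LamG_has_derivative[OF z F v]
 have dL: "dfield (\<lambda>y. LamG (\<Omega> y) (v y)) z"
  using DL by (auto intro: differentiableI)
 have pdL: "pd (\<lambda>y. LamG (\<Omega> y) (v y)) z b = (\<lambda>vs. Lam F (pd v z b) vs + 1/2 * cov2 (pd \<Omega> z b) (v z) vs)" for b
  unfolding pd_def[of "\<lambda>y. LamG (\<Omega> y) (v y)"] Lam_eq_LamG[OF F apd] using fder_eqI[OF DL] by blast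
 have Dv: "Dl \<eta> v z = (\<lambda>vs. (\<Sum>b\<in>Basis. ext (?s b) (pd v z b) vs) - ext (alc \<eta> z) (Np (v z)) vs)"
  by (rule HOL.ext, rule Dl_formula[OF U_open z _ v(2) \<eta>]) (rule v(1))
 have DLv: "Dl \<eta> (\<lambda>y. LamG (\<Omega> y) (v y)) z vs = (\<Sum>b\<in>Basis. ext (?s b) (\<lambda>vs. Lam F (pd v z b) vs + 1/2 * cov2 (pd \<Omega> z b) (v z) vs) vs)
   - ext (alc \<eta> z) (Np (LamG (\<Omega> z) (v z))) vs"
  unfolding pdL[symmetric] by (rule Dl_formula[OF U_open z _ dL \<eta>]) (rule altL)
 have NL: "Np (LamG (\<Omega> z) (v z)) = (\<lambda>vs. Lam F (Np (v z)) vs - Lam F (v z) vs)"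
  unfolding Lam_eq_LamG[OF F av, symmetric] using Np_Lam[OF av] by blast
 have cs: "cov F (\<lambda>x. ?s b (cJ x)) q vs = - \<i> * cov F (\<lambda>x. cnj (tw2 (of_real (\<eta> z)) (xb b) x)) q vs" for b q
  unfolding tw1_J cov_cov_scale ..
 have ca: "cov F (\<lambda>x. alc \<eta> z (cJ x)) q vs = - \<i> * cov F (\<lambda>x. cnj (bec \<eta> z x)) q vs" for q
  unfolding alc_J cov_cov_scale ..
 have LD: "Lam F (Dl \<eta> v z) vs = (\<Sum>b\<in>Basis. ext (?s b) (Lam F (pd v z b)) vs) + \<i> * (\<Sum>b\<in>Basis. cov F (\<lambda>x. cnj (tw2 (of_real (\<eta> z)) (xb b) x)) (pd v z b) vs)
   - ext (alc \<eta> z) (Lam F (Np (v z))) vs - \<i> * cov F (\<lambda>x. cnj (bec \<eta> z x)) (Np (v z)) vs"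
  unfolding Dv Lam_diff Lam_sum Lam_ext[OF apd linear_tw(1)[OF linear_xb]] Lam_ext[OF alt_Np[OF av] linear_alc] cs ca
  by (simp add: sum.distrib sum_subtractf sum_distrib_left sum_negf)
 show ?thesis
  unfolding LD DLv NL ext_add ext_scale ext_diff by (simp add: sum.distrib sum_distrib_left)
qed

lemma ad2_Dl_\<Omega>:
 assumes z: "z \<in> U" and F: "hframe (\<Omega> z) F" and v: "alternating v"
  and \<eta>: "\<eta> differentiable (at z)" "\<eta> z \<noteq> 0"
 shows "adL F (adL F (alt_wedge (Dl \<eta> \<Omega> z))) v vs =
  (\<Sum>b\<in>Basis. ext (tw1 (of_real (\<eta> z)) (xb b)) (hframe.cov2 F (pd \<Omega> z b) v) vs)
  + 2 * \<i> * (\<Sum>b\<in>Basis. cov F (\<lambda>x. cnj (tw2 (of_real (\<eta> z)) (xb b) x)) (adL F (alt_wedge (pd \<Omega> z b)) v) vs)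
  + 2 * ext (alc \<eta> z) (Lam F v) vs
  - 2 * \<i> * (of_nat CARD('n) * cov F (\<lambda>x. cnj (bec \<eta> z x)) v vs - cov F (\<lambda>x. cnj (bec \<eta> z x)) (\<lambda>ws. of_nat (length ws) * v ws) vs)"
proof -
 interpret hframe "\<Omega> z" F by fact
 let ?s = "\<lambda>b. tw1 (of_real (\<eta> z)) (xb b)"
 have e: "alt_wedge (Dl \<eta> \<Omega> z) = (\<lambda>q vs. (\<Sum>b\<in>Basis. ext (?s b) (alt_wedge (pd \<Omega> z b) q) vs) -
   ext (alc \<eta> z) (alt_wedge (\<Omega> z) q) vs)"
  using wedge_Dl_\<Omega>(1)[OF z \<eta>] by blast
 have f: "adL F (\<lambda>q vs. (\<Sum>b\<in>Basis. P b q vs) - Q q vs) = (\<lambda>q vs. (\<Sum>b\<in>Basis. adL F (P b) q vs) - adL F Q q vs)" for P Q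
  by (rule HOL.ext) (simp add: adL_diff adL_sum)
 have cs: "cov F (\<lambda>x. ?s b (cJ x)) q vs = - \<i> * cov F (\<lambda>x. cnj (tw2 (of_real (\<eta> z)) (xb b) x)) q vs" for b q
  unfolding tw1_J cov_cov_scale ..
 have ca: "cov F (\<lambda>x. alc \<eta> z (cJ x)) q vs = - \<i> * cov F (\<lambda>x. cnj (bec \<eta> z x)) q vs" for q
  unfolding alc_J cov_cov_scale ..
 have aw: "adL F (alt_wedge (\<Omega> z)) v = (\<lambda>vs. of_nat CARD('n) * v vs - of_nat (length vs) * v vs)"
  using ad_w[OF v] by (auto simp: left_diff_distrib)
 show ?thesis
  unfolding e f ad2_ext[OF linear_tw(1)[OF linear_xb] pd_\<Omega>(1)[OF z] v] ad2_ext[OF linear_alc two_form11_w v] cs ca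
   cov2_w[OF v] ext_scale aw cov_diff cov_scale
  by (simp add: sum_subtractf sum.distrib sum_distrib_left sum_negf algebra_simps)
qed

text \<open>The terms that multiply by a covector cancel between \<open>adL_Dl\<close> and i/2 times
  \<open>ad2_Dl_\<Omega>\<close>; this fixes the coefficient of the torsion term. In the contraction
  with b the contributions p, n - (p + q) and -n add up to -q.\<close>

lemma MM_eq:
 assumes z: "z \<in> U" and F: "hframe (\<Omega> z) F" and v: "\<And>y. y \<in> U ==> alternating (v y)" "dfield v z"
  and \<eta>: "\<eta> differentiable (at z)" "\<eta> z \<noteq> 0"
 shows "MM \<eta> F v z vs = - cov F (\<lambda>x. cnj (bec \<eta> z x)) (Nq (v z)) vs
  - (\<Sum>b\<in>Basis. cov F (\<lambda>x. cnj (tw2 (of_real (\<eta> z)) (xb b) x)) (pd v z b) vs)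
  - (\<Sum>b\<in>Basis. cov F (\<lambda>x. cnj (tw2 (of_real (\<eta> z)) (xb b) x)) (adL F (alt_wedge (pd \<Omega> z b)) (v z)) vs)"
proof -
 have "(\<lambda>ws. of_nat (length ws) * v z ws) = (\<lambda>ws. Np (v z) ws + Nq (v z) ws)"
  by (simp add: Np_plus_Nq)
 then have c: "cov F a (\<lambda>ws. of_nat (length ws) * v z ws) vs = cov F a (Np (v z)) vs + cov F a (Nq (v z)) vs" for a
  by (simp only: cov_add)
 note e = ad2_Dl_\<Omega>[OF z F v(1)[OF z] \<eta>, of vs]
 have d: "Lam F (Dl \<eta> v z) vs - Dl \<eta> (\<lambda>y. LamG (\<Omega> y) (v y)) z vs =
  \<i> * (\<Sum>b\<in>Basis. cov F (\<lambda>x. cnj (tw2 (of_real (\<eta> z)) (xb b) x)) (pd v z b) vs)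
  - \<i> * cov F (\<lambda>x. cnj (bec \<eta> z x)) (Np (v z)) vs
  - 1/2 * (\<Sum>b\<in>Basis. ext (tw1 (of_real (\<eta> z)) (xb b)) (hframe.cov2 F (pd \<Omega> z b) (v z)) vs)
  - ext (alc \<eta> z) (Lam F (v z)) vs"
  by (rule adL_Dl[OF z F _ v(2) \<eta>]) (rule v(1))
 show ?thesis
  unfolding MM_def d e by (simp add: c algebra_simps)
qed

lemma ext_tw2_has_derivative:
 fixes u :: "complex^'n => 'n alt"
 assumes \<eta>: "\<eta> differentiable (at z)" and u: "dfield u z"
 shows "((\<lambda>y. ext (tw2 (of_real (\<eta> y)) (xb b)) (u y) vs) has_derivative
  (\<lambda>h. ext (tw2 (of_real (\<eta> z)) (xb b)) (pd u z h) vs - of_real (fder \<eta> z h) * ext (\<lambda>v. (xb b v + \<i> * xb b (cJ v)) / 2) (u z) vs)) (at z)"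
proof -
 have e: "ext (tw2 s (xb b)) q vs = ext (tw2 0 (xb b)) q vs - s * ext (\<lambda>v. (xb b v + \<i> * xb b (cJ v)) / 2) q vs" for s q
 proof -
  have "tw2 s (xb b) = (\<lambda>v. tw2 0 (xb b) v + (- s) * ((xb b v + \<i> * xb b (cJ v)) / 2))"
   by (auto simp: tw2_def field_simps)
  show ?thesis unfolding \<open>tw2 s (xb b) = _\<close> ext_cov_add ext_cov_scale by simp
 qed
 have "((\<lambda>y. ext (tw2 0 (xb b)) (u y) vs - of_real (\<eta> y) * ext (\<lambda>v. (xb b v + \<i> * xb b (cJ v)) / 2) (u y) vs) has_derivative
  (\<lambda>h. ext (tw2 0 (xb b)) (pd u z h) vs - (of_real (\<eta> z) * ext (\<lambda>v. (xb b v + \<i> * xb b (cJ v)) / 2) (pd u z h) vs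
   + of_real (fder \<eta> z h) * ext (\<lambda>v. (xb b v + \<i> * xb b (cJ v)) / 2) (u z) vs))) (at z)"
  by (intro has_derivative_diff has_derivative_mult has_derivative_of_real fder_works \<eta> ext_field_has_derivative[OF u])
 then show ?thesis
  unfolding e[of "of_real (\<eta> _)"] by (simp add: algebra_simps)
qed

text \<open>Differentiating the density and the inverse metric together gives trace minus
  derivation, hence by \<open>ad_two\<close> the commutator of \<Lambda> with the derivative of the
  metric form. This produces the last sum of \<open>MM_eq\<close>.\<close>

theorem divergence_identity:
 assumes z: "z \<in> U" and fs: "hframe (\<Omega> z) (set fs)" "distinct fs"
  and u: "\<And>y. y \<in> U ==> alternating (u y)" "dfield u z"
  and v: "\<And>y. y \<in> U ==> alternating (v y)" "dfield v z"
  and \<eta>: "\<eta> differentiable (at z)" "\<eta> z \<noteq> 0"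
 shows "(\<Sum>b\<in>Basis. fder (\<lambda>y. of_real (rho (\<Omega> y)) * innG (\<Omega> y) (ext (tw2 (of_real (\<eta> y)) (xb b)) (u y)) (v y)) z b) =
  of_real (rho (\<Omega> z)) * (inn fs (Dbl \<eta> u z) (v z) - inn fs (u z) (MM \<eta> (set fs) v z))"
proof -
 let ?F = "set fs"
 interpret hframe "\<Omega> z" ?F by fact
 let ?s = "\<lambda>b. tw2 (of_real (\<eta> z)) (xb b)"
 let ?d = "\<lambda>b v. (xb b v + \<i> * xb b (cJ v)) / 2"
 note av = v(1)[OF z] and au = u(1)[OF z]
 define ub where "ub = (\<lambda>b y. ext (tw2 (of_real (\<eta> y)) (xb b)) (u y))"
 have aub: "alternating (ub b y)" if "y \<in> U" for b y
  unfolding ub_def by (rule alt_ext[OF u(1)[OF that] linear_tw(2)[OF linear_xb]])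
 note Dub = ext_tw2_has_derivative[OF \<eta>(1) u(2)]
 have dub: "dfield (ub b) z" for b unfolding ub_def using Dub by (auto intro: differentiableI)
 have pdub: "pd (ub b) z h = (\<lambda>vs. ext (?s b) (pd u z h) vs - of_real (fder \<eta> z h) * ext (?d b) (u z) vs)" for b h
  unfolding pd_def[of "ub b"] unfolding ub_def using fder_eqI[OF Dub] by blast
 have apd: "alternating (pd v z b)" for b by (rule alt_pd[OF U_open z v])
 have apdu: "alternating (pd u z b)" for b by (rule alt_pd[OF U_open z u])
 have apub: "alternating (pd (ub b) z h)" for b h by (rule alt_pd[OF U_open z aub dub])
 define N where "N = (\<lambda>h vs. \<Sum>f\<in>?F. ext (\<lambda>x. of_real (g f x)) (cov ?F (\<lambda>x. pd \<Omega> z h [f, cJ x]) (v z)) vs)"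
 define t where "t = (\<lambda>h. (\<Sum>f\<in>?F. pd \<Omega> z h [f, cJ f]) / 2)"
 have adK: "adL ?F (alt_wedge (pd \<Omega> z h)) (v z) = (\<lambda>vs. t h * v z vs - N h vs)" for h
  unfolding t_def N_def by (rule ad_two[OF pd_\<Omega>(1)[OF z] av])
 have treal: "cnj (t h) = t h" "of_real (Re (t h)) = t h" for h
 proof -
  show "cnj (t h) = t h" unfolding t_def by (simp add: pd_\<Omega>(2)[OF z])
  then show "of_real (Re (t h)) = t h" by (simp add: complex_eq_iff)
 qed
 have aN: "alternating (N h)" for h
 proof -
  have "linear (\<lambda>x. complex_of_real (g f x))" for f by (rule linear_g)
  then show ?thesis unfolding N_def
   using alt_lincomb[of ?F "\<lambda>f. ext (\<lambda>x. of_real (g f x)) (cov ?F (\<lambda>x. pd \<Omega> z h [f, cJ x]) (v z))" "\<lambda>_. 1"]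
   by (simp add: alt_ext alt_cov av)
 qed
 have aK: "alternating (adL ?F (alt_wedge (pd \<Omega> z h)) (v z))" for h
  by (rule alt_adL[OF alt_alt_wedge_two[OF pd_\<Omega>(1)[OF z]] av])
 have Gi: "innG (\<Omega> z) a b = inn fs a b" if "alternating a" "alternating b" for a b
  using inn_eq_innG[OF fs that] by simp
 have D: "fder (\<lambda>y. of_real (rho (\<Omega> y)) * innG (\<Omega> y) (ub b y) (v y)) z h =
   of_real (rho (\<Omega> z)) * (inn fs (pd (ub b) z h) (v z) + inn fs (ub b z) (pd v z h) + inn fs (ub b z) (adL ?F (alt_wedge (pd \<Omega> z h)) (v z)))" for b h
 proof -
  have "((\<lambda>y. of_real (rho (\<Omega> y)) * innG (\<Omega> y) (ub b y) (v y)) has_derivative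
   (\<lambda>h. of_real (rho (\<Omega> z)) * (innG (\<Omega> z) (pd (ub b) z h) (v z) + innG (\<Omega> z) (ub b z) (\<lambda>vs. pd v z h vs - N h vs))
    + of_real (rho (\<Omega> z) * Re (t h)) * innG (\<Omega> z) (ub b z) (v z))) (at z)"
   unfolding N_def t_def
   by (intro has_derivative_mult has_derivative_of_real rho_has_derivative[OF z fs(1)] innG_has_derivative[OF z fs(1) aub dub v])
  from fder_eqI[OF this] show ?thesis
   unfolding Gi[OF apub av] Gi[OF aub[OF z] alt_diff[OF apd aN]] Gi[OF aub[OF z] av] adK
    inn_diff_right inn_scale_right treal(1) of_real_mult treal(2)
   by (simp add: algebra_simps)
 qed
 have c1: "inn fs (ub b z) w = inn fs (u z) (cov ?F (\<lambda>x. cnj (?s b x)) w)" if "alternating w" for b w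
  unfolding ub_def by (rule adj_ext[OF refl fs(2) that])
 have Dbu: "Dbl \<eta> u z = (\<lambda>vs. (\<Sum>b\<in>Basis. ext (?s b) (pd u z b) vs) - ext (bec \<eta> z) (Nq (u z)) vs)"
  by (rule HOL.ext, rule Dbl_formula[OF U_open z _ u(2) \<eta>]) (rule u(1))
 \<comment> \<open>The twisted coordinate covectors contain \<eta>, so the divergence also
   differentiates \<eta>. The (0,1)-covector so produced is the one by which \<open>Nq\<close> fails
   to commute with multiplication by b.\<close>
 have del: "(\<lambda>v. (bec \<eta> z v + \<i> * bec \<eta> z (cJ v)) / 2) = (\<lambda>v. \<Sum>b\<in>Basis. (- of_real (fder \<eta> z b)) * ?d b v)"
 proof
  fix v :: "complex^'n"
  have "(tw2 (of_real (\<eta> z)) (xb b) v + \<i> * tw2 (of_real (\<eta> z)) (xb b) (cJ v)) / 2 = - of_real (\<eta> z) * ?d b v" for b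
   by (simp add: tw2_def field_simps)
  then have "of_real (fder \<eta> z b / \<eta> z) * ((tw2 (of_real (\<eta> z)) (xb b) v + \<i> * tw2 (of_real (\<eta> z)) (xb b) (cJ v)) / 2) =
    (- of_real (fder \<eta> z b)) * ?d b v" for b
   using \<eta>(2) by simp
  then have "(\<Sum>b\<in>Basis. of_real (fder \<eta> z b / \<eta> z) * ((tw2 (of_real (\<eta> z)) (xb b) v + \<i> * tw2 (of_real (\<eta> z)) (xb b) (cJ v)) / 2)) =
    (\<Sum>b\<in>Basis. (- of_real (fder \<eta> z b)) * ?d b v)"
   by (rule sum.cong[OF refl])
  moreover have "(bec \<eta> z v + \<i> * bec \<eta> z (cJ v)) / 2 =
    (\<Sum>b\<in>Basis. of_real (fder \<eta> z b / \<eta> z) * ((tw2 (of_real (\<eta> z)) (xb b) v + \<i> * tw2 (of_real (\<eta> z)) (xb b) (cJ v)) / 2))"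
   unfolding bec_def sum_distrib_left sum.distrib[symmetric] sum_divide_distrib by (intro sum.cong refl) (simp add: algebra_simps)
  ultimately show "(bec \<eta> z v + \<i> * bec \<eta> z (cJ v)) / 2 = (\<Sum>b\<in>Basis. (- of_real (fder \<eta> z b)) * ?d b v)" by simp
 qed
 have Nqe: "Nq (ext (bec \<eta> z) (u z)) = (\<lambda>vs. ext (bec \<eta> z) (Nq (u z)) vs + (\<Sum>b\<in>Basis. - of_real (fder \<eta> z b) * ext (?d b) (u z) vs))"
  by (rule HOL.ext) (simp only: Nq_ext del ext_cov_lincomb)
 have P: "(\<Sum>b\<in>Basis. inn fs (pd (ub b) z b) (v z)) = inn fs (Dbl \<eta> u z) (v z) + inn fs (u z) (cov ?F (\<lambda>x. cnj (bec \<eta> z x)) (Nq (v z)))"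
 proof -
  have "inn fs (u z) (cov ?F (\<lambda>x. cnj (bec \<eta> z x)) (Nq (v z))) = inn fs (Nq (ext (bec \<eta> z) (u z))) (v z)"
   unfolding adj_Nq[OF refl fs(2) alt_ext[OF au linear_bec] av] by (rule adj_ext[OF refl fs(2) alt_Nq[OF av], symmetric])
  then show ?thesis
   unfolding Nqe Dbu pdub inn_diff_left inn_add_left inn_sum_left inn_scale_left inn_lincomb_left
   by (simp add: sum_subtractf sum_negf)
 qed
 have M: "MM \<eta> ?F v z = (\<lambda>vs. - 1 * cov ?F (\<lambda>x. cnj (bec \<eta> z x)) (Nq (v z)) vs
  - (\<Sum>b\<in>Basis. cov ?F (\<lambda>x. cnj (?s b x)) (pd v z b) vs)
  - (\<Sum>b\<in>Basis. cov ?F (\<lambda>x. cnj (?s b x)) (adL ?F (alt_wedge (pd \<Omega> z b)) (v z)) vs))"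
  using MM_eq[OF z fs(1) v \<eta>] by auto
 have "(\<Sum>b\<in>Basis. fder (\<lambda>y. of_real (rho (\<Omega> y)) * innG (\<Omega> y) (ub b y) (v y)) z b) =
   of_real (rho (\<Omega> z)) * ((\<Sum>b\<in>Basis. inn fs (pd (ub b) z b) (v z)) + (\<Sum>b\<in>Basis. inn fs (u z) (cov ?F (\<lambda>x. cnj (?s b x)) (pd v z b)))
    + (\<Sum>b\<in>Basis. inn fs (u z) (cov ?F (\<lambda>x. cnj (?s b x)) (adL ?F (alt_wedge (pd \<Omega> z b)) (v z)))))"
  unfolding D c1[OF apd] c1[OF aK] by (simp only: sum_distrib_left[symmetric] sum.distrib)
 also have "\<dots> = of_real (rho (\<Omega> z)) * (inn fs (Dbl \<eta> u z) (v z) - inn fs (u z) (MM \<eta> ?F v z))"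
  unfolding P M inn_diff_right inn_scale_right inn_sum_right by simp
 finally show ?thesis unfolding ub_def .
qed

end

section \<open>Forms on complex manifolds\<close>

lemma smooth_on_pull:
 fixes W :: "complex^'m::finite => 'n::finite alt"
 assumes U: "open U" and "\<And>z. z \<in> U ==> alternating (W z)" "sfield U W" and G: "\<And>v. smooth_on U (\<lambda>z. G z v)"
 shows "smooth_on U (\<lambda>z. W z (map (G z) vs))"
 using assms(2,3)
proof (induction vs arbitrary: W)
 case Nil
 then show ?case by (simp add: sfield_def)
next
 case (Cons v vs)
 have "smooth_on U (\<lambda>z. \<Sum>b\<in>Basis. xb b (G z v) * W z (b # map (G z) vs))"
 proof (intro smooth_on_sum[OF U] smooth_on_mult[OF U] smooth_on_of_real[OF U])
  fix b
  show "smooth_on U (\<lambda>z. G z v \<bullet> b)"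
   by (rule smooth_on_bounded_linear[OF bounded_linear_inner_left U G])
  show "smooth_on U (\<lambda>z. W z (b # map (G z) vs))"
   by (rule Cons.IH[of "\<lambda>z ws. W z (b # ws)"]) (use Cons.prems in \<open>auto intro: alt_contr simp: sfield_def\<close>)
 qed
 moreover have "W z (map (G z) (v # vs)) = (\<Sum>b\<in>Basis. xb b (G z v) * W z (b # map (G z) vs))" if "z \<in> U" for z
  using alt_expand[OF Cons.prems(1)[OF that], of "G z v" "map (G z) vs"] by simp
 ultimately show ?case by (simp only: smooth_on_cong[OF U, of "\<lambda>z. W z (map (G z) (v # vs))"])
qed

lemma smooth_on_inn:
 assumes U: "open U" and "\<And>fs. smooth_on U (\<lambda>z. u z fs)" "\<And>fs. smooth_on U (\<lambda>z. v z fs)"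
 shows "smooth_on U (\<lambda>z. inn fs (u z) (v z))"
 unfolding inn_def by (intro smooth_on_sum smooth_on_mult smooth_on_cnj assms)

context metric_field
begin

lemma smooth_innG:
 assumes "\<And>z. z \<in> U ==> alternating (u z)" "sfield U u" "\<And>z. z \<in> U ==> alternating (v z)" "sfield U v"
 shows "smooth_on U (\<lambda>z. innG (\<Omega> z) (u z) (v z))"
 unfolding innG_def
 by (intro smooth_on_inn U_open) (use assms in \<open>auto simp: sfield_def intro!: smooth_on_pull[OF U_open] smooth_Ginv\<close>)

lemma sfield_LamG:
 assumes v: "\<And>z. z \<in> U ==> alternating (v z)" "sfield U v"
 shows "sfield U (\<lambda>z. LamG (\<Omega> z) (v z))"
 unfolding sfield_def
proof
 fix vs
 have sJ: "smooth_on U (\<lambda>z. cJ (Ginv (\<Omega> z) b))" for b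
  by (rule smooth_on_bounded_linear[OF bounded_linear_smult_right U_open smooth_Ginv])
 have "smooth_on U (\<lambda>z. \<Sum>b\<in>Basis. \<Sum>b'\<in>Basis. xb b' (cJ (Ginv (\<Omega> z) b)) * v z (b # b' # vs) / 2)"
  using v(2) unfolding sfield_def
  by (intro smooth_on_sum[OF U_open] smooth_on_divide[OF U_open] smooth_on_mult[OF U_open] smooth_on_of_real[OF U_open]
   smooth_on_bounded_linear[OF bounded_linear_inner_left U_open sJ]) auto
 moreover have "LamG (\<Omega> z) (v z) vs = (\<Sum>b\<in>Basis. \<Sum>b'\<in>Basis. xb b' (cJ (Ginv (\<Omega> z) b)) * v z (b # b' # vs) / 2)" if "z \<in> U" for z
  unfolding LamG_def sum_divide_distrib
  by (subst alt_expand[OF alt_contr[OF v(1)[OF that]]]) (simp add: sum_divide_distrib)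
 ultimately show "smooth_on U (\<lambda>z. LamG (\<Omega> z) (v z) vs)"
  by (simp only: smooth_on_cong[OF U_open, of "\<lambda>z. LamG (\<Omega> z) (v z) vs"])
qed

end

text \<open>A coordinate change is at each point a complex-linear isometry and carries orthonormal
  frames to orthonormal frames. Chart independence of \<Lambda> and of the inner product
  follows.\<close>

lemma hframe_push:
 fixes w w' :: "'n::finite alt"
 assumes F: "hframe w F" and w': "hpoint w'" and L: "linear L" "inj L" "\<And>v. L (cJ v) = cJ (L v)" "\<And>vs. w vs = w' (map L vs)"
 shows "hframe w' (L ` F)"
proof -
 interpret hframe w F by fact
 interpret w': hpoint w' by fact
 have "w'.g (L u) (L v) = g u v" for u v
  unfolding g_def w'.g_def L(4) by (simp add: L(3))
 then have "w'.orth (L ` F)"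
  using F_orth inj_eq[OF L(2)] unfolding w'.orth_def orth_def by auto
 moreover have "card (L ` F) = card F"
  by (rule card_image) (rule inj_on_subset[OF L(2) subset_UNIV])
 ultimately show ?thesis
  unfolding hframe_def hframe_axioms_def using w' F_fin F_card by simp
qed

lemma LamG_pull:
 fixes w w' :: "'n::finite alt"
 assumes w: "hpoint w" and w': "hpoint w'" and q: "alternating q"
  and L: "linear L" "inj L" "\<And>v. L (cJ v) = cJ (L v)" "\<And>vs. w vs = w' (map L vs)"
 shows "LamG w (\<lambda>vs. q (map L vs)) vs = LamG w' q (map L vs)"
proof -
 obtain fs where fs: "hframe w (set fs)" using hpoint_ex_frame[OF w] by blast
 have "inj_on L (set fs)" by (rule inj_on_subset[OF L(2) subset_UNIV])
 then show ?thesis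
  unfolding Lam_eq_LamG[OF fs alt_map[OF q L(1)], symmetric] Lam_eq_LamG[OF hframe_push[OF fs w' L] q, symmetric]
  by (simp add: Lam_def sum.reindex L(3))
qed

lemma innG_pull:
 fixes w w' :: "'n::finite alt"
 assumes w: "hpoint w" and w': "hpoint w'" and q: "alternating q" "alternating p"
  and L: "linear L" "inj L" "\<And>v. L (cJ v) = cJ (L v)" "\<And>vs. w vs = w' (map L vs)"
 shows "innG w (\<lambda>vs. q (map L vs)) (\<lambda>vs. p (map L vs)) = innG w' q p"
proof -
 obtain fs where fs: "hframe w (set fs)" "distinct fs" using hpoint_ex_frame[OF w] by blast
 have "distinct (map L fs)" using fs(2) L(2) by (simp add: distinct_map inj_on_subset[OF L(2) subset_UNIV])
 then have "innG w' q p = inn (map L fs) q p"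
  by (subst inn_eq_innG[OF _ _ q]) (use hframe_push[OF fs(1) w' L] in simp_all)
 then show ?thesis
  unfolding inn_eq_innG[OF fs alt_map[OF q(1) L(1)] alt_map[OF q(2) L(1)], symmetric]
  by (simp add: inn_def nths_map)
qed

section \<open>Charts, transition maps and the basic operations on smooth forms\<close>

locale atlas =
 fixes A :: "('a::{t2_space,second_countable_topology}, 'n::finite) chart set"
 assumes atl: "complex_atlas A"
begin

abbreviation sf :: "('a, 'n) form => bool" where "sf == smooth_form A"

abbreviation im :: "('a, 'n) chart => (complex^'n) set" where "im c \<equiv> snd c ` fst c"

abbreviation rp :: "('a, 'n) chart => ('a, 'n) form => complex^'n => 'n alt" where
 "rp c u \<equiv> (\<lambda>z. u c (chart_inv c z))"

lemma chart:
 assumes "c \<in> A"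
 shows chart_open: "open (fst c)" and im_open: "open (im c)"
  and chart_cont: "continuous_on (fst c) (snd c)" and chart_inv_cont: "continuous_on (im c) (chart_inv c)"
  and chart_inv_chart: "x \<in> fst c ==> chart_inv c (snd c x) = x"
  and chart_chart_inv: "z \<in> im c ==> snd c (chart_inv c z) = z"
  and chart_inv_in: "z \<in> im c ==> chart_inv c z \<in> fst c"
 using atl assms unfolding complex_atlas_def complex_chart_def homeomorphism_def
 by (auto simp: f_inv_into_f inv_into_into)

lemma chart_inj: "c \<in> A ==> inj_on (snd c) (fst c)"
 by (rule inj_on_inverseI) (rule chart_inv_chart)

lemma overlap_open:
 assumes "c \<in> A" "open B" shows "open (snd c ` (fst c \<inter> B))"
proof -
 have "snd c ` (fst c \<inter> B) = im c \<inter> chart_inv c -` B"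
  using chart_inv_chart[OF assms(1)] chart_chart_inv[OF assms(1)] chart_inv_in[OF assms(1)] by force
 then show ?thesis
  using continuous_on_open_vimage[OF im_open[OF assms(1)], of "chart_inv c"] chart_inv_cont[OF assms(1)] assms(2)
  by (simp add: Int_commute)
qed

lemma transition:
 assumes c: "c \<in> A" "c' \<in> A" and z: "z \<in> snd c ` (fst c \<inter> fst c')"
 shows transition_in: "transition c c' z \<in> im c'"
  and transition_inv: "chart_inv c' (transition c c' z) = chart_inv c z"
  and transition_back: "transition c' c (transition c c' z) = z"
  and transition_over: "transition c c' z \<in> snd c' ` (fst c' \<inter> fst c)"
 using z chart_inv_chart[OF c(1)] chart_inv_chart[OF c(2)] unfolding transition_def by auto

lemma transition_holo: "c \<in> A ==> c' \<in> A ==> holomorphic_map (snd c ` (fst c \<inter> fst c')) (transition c c')"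
 using atl unfolding complex_atlas_def by blast

lemma overlap: "c \<in> A ==> c' \<in> A ==> open (snd c ` (fst c \<inter> fst c'))"
 by (intro overlap_open chart_open)

abbreviation jac :: "('a, 'n) chart => ('a, 'n) chart => 'a => complex^'n => complex^'n" where
 "jac c c' x \<equiv> fder (transition c c') (snd c x)"

lemma jac:
 assumes c: "c \<in> A" "c' \<in> A" and x: "x \<in> fst c" "x \<in> fst c'"
 shows jac_linear: "linear (jac c c' x)" and jac_scale: "jac c c' x (a *s v) = a *s jac c c' x v"
  and jac_back: "jac c' c x (jac c c' x v) = v" and jac_inj: "inj (jac c c' x)"
proof -
 let ?V = "snd c ` (fst c \<inter> fst c')"
 have z: "snd c x \<in> ?V" using x by blast
 have z': "snd c' x \<in> snd c' ` (fst c' \<inter> fst c)" using x by blast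
 have t: "transition c c' (snd c x) = snd c' x" using x chart_inv_chart[OF c(1)] by (simp add: transition_def)
 note h = holomorphic_map_fder[OF transition_holo[OF c] z]
 show "linear (jac c c' x)" "jac c c' x (a *s v) = a *s jac c c' x v" using h by blast+
 have "(transition c' c \<circ> transition c c' has_derivative (jac c' c x \<circ> jac c c' x)) (at (snd c x))"
  using holomorphic_map_fder(1)[OF transition_holo[OF c(2,1)] z'] h(1) by (intro diff_chain_at) (simp_all add: t)
 then have "((\<lambda>z. z) has_derivative (jac c' c x \<circ> jac c c' x)) (at (snd c x))"
  by (rule has_derivative_transform_within_open[OF _ overlap[OF c] z]) (use transition_back[OF c] in auto)
 then have "jac c' c x \<circ> jac c c' x = (\<lambda>v. v)"
  using has_derivative_unique has_derivative_ident by blast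
 then have b: "jac c' c x (jac c c' x v) = v" for v by (simp add: fun_eq_iff)
 show "jac c' c x (jac c c' x v) = v" by (rule b)
 show "inj (jac c c' x)" by (rule inj_on_inverseI[where g = "jac c' c x"]) (rule b)
qed

lemma is_form:
 assumes "is_form A u"
 shows form_out: "\<not> (c \<in> A \<and> x \<in> fst c) ==> u c x = (\<lambda>_. 0)"
  and form_alt: "alternating (u c x)"
  and form_compat: "c \<in> A ==> c' \<in> A ==> x \<in> fst c ==> x \<in> fst c' ==> u c x = (\<lambda>vs. u c' x (map (jac c c' x) vs))"
proof -
 show out: "\<not> (c \<in> A \<and> x \<in> fst c) ==> u c x = (\<lambda>_. 0)" using assms unfolding is_form_def by blast
 show "alternating (u c x)"
 proof (cases "c \<in> A \<and> x \<in> fst c")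
  case True then show ?thesis using assms unfolding is_form_def by blast
 qed (simp add: out alt_zero)
 assume "c \<in> A" "c' \<in> A" "x \<in> fst c" "x \<in> fst c'"
 then show "u c x = (\<lambda>vs. u c' x (map (jac c c' x) vs))"
  using assms unfolding is_form_def by (intro HOL.ext) blast
qed

lemma is_formI:
 assumes "\<And>c x. \<not> (c \<in> A \<and> x \<in> fst c) ==> u c x = (\<lambda>_. 0)"
  "\<And>c x. c \<in> A ==> x \<in> fst c ==> alternating (u c x)"
  "\<And>c c' x. c \<in> A ==> c' \<in> A ==> x \<in> fst c ==> x \<in> fst c' ==> u c x = (\<lambda>vs. u c' x (map (jac c c' x) vs))"
 shows "is_form A u"
 using assms unfolding is_form_def by (metis IntD1 IntD2)

text \<open>For constructions that use only the complex structure, chart independence is naturality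
  under complex-linear maps, since derivatives of transition maps are such maps.\<close>

lemma is_form_pointwise:
 assumes u: "is_form A u" and "\<And>x. P x (\<lambda>_. 0) = (\<lambda>_. 0)" "\<And>x q. alternating q ==> alternating (P x q)"
  and P: "\<And>x q L. (\<And>v. L (cJ v) = cJ (L v)) ==> P x (\<lambda>vs. q (map L vs)) = (\<lambda>vs. P x q (map L vs))"
 shows "is_form A (\<lambda>c x. P x (u c x))"
proof (rule is_formI)
 fix c c' x assume c: "c \<in> A" "c' \<in> A" "x \<in> fst c" "x \<in> fst c'"
 show "P x (u c x) = (\<lambda>vs. P x (u c' x) (map (jac c c' x) vs))"
  by (subst form_compat[OF u c]) (rule P, rule jac_scale[OF c])
qed (simp_all add: form_out[OF u] assms(2,3) form_alt[OF u])

lemma smooth_form_iff: "sf u \<longleftrightarrow> is_form A u \<and> (\<forall>c\<in>A. sfield (im c) (rp c u))"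
 unfolding smooth_form_def sfield_def by blast

lemmas smooth_formI = smooth_form_iff[THEN iffD2, OF conjI, OF _ ballI]

lemma smooth_form:
 assumes "sf u"
 shows smooth_is_form: "is_form A u" and smooth_sfield: "c \<in> A ==> sfield (im c) (rp c u)"
 using assms smooth_form_iff by blast+

lemmas smooth_alt = form_alt[OF smooth_is_form]

lemma smooth_wedge:
 assumes "sf u" "sf v"
 shows "sf (wedge_op u v)"
proof (rule smooth_formI)
 note u = smooth_form[OF assms(1)] and v = smooth_form[OF assms(2)]
 show "is_form A (wedge_op u v)"
 proof (rule is_formI)
  fix c x assume "\<not> (c \<in> A \<and> x \<in> fst c)"
  then show "wedge_op u v c x = (\<lambda>_. 0)" unfolding wedge_op_def
   by (intro HOL.ext) (simp add: form_out[OF u(1)] alt_wedge_zero_left)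
 next
  fix c c' x assume "c \<in> A" "c' \<in> A" "x \<in> fst c" "x \<in> fst c'"
  then show "wedge_op u v c x = (\<lambda>vs. wedge_op u v c' x (map (jac c c' x) vs))"
   unfolding wedge_op_def alt_wedge_map by (simp only: form_compat[OF u(1), of c c' x] form_compat[OF v(1), of c c' x])
 qed (simp add: wedge_op_def alt_alt_wedge form_alt[OF u(1)] form_alt[OF v(1)])
 show "sfield (im c) (rp c (wedge_op u v))" if "c \<in> A" for c
  unfolding wedge_op_def by (intro sfield_alt_wedge im_open u v that)
qed

lemma smooth_conj:
 assumes "sf u" shows "sf (conj_form u)"
proof (rule smooth_formI)
 note u = smooth_form[OF assms]
 show "is_form A (conj_form u)"
  unfolding conj_form_def by (rule is_form_pointwise[OF u(1)]) (simp_all add: alt_cnj)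
 show "sfield (im c) (rp c (conj_form u))" if "c \<in> A" for c
  unfolding conj_form_def by (intro sfield_cnj im_open u that)
qed

lemma smooth_add:
 assumes "sf u" "sf v" shows "sf (u + v)"
proof (rule smooth_formI)
 note u = smooth_form[OF assms(1)] and v = smooth_form[OF assms(2)]
 show "is_form A (u + v)"
 proof (rule is_formI)
  fix c c' x assume c: "c \<in> A" "c' \<in> A" "x \<in> fst c" "x \<in> fst c'"
  show "(u + v) c x = (\<lambda>vs. (u + v) c' x (map (jac c c' x) vs))"
   using fun_cong[OF form_compat[OF u(1) c]] fun_cong[OF form_compat[OF v(1) c]] by auto
 qed (auto simp: plus_fun_def form_out[OF u(1)] form_out[OF v(1)] intro!: alt_add form_alt[OF u(1)] form_alt[OF v(1)])
 show "sfield (im c) (rp c (u + v))" if "c \<in> A" for c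
  using u(2)[OF that] v(2)[OF that] unfolding sfield_def plus_fun_def by (auto intro: smooth_on_add[OF im_open[OF that]])
qed

lemma smooth_scale:
 assumes "sf u" and f: "\<And>c. c \<in> A ==> smooth_on (im c) (\<lambda>z. f (chart_inv c z))"
 shows "sf (\<lambda>c x vs. f x * u c x vs)"
proof (rule smooth_formI)
 note u = smooth_form[OF assms(1)]
 show "is_form A (\<lambda>c x vs. f x * u c x vs)"
  by (rule is_form_pointwise[OF u(1)]) (simp_all add: alt_scale)
 show "sfield (im c) (rp c (\<lambda>c x vs. f x * u c x vs))" if "c \<in> A" for c
  using u(2)[OF that] f[OF that] unfolding sfield_def by (auto intro: smooth_on_mult[OF im_open[OF that]])
qed

lemma smooth_cscale: "sf u ==> sf (\<lambda>c x vs. a * u c x vs)"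
 by (rule smooth_scale) auto

lemma smooth_diff:
 assumes "sf u" "sf v" shows "sf (u - v)"
proof -
 have "u - v = u + (\<lambda>c x vs. - 1 * v c x vs)" by (auto simp: fun_eq_iff)
 then show ?thesis using smooth_add[OF assms(1) smooth_cscale[OF assms(2)]] by metis
qed

lemma theta_thp: "theta \<sigma> u = (\<lambda>c x. thp (of_real (\<sigma> x)) (u c x))"
 unfolding theta_def thp_def form_type_part_def ..

lemma smooth_theta:
 assumes "sf u" and \<sigma>: "smooth_fun A \<sigma>"
 shows "sf (theta \<sigma> u)"
proof (rule smooth_formI)
 note u = smooth_form[OF assms(1)]
 show "is_form A (theta \<sigma> u)"
  unfolding theta_thp by (rule is_form_pointwise[OF u(1)]) (auto simp: thp_zero alt_thp thp_map)
 show "sfield (im c) (rp c (theta \<sigma> u))" if "c \<in> A" for c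
  unfolding theta_thp using \<sigma> that
  by (intro sfield_thp smooth_on_of_real im_open u that) (auto simp: smooth_fun_def o_def)
qed

lemma ext_d_dl: "ext_d u c x = (if x \<in> fst c then dl (rp c u) (snd c x) else (\<lambda>_. 0))"
 unfolding ext_d_def dl_def by auto

lemma dl_cong:
 assumes "open U" "z \<in> U" "\<And>y. y \<in> U ==> W y = W' y"
 shows "dl W z = dl W' z"
proof -
 have "fder (\<lambda>y. W y vs) z = fder (\<lambda>y. W' y vs) z" for vs
  by (rule frechet_derivative_cong_open[OF assms(1,2)]) (simp add: assms(3))
 then show ?thesis unfolding dl_def by simp
qed

lemma dl_zero: "dl (\<lambda>z vs. 0) z = (\<lambda>_. 0)"
 unfolding dl_def by (simp add: frechet_derivative_const)

lemma smooth_ext_d: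
 assumes "sf u"
 shows "sf (ext_d u)"
proof (rule smooth_formI)
 note u = smooth_form[OF assms(1)]
 show "is_form A (ext_d u)"
 proof (rule is_formI)
  fix c x assume "\<not> (c \<in> A \<and> x \<in> fst c)"
  then show "ext_d u c x = (\<lambda>_. 0)"
   using form_out[OF u(1)] dl_zero by (cases "c \<in> A") (auto simp: ext_d_dl)
 next
  fix c x assume c: "c \<in> A" "x \<in> fst c"
  then have z: "snd c x \<in> im c" by blast
  show "alternating (ext_d u c x)"
   using alt_dl[OF im_open[OF c(1)] z form_alt[OF u(1)] sfield_dfield[OF u(2)[OF c(1)] z]] c by (simp add: ext_d_dl)
 next
  \<comment> \<open>Chart independence of d: near the point one representation is the pullback of
    the other by the holomorphic transition map, and \<open>dl_pull\<close> applies.\<close>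
  fix c c' x assume c: "c \<in> A" "c' \<in> A" "x \<in> fst c" "x \<in> fst c'"
  let ?T = "transition c c'" and ?V = "snd c ` (fst c \<inter> fst c')"
  have z: "snd c x \<in> ?V" using c by blast
  have t: "?T (snd c x) = snd c' x" using c chart_inv_chart[OF c(1)] by (simp add: transition_def)
  have "rp c u y = (\<lambda>vs. rp c' u (?T y) (map (fder ?T y) vs))" if y: "y \<in> ?V" for y
  proof -
   have i: "chart_inv c y \<in> fst c" "chart_inv c y \<in> fst c'" "snd c (chart_inv c y) = y"
    using y chart_inv_chart[OF c(1)] by auto
   show ?thesis
    using form_compat[OF u(1) c(1,2) i(1,2)] unfolding i(3) transition_inv[OF c(1,2) y] .
  qed
  then have "dl (rp c u) (snd c x) = dl (\<lambda>y vs. rp c' u (?T y) (map (fder ?T y) vs)) (snd c x)"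
   by (rule dl_cong[OF overlap[OF c(1,2)] z])
  also have "\<dots> = (\<lambda>vs. dl (rp c' u) (snd c' x) (map (jac c c' x) vs))"
  proof
   fix vs
   have z': "?T (snd c x) \<in> im c'" using t c by auto
   show "dl (\<lambda>y vs. rp c' u (?T y) (map (fder ?T y) vs)) (snd c x) vs = dl (rp c' u) (snd c' x) (map (jac c c' x) vs)"
    using dl_pull[OF overlap[OF c(1,2)] transition_holo[OF c(1,2)] z im_open[OF c(2)] z' form_alt[OF u(1)] sfield_dfield[OF u(2)[OF c(2)] z']]
    by (simp add: t)
  qed
  finally show "ext_d u c x = (\<lambda>vs. ext_d u c' x (map (jac c c' x) vs))"
   using c by (simp add: ext_d_dl)
 qed
 show "sfield (im c) (rp c (ext_d u))" if "c \<in> A" for c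
 proof -
  have "sfield (im c) (dl (rp c u))" by (rule sfield_dl[OF im_open u(2)]) (rule that)+
  moreover have "rp c (ext_d u) z = dl (rp c u) z" if z: "z \<in> im c" for z
   unfolding ext_d_dl using chart_inv_in[OF \<open>c \<in> A\<close> z] chart_chart_inv[OF \<open>c \<in> A\<close> z] by simp
  ultimately show ?thesis unfolding sfield_def
   by (simp only: smooth_on_cong[OF im_open[OF that], of "\<lambda>z. rp c (ext_d u) z _" "\<lambda>z. dl (rp c u) z _"]) simp
 qed
qed

end

section \<open>The twisted operators in charts and the one-forms obtained from \<eta>\<close>

locale eta_atlas = atlas A for A :: "('a::{t2_space,second_countable_topology}, 'n::finite) chart set" +
 fixes \<eta> :: "'a => real"
 assumes \<eta>_smooth: "smooth_fun A \<eta>" and \<eta>_nz: "x \<in> carrier A ==> \<eta> x \<noteq> 0"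
begin

abbreviation e :: "('a, 'n) chart => complex^'n => real" where "e c \<equiv> (\<lambda>z. \<eta> (chart_inv c z))"

lemma e:
 assumes "c \<in> A"
 shows e_smooth: "smooth_on (im c) (e c)" and e_nz: "z \<in> im c ==> e c z \<noteq> 0"
  and e_diff: "z \<in> im c ==> e c differentiable (at z)"
proof -
 show s: "smooth_on (im c) (e c)" using \<eta>_smooth assms by (simp add: smooth_fun_def o_def)
 show "z \<in> im c ==> e c differentiable (at z)" using s by (rule smooth_on_imp_differentiable)
 show "z \<in> im c ==> e c z \<noteq> 0" using \<eta>_nz chart_inv_in[OF assms] assms by (auto simp: carrier_def)
qed

lemma smooth_inverse_eta: "smooth_fun A (\<lambda>x. 1 / \<eta> x)"
 unfolding smooth_fun_def o_def by (intro ballI smooth_on_divide im_open e_smooth smooth_on_const e_nz)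

text \<open>Statements on the conjugate operator are obtained by conjugating those on
  \<open>D_eta\<close> at -\<eta>, so the setting has to be stable under the change of sign.\<close>

lemma minus: "eta_atlas A (\<lambda>x. - \<eta> x)"
proof unfold_locales
 show "smooth_fun A (\<lambda>x. - \<eta> x)"
  unfolding smooth_fun_def o_def by (intro ballI smooth_on_minus im_open e_smooth)
qed (use \<eta>_nz in auto)

lemma smooth_D: "sf u ==> sf (D_eta \<eta> u)"
 unfolding D_eta_def o_def by (intro smooth_theta smooth_ext_d \<eta>_smooth smooth_inverse_eta)

lemma smooth_Dbar: "sf u ==> sf (Dbar_minus_eta \<eta> u)"
 unfolding Dbar_minus_eta_def conj_op_def by (intro smooth_conj eta_atlas.smooth_D[OF minus])

lemma D_Dl: "c \<in> A ==> x \<in> fst c ==> D_eta \<eta> u c x = Dl (e c) (rp c u) (snd c x)"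
 unfolding D_eta_def o_def theta_thp Dl_def by (simp add: ext_d_dl chart_inv_chart)

lemma Dbar_Dbl: "c \<in> A ==> x \<in> fst c ==> Dbar_minus_eta \<eta> u c x = Dbl (e c) (rp c u) (snd c x)"
 unfolding Dbar_minus_eta_def conj_op_def Dbl_def by (simp add: conj_form_def eta_atlas.D_Dl[OF minus])

lemma smooth_form_of_eta: "sf (form_of_fun A \<eta>)"
proof (rule smooth_formI)
 have a: "alternating (\<lambda>vs. if vs = [] then r else (0::complex))" for r :: complex
  unfolding alternating_def by (auto simp: list_update_nonempty intro!: linear_zero)
 show "is_form A (form_of_fun A \<eta>)"
 proof (rule is_formI)
  fix c x assume "c \<in> A" "x \<in> fst c"
  then show "alternating (form_of_fun A \<eta> c x)" using a[of "of_real (\<eta> x)"] by (simp add: form_of_fun_def)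
 qed (auto simp: form_of_fun_def)
 show "sfield (im c) (rp c (form_of_fun A \<eta>))" if c: "c \<in> A" for c
  unfolding sfield_def
 proof
  fix vs :: "(complex^'n) list"
  have "smooth_on (im c) (\<lambda>z. if vs = [] then complex_of_real (e c z) else 0)"
   by (cases "vs = []") (auto intro!: smooth_on_of_real im_open e_smooth c)
  then show "smooth_on (im c) (\<lambda>z. form_of_fun A \<eta> c (chart_inv c z) vs)"
   by (subst smooth_on_cong[OF im_open[OF c]]) (use chart_inv_in[OF c] in \<open>auto simp: form_of_fun_def c\<close>)
 qed
qed

lemma type_part_1: "type_part 1 0 q [v] = (q [v] - \<i> * q [cJ v]) / 2" "type_part 0 1 q [v] = (q [v] + \<i> * q [cJ v]) / 2"
proof -
 have P: "Pow {..<Suc 0} = {{}, {0}}" by (auto simp: lessThan_Suc)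
 have "{S. S \<subseteq> {..<Suc 0} \<and> card S = 1} = {{0}}" "{S. S \<subseteq> {..<Suc 0} \<and> card S = 0} = {{}}"
  unfolding Pow_iff[symmetric] P by auto
 then show "type_part 1 0 q [v] = (q [v] - \<i> * q [cJ v]) / 2" "type_part 0 1 q [v] = (q [v] + \<i> * q [cJ v]) / 2"
  unfolding type_part_def by (simp_all add: P)
qed

lemma type_part_fun: "vs \<noteq> [] ==> type_part p q (form_of_fun A \<eta> c x) vs = 0"
 unfolding type_part_def form_of_fun_def by simp

lemma type_part_0: "type_part 0 0 (form_of_fun A \<eta> c x) = form_of_fun A \<eta> c x"
proof -
 have "{S::nat set. S = {} \<and> card S = 0} = {{}}" by auto
 then show ?thesis by (intro HOL.ext) (auto simp: type_part_def form_of_fun_def)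
qed

lemma type_part_zero: "type_part p q (\<lambda>_. 0) vs = 0"
 unfolding type_part_def by simp

lemma ext_d_type_part_fun:
 assumes "(p, q) \<noteq> (0, 0)" shows "ext_d (form_type_part p q (form_of_fun A \<eta>)) c x = (\<lambda>_. 0)"
proof -
 have "form_type_part p q (form_of_fun A \<eta>) c x = (\<lambda>_. 0)" for c x
 proof
  fix vs
  show "form_type_part p q (form_of_fun A \<eta>) c x vs = 0"
   using assms type_part_fun[of vs p q c x] by (cases "vs = []") (auto simp: form_type_part_def type_part_def)
 qed
 then show ?thesis unfolding ext_d_dl by (simp add: dl_zero)
qed

definition dfun :: "('a, 'n) form" where "dfun = ext_d (form_of_fun A \<eta>)"

lemma dfun_eq:
 assumes "c \<in> A" "x \<in> fst c"
 shows "dfun c x vs = (if length vs = 1 then of_real (fder (e c) (snd c x) (hd vs)) else 0)"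
proof -
 have z: "snd c x \<in> im c" using assms by blast
 have 1: "fder (\<lambda>y. form_of_fun A \<eta> c (chart_inv c y) []) (snd c x) v = of_real (fder (e c) (snd c x) v)" for v
 proof -
  have "((\<lambda>y. complex_of_real (e c y)) has_derivative (\<lambda>h. of_real (fder (e c) (snd c x) h))) (at (snd c x))"
   by (intro has_derivative_of_real fder_works e_diff[OF assms(1) z])
  then have "((\<lambda>y. form_of_fun A \<eta> c (chart_inv c y) []) has_derivative (\<lambda>h. of_real (fder (e c) (snd c x) h))) (at (snd c x))"
   by (rule has_derivative_transform_within_open[OF _ im_open[OF assms(1)] z])
    (use chart_inv_in[OF assms(1)] assms in \<open>auto simp: form_of_fun_def\<close>)
  then show ?thesis by (rule fder_eqI)
 qed
 have 2: "fder (\<lambda>y. form_of_fun A \<eta> c (chart_inv c y) vs) z v = 0" if "vs \<noteq> []" for vs z v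
  using that by (simp add: form_of_fun_def frechet_derivative_const)
 have t: "take i vs @ drop (Suc i) vs \<noteq> []" if "length vs \<noteq> 1" "i < length vs" for i
  using that by auto
 show ?thesis
 proof (cases "length vs = 1")
  case True
  then obtain v where "vs = [v]" by (auto simp: length_Suc_conv)
  then show ?thesis using assms by (simp add: dfun_def ext_d_dl dl_def 1)
 next
  case False
  then show ?thesis using assms t by (simp add: dfun_def ext_d_dl dl_def 2)
 qed
qed

lemma dfun_out: "\<not> (c \<in> A \<and> x \<in> fst c) ==> dfun c x = (\<lambda>_. 0)"
 unfolding dfun_def by (rule form_out[OF smooth_is_form[OF smooth_ext_d[OF smooth_form_of_eta]]])

lemma dfun_degree: "length vs \<noteq> 1 ==> dfun c x vs = 0"
 using dfun_eq[of c x vs] dfun_out[of c x] by (cases "c \<in> A \<and> x \<in> fst c") auto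

text \<open>A function has bidegree (0,0) only, so in the sums defining \<open>del\<close> and
  \<open>delbar\<close> just p = 0 on lists of length one contributes.\<close>

lemma del_fun:
 "del (form_of_fun A \<eta>) c x vs = (if length vs = 1 then (dfun c x vs - \<i> * dfun c x [cJ (hd vs)]) / 2 else 0)"
 "delbar (form_of_fun A \<eta>) c x vs = (if length vs = 1 then (dfun c x vs + \<i> * dfun c x [cJ (hd vs)]) / 2 else 0)"
proof -
 have d: "ext_d (form_type_part 0 0 (form_of_fun A \<eta>)) = dfun"
  unfolding form_type_part_def type_part_0 dfun_def ..
 have "form_type_part p' q' (ext_d (form_type_part p (length vs - Suc p) (form_of_fun A \<eta>))) c x vs = 0"
  if "length vs \<noteq> 1" "p < length vs" for p p' q'
 proof -
  have "(p, length vs - Suc p) \<noteq> (0, 0)"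
  proof
   assume "(p, length vs - Suc p) = (0, 0)"
   then have "p = 0" "length vs \<le> 1" by auto
   with that show False by linarith
  qed
  from ext_d_type_part_fun[OF this, of c x] show ?thesis by (simp add: form_type_part_def[of p' q'] type_part_zero)
 qed
 then have "length vs \<noteq> 1 ==> del (form_of_fun A \<eta>) c x vs = 0" "length vs \<noteq> 1 ==> delbar (form_of_fun A \<eta>) c x vs = 0"
  by (simp_all add: del_def delbar_def Let_def)
 moreover have "del (form_of_fun A \<eta>) c x [v] = (dfun c x [v] - \<i> * dfun c x [cJ v]) / 2"
  "delbar (form_of_fun A \<eta>) c x [v] = (dfun c x [v] + \<i> * dfun c x [cJ v]) / 2" for v
  using type_part_1 by (simp_all add: del_def delbar_def Let_def form_type_part_def d[unfolded form_type_part_def])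
 ultimately show "del (form_of_fun A \<eta>) c x vs = (if length vs = 1 then (dfun c x vs - \<i> * dfun c x [cJ (hd vs)]) / 2 else 0)"
  "delbar (form_of_fun A \<eta>) c x vs = (if length vs = 1 then (dfun c x vs + \<i> * dfun c x [cJ (hd vs)]) / 2 else 0)"
  by (auto simp: length_Suc_conv)
qed

lemma thp_degree_one:
 assumes "\<And>vs. length vs \<noteq> 1 ==> q vs = 0"
 shows "thp s q vs = (if length vs = 1 then ((s + 1) * q vs + \<i> * (1 - s) * q [cJ (hd vs)]) / 2 else 0)"
proof -
 have "q = (\<lambda>vs. (if length vs = 1 then 1 else 0) * q vs)" using assms by (intro HOL.ext) auto
 then have "thp s q vs = (if length vs = 1 then 1 else 0) * thp s q vs"
  using thp_degree[of s "\<lambda>k. if k = 1 then 1 else 0" q vs] by simp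
 then show ?thesis by (auto simp: length_Suc_conv thp_Cons thp_Nil)
qed

text \<open>The one-form before division by \<eta>, as in the statement; \<open>ps_eq\<close>
  relates it to the divided form \<open>alc\<close>, and its companion \<open>psb\<close> to
  \<open>bec\<close>.\<close>

definition psa :: "('a, 'n) form" where "psa = d_eta \<eta> (form_of_fun A \<eta>)"
definition psb :: "('a, 'n) form" where "psb = dbar_minus_eta \<eta> (form_of_fun A \<eta>)"

lemma psa_theta: "psa = theta \<eta> dfun"
 unfolding psa_def theta_thp
 by (intro HOL.ext, subst thp_degree_one) (auto simp: dfun_degree d_eta_def scale_op_def del_fun field_simps)

lemma psb_theta: "psb = conj_form (theta (\<lambda>x. - \<eta> x) dfun)"
proof -
 have r: "cnj (dfun c x vs) = dfun c x vs" for c x vs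
  using dfun_eq[of c x vs] dfun_out[of c x] by (cases "c \<in> A \<and> x \<in> fst c") auto
 show ?thesis
  unfolding psb_def theta_thp conj_form_def
  by (intro HOL.ext, subst thp_degree_one) (auto simp: dfun_degree dbar_minus_eta_def scale_op_def del_fun field_simps r)
qed

lemma smooth_ps: "sf psa" "sf psb"
 unfolding psa_theta psb_theta dfun_def
 by (intro smooth_conj smooth_theta smooth_ext_d smooth_form_of_eta \<eta>_smooth eta_atlas.\<eta>_smooth[OF minus])+

lemma ps_eq:
 assumes "c \<in> A" "x \<in> fst c"
 shows "psa c x vs = (if length vs = 1 then \<eta> x * alc (e c) (snd c x) (hd vs) else 0)"
  and "psb c x vs = (if length vs = 1 then \<eta> x * bec (e c) (snd c x) (hd vs) else 0)"
proof -
 have z: "snd c x \<in> im c" using assms by blast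
 have [simp]: "e c (snd c x) = \<eta> x" using chart_inv_chart assms by simp
 have nz: "\<eta> x \<noteq> 0" using e_nz[OF assms(1) z] by simp
 have f: "fder (e c) (snd c x) v = (\<Sum>b\<in>Basis. (v \<bullet> b) * fder (e c) (snd c x) b)" for v
 proof -
  have "fder (e c) (snd c x) (\<Sum>b\<in>Basis. (v \<bullet> b) *\<^sub>R b) = (\<Sum>b\<in>Basis. (v \<bullet> b) * fder (e c) (snd c x) b)"
   by (subst linear_sum[OF fder_linear[OF e_diff[OF assms(1) z]]])
    (simp add: linear_cmul[OF fder_linear[OF e_diff[OF assms(1) z]]])
  then show ?thesis by (simp only: euclidean_representation)
 qed
 have "\<eta> x * alc (e c) (snd c x) v = tw1 (of_real (\<eta> x)) (\<lambda>v. of_real (fder (e c) (snd c x) v)) v" for v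
  unfolding alc_def tw1_def f[of v] f[of "cJ v"]
  by (simp add: sum_distrib_left sum.distrib[symmetric] sum_divide_distrib nz) (auto simp: algebra_simps intro!: sum.cong)
 then show "psa c x vs = (if length vs = 1 then \<eta> x * alc (e c) (snd c x) (hd vs) else 0)"
  unfolding psa_theta theta_thp by (subst thp_degree_one) (auto simp: dfun_degree dfun_eq[OF assms] tw1_def)
 have "\<eta> x * bec (e c) (snd c x) v = tw2 (of_real (\<eta> x)) (\<lambda>v. of_real (fder (e c) (snd c x) v)) v" for v
  unfolding bec_def tw2_def f[of v] f[of "cJ v"]
  by (simp add: sum_distrib_left sum_subtractf[symmetric] sum_divide_distrib nz) (auto simp: algebra_simps intro!: sum.cong)
 then show "psb c x vs = (if length vs = 1 then \<eta> x * bec (e c) (snd c x) (hd vs) else 0)"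
  unfolding psb_theta theta_thp conj_form_def by (subst thp_degree_one) (auto simp: dfun_degree dfun_eq[OF assms] tw2_def)
qed

lemma wedge_one: "(\<And>vs. \<psi> vs = (if length vs = 1 then a (hd vs) else 0)) ==> alt_wedge \<psi> q = ext a q" for \<psi> :: "'m::finite alt"
proof
 fix vs assume "\<And>vs. \<psi> vs = (if length vs = 1 then a (hd vs) else 0)"
 then have "\<psi> = ext a (\<lambda>ws. if ws = [] then 1 else 0)"
 proof (intro HOL.ext)
  fix vs assume \<psi>: "\<And>vs. \<psi> vs = (if length vs = 1 then a (hd vs) else 0)"
  show "\<psi> vs = ext a (\<lambda>ws. if ws = [] then 1 else 0) vs"
   unfolding \<psi> by (cases vs) (auto simp: ext_zero)
 qed
 moreover have "alt_wedge (\<lambda>ws. if ws = [] then 1 else 0) q = q"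
 proof
  fix vs show "alt_wedge (\<lambda>ws. if ws = [] then 1 else 0) q vs = q vs"
  proof (induction vs arbitrary: q)
   case (Cons v vs)
   have "(\<lambda>ws. (- 1) ^ length ws * (if ws = [] then 1 else 0)) = (\<lambda>ws::(complex,'m) vec list. if ws = [] then 1 else (0::complex))" by auto
   then show ?case unfolding alt_wedge_Cons using Cons.IH by (simp add: alt_wedge_zero_left)
  qed (simp add: alt_wedge_Nil)
 qed
 ultimately show "alt_wedge \<psi> q vs = ext a q vs"
  by (simp add: alt_wedge_ext_left)
qed

end

lemma type_part_11: "type_part 1 1 q [u, v] = (q [u, v] + q [cJ u, cJ v]) / 2"
proof -
 have P: "Pow {..<Suc (Suc 0)} = {{}, {0}, {1}, {0, 1}}" by (auto simp: lessThan_Suc)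
 have S: "{S. S \<subseteq> {..<Suc (Suc 0)} \<and> card S = 1} = {{0}, {1}}"
  unfolding Pow_iff[symmetric] P by auto
 have d: "({0} :: nat set) \<noteq> {Suc 0}" "({} :: nat set) \<noteq> {0, Suc 0}" "({0} :: nat set) \<noteq> {0, Suc 0}" "({Suc 0} :: nat set) \<noteq> {0, Suc 0}" by auto
 have "type_part 1 1 q [u, v] = ((q [u, v] - \<i> * q [cJ u, v] + \<i> * q [u, cJ v] + q [cJ u, cJ v])
   + (q [u, v] + \<i> * q [cJ u, v] - \<i> * q [u, cJ v] + q [cJ u, cJ v])) / 4"
  unfolding type_part_def using S by (simp add: P d)
 also have "\<dots> = (q [u, v] + q [cJ u, cJ v]) / 2" by (simp add: field_simps)
 finally show ?thesis .
qed

section \<open>Pointwise metric operations on a Hermitian manifold\<close>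

locale herm = eta_atlas A \<eta>
 for A :: "('a::{t2_space,second_countable_topology}, 'n::finite) chart set" and \<eta> :: "'a => real" +
 fixes \<omega> :: "('a, 'n) form"
 assumes hm: "hermitian_manifold A \<omega>"
begin

abbreviation pin :: "('a, 'n) form => ('a, 'n) form => 'a => complex" where "pin == pointwise_inner A \<omega>"

lemma minus_herm: "herm A (\<lambda>x. - \<eta> x) \<omega>"
 using minus hm by (simp add: herm_def herm_axioms_def)

lemma smooth_\<omega>: "sf \<omega>"
 using hm by (simp add: hermitian_manifold_def)

lemma \<omega>_real: "conj_form \<omega> = \<omega>"
 using hm by (simp add: hermitian_manifold_def)

lemma \<omega>_hp:
 assumes "c \<in> A" "x \<in> fst c"
 shows "hpoint (\<omega> c x)"
proof
 show a: "alternating (\<omega> c x)" by (rule smooth_alt[OF smooth_\<omega>])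
 have t: "\<omega> c x vs = type_part 1 1 (\<omega> c x) vs" for vs
  using hm unfolding hermitian_manifold_def form_type_part_def by metis
 show "length vs \<noteq> 2 ==> \<omega> c x vs = 0" for vs
  by (subst t) (simp add: type_part_def)
 have neg: "\<omega> c x [- u, - v] = \<omega> c x [u, v]" for u v
  using linear_neg[OF alt_linear2[OF a]] linear_neg[OF alt_linear[OF a]] by simp
 show "\<omega> c x [cJ u, cJ v] = \<omega> c x [u, v]" for u v
  by (subst (1 2) t) (simp add: type_part_11 neg del: One_nat_def)
 show "cnj (\<omega> c x vs) = \<omega> c x vs" for vs
  using fun_cong[OF fun_cong[OF fun_cong[OF \<omega>_real]], of c x vs] by (simp add: conj_form_def)
 show "v \<noteq> 0 ==> 0 < Re (\<omega> c x [v, cJ v])" for v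
  using hm assms unfolding hermitian_manifold_def by blast
qed

lemma mf: "c \<in> A ==> metric_field (im c) (rp c \<omega>)"
 by (intro metric_field.intro im_open smooth_sfield smooth_\<omega> \<omega>_hp chart_inv_in)

abbreviation frame :: "('a, 'n) chart => 'a => (complex^'n) list => bool" where
 "frame c x fs \<equiv> hframe (\<omega> c x) (set fs) \<and> distinct fs"

lemma orthonormal_frame_iff:
 assumes "c \<in> A" "x \<in> fst c"
 shows "orthonormal_frame \<omega> c x fs \<longleftrightarrow> frame c x fs"
proof -
 interpret hpoint "\<omega> c x" by (rule \<omega>_hp[OF assms])
 have d: "distinct fs" if "\<forall>a<length fs. \<forall>b<length fs. g (fs ! a) (fs ! b) = (if a = b then 1 else 0)"
  using that unfolding distinct_conv_nth by (metis zero_neq_one)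
 have "orth (set fs) \<longleftrightarrow> (\<forall>a<length fs. \<forall>b<length fs. g (fs ! a) (fs ! b) = (if a = b then 1 else 0))" if "distinct fs"
  unfolding orth_def all_set_conv_all_nth using nth_eq_iff_index_eq[OF that] by auto
 then show ?thesis
  unfolding orthonormal_frame_def hframe_def hframe_axioms_def w_eq using hpoint_axioms d
  by (auto simp: distinct_card of_real_eq_iff[of _ 0, simplified] of_real_eq_iff[of _ 1, simplified] split: if_splits)
qed

lemma ex_frame: "c \<in> A ==> x \<in> fst c ==> \<exists>fs. frame c x fs"
 by (rule hpoint_ex_frame[OF \<omega>_hp])

text \<open>Frees the inner product from its choices of chart and frame: every orthonormal frame
  gives the same value, and the change to the given chart is an isometry.\<close>

lemma pointwise_inner_innG:
 assumes c: "c \<in> A" "x \<in> fst c" and u: "is_form A u" and v: "is_form A v"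
 shows "pin u v x = innG (\<omega> c x) (u c x) (v c x)"
proof -
 define c' where "c' = (SOME c. c \<in> A \<and> x \<in> fst c)"
 have c': "c' \<in> A" "x \<in> fst c'" using someI[of "\<lambda>c. c \<in> A \<and> x \<in> fst c" c] c unfolding c'_def by blast+
 define fs where "fs = (SOME fs. orthonormal_frame \<omega> c' x fs)"
 have o: "orthonormal_frame \<omega> c' x fs"
  using someI_ex[of "orthonormal_frame \<omega> c' x"] ex_frame[OF c'] orthonormal_frame_iff[OF c'] unfolding fs_def by blast
 have l: "length fs = 2 * CARD('n)" using o by (simp add: orthonormal_frame_def)
 have "pin u v x = inn fs (u c' x) (v c' x)"
  unfolding pointwise_inner_def Let_def c'_def[symmetric] fs_def[symmetric] inn_def l ..
 also have "\<dots> = innG (\<omega> c' x) (u c' x) (v c' x)"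
  by (rule inn_eq_innG) (use o orthonormal_frame_iff[OF c'] form_alt[OF u] form_alt[OF v] in auto)
 also have "\<dots> = innG (\<omega> c x) (\<lambda>vs. u c' x (map (jac c c' x) vs)) (\<lambda>vs. v c' x (map (jac c c' x) vs))"
  by (rule innG_pull[symmetric, OF \<omega>_hp[OF c] \<omega>_hp[OF c'] form_alt[OF u] form_alt[OF v]])
   (use c c' jac_linear jac_inj jac_scale fun_cong[OF form_compat[OF smooth_is_form[OF smooth_\<omega>] c(1) c'(1) c(2) c'(2)]] in auto)
 also have "\<dots> = innG (\<omega> c x) (u c x) (v c x)"
  using form_compat[OF u c(1) c'(1) c(2) c'(2)] form_compat[OF v c(1) c'(1) c(2) c'(2)] by simp
 finally show ?thesis .
qed

lemma pointwise_inner_frame: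
 assumes c: "c \<in> A" "x \<in> fst c" and fs: "frame c x fs" and u: "is_form A u" and v: "is_form A v"
 shows "pin u v x = inn fs (u c x) (v c x)"
 unfolding pointwise_inner_innG[OF c u v] by (rule inn_eq_innG[symmetric]) (use fs form_alt[OF u] form_alt[OF v] in auto)

definition Lh :: "('a, 'n) operator" where "Lh u = (\<lambda>c x. LamG (\<omega> c x) (u c x))"

definition adh :: "('a, 'n) operator => ('a, 'n) operator" where
 "adh P = (\<lambda>u. Lh (P u) - P (Lh u))"

lemma is_form_Lh:
 assumes u: "is_form A u" shows "is_form A (Lh u)"
proof (rule is_formI)
 fix c c' x assume c: "c \<in> A" "c' \<in> A" "x \<in> fst c" "x \<in> fst c'"
 show "Lh u c x = (\<lambda>vs. Lh u c' x (map (jac c c' x) vs))"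
  unfolding Lh_def form_compat[OF u c]
  by (rule HOL.ext, rule LamG_pull[OF \<omega>_hp[OF c(1,3)] \<omega>_hp[OF c(2,4)] form_alt[OF u]])
   (use c jac_linear jac_inj jac_scale fun_cong[OF form_compat[OF smooth_is_form[OF smooth_\<omega>] c]] in auto)
next
 fix c x assume "c \<in> A" "x \<in> fst c"
 then show "alternating (Lh u c x)" unfolding Lh_def by (intro alt_LamG \<omega>_hp form_alt[OF u])
qed (simp add: Lh_def form_out[OF u] LamG_def)

lemma smooth_Lh:
 assumes u: "sf u" shows "sf (Lh u)"
proof (rule smooth_formI)
 show "sfield (im c) (rp c (Lh u))" if "c \<in> A" for c
  unfolding Lh_def by (rule metric_field.sfield_LamG[OF mf[OF that] smooth_alt[OF u] smooth_sfield[OF u that]])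
qed (rule is_form_Lh[OF smooth_is_form[OF u]])

lemma Lh_frame: "frame c x fs ==> is_form A u ==> Lh u c x = Lam (set fs) (u c x)"
 unfolding Lh_def by (rule Lam_eq_LamG[symmetric]) (auto intro: form_alt)

lemma smooth_adh: "(\<And>u. sf u ==> sf (P u)) ==> sf u ==> sf (adh P u)"
 unfolding adh_def by (intro smooth_diff smooth_Lh) (auto intro: smooth_Lh)

text \<open>The class of operators given by linear algebra at each point, to which the results on
  \<open>adL\<close> transfer. It is closed under commutators with \<Lambda>.\<close>

definition ptw :: "('a, 'n) chart => 'a => ('a, 'n) operator => ('n alt => 'n alt) => bool" where
 "ptw c x P P0 \<longleftrightarrow> (\<forall>u. sf u --> sf (P u) \<and> P u c x = P0 (u c x))"

lemma ptw_wedge: "sf \<psi> ==> ptw c x (wedge_op \<psi>) (alt_wedge (\<psi> c x))"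
 unfolding ptw_def using smooth_wedge by (simp add: wedge_op_def)

lemma ptw_adh: "frame c x fs ==> ptw c x P P0 ==> ptw c x (adh P) (adL (set fs) P0)"
 unfolding ptw_def using smooth_adh[of P] smooth_Lh
 by (auto simp: adh_def Lh_frame smooth_is_form adL_def fun_diff_def)

abbreviation \<gamma> :: "('a, 'n) form" where "\<gamma> \<equiv> Dbar_minus_eta \<eta> \<omega>"
abbreviation \<gamma>' :: "('a, 'n) form" where "\<gamma>' \<equiv> D_eta \<eta> \<omega>"

text \<open>Commutator expressions for the formal adjoints of \<open>\<gamma> \<and> \<cdot>\<close>, of multiplication by the two derivatives of \<open>\<eta>\<close>,
and of the operators \<open>Dbar_minus_eta \<eta>\<close> and \<open>D_eta \<eta>\<close>.\<close>

definition Gs :: "('a, 'n) operator" where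
 "Gs u = (\<lambda>c x vs. \<i> / 6 * adh (adh (adh (wedge_op \<gamma>'))) u c x vs)"

definition bs :: "('a, 'n) operator" where "bs u = (\<lambda>c x vs. - \<i> * adh (wedge_op psa) u c x vs)"
definition as :: "('a, 'n) operator" where "as u = (\<lambda>c x vs. \<i> * adh (wedge_op psb) u c x vs)"

definition Dbs :: "('a, 'n) operator" where
 "Dbs u = (\<lambda>c x vs. \<i> * adh (D_eta \<eta>) u c x vs + \<i> / 2 * adh (adh (wedge_op \<gamma>')) u c x vs
   - of_nat CARD('n) * (1 / of_real (\<eta> x) * bs u c x vs))"

definition Ds :: "('a, 'n) operator" where
 "Ds u = (\<lambda>c x vs. - \<i> * adh (Dbar_minus_eta \<eta>) u c x vs - \<i> / 2 * adh (adh (wedge_op \<gamma>)) u c x vs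
   - of_nat CARD('n) * (1 / of_real (\<eta> x) * as u c x vs))"

lemma smooth_ops:
 assumes "sf u"
 shows "sf (Gs u)" "sf (bs u)" "sf (as u)" "sf (Dbs u)" "sf (Ds u)"
proof -
 note s = smooth_wedge[OF smooth_D[OF smooth_\<omega>]] smooth_wedge[OF smooth_Dbar[OF smooth_\<omega>]] smooth_wedge[OF smooth_ps(1)]
  smooth_wedge[OF smooth_ps(2)] smooth_adh smooth_D smooth_Dbar
 have \<eta>: "smooth_on (im c) (\<lambda>z. 1 / complex_of_real (\<eta> (chart_inv c z)))" if "c \<in> A" for c
  by (rule smooth_on_divide[OF im_open[OF that] smooth_on_const smooth_on_of_real[OF im_open[OF that] e_smooth[OF that]]])
   (simp only: of_real_eq_0_iff not_False_eq_True e_nz[OF that])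
 have add: "sf (\<lambda>c x vs. u c x vs + v c x vs)" if "sf u" "sf v" for u v
  using smooth_add[OF that] by (simp add: plus_fun_def)
 have diff: "sf (\<lambda>c x vs. u c x vs - v c x vs)" if "sf u" "sf v" for u v
  using smooth_diff[OF that] by (simp add: fun_diff_def)
 show "sf (Gs u)" and b: "sf (bs u)" and a: "sf (as u)"
  unfolding Gs_def bs_def as_def by (intro smooth_cscale s assms; assumption)+
 show "sf (Dbs u)" "sf (Ds u)"
  unfolding Dbs_def Ds_def by (intro add diff smooth_cscale smooth_scale[OF _ \<eta>] a b s assms; assumption)+
qed

context
 fixes c x fs
 assumes c: "c \<in> A" "x \<in> fst c" and fs: "frame c x fs"
begin

lemma e_at: "e c (snd c x) = \<eta> x" "rp c u (snd c x) = u c x" "\<eta> x \<noteq> 0" "snd c x \<in> im c"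
 using chart_inv_chart c e_nz[of c "snd c x"] by auto

lemma inn_wedge_\<omega>: "sf v ==> inn fs (wedge_op \<omega> u c x) (v c x) = inn fs (u c x) (Lh v c x)"
 using hframe.adj_w[OF conjunct1[OF fs] refl conjunct2[OF fs] smooth_alt] by (simp add: wedge_op_def Lh_frame[OF fs smooth_is_form])

lemma inn_wedge_\<gamma>:
 assumes v: "sf v"
 shows "inn fs (wedge_op \<gamma> u c x) (v c x) = inn fs (u c x) (Gs v c x)"
proof -
 interpret m: metric_field "im c" "rp c \<omega>" by (rule mf[OF c(1)])
 have "ptw c x (adh (adh (adh (wedge_op \<gamma>')))) (adL (set fs) (adL (set fs) (adL (set fs) (alt_wedge (\<gamma>' c x)))))"
  by (intro ptw_adh fs ptw_wedge smooth_D smooth_\<omega>)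
 then have "Gs v c x = (\<lambda>vs. \<i> / 6 * adL (set fs) (adL (set fs) (adL (set fs) (alt_wedge (\<gamma>' c x)))) (v c x) vs)"
  unfolding Gs_def ptw_def using v by simp
 then show ?thesis
  unfolding wedge_op_def D_Dl[OF c] Dbar_Dbl[OF c]
  using m.adj_Dbl_\<Omega>[OF e_at(4) e_diff[OF c(1) e_at(4)], of fs "v c x" "u c x"] fs e_at smooth_alt[OF v] by simp
qed

text \<open>By \<open>Lam_ext\<close> and the J-relation between the two one-forms, the commutator
  with one of them is contraction with the conjugate of the other. Hence \<open>bs\<close> is built
  from \<open>psa\<close> and \<open>as\<close> from \<open>psb\<close>.\<close>

lemma adh_ps:
 assumes v: "sf v"
 shows "adh (wedge_op psa) v c x = (\<lambda>vs. \<i> * (\<eta> x * cov (set fs) (\<lambda>y. cnj (bec (e c) (snd c x) y)) (v c x) vs))"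
  "adh (wedge_op psb) v c x = (\<lambda>vs. - \<i> * (\<eta> x * cov (set fs) (\<lambda>y. cnj (alc (e c) (snd c x) y)) (v c x) vs))"
proof -
 interpret hframe "\<omega> c x" "set fs" using fs by blast
 interpret m: metric_field "im c" "rp c \<omega>" by (rule mf[OF c(1)])
 note av = smooth_alt[OF v, of c x]
 have ad: "adh (wedge_op \<psi>) v c x = adL (set fs) (alt_wedge (\<psi> c x)) (v c x)" if "sf \<psi>" for \<psi>
  using ptw_adh[OF fs ptw_wedge[OF that]] v unfolding ptw_def by blast
 have b: "bec (e c) z (cJ y) = \<i> * cnj (alc (e c) z y)" for z y
  using m.alc_J[of "e c" z "cJ y"] m.alc_J[of "e c" z y] linear_neg[OF m.linear_alc[of "e c" z], of y] by (simp add: complex_eq_iff)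
 have 1: "adL (set fs) (ext (\<lambda>y. s * a y)) q = (\<lambda>vs. - (s * cov (set fs) (\<lambda>y. a (cJ y)) q vs))" if "linear a" "alternating q" for s a q
  unfolding adL_def Lam_ext[OF that(2) linear_mult_left[OF that(1)]] cov_cov_scale by simp
 show "adh (wedge_op psa) v c x = (\<lambda>vs. \<i> * (\<eta> x * cov (set fs) (\<lambda>y. cnj (bec (e c) (snd c x) y)) (v c x) vs))"
  unfolding ad[OF smooth_ps(1)] wedge_one[OF ps_eq(1)[OF c], abs_def] 1[OF m.linear_alc av] m.alc_J cov_cov_scale by (simp add: mult_ac)
 show "adh (wedge_op psb) v c x = (\<lambda>vs. - \<i> * (\<eta> x * cov (set fs) (\<lambda>y. cnj (alc (e c) (snd c x) y)) (v c x) vs))"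
  unfolding ad[OF smooth_ps(2)] wedge_one[OF ps_eq(2)[OF c], abs_def] 1[OF m.linear_bec av] b cov_cov_scale by (simp add: mult_ac)
qed

lemma inn_wedge_ps:
 assumes v: "sf v"
 shows "inn fs (wedge_op psb u c x) (v c x) = inn fs (u c x) (bs v c x)"
  "inn fs (wedge_op psa u c x) (v c x) = inn fs (u c x) (as v c x)"
proof -
 have s: "cov (set fs) (\<lambda>v. complex_of_real (\<eta> x) * a v) (v c x) = (\<lambda>vs. of_real (\<eta> x) * cov (set fs) a (v c x) vs)" for a
  by (rule HOL.ext) (rule cov_cov_scale)
 show "inn fs (wedge_op psb u c x) (v c x) = inn fs (u c x) (bs v c x)"
  "inn fs (wedge_op psa u c x) (v c x) = inn fs (u c x) (as v c x)"
  unfolding wedge_op_def wedge_one[OF ps_eq(1)[OF c]] wedge_one[OF ps_eq(2)[OF c]]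
   inn_ext[OF smooth_alt[OF v] conjunct2[OF fs]] bs_def as_def adh_ps[OF v]
  by (simp_all add: s mult.assoc[symmetric] del: mult.assoc)
qed

lemma Dbs_MM:
 assumes v: "sf v"
 shows "Dbs v c x = metric_field.MM (rp c \<omega>) (e c) (set fs) (rp c v) (snd c x)"
proof -
 interpret m: metric_field "im c" "rp c \<omega>" by (rule mf[OF c(1)])
 have "ptw c x (adh (adh (wedge_op \<gamma>'))) (adL (set fs) (adL (set fs) (alt_wedge (\<gamma>' c x))))"
  by (intro ptw_adh fs ptw_wedge smooth_D smooth_\<omega>)
 then have 1: "adh (adh (wedge_op \<gamma>')) v c x = adL (set fs) (adL (set fs) (alt_wedge (\<gamma>' c x))) (v c x)"
  unfolding ptw_def using v by simp
 have 2: "adh (D_eta \<eta>) v c x vs = Lam (set fs) (Dl (e c) (rp c v) (snd c x)) vs - Dl (e c) (\<lambda>y. LamG (rp c \<omega> y) (rp c v y)) (snd c x) vs" for vs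
  unfolding adh_def using Lh_frame[OF fs smooth_is_form[OF smooth_D[OF v]]] by (simp add: D_Dl[OF c] Lh_def)
 show ?thesis
  unfolding m.MM_def Dbs_def 1 2 bs_def adh_ps(1)[OF v] D_Dl[OF c] e_at(2) by (simp add: e_at(3) cov_cov_scale mult.assoc[symmetric] del: mult.assoc)
qed

end

end

section \<open>Change of variables for holomorphic maps\<close>

text \<open>The library's change of variables formula is stated for \<open>real^'m\<close> with a well-ordered index type.\<close>

typedef (overloaded) ('n::finite) ridx = "Basis :: (complex^'n) set"
 using nonempty_Basis by blast

instance ridx :: (finite) finite
proof
 have "finite (Abs_ridx ` (Basis :: (complex^'a) set))" by simp
 moreover have "(UNIV :: 'a ridx set) \<subseteq> Abs_ridx ` Basis"
  by (metis Rep_ridx Rep_ridx_inverse image_iff subsetI)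
 ultimately show "finite (UNIV :: 'a ridx set)" by (rule rev_finite_subset)
qed

instantiation ridx :: (finite) wellorder
begin

text \<open>Any injection into the naturals transports their well-order to the index type.\<close>

definition idx :: "'a ridx => nat" where "idx = (SOME f. inj f)"
definition less_eq_ridx :: "'a ridx => 'a ridx => bool" where "x \<le> y \<longleftrightarrow> idx x \<le> idx y"
definition less_ridx :: "'a ridx => 'a ridx => bool" where "x < y \<longleftrightarrow> idx x < idx y"

lemma inj_idx: "inj (idx :: 'a::finite ridx => nat)"
proof -
 have "\<exists>f :: 'a ridx => nat. inj f"
  using finite_imp_inj_to_nat_seg[of "UNIV :: 'a ridx set"] by auto
 then show ?thesis unfolding idx_def by (rule someI_ex)
qed

instance
proof
 fix x y z :: "'a ridx"
 show "x < y \<longleftrightarrow> x \<le> y \<and> \<not> y \<le> x" "x \<le> x" "x \<le> y ==> y \<le> z ==> x \<le> z" "x \<le> y \<or> y \<le> x"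
  unfolding less_eq_ridx_def less_ridx_def by linarith+
 show "x \<le> y ==> y \<le> x ==> x = y"
  unfolding less_eq_ridx_def by (rule injD[OF inj_idx]) linarith
next
 fix P :: "'a ridx => bool" and a
 assume step: "\<And>x. (\<And>y. y < x ==> P y) ==> P x"
 have "\<And>x. idx x = n ==> P x" for n
 proof (induction n rule: less_induct)
  case (less n)
  show ?case by (rule step) (use less in \<open>auto simp: less_ridx_def\<close>)
 qed
 then show "P a" by blast
qed

end

section \<open>Real coordinates of complex vectors\<close>

definition toR :: "complex^'n::finite => real^'n ridx" where "toR v = (\<chi> i. v \<bullet> Rep_ridx i)"
definition fromR :: "real^'n ridx => complex^'n::finite" where "fromR y = (\<Sum>i\<in>UNIV. (y $ i) *\<^sub>R Rep_ridx i)"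

lemma Rep_ridx_inner: "Rep_ridx i \<bullet> Rep_ridx j = (if i = j then 1 else 0)"
 using Rep_ridx[of i] Rep_ridx[of j] by (auto simp: inner_Basis Rep_ridx_inject)

lemma sum_ridx: "(\<Sum>i\<in>UNIV. X (Rep_ridx i)) = (\<Sum>b\<in>Basis. X b)"
 by (rule sum.reindex_bij_betw) (metis Rep_ridx_inject bij_betw_def injI type_definition.Rep_range type_definition_ridx)

lemma prod_ridx: "(\<Prod>i\<in>UNIV. X (Rep_ridx i)) = (\<Prod>b\<in>Basis. X b)"
 by (rule prod.reindex_bij_betw) (metis Rep_ridx_inject bij_betw_def injI type_definition.Rep_range type_definition_ridx)

lemma toR_fromR [simp]: "toR (fromR y) = y"
 by (simp add: toR_def fromR_def vec_eq_iff inner_sum_left Rep_ridx_inner if_distrib cong: if_cong)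

lemma fromR_toR [simp]: "fromR (toR v) = v"
 unfolding toR_def fromR_def by (simp add: sum_ridx[of "\<lambda>b. (v \<bullet> b) *\<^sub>R b"] euclidean_representation)

lemma linear_toR: "linear toR"
 by (rule linearI) (simp_all add: toR_def vec_eq_iff inner_add_left)

lemma linear_fromR: "linear fromR"
 by (rule linearI) (simp_all add: fromR_def scaleR_add_left sum.distrib scaleR_sum_right)

lemma fromR_inner: "fromR y \<bullet> Rep_ridx i = y $ i"
 using toR_fromR[of y] unfolding toR_def by (simp add: vec_eq_iff)

lemma fromR_axis: "fromR (axis i 1) = Rep_ridx i"
proof -
 have "fromR (axis i 1) = (\<Sum>j\<in>UNIV. if j = i then Rep_ridx j else 0)"
  unfolding fromR_def by (rule sum.cong) (auto simp: axis_def)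
 then show ?thesis by simp
qed

lemma continuous_fromR: "continuous_on S fromR"
 by (simp add: linear_continuous_on linear_linear linear_fromR)

lemma measurable_fromR: "fromR \<in> borel_measurable borel"
 by (rule borel_measurable_continuous_onI[OF continuous_fromR])

lemma lborel_fromR: "distr lborel borel fromR = (lborel :: (complex^'n::finite) measure)"
proof (rule lborel_eqI[symmetric])
 fix l u :: "complex^'n" assume lu: "\<And>b. b \<in> Basis ==> l \<bullet> b \<le> u \<bullet> b"
 have "fromR -` box l u = box (toR l) (toR u)"
 proof -
  have "fromR y \<in> box l u \<longleftrightarrow> y \<in> box (toR l) (toR u)" for y
  proof -
   have "fromR y \<in> box l u \<longleftrightarrow> (\<forall>i. l \<bullet> Rep_ridx i < fromR y \<bullet> Rep_ridx i \<and> fromR y \<bullet> Rep_ridx i < u \<bullet> Rep_ridx i)"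
    unfolding mem_box by (metis Rep_ridx Rep_ridx_cases)
   then show ?thesis by (simp add: mem_box_cart fromR_inner toR_def)
  qed
  then show ?thesis by auto
 qed
 then have "emeasure (distr lborel borel fromR) (box l u) = emeasure lborel (box (toR l) (toR u))"
  using measurable_fromR by (subst emeasure_distr) auto
 also have "\<dots> = (\<Prod>b\<in>Basis. (toR u - toR l) \<bullet> b)"
 proof (rule emeasure_lborel_box)
  fix b :: "real^'n ridx" assume "b \<in> Basis"
  then show "toR l \<bullet> b \<le> toR u \<bullet> b"
   using lu[OF Rep_ridx] by (auto simp: Basis_vec_def toR_def cart_eq_inner_axis[symmetric])
 qed
 also have "\<dots> = (\<Prod>b\<in>Basis. (u - l) \<bullet> b)"
 proof -
  have "(\<Prod>b\<in>(Basis :: (real^'n ridx) set). (toR u - toR l) \<bullet> b) = (\<Prod>i\<in>UNIV. (toR u - toR l) \<bullet> axis i 1)"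
  proof -
   have B: "(Basis :: (real^'n ridx) set) = (\<lambda>i. axis i 1) ` UNIV" by (auto simp: Basis_vec_def)
   have i: "inj (\<lambda>i. axis i 1 :: real^'n ridx)" by (simp add: inj_def axis_eq_axis)
   show ?thesis unfolding B prod.reindex[OF i] by simp
  qed
  also have "\<dots> = (\<Prod>i\<in>UNIV. (u - l) \<bullet> Rep_ridx i)"
   by (simp add: cart_eq_inner_axis[symmetric] toR_def inner_diff_left)
  finally show ?thesis by (simp add: prod_ridx[of "\<lambda>b. (u - l) \<bullet> b"])
 qed
 finally show "emeasure (distr lborel borel fromR) (box l u) = (\<Prod>b\<in>Basis. (u - l) \<bullet> b)" .
qed simp

section \<open>The real determinant of a complex matrix\<close>

definition rdet :: "(complex^'n::finite => complex^'n) => real" where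
 "rdet L = \<bar>det (matrix (toR \<circ> L \<circ> fromR))\<bar>"

lemma rdet_comp: "linear L ==> linear M ==> rdet (L \<circ> M) = rdet L * rdet M"
proof -
 assume l: "linear L" "linear M"
 have "toR \<circ> (L \<circ> M) \<circ> fromR = (toR \<circ> L \<circ> fromR) \<circ> (toR \<circ> M \<circ> fromR)" by (simp add: fun_eq_iff)
 then show ?thesis
  unfolding rdet_def by (simp add: matrix_compose linear_compose l linear_toR linear_fromR det_mul abs_mult)
qed

lemma rdet_id: "rdet (\<lambda>v :: complex^'n::finite. v) = 1"
proof -
 have "toR \<circ> (\<lambda>v. v) \<circ> fromR = (id :: real^'n ridx => _)" by (simp add: fun_eq_iff)
 then show ?thesis by (simp add: rdet_def matrix_id_mat_1)
qed

lemma rdet_not_inj: "linear L ==> \<not> inj L ==> rdet L = 0"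
proof -
 assume l: "linear L" "\<not> inj L"
 then obtain x y where xy: "x \<noteq> y" "L x = L y" by (auto simp: inj_def)
 have "(toR \<circ> L \<circ> fromR) (toR x) = (toR \<circ> L \<circ> fromR) (toR y)" using xy by simp
 moreover have "toR x \<noteq> toR y"
 proof
  assume "toR x = toR y"
  then have "fromR (toR x) = fromR (toR y)" by (rule arg_cong)
  with xy(1) show False by simp
 qed
 ultimately have "\<not> inj (toR \<circ> L \<circ> fromR)" unfolding inj_def by blast
 then show ?thesis
  unfolding rdet_def using det_nz_iff_inj[of "toR \<circ> L \<circ> fromR"] by (simp add: linear_compose l linear_toR linear_fromR)
qed

abbreviation mv :: "complex^'n::finite^'n => complex^'n => complex^'n" where "mv M \<equiv> (*v) M"

lemma linear_mv: "linear (mv M)"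
 by (rule linearI) (simp_all add: matrix_vector_right_distrib, simp add: vec_eq_iff matrix_vector_mult_def scaleR_sum_right)

lemma rdet_mul: "rdet (mv (M ** N)) = rdet (mv M) * rdet (mv N)"
proof -
 have "mv (M ** N) = mv M \<circ> mv N" by (simp add: fun_eq_iff matrix_vector_mul_assoc)
 then show ?thesis by (simp add: rdet_comp linear_mv)
qed

text \<open>Generators for the elimination in \<open>rdet_eq_det\<close>: \<open>Dm\<close> scales
  one coordinate, and \<open>Em m r\<close> with r_m = 0 is a transvection.\<close>

definition Dm :: "'n::finite => complex => complex^'n^'n" where
 "Dm m a = (\<chi> i j. if i = j then if i = m then a else 1 else 0)"

definition Em :: "'n::finite => complex^'n => complex^'n^'n" where
 "Em m r = (\<chi> i j. (if i = j then 1 else 0) + (if i = m then r $ j else 0))"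

lemma mv_Dm: "mv (Dm m a) v = (\<chi> i. if i = m then a * v $ i else v $ i)"
 by (simp add: vec_eq_iff matrix_vector_mult_def Dm_def if_distrib[of "\<lambda>x. x * _"] cong: if_cong)

lemma det_Dm: "det (Dm m a) = a"
 by (subst det_diagonal) (auto simp: Dm_def prod.remove[of UNIV m])

text \<open>A real factor scales exactly the two real coordinates of the complex coordinate
  \<open>m\<close>.\<close>

lemma rdet_Dm_real:
 assumes "0 < r" shows "rdet (mv (Dm m (of_real r) :: complex^'n::finite^'n)) = r\<^sup>2"
proof -
 have "matrix (toR \<circ> mv (Dm m (of_real r)) \<circ> fromR) =
   (\<chi> i j. if i = j then if Rep_ridx i \<in> {axis m 1, axis m \<i>} then r else 1 else 0)" (is "_ = ?D")
 proof -
  have "(mv (Dm m (of_real r)) b) \<bullet> b' = (if b = b' then if b' \<in> {axis m 1, axis m \<i>} then r else 1 else 0)"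
   if bb: "b \<in> Basis" "b' \<in> Basis" for b b' :: "complex^'n"
  proof -
   obtain i s where b: "b = axis i s" "s = 1 \<or> s = \<i>" using bb(1) by (auto simp: Basis_vec_def Basis_complex_def)
   have "mv (Dm m (of_real r)) b = (if i = m then r else 1) *\<^sub>R b"
    unfolding mv_Dm b by (simp add: vec_eq_iff axis_def scaleR_complex)
   then show ?thesis using bb b by (auto simp: inner_Basis axis_eq_axis)
  qed
  then have "mv (Dm m (of_real r)) (Rep_ridx j) \<bullet> Rep_ridx i = (if i = j then if Rep_ridx i \<in> {axis m 1, axis m \<i>} then r else 1 else 0)" for i j
   using Rep_ridx_inject[of j i] Rep_ridx[of i] Rep_ridx[of j] by (metis (no_types))
  then show ?thesis
   unfolding matrix_def by (simp add: vec_eq_iff fromR_axis toR_def)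
 qed
 then have "det (matrix (toR \<circ> mv (Dm m (of_real r)) \<circ> fromR)) = det ?D" by simp
 also have "\<dots> = (\<Prod>i\<in>UNIV. if Rep_ridx i \<in> {axis m 1, axis m \<i> :: complex^'n} then r else 1)"
  by (subst det_diagonal) auto
 also have "\<dots> = (\<Prod>b\<in>Basis. if b \<in> {axis m 1, axis m \<i> :: complex^'n} then r else 1)"
  by (rule prod_ridx)
 also have "\<dots> = (\<Prod>b\<in>{axis m 1, axis m \<i> :: complex^'n}. r)"
  by (rule prod.mono_neutral_cong_right) (auto simp: Basis_vec_def Basis_complex_def)
 also have "\<dots> = r\<^sup>2" by (simp add: axis_eq_axis complex_eq_iff power2_eq_square)
 finally show ?thesis by (simp add: rdet_def)
qed

lemma rdet_nonneg: "0 \<le> rdet L" by (simp add: rdet_def)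

text \<open>Coordinatewise conjugation is a real-linear involution, so its real determinant has
  modulus one, and it conjugates scaling by \<open>a\<close> into scaling by the conjugate of
  \<open>a\<close>. The product of the two scalings has the real factor |a|^2.\<close>

lemma rdet_Dm:
 fixes m :: "'n::finite"
 assumes "a \<noteq> 0" shows "rdet (mv (Dm m a)) = (cmod a)\<^sup>2"
proof -
 define C :: "complex^'n => complex^'n" where "C = (\<lambda>v. \<chi> i. cnj (v $ i))"
 have lC: "linear C" unfolding C_def by (rule linearI) (simp_all add: vec_eq_iff)
 have "C \<circ> C = (\<lambda>v. v)" by (simp add: C_def fun_eq_iff)
 then have c: "rdet C * rdet C = 1" using rdet_comp[OF lC lC] rdet_id by metis
 have "mv (Dm m (cnj a)) = C \<circ> (mv (Dm m a) \<circ> C)"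
  by (auto simp: fun_eq_iff C_def mv_Dm vec_eq_iff)
 then have "rdet (mv (Dm m (cnj a))) = rdet (mv (Dm m a))"
  using c by (simp add: rdet_comp lC linear_mv linear_compose)
 moreover have "Dm m a ** Dm m (cnj a) = Dm m (of_real ((cmod a)\<^sup>2))"
  by (simp add: vec_eq_iff matrix_matrix_mult_def Dm_def if_distrib[of "\<lambda>x. x * _"] complex_norm_square[symmetric] del: of_real_power cong: if_cong)
 ultimately have "(rdet (mv (Dm m a)))\<^sup>2 = ((cmod a)\<^sup>2)\<^sup>2"
  using rdet_mul[of "Dm m a" "Dm m (cnj a)"] rdet_Dm_real[of "(cmod a)\<^sup>2" m] assms by (simp add: power2_eq_square[of "rdet _"])
 then show ?thesis by (rule power2_eq_imp_eq) (simp_all add: rdet_nonneg)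
qed

lemma Em_mul:
 assumes "r $ m = 0"
 shows "Em m r ** Em m s = Em m (r + s)" "Dm m 2 ** Em m r = Em m (2 *s r) ** Dm m 2"
 using assms
 by (auto simp: vec_eq_iff matrix_matrix_mult_def Em_def Dm_def distrib_left distrib_right sum.distrib if_distrib[of "\<lambda>x. x * _"]
  if_distrib[of "\<lambda>x. _ * x"] cong: if_cong)

text \<open>Conjugation by scaling with 2 sends \<open>Em m r\<close> to its own square, so a
  multiplicative invariant equals its square there; being nonzero it is 1.\<close>

lemma Em_rdet_det:
 fixes m :: "'a::finite"
 assumes "r $ m = 0"
 shows "rdet (mv (Em m r)) = 1" "det (Em m r) = 1"
proof -
 have 2: "2 *s r = r + r" by (simp add: vec_eq_iff)
 have z: "Em m 0 = mat 1" by (simp add: Em_def mat_def vec_eq_iff)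
 have inv: "Em m r ** Em m (- r) = mat 1" using Em_mul(1)[OF assms, of "- r"] z by simp
 have "rdet (mv (Dm m 2)) * rdet (mv (Em m r)) = rdet (mv (Em m r)) * rdet (mv (Em m r)) * rdet (mv (Dm m 2))"
  using arg_cong[OF Em_mul(2)[OF assms], of "\<lambda>M. rdet (mv M)"] unfolding 2 Em_mul(1)[OF assms, symmetric] by (simp add: rdet_mul)
 moreover have "rdet (mv (Em m r)) \<noteq> 0"
 proof
  assume "rdet (mv (Em m r)) = 0"
  then have "rdet (mv (mat 1 :: complex^'a^'a)) = 0" using rdet_mul[of "Em m r" "Em m (- r)"] inv by simp
  moreover have "mv (mat 1 :: complex^'a^'a) = (\<lambda>v. v)" by (simp add: fun_eq_iff)
  ultimately show False by (simp add: rdet_id)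
 qed
 ultimately show "rdet (mv (Em m r)) = 1" by (simp add: rdet_Dm)
 have "det (Dm m 2) * det (Em m r) = det (Em m r) * det (Em m r) * det (Dm m 2)"
  using arg_cong[OF Em_mul(2)[OF assms], of det] unfolding 2 Em_mul(1)[OF assms, symmetric] by (simp add: det_mul)
 moreover have "det (Em m r) \<noteq> 0" using det_mul[of "Em m r" "Em m (- r)"] inv by auto
 ultimately show "det (Em m r) = 1" by (simp add: det_Dm)
qed

text \<open>Gaussian elimination on the set \<open>S\<close> of rows that may differ from those of
  the identity: both sides are multiplicative and agree on the elementary matrices.\<close>

lemma rdet_eq_det: "rdet (mv M) = (cmod (det M))\<^sup>2" for M :: "complex^'n::finite^'n"
proof -
 have "(\<forall>i. i \<notin> S --> M $ i = axis i 1) --> rdet (mv M) = (cmod (det M))\<^sup>2" if "finite S" for S and M :: "complex^'n^'n"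
  using that
 proof (induction S arbitrary: M)
  case empty
  show ?case
  proof
   assume "\<forall>i. i \<notin> {} --> M $ i = axis i 1"
   then have "M = mat 1" by (simp add: mat_def vec_eq_iff axis_def)
   moreover have "mv (mat 1 :: complex^'n^'n) = (\<lambda>v. v)" by (simp add: fun_eq_iff)
   ultimately show "rdet (mv M) = (cmod (det M))\<^sup>2" by (simp add: rdet_id)
  qed
 next
  case (insert m S)
  \<comment> \<open>With a nonzero pivot, row \<open>m\<close> is made a unit vector by column
    operations with column \<open>m\<close>. The rows outside \<open>insert m S\<close> vanish in
    that column and stay as they are.\<close>
  have step: "rdet (mv M) = (cmod (det M))\<^sup>2" if M: "\<forall>i. i \<notin> insert m S --> M $ i = axis i 1" "M $ m $ m \<noteq> 0" for M
  proof -
   let ?a = "M $ m $ m"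
   let ?r = "\<chi> j. if j = m then 0 else - M $ m $ j"
   let ?N = "M ** Dm m (1 / ?a) ** Em m ?r"
   have MD: "(M ** Dm m (1 / ?a)) $ i $ j = (if j = m then M $ i $ j / ?a else M $ i $ j)" for i j
    by (simp add: matrix_matrix_mult_def Dm_def if_distrib[of "\<lambda>x. _ * x"] cong: if_cong)
   have N: "?N $ i $ j = (M ** Dm m (1 / ?a)) $ i $ j + (M ** Dm m (1 / ?a)) $ i $ m * ?r $ j" for i j
    by (simp add: matrix_matrix_mult_def[of "M ** Dm m (1 / ?a)"] Em_def distrib_left sum.distrib if_distrib[of "\<lambda>x. _ * x"] cong: if_cong)
   have "\<forall>i. i \<notin> S --> ?N $ i = axis i 1"
   proof (intro allI impI)
    fix i assume i: "i \<notin> S"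
    show "?N $ i = axis i 1"
    proof (cases "i = m")
     case True
     then show ?thesis using M(2) by (simp add: vec_eq_iff N MD axis_def)
    next
     case False
     then have "M $ i $ j = (if i = j then 1 else 0)" for j using M(1) i by (simp add: axis_def)
     then show ?thesis using False by (auto simp: vec_eq_iff N MD axis_def)
    qed
   qed
   then have "rdet (mv ?N) = (cmod (det ?N))\<^sup>2" using insert.IH by blast
   then show ?thesis
    using M(2) by (simp add: rdet_mul det_mul rdet_Dm det_Dm Em_rdet_det norm_divide norm_mult power_divide field_simps power2_eq_square)
  qed
  show ?case
  proof
   assume M: "\<forall>i. i \<notin> insert m S --> M $ i = axis i 1"
   show "rdet (mv M) = (cmod (det M))\<^sup>2"
   proof (cases "\<exists>j\<in>insert m S. M $ m $ j \<noteq> 0")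
    case True
    show ?thesis
    proof (cases "M $ m $ m = 0")
     case nz: True
     then obtain j where j: "j \<in> S" "j \<noteq> m" "M $ m $ j \<noteq> 0" using True by auto
     \<comment> \<open>A zero pivot is repaired by adding column \<open>j\<close> to column
       \<open>m\<close>; the rows outside \<open>insert m S\<close> have a zero in column
       \<open>j\<close>.\<close>
     let ?N = "M ** Em j (axis m 1)"
     have N: "?N $ i $ k = M $ i $ k + (if k = m then M $ i $ j else 0)" for i k
      by (simp add: matrix_matrix_mult_def Em_def axis_def distrib_left sum.distrib if_distrib[of "\<lambda>x. _ * x"] cong: if_cong)
     have "\<forall>i. i \<notin> insert m S --> ?N $ i = axis i 1"
      unfolding vec_eq_iff N using M j by (auto simp: axis_def)
     then have "rdet (mv ?N) = (cmod (det ?N))\<^sup>2"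
      by (rule step) (use nz j in \<open>simp add: N\<close>)
     then show ?thesis using Em_rdet_det[of "axis m 1" j] j by (simp add: rdet_mul det_mul axis_def)
    qed (use step M in blast)
   next
    case False
    \<comment> \<open>Row \<open>m\<close> is supported on columns whose rows are unit vectors.
      Subtracting multiples of those rows makes it zero, and both sides vanish.\<close>
    let ?r = "\<chi> j. if j = m then 0 else - M $ m $ j"
    let ?N = "Em m ?r ** M"
    have "?N $ m $ k = M $ m $ k + (\<Sum>j\<in>UNIV. ?r $ j * M $ j $ k)" for k
     by (simp add: matrix_matrix_mult_def Em_def distrib_right sum.distrib if_distrib[of "\<lambda>x. x * _"] cong: if_cong)
    moreover have "(\<Sum>j\<in>UNIV. ?r $ j * M $ j $ k) = (\<Sum>j\<in>UNIV. if j = k then - M $ m $ k else 0)" for k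
     by (rule sum.cong) (use M False in \<open>auto simp: axis_def\<close>)
    ultimately have z: "?N $ m $ k = 0" for k by simp
    then have "det ?N = 0" by (intro det_zero_row(1)[where i = m]) (simp add: row_def vec_eq_iff z)
    moreover have "rdet (mv ?N) = 0"
    proof (rule rdet_not_inj[OF linear_mv])
     have m0: "(mv ?N v) $ m = 0" for v unfolding matrix_vector_mult_def using z by simp
     have "\<not> surj (mv ?N)"
     proof
      assume "surj (mv ?N)"
      then obtain v where v: "axis m 1 = mv ?N v" by (rule surjE)
      have "(axis m 1 :: complex^'n) $ m = 0" unfolding v by (rule m0)
      then show False by (simp add: axis_def)
     qed
     then show "\<not> inj (mv ?N)" using linear_injective_imp_surjective[OF linear_mv] by blast
    qed
    ultimately show ?thesis using Em_rdet_det[of ?r m] by (simp add: rdet_mul det_mul)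
   qed
  qed
 qed
 from this[of UNIV M] show ?thesis by simp
qed

section \<open>Change of variables under injective holomorphic maps\<close>

definition jacd :: "(complex^'n::finite => complex^'n) => complex^'n => real" where
 "jacd T z = (cmod (det (matrix (fder T z))))\<^sup>2"

context
 fixes V :: "(complex^'n::finite) set" and T :: "complex^'n => complex^'n"
 assumes V: "open V" and T: "holomorphic_map V T" and inj: "inj_on T V" and TV: "open (T ` V)"
begin

lemma rdet_jacd:
 assumes "z \<in> V" shows "rdet (fder T z) = jacd T z"
proof -
 note h = holomorphic_map_fder[OF T assms]
 have "fder T z v = mv (matrix (fder T z)) v" for v
 proof -
  have "v = (\<Sum>j\<in>UNIV. v $ j *s axis j 1)" by (simp add: vec_eq_iff axis_def if_distrib cong: if_cong)
  then have "fder T z v = (\<Sum>j\<in>UNIV. v $ j *s fder T z (axis j 1))"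
   by (metis (no_types, lifting) h(2) linear_sum[OF h(3)] sum.cong)
  then show ?thesis by (simp add: vec_eq_iff matrix_vector_mult_def matrix_def mult.commute)
 qed
 then show ?thesis using rdet_eq_det[of "matrix (fder T z)"] unfolding jacd_def by (metis HOL.ext)
qed

lemma continuous_jacd: "continuous_on V (jacd T)"
proof -
 have "continuous_on V (\<lambda>z. det (matrix (fder T z)))"
  by (rule smooth_on_imp_continuous_on[OF smooth_on_det[OF V]])
   (simp add: matrix_def smooth_on_vec_nth[OF V] smooth_on_fder[OF holomorphic_map_smooth_on[OF V T]])
 then show ?thesis unfolding jacd_def by (intro continuous_intros)
qed

lemma jacd_measurable: "(\<lambda>z. ennreal (jacd T z) * indicator V z) \<in> borel_measurable borel"
proof -
 have "(\<lambda>z. indicator V z *\<^sub>R jacd T z) \<in> borel_measurable borel"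
  by (rule borel_measurable_continuous_on_indicator[OF _ continuous_jacd]) (simp add: V)
 then have "(\<lambda>z. ennreal (indicator V z *\<^sub>R jacd T z)) \<in> borel_measurable borel" by measurable
 moreover have "ennreal (indicator V z *\<^sub>R jacd T z) = ennreal (jacd T z) * indicator V z" for z
  by (simp add: indicator_def)
 ultimately show ?thesis by simp
qed

text \<open>The real change of variables is an equivalence between a finite integral and a finite
  image measure. Read forwards it settles the finite case; read backwards it excludes a finite image
  when the integral is infinite.\<close>

lemma emeasure_holo_image:
 assumes S: "S \<in> sets borel" "S \<subseteq> V" "T ` S \<in> sets borel"
 shows "emeasure lborel (T ` S) = (\<integral>\<^sup>+z. ennreal (jacd T z) * indicator S z \<partial>lborel)"
proof -
 let ?S = "fromR -` S" and ?f = "toR \<circ> T \<circ> fromR" and ?f' = "\<lambda>y. toR \<circ> fder T (fromR y) \<circ> fromR"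
 have pre: "fromR -` B = toR ` B" for B :: "(complex^'n) set"
  by (force simp: image_iff intro: toR_fromR[symmetric])
 have img: "?f ` ?S = fromR -` (T ` S)" unfolding pre by (auto simp: image_iff)
 have mS: "?S \<in> sets borel" "fromR -` (T ` S) \<in> sets borel"
  using measurable_sets[OF measurable_fromR S(1)] measurable_sets[OF measurable_fromR S(3)] by auto
 have leb: "?S \<in> sets lebesgue" using mS by simp
 have der: "(?f has_derivative ?f' y) (at y within ?S)" if "y \<in> ?S" for y
 proof -
  have z: "fromR y \<in> V" using that S by auto
  have "(?f has_derivative ?f' y) (at y)"
   by (intro diff_chain_at linear_imp_has_derivative linear_toR linear_fromR)
    (use holomorphic_map_fder(1)[OF T z] in auto)
  then show ?thesis by (rule has_derivative_at_withinI)
 qed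
 have injS: "inj_on ?f ?S"
 proof (rule inj_onI)
  fix x y assume xy: "x \<in> ?S" "y \<in> ?S" "?f x = ?f y"
  then have "fromR (toR (T (fromR x))) = fromR (toR (T (fromR y)))" by simp
  then have "fromR x = fromR y" using inj_onD[OF inj] xy S(2) by auto
  then have "toR (fromR x) = toR (fromR y)" by (rule arg_cong)
  then show "x = y" by simp
 qed
 have K: "\<bar>det (matrix (?f' y))\<bar> = jacd T (fromR y)" if "y \<in> ?S" for y
  using rdet_jacd[of "fromR y"] that S(2) unfolding rdet_def by auto
 note iff = has_measure_differentiable_image[OF leb der injS]
 have jS: "(\<lambda>z. ennreal (jacd T z) * indicator S z) \<in> borel_measurable borel"
 proof -
  have "(\<lambda>z. ennreal (jacd T z) * indicator V z * indicator S z) \<in> borel_measurable borel"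
   using jacd_measurable S(1) by measurable
  moreover have "ennreal (jacd T z) * indicator V z * indicator S z = ennreal (jacd T z) * indicator S z" for z
   using S(2) by (auto simp: indicator_def)
  ultimately show ?thesis by simp
 qed
 let ?I = "\<integral>\<^sup>+z. ennreal (jacd T z) * indicator S z \<partial>lborel"
 have I: "?I = (\<integral>\<^sup>+y. ennreal (jacd T (fromR y) * indicator ?S y) \<partial>lborel)"
  by (subst lborel_fromR[symmetric], subst nn_integral_distr)
   (use jS measurable_fromR in \<open>auto intro!: nn_integral_cong simp: indicator_def\<close>)
 have m: "emeasure lborel (T ` S) = emeasure lborel (fromR -` (T ` S))"
  by (subst lborel_fromR[symmetric], subst emeasure_distr) (use S measurable_fromR in auto)
 show ?thesis
 proof (cases "?I = \<infinity>")
  case False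
  then obtain r where r: "?I = ennreal r" "0 \<le> r" by (cases ?I rule: ennreal_cases) auto
  have "((\<lambda>y. jacd T (fromR y) * indicator ?S y) has_integral r) UNIV"
  proof (rule nn_integral_has_integral)
   have "(\<lambda>y. enn2real (ennreal (jacd T (fromR y)) * indicator S (fromR y))) \<in> borel_measurable borel"
    using measurable_compose[OF measurable_fromR jS] by measurable
   moreover have "enn2real (ennreal (jacd T (fromR y)) * indicator S (fromR y)) = jacd T (fromR y) * indicator ?S y" for y
    by (simp add: indicator_def jacd_def)
   ultimately show "(\<lambda>y. jacd T (fromR y) * indicator ?S y) \<in> borel_measurable borel" by simp
   show "0 \<le> jacd T (fromR y) * indicator ?S y" for y by (simp add: jacd_def)
  qed (use r I in auto)
  then have "((\<lambda>y. if y \<in> ?S then jacd T (fromR y) else 0) has_integral r) UNIV"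
   by (rule has_integral_eq[rotated]) (simp add: indicator_def)
  then have "((\<lambda>y. jacd T (fromR y)) has_integral r) ?S" by (simp only: has_integral_restrict_UNIV)
  then have "((\<lambda>y. \<bar>det (matrix (?f' y))\<bar>) has_integral r) ?S"
   by (rule has_integral_eq[rotated]) (simp add: K)
  then have "?f ` ?S \<in> lmeasurable" "measure lebesgue (?f ` ?S) = r" using iff by blast+
  then have "emeasure lebesgue (fromR -` (T ` S)) = ennreal r"
   unfolding img by (simp add: emeasure_eq_measure2 fmeasurableD2)
  then show ?thesis using m r mS by simp
 next
  case True
  have "emeasure lborel (T ` S) = \<infinity>"
  proof (rule ccontr)
   assume "emeasure lborel (T ` S) \<noteq> \<infinity>"
   then have "fromR -` (T ` S) \<in> lmeasurable" using m mS by (simp add: fmeasurable_def less_top)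
   then have "((\<lambda>y. \<bar>det (matrix (?f' y))\<bar>) has_integral measure lebesgue (?f ` ?S)) ?S" using iff img by auto
   then have "((\<lambda>y. jacd T (fromR y)) has_integral measure lebesgue (?f ` ?S)) ?S"
    by (rule has_integral_eq[rotated]) (simp add: K)
   from nn_integral_has_integral_lebesgue'[OF _ this] have "(\<integral>\<^sup>+y. ennreal (jacd T (fromR y)) * indicator ?S y \<partial>lborel) \<noteq> \<infinity>"
    by (simp add: jacd_def)
   moreover have "(\<lambda>y. ennreal (jacd T (fromR y) * indicator ?S y)) = (\<lambda>y. ennreal (jacd T (fromR y)) * indicator ?S y)"
    by (auto simp: indicator_def)
   ultimately show False using True I by simp
  qed
  then show ?thesis using True by simp
 qed
qed

text \<open>The formula for sets says that the push-forward of the Jacobian density is Lebesgue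
  measure on the image; integrating \<open>h\<close> against both measures gives the formula for
  functions.\<close>

lemma nn_integral_holo_image:
 assumes h: "h \<in> borel_measurable borel"
 shows "(\<integral>\<^sup>+y. h y * indicator (T ` V) y \<partial>lborel) = (\<integral>\<^sup>+z. h (T z) * ennreal (jacd T z) * indicator V z \<partial>lborel)"
proof -
 have cT: "continuous_on V T" by (rule smooth_on_imp_continuous_on[OF holomorphic_map_smooth_on[OF V T]])
 let ?D = "density lborel (\<lambda>z. ennreal (jacd T z) * indicator V z)"
 have mT: "T \<in> measurable (restrict_space ?D V) borel"
  using borel_measurable_continuous_on_restrict[OF cT] by (simp add: measurable_def sets_restrict_space space_restrict_space)
 have "distr (restrict_space ?D V) borel T = density lborel (indicator (T ` V))"
 proof (rule measure_eqI)
  fix B assume "B \<in> sets (distr (restrict_space ?D V) borel T)"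
  then have B: "B \<in> sets borel" by simp
  have pre: "T -` B \<inter> V \<in> sets borel"
   using measurable_sets[OF mT B] V by (simp add: sets_restrict_space_iff space_restrict_space)
  have img: "T ` (T -` B \<inter> V) = T ` V \<inter> B" by auto
  have "emeasure (distr (restrict_space ?D V) borel T) B = emeasure ?D (T -` B \<inter> V)"
   using mT B V by (simp add: emeasure_distr emeasure_restrict_space space_restrict_space)
  also have "\<dots> = (\<integral>\<^sup>+z. ennreal (jacd T z) * indicator (T -` B \<inter> V) z \<partial>lborel)"
   using pre jacd_measurable by (subst emeasure_density) (auto intro!: nn_integral_cong simp: indicator_def)
  also have "\<dots> = emeasure lborel (T ` V \<inter> B)"
   using emeasure_holo_image[OF pre] B TV unfolding img by simp
  also have "\<dots> = (\<integral>\<^sup>+y. indicator (T ` V \<inter> B) y \<partial>lborel)"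
   by (rule nn_integral_indicator[symmetric]) (use B TV in auto)
  also have "\<dots> = (\<integral>\<^sup>+y. indicator (T ` V) y * indicator B y \<partial>lborel)"
   by (simp only: indicator_inter_arith)
  also have "\<dots> = emeasure (density lborel (indicator (T ` V))) B"
   by (rule emeasure_density[symmetric]) (use B TV in auto)
  finally show "emeasure (distr (restrict_space ?D V) borel T) B = emeasure (density lborel (indicator (T ` V))) B" .
 qed simp
 then have "(\<integral>\<^sup>+y. h y \<partial>density lborel (indicator (T ` V))) = (\<integral>\<^sup>+z. h (T z) \<partial>restrict_space ?D V)"
  using nn_integral_distr[OF mT, of h] h by simp
 also have "\<dots> = (\<integral>\<^sup>+z. h (T z) * indicator V z \<partial>?D)"
  using V by (simp add: nn_integral_restrict_space)
 also have "\<dots> = (\<integral>\<^sup>+z. ennreal (jacd T z) * indicator V z * (h (T z) * indicator V z) \<partial>lborel)"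
 proof (rule nn_integral_density)
  have "(\<lambda>z. h (T z)) \<in> borel_measurable (restrict_space borel V)"
   using measurable_compose[OF borel_measurable_continuous_on_restrict[OF cT] h] .
  then show "(\<lambda>z. h (T z) * indicator V z) \<in> borel_measurable lborel"
   using V by (simp add: borel_measurable_restrict_space_iff_ennreal mult.commute)
 qed (use jacd_measurable in simp)
 finally show ?thesis
  using h TV by (simp add: nn_integral_density) (auto intro!: nn_integral_cong simp: indicator_def mult_ac)
qed

end

text \<open>The Hermitian matrix is multiplied by the transposed complex Jacobian on the left and
  its conjugate on the right, so the density changes by the squared modulus of the complex
  determinant, which is the factor in \<open>jacd\<close>.\<close>

lemma rho_pull:
 fixes w w' :: "'n::finite alt"
 assumes w: "two_form11 w" "two_form11 w'" and L: "linear L" "\<And>a v. L (a *s v) = a *s L v" "\<And>vs. w vs = w' (map L vs)"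
  and h: "hpoint w'"
 shows "rho w = rho w' * (cmod (det (matrix L)))\<^sup>2"
proof -
 let ?M = "matrix L"
 have hm: "hmat \<psi> $ j $ k = sesq \<psi> (axis j 1) (axis k 1)" for \<psi> :: "'n alt" and j k
  by (simp add: hmat_def sesq_def cJ_axis)
 have "hmat w = transpose ?M ** hmat w' ** (\<chi> i j. cnj (?M $ i $ j))"
 proof -
  have "hmat w $ j $ k = sesq w' (L (axis j 1)) (L (axis k 1))" for j k
   unfolding hm by (simp add: sesq_def L(3) L(2))
  also have "\<dots> j k = (\<Sum>a\<in>UNIV. \<Sum>b\<in>UNIV. ?M $ a $ j * cnj (?M $ b $ k) * hmat w' $ a $ b)" for j k
   unfolding sesq_expand[OF w(2)] by (simp add: matrix_def)
  finally show ?thesis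
   by (simp add: vec_eq_iff matrix_matrix_mult_def transpose_def sum_distrib_right sum_distrib_left mult_ac)
    (intro allI, subst sum.swap, simp add: mult_ac)
 qed
 then have "det (hmat w) = det ?M * det (hmat w') * det (\<chi> i j. cnj (?M $ i $ j))"
  by (simp add: det_mul)
 also have "det (\<chi> i j. cnj (?M $ i $ j)) = cnj (det ?M)"
  by (simp add: det_def)
 finally have "det (hmat w) = of_real ((cmod (det ?M))\<^sup>2) * det (hmat w')"
  by (simp add: complex_norm_square mult_ac del: of_real_power)
 then show ?thesis unfolding rho_def by simp
qed

section \<open>The volume measure\<close>

context herm
begin

abbreviation BM :: "'a measure" where "BM \<equiv> restrict_space borel (carrier A)"

lemma carrier_open: "open (carrier A)"
 unfolding carrier_def by (intro open_UN ballI chart_open)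

lemma chart_subset: "c \<in> A ==> fst c \<subseteq> carrier A"
 unfolding carrier_def by blast

lemma sets_BM: "E \<in> sets BM \<longleftrightarrow> E \<in> sets borel \<and> E \<subseteq> carrier A"
 using carrier_open by (subst sets_restrict_space_iff) auto

lemma space_BM: "space BM = carrier A" by (simp add: space_restrict_space)

definition dens :: "('a, 'n) chart => complex^'n => real" where "dens c z = rho (rp c \<omega> z)"

text \<open>The volume of one chart, pushed to the manifold and regarded as a measure on the whole
  carrier, with no mass outside the chart domain.\<close>

definition \<nu> :: "('a, 'n) chart => 'a measure" where
 "\<nu> c = distr (density (restrict_space lborel (im c)) (\<lambda>z. ennreal (dens c z))) BM (chart_inv c)"

lemma sets_\<nu> [simp]: "sets (\<nu> c) = sets BM" by (simp add: \<nu>_def)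

lemma volume_density_dens: "volume_density \<omega> c (chart_inv c z) = dens c z"
 unfolding volume_density_def dens_def rho_def hmat_def ..

context
 fixes c assumes c: "c \<in> A"
begin

lemma dens_cont: "continuous_on (im c) (dens c)"
 unfolding dens_def by (rule smooth_on_imp_continuous_on[OF metric_field.smooth_rho[OF mf[OF c]]])

lemma dens_pos: "z \<in> im c ==> 0 < dens c z"
 unfolding dens_def by (intro hpoint.rho_pos \<omega>_hp c chart_inv_in)

lemma dens_measurable: "dens c \<in> borel_measurable (restrict_space lborel (im c))"
 using borel_measurable_continuous_on_restrict[OF dens_cont] by (simp add: measurable_def sets_restrict_space space_restrict_space)

lemma chart_inv_measurable: "chart_inv c \<in> measurable (restrict_space lborel (im c)) BM"
proof (rule measurable_restrict_space2)
 show "chart_inv c \<in> borel_measurable (restrict_space lborel (im c))"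
  using borel_measurable_continuous_on_restrict[OF chart_inv_cont[OF c]] by (simp add: measurable_def sets_restrict_space space_restrict_space)
qed (use chart_inv_in[OF c] chart_subset[OF c] in \<open>auto simp: space_restrict_space\<close>)

lemma chart_preimage: "E \<subseteq> fst c ==> chart_inv c -` E \<inter> im c = snd c ` E"
 using chart_inv_chart[OF c] chart_chart_inv[OF c] by force

lemma chart_image_borel: "E \<in> sets BM ==> E \<subseteq> fst c ==> snd c ` E \<in> sets borel"
 using measurable_sets[OF chart_inv_measurable, of E] chart_preimage[of E] im_open[OF c]
 by (simp add: sets_restrict_space_iff space_restrict_space)

lemma emeasure_\<nu>:
 assumes E: "E \<in> sets BM" "E \<subseteq> fst c"
 shows "emeasure (\<nu> c) E = (\<integral>\<^sup>+z. ennreal (dens c z) * indicator (snd c ` E) z \<partial>lborel)"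
proof -
 let ?R = "restrict_space lborel (im c)"
 have im: "im c \<inter> space lborel \<in> sets lborel" using im_open[OF c] by simp
 have sE: "snd c ` E \<subseteq> im c" using E by auto
 have mE: "snd c ` E \<in> sets ?R"
  using chart_image_borel[OF E] sE by (subst sets_restrict_space_iff[OF im]) simp
 have "emeasure (\<nu> c) E = emeasure (density ?R (\<lambda>z. ennreal (dens c z))) (snd c ` E)"
  unfolding \<nu>_def using chart_inv_measurable E chart_preimage[OF E(2)] by (subst emeasure_distr) (auto simp: space_restrict_space)
 also have "\<dots> = (\<integral>\<^sup>+z. ennreal (dens c z) * indicator (snd c ` E) z \<partial>?R)"
  by (rule emeasure_density) (use dens_measurable mE in auto)
 also have "\<dots> = (\<integral>\<^sup>+z. ennreal (dens c z) * indicator (snd c ` E) z * indicator (im c) z \<partial>lborel)"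
  by (rule nn_integral_restrict_space[OF im])
 also have "\<dots> = (\<integral>\<^sup>+z. ennreal (dens c z) * indicator (snd c ` E) z \<partial>lborel)"
  by (rule nn_integral_cong) (use sE in \<open>auto simp: indicator_def\<close>)
 finally show ?thesis .
qed

end

text \<open>The factor by which the densities differ is the Jacobian of the change of variables, so
  both integrals over the overlap coincide.\<close>

lemma \<nu>_agree:
 assumes c: "c \<in> A" "c' \<in> A" and E: "E \<in> sets BM" "E \<subseteq> fst c" "E \<subseteq> fst c'"
 shows "emeasure (\<nu> c) E = emeasure (\<nu> c') E"
proof -
 let ?V = "snd c ` (fst c \<inter> fst c')" and ?T = "transition c c'"
 have TV: "?T ` ?V = snd c' ` (fst c' \<inter> fst c)"
  using transition_over[OF c] transition_over[OF c(2,1)] transition_back[OF c(2,1)] by (metis (no_types, lifting) Int_commute image_eqI image_subsetI subsetI subset_antisym)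
 have inj: "inj_on ?T ?V"
  by (rule inj_on_inverseI) (rule transition_back[OF c])
 have dens: "dens c z = dens c' (?T z) * jacd ?T z" if z: "z \<in> ?V" for z
 proof -
  have i: "chart_inv c z \<in> fst c" "chart_inv c z \<in> fst c'" "snd c (chart_inv c z) = z"
   using z chart_inv_chart[OF c(1)] by auto
  note h = holomorphic_map_fder[OF transition_holo[OF c] z]
  show ?thesis
   unfolding dens_def jacd_def transition_inv[OF c z]
  proof (rule rho_pull[OF hpoint.two_form11_w[OF \<omega>_hp[OF c(1) i(1)]] hpoint.two_form11_w[OF \<omega>_hp[OF c(2) i(2)]] h(3)])
   show "fder ?T z (a *s v) = a *s fder ?T z v" for a v by (rule h(2))
   show "\<omega> c (chart_inv c z) vs = \<omega> c' (chart_inv c z) (map (fder ?T z) vs)" for vs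
    using fun_cong[OF form_compat[OF smooth_is_form[OF smooth_\<omega>] c i(1,2)]] unfolding i(3) .
  qed (rule \<omega>_hp[OF c(2) i(2)])
 qed
 have sub: "snd c' ` E \<subseteq> ?T ` ?V" unfolding TV using E by auto
 define h where "h = (\<lambda>y. ennreal (dens c' y) * indicator (snd c' ` E) y)"
 have hm: "h \<in> borel_measurable borel"
 proof -
  have "(\<lambda>y. indicator (im c') y *\<^sub>R dens c' y) \<in> borel_measurable borel"
   by (rule borel_measurable_continuous_on_indicator[OF _ dens_cont[OF c(2)]]) (simp add: im_open[OF c(2)])
  then have "(\<lambda>y. ennreal (indicator (im c') y *\<^sub>R dens c' y) * indicator (snd c' ` E) y) \<in> borel_measurable borel"
   using chart_image_borel[OF c(2) E(1,3)] by measurable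
  moreover have "ennreal (indicator (im c') y *\<^sub>R dens c' y) * indicator (snd c' ` E) y = h y" for y
   using E(3) by (auto simp: h_def indicator_def)
  ultimately show ?thesis by simp
 qed
 have mem: "?T z \<in> snd c' ` E \<longleftrightarrow> z \<in> snd c ` E" if z: "z \<in> ?V" for z
 proof -
  obtain x where x: "x \<in> fst c" "x \<in> fst c'" "z = snd c x" using z by auto
  have "?T z = snd c' x" using x chart_inv_chart[OF c(1)] by (simp add: transition_def)
  then show ?thesis
   using x E inj_on_image_mem_iff[OF chart_inj[OF c(1)]] inj_on_image_mem_iff[OF chart_inj[OF c(2)]] by auto
 qed
 have "emeasure (\<nu> c') E = (\<integral>\<^sup>+y. h y * indicator (?T ` ?V) y \<partial>lborel)"
  unfolding emeasure_\<nu>[OF c(2) E(1,3)] h_def by (rule nn_integral_cong) (use sub in \<open>auto simp: indicator_def\<close>)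
 also have "\<dots> = (\<integral>\<^sup>+z. h (?T z) * ennreal (jacd ?T z) * indicator ?V z \<partial>lborel)"
  by (rule nn_integral_holo_image[OF overlap[OF c] transition_holo[OF c] inj _ hm]) (simp only: TV overlap[OF c(2,1)])
 also have "\<dots> = (\<integral>\<^sup>+z. ennreal (dens c z) * indicator (snd c ` E) z \<partial>lborel)"
 proof (rule nn_integral_cong)
  fix z
  show "h (?T z) * ennreal (jacd ?T z) * indicator ?V z = ennreal (dens c z) * indicator (snd c ` E) z"
  proof (cases "z \<in> ?V")
   case True
   have "0 \<le> dens c' (?T z)" using dens_pos[OF c(2) transition_in[OF c True]] by simp
   then show ?thesis using True mem[OF True] dens[OF True]
    by (auto simp: h_def indicator_def ennreal_mult jacd_def)
  next
   case False
   then have "z \<notin> snd c ` E" using E by auto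
   then show ?thesis using False by simp
  qed
 qed
 also have "\<dots> = emeasure (\<nu> c) E" by (rule emeasure_\<nu>[OF c(1) E(1,2), symmetric])
 finally show ?thesis ..
qed

lemma ex_partition:
 obtains P :: "nat => 'a set" and ch :: "nat => ('a, 'n) chart" where
  "\<And>i. P i \<in> sets BM" "disjoint_family P" "(\<Union>i. P i) = carrier A" "\<And>i. P i \<subseteq> fst (ch i)" "\<And>i. P i \<noteq> {} ==> ch i \<in> A"
proof -
 have "open S" if "S \<in> fst ` A" for S using that chart_open by blast
 then obtain F where F: "F \<subseteq> fst ` A" "countable F" "\<Union>F = \<Union>(fst ` A)"
  using Lindelof[of "fst ` A"] by metis
 define U where "U = (\<lambda>i. if F = {} then {} else from_nat_into F i)"
 have U: "U i = {} \<or> U i \<in> fst ` A" for i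
  unfolding U_def using F(1) from_nat_into[of F i] by auto
 have UU: "(\<Union>i. U i) = carrier A"
  using F UN_from_nat_into[of F "\<lambda>x. x"] unfolding U_def carrier_def by (cases "F = {}") auto
 \<comment> \<open>For an empty piece, as happens with an empty atlas, \<open>ch i\<close> is an
   arbitrary pair; membership in the atlas is claimed for nonempty pieces only.\<close>
 define ch where "ch = (\<lambda>i. SOME c. U i \<subseteq> fst c \<and> (U i \<noteq> {} --> c \<in> A))"
 have ch: "U i \<subseteq> fst (ch i) \<and> (U i \<noteq> {} --> ch i \<in> A)" for i
  unfolding ch_def by (rule someI_ex) (use U[of i] in auto)
 have Uo: "U i \<in> sets BM" for i
 proof (cases "U i = {}")
  case False
  then obtain c where "c \<in> A" "U i = fst c" using U[of i] by blast
  then show ?thesis using chart_open[of c] chart_subset[of c] by (simp add: sets_BM)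
 qed simp
 show thesis
 proof (rule that[of "disjointed U" ch])
  show "disjointed U i \<in> sets BM" for i
   using sets.range_disjointed_sets[of U BM] Uo by auto
  show "disjointed U i \<subseteq> fst (ch i)" "disjointed U i \<noteq> {} ==> ch i \<in> A" for i
   using disjointed_subset[of U i] ch[of i] by auto
 qed (simp_all add: disjoint_family_disjointed UN_disjointed_eq UU)
qed

lemma emeasure_split:
 assumes "sets M = sets BM" "\<And>i. P i \<in> sets BM" "disjoint_family P" "(\<Union>i. P i) = carrier A" "E \<in> sets BM"
 shows "emeasure M E = (\<Sum>i. emeasure M (E \<inter> P i))"
proof -
 have "(\<Sum>i. emeasure M (E \<inter> P i)) = emeasure M (\<Union>i. E \<inter> P i)"
  using assms(1,2,5) by (intro suminf_emeasure) (auto intro: disjoint_family_subset[OF assms(3)])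
 also have "(\<Union>i. E \<inter> P i) = E" using assms(4,5) sets_BM by blast
 finally show ?thesis ..
qed

text \<open>Existence: the chart measures agree on overlaps and are glued along a countable
  partition into pieces inside charts. Uniqueness: any candidate is determined by its values on sets
  inside such pieces.\<close>

lemma volume_measure:
 shows sets_volume: "sets (volume_measure A \<omega>) = sets BM"
  and emeasure_volume: "c \<in> A ==> E \<in> sets BM ==> E \<subseteq> fst c ==> emeasure (volume_measure A \<omega>) E = emeasure (\<nu> c) E"
proof -
 obtain P and ch :: "nat => ('a, 'n) chart" where P: "\<And>i. P i \<in> sets BM" "disjoint_family P" "(\<Union>i. P i) = carrier A"
  and ch: "\<And>i. P i \<subseteq> fst (ch i)" "\<And>i. P i \<noteq> {} ==> ch i \<in> A"
  using ex_partition by metis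
 \<comment> \<open>The sum over the pieces is written as an integral over counting measure, so that
   countable additivity becomes an exchange of sum and integral.\<close>
 define m where "m = (\<lambda>E. \<integral>\<^sup>+i. emeasure (\<nu> (ch i)) (E \<inter> P i) \<partial>count_space UNIV)"
 define \<mu> where "\<mu> = measure_of (carrier A) (sets BM) m"
 have sa: "sigma_algebra (carrier A) (sets BM)" using sets.sigma_algebra_axioms[of BM] unfolding space_BM .
 have s\<mu>: "sets \<mu> = sets BM" unfolding \<mu>_def by (rule sigma_algebra.sets_measure_of_eq[OF sa])
 have ca: "countably_additive (sets BM) m"
 proof (rule countably_additiveI)
  fix B :: "nat => 'a set" assume B: "range B \<subseteq> sets BM" "disjoint_family B"
  have "(\<Sum>k. m (B k)) = (\<integral>\<^sup>+i. (\<Sum>k. emeasure (\<nu> (ch i)) (B k \<inter> P i)) \<partial>count_space UNIV)"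
   unfolding m_def by (rule nn_integral_suminf[symmetric]) simp
  also have "(\<lambda>i. \<Sum>k. emeasure (\<nu> (ch i)) (B k \<inter> P i)) = (\<lambda>i. emeasure (\<nu> (ch i)) ((\<Union>k. B k) \<inter> P i))"
  proof
   fix i
   have "(\<Sum>k. emeasure (\<nu> (ch i)) (B k \<inter> P i)) = emeasure (\<nu> (ch i)) (\<Union>k. B k \<inter> P i)"
    using B(1) P(1) by (intro suminf_emeasure) (auto intro: disjoint_family_subset[OF B(2)])
   then show "(\<Sum>k. emeasure (\<nu> (ch i)) (B k \<inter> P i)) = emeasure (\<nu> (ch i)) ((\<Union>k. B k) \<inter> P i)" by simp
  qed
  finally show "(\<Sum>k. m (B k)) = m (\<Union>k. B k)" unfolding m_def .
 qed
 have em: "emeasure \<mu> E = m E" if "E \<in> sets BM" for E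
  unfolding \<mu>_def by (rule emeasure_measure_of_sigma[OF sa _ ca that]) (simp add: positive_def m_def)
 have \<mu>: "emeasure \<mu> E = emeasure (\<nu> c) E" if c: "c \<in> A" and E: "E \<in> sets BM" "E \<subseteq> fst c" for c E
 proof -
  have "emeasure (\<nu> (ch i)) (E \<inter> P i) = emeasure (\<nu> c) (E \<inter> P i)" for i
  proof (cases "P i = {}")
   case False
   then show ?thesis
    using E P(1) ch by (intro \<nu>_agree c) auto
  qed simp
  then have "m E = (\<Sum>i. emeasure (\<nu> c) (E \<inter> P i))"
   by (simp add: m_def nn_integral_count_space_nat)
  then show ?thesis using em[OF E(1)] emeasure_split[OF sets_\<nu> P E(1), of c] by simp
 qed
 have spec: "(\<integral>\<^sup>+ z\<in>snd c ` E. ennreal (volume_density \<omega> c (chart_inv c z)) \<partial>lborel) = emeasure (\<nu> c) E"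
  if "c \<in> A" "E \<in> sets BM" "E \<subseteq> fst c" for c E
  unfolding volume_density_dens emeasure_\<nu>[OF that] ..
 have "volume_measure A \<omega> = \<mu>"
  unfolding volume_measure_def
 proof (rule the_equality)
  show "sets \<mu> = sets BM \<and> (\<forall>c\<in>A. \<forall>E\<in>sets \<mu>. E \<subseteq> fst c -->
    emeasure \<mu> E = (\<integral>\<^sup>+ z\<in>snd c ` E. ennreal (volume_density \<omega> c (chart_inv c z)) \<partial>lborel))"
   using s\<mu> \<mu> spec by simp
 next
  fix M assume M: "sets M = sets BM \<and> (\<forall>c\<in>A. \<forall>E\<in>sets M. E \<subseteq> fst c -->
    emeasure M E = (\<integral>\<^sup>+ z\<in>snd c ` E. ennreal (volume_density \<omega> c (chart_inv c z)) \<partial>lborel))"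
  show "M = \<mu>"
  proof (rule measure_eqI)
   fix E assume "E \<in> sets M"
   then have E: "E \<in> sets BM" using M by simp
   have "emeasure M (E \<inter> P i) = emeasure \<mu> (E \<inter> P i)" for i
   proof (cases "P i = {}")
    case False
    have "E \<inter> P i \<in> sets BM" "E \<inter> P i \<subseteq> fst (ch i)" using E P(1) ch by auto
    then show ?thesis using M \<mu>[OF ch(2)[OF False]] spec[OF ch(2)[OF False]] ch(2)[OF False] by simp
   qed simp
   then show "emeasure M E = emeasure \<mu> E"
    using emeasure_split[OF _ P E, of M] emeasure_split[OF s\<mu> P E] M by simp
  qed (simp add: M s\<mu>)
 qed
 then show "sets (volume_measure A \<omega>) = sets BM"
  and "c \<in> A ==> E \<in> sets BM ==> E \<subseteq> fst c ==> emeasure (volume_measure A \<omega>) E = emeasure (\<nu> c) E"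
  using s\<mu> \<mu> by auto
qed

lemma chart_integral:
 fixes F :: "'a => complex"
 assumes c: "c \<in> A" and F: "continuous_on (carrier A) F" and K: "compact K" "K \<subseteq> fst c" "\<And>x. x \<notin> K ==> F x = 0"
 shows "integrable (volume_measure A \<omega>) F"
  and "(LINT x|volume_measure A \<omega>. F x) = (LINT z|lborel. indicator (snd c ` K) z *\<^sub>R (dens c z *\<^sub>R F (chart_inv c z)))"
proof -
 let ?\<mu> = "volume_measure A \<omega>" and ?R = "restrict_space lborel (im c)" and ?S = "snd c ` K"
 have im: "im c \<inter> space lborel \<in> sets lborel" using im_open[OF c] by simp
 have fB: "fst c \<in> sets BM" using chart_open[OF c] chart_subset[OF c] by (simp add: sets_BM)
 have f\<mu>: "fst c \<inter> space ?\<mu> \<in> sets ?\<mu>" "fst c \<inter> space (\<nu> c) \<in> sets (\<nu> c)"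
  using fB sets_eq_imp_space_eq[OF sets_volume] chart_subset[OF c] by (simp_all add: sets_volume space_BM Int_absorb2 \<nu>_def)
 have FB: "F \<in> borel_measurable BM" by (rule borel_measurable_continuous_on_restrict[OF F])
 have F\<nu>: "F \<in> borel_measurable (\<nu> c)" using FB by (simp add: \<nu>_def)
 have Fc: "indicator (fst c) x *\<^sub>R F x = F x" for x using K(2,3) by (auto simp: indicator_def)
 have R: "restrict_space ?\<mu> (fst c) = restrict_space (\<nu> c) (fst c)"
 proof (rule measure_eqI)
  show "sets (restrict_space ?\<mu> (fst c)) = sets (restrict_space (\<nu> c) (fst c))"
   by (simp add: sets_restrict_space sets_volume)
  fix E assume "E \<in> sets (restrict_space ?\<mu> (fst c))"
  then have E: "E \<in> sets BM" "E \<subseteq> fst c" using f\<mu> by (auto simp: sets_restrict_space_iff sets_volume)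
  then show "emeasure (restrict_space ?\<mu> (fst c)) E = emeasure (restrict_space (\<nu> c) (fst c)) E"
   using f\<mu> by (simp add: emeasure_restrict_space emeasure_volume[OF c])
 qed
 have Fi: "(\<lambda>z. F (chart_inv c z)) \<in> borel_measurable ?R"
  by (rule measurable_compose[OF chart_inv_measurable[OF c] FB])
 have AEp: "AE z in ?R. 0 \<le> dens c z"
  using dens_pos[OF c] by (intro AE_I2) (simp add: space_restrict_space less_imp_le)
 have comp: "compact ?S" using K(1,2) chart_cont[OF c] by (intro compact_continuous_image continuous_on_subset[OF chart_cont[OF c]])
 have e: "indicator (im c) z *\<^sub>R (dens c z *\<^sub>R F (chart_inv c z)) = indicator ?S z *\<^sub>R (dens c z *\<^sub>R F (chart_inv c z))" for z
 proof (cases "z \<in> im c \<and> z \<notin> ?S")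
  case True
  then have "chart_inv c z \<notin> K" using chart_chart_inv[OF c] by (metis image_eqI)
  then show ?thesis using K(3) by simp
 next
  case False
  then show ?thesis using K(2) by (auto simp: indicator_def)
 qed
 have cont: "continuous_on ?S (\<lambda>z. dens c z *\<^sub>R F (chart_inv c z))"
 proof (rule continuous_on_subset)
  show "continuous_on (im c) (\<lambda>z. dens c z *\<^sub>R F (chart_inv c z))"
   by (intro continuous_on_scaleR dens_cont c continuous_on_compose2[OF F chart_inv_cont[OF c]])
    (use chart_inv_in[OF c] chart_subset[OF c] in auto)
 qed (use K(2) in auto)
 have "integrable ?\<mu> F \<longleftrightarrow> integrable (\<nu> c) F"
  using integrable_restrict_space[OF f\<mu>(1), of F] integrable_restrict_space[OF f\<mu>(2), of F] unfolding R Fc by simp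
 also have "\<dots> \<longleftrightarrow> integrable (density ?R (\<lambda>z. ennreal (dens c z))) (\<lambda>z. F (chart_inv c z))"
  unfolding \<nu>_def by (rule integrable_distr_eq) (use chart_inv_measurable[OF c] FB in auto)
 also have "\<dots> \<longleftrightarrow> integrable ?R (\<lambda>z. dens c z *\<^sub>R F (chart_inv c z))"
  by (rule integrable_density[OF Fi dens_measurable[OF c] AEp])
 also have "\<dots> \<longleftrightarrow> integrable lborel (\<lambda>z. indicator ?S z *\<^sub>R (dens c z *\<^sub>R F (chart_inv c z)))"
  unfolding integrable_restrict_space[OF im] e ..
 finally show "integrable ?\<mu> F" using borel_integrable_compact[OF comp cont] by blast
 have "(LINT x|?\<mu>. F x) = (LINT x|\<nu> c. F x)"
  using integral_restrict_space[OF f\<mu>(1), of F] integral_restrict_space[OF f\<mu>(2), of F] unfolding R Fc by simp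
 also have "\<dots> = (LINT z|density ?R (\<lambda>z. ennreal (dens c z)). F (chart_inv c z))"
  unfolding \<nu>_def by (rule integral_distr) (use chart_inv_measurable[OF c] FB in auto)
 also have "\<dots> = (LINT z|?R. dens c z *\<^sub>R F (chart_inv c z))"
  by (rule integral_density[OF Fi dens_measurable[OF c] AEp])
 also have "\<dots> = (LINT z|lborel. indicator ?S z *\<^sub>R (dens c z *\<^sub>R F (chart_inv c z)))"
  unfolding integral_restrict_space[OF im] e ..
 finally show "(LINT x|?\<mu>. F x) = (LINT z|lborel. indicator ?S z *\<^sub>R (dens c z *\<^sub>R F (chart_inv c z)))" .
qed

end

section \<open>Integration by parts\<close>

text \<open>Difference quotients have integral zero by translation invariance and converge to the
  directional derivative; a bound on that derivative dominates them.\<close>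

lemma integral_fder_eq_0:
 fixes f :: "'b::euclidean_space => complex"
 assumes d: "\<And>z. f differentiable (at z)" and cont: "continuous_on UNIV (\<lambda>z. fder f z b)"
  and S: "compact S" "\<And>z. z \<notin> S ==> f z = 0"
 shows "(LINT z|lborel. fder f z b) = 0"
proof (cases "b = 0")
 case True
 then show ?thesis using linear_0[OF has_derivative_linear[OF fder_works[OF d]]] by simp
next
 case b: False
 have So: "open (- S)" using compact_imp_closed[OF S(1)] by auto
 have f0: "fder f z b = 0" if "z \<notin> S" for z
  using frechet_derivative_cong_open[OF So, of z f "\<lambda>_. 0"] S(2) that by (simp add: frechet_derivative_const)
 have "bounded ((\<lambda>z. fder f z b) ` S)"
  by (intro compact_imp_bounded compact_continuous_image continuous_on_subset[OF cont] S(1)) simp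
 then obtain M where M: "0 < M" "\<And>z. z \<in> S ==> norm (fder f z b) \<le> M" by (auto simp: bounded_pos)
 have Mb: "norm (fder f z b) \<le> M" for z using M f0[of z] by (cases "z \<in> S") auto
 obtain r where r: "\<And>z. z \<in> S ==> norm z \<le> r" using compact_imp_bounded[OF S(1)] by (auto simp: bounded_iff)
 have fc: "continuous_on UNIV f" using d by (simp add: continuous_on_eq_continuous_within differentiable_imp_continuous_within)
 have fi: "integrable lborel f"
 proof -
  have "(\<lambda>z. indicator S z *\<^sub>R f z) = f" using S(2) by (auto simp: indicator_def)
  then show ?thesis using borel_integrable_compact[OF S(1) continuous_on_subset[OF fc]] by simp
 qed
 have fm: "f \<in> borel_measurable borel" by (rule borel_measurable_continuous_onI[OF fc])
 \<comment> \<open>Steps in (0, 1] tending to 0: the upper bound keeps the supports of all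
   difference quotients inside one ball.\<close>
 define h where "h = (\<lambda>n. inverse (real (Suc n)))"
 have h: "0 < h n" "h n \<le> 1" "h \<longlonglongrightarrow> 0" for n
  unfolding h_def using LIMSEQ_inverse_real_of_nat by (auto simp: field_simps)
 define q where "q = (\<lambda>n z. (f (h n *\<^sub>R b + z) - f z) /\<^sub>R h n)"
 have tr: "integrable lborel (\<lambda>z. f (a + z))" "(LINT z|lborel. f (a + z)) = (LINT z|lborel. f z)" for a
 proof -
  have "integrable (distr lborel borel ((+) a)) f" using fi by (simp add: lborel_distr_plus)
  then show "integrable lborel (\<lambda>z. f (a + z))" by (subst (asm) integrable_distr_eq) (simp_all add: fm)
  have "(LINT z|distr lborel borel ((+) a). f z) = (LINT z|lborel. f (a + z))" by (rule integral_distr) (simp_all add: fm)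
  then show "(LINT z|lborel. f (a + z)) = (LINT z|lborel. f z)" by (simp add: lborel_distr_plus)
 qed
 have q0: "(LINT z|lborel. q n z) = 0" for n
  unfolding q_def by (simp add: tr fi)
 have qm: "q n \<in> borel_measurable lborel" for n
  unfolding q_def using fm by measurable
 have line: "((\<lambda>t. f (z + t *\<^sub>R b)) has_vector_derivative fder f (z + t *\<^sub>R b) b) (at t within T)" for z t T
 proof -
  have "((\<lambda>t. f (z + t *\<^sub>R b)) has_derivative (\<lambda>s. fder f (z + t *\<^sub>R b) (s *\<^sub>R b))) (at t within T)"
   by (rule has_derivative_compose[OF _ fder_works[OF d]]) (auto intro!: derivative_eq_intros)
  then show ?thesis
   unfolding has_vector_derivative_def by (simp add: linear_cmul[OF has_derivative_linear[OF fder_works[OF d]]])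
 qed
 have qb: "norm (q n z) \<le> M * indicator (cball 0 (\<bar>r\<bar> + norm b)) z" for n z
 proof (cases "z \<in> cball 0 (\<bar>r\<bar> + norm b)")
  case True
  have "((\<lambda>t. fder f (z + t *\<^sub>R b) b) has_integral (f (z + h n *\<^sub>R b) - f (z + 0 *\<^sub>R b))) {0..h n}"
   by (rule fundamental_theorem_of_calculus) (use h(1)[of n] line in auto)
  then have "norm (f (z + h n *\<^sub>R b) - f (z + 0 *\<^sub>R b)) \<le> M * measure lborel (cbox 0 (h n))"
   using Mb M by (intro has_integral_bound[where f = "\<lambda>t. fder f (z + t *\<^sub>R b) b"]) (auto simp: box_real)
  then have "norm (f (z + h n *\<^sub>R b) - f z) / h n \<le> M"
   using h(1)[of n] by (simp add: pos_divide_le_eq)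
  then show ?thesis
   using True h(1)[of n] by (simp add: q_def add.commute divide_inverse mult.commute)
 next
  case False
  have "h n * norm b \<le> norm b" using h(1,2)[of n] by (simp add: mult_left_le_one_le)
  moreover have "\<bar>r\<bar> + norm b < norm z" using False by simp
  moreover have "norm z - h n * norm b \<le> norm (h n *\<^sub>R b + z)"
   using norm_triangle_ineq2[of z "- (h n *\<^sub>R b)"] h(1)[of n] by (simp add: add.commute[of z])
  ultimately have "r < norm z" "r < norm (h n *\<^sub>R b + z)" using norm_ge_zero[of b] by linarith+
  then have "z \<notin> S" "h n *\<^sub>R b + z \<notin> S" using r by force+
  then show ?thesis using S(2) False by (simp add: q_def)
 qed
 have lim: "(\<lambda>n. q n z) \<longlonglongrightarrow> fder f z b" for z
 proof -
  have "((\<lambda>y. norm (f (z + y) - f z - fder f z y) / norm y) \<longlongrightarrow> 0) (at 0)"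
   using fder_works[OF d] unfolding has_derivative_at by blast
  moreover have "filterlim (\<lambda>n. h n *\<^sub>R b) (at 0) sequentially"
   using tendsto_scaleR[OF h(3) tendsto_const[of b]] b h(1) by (auto simp: filterlim_at less_imp_neq[symmetric])
  ultimately have "(\<lambda>n. norm (f (z + h n *\<^sub>R b) - f z - fder f z (h n *\<^sub>R b)) / norm (h n *\<^sub>R b)) \<longlonglongrightarrow> 0"
   by (rule filterlim_compose)
  then have "(\<lambda>n. norm (f (z + h n *\<^sub>R b) - f z - fder f z (h n *\<^sub>R b)) / norm (h n *\<^sub>R b) * norm b) \<longlonglongrightarrow> 0"
   by (rule tendsto_mult_left_zero)
  moreover have "norm (f (z + h n *\<^sub>R b) - f z - fder f z (h n *\<^sub>R b)) / norm (h n *\<^sub>R b) * norm b = norm (q n z - fder f z b)" for n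
  proof -
   have "f (z + h n *\<^sub>R b) - f z - fder f z (h n *\<^sub>R b) = h n *\<^sub>R (q n z - fder f z b)"
    using h(1)[of n] linear_cmul[OF has_derivative_linear[OF fder_works[OF d]]]
    by (simp add: q_def scaleR_diff_right add.commute)
   then show ?thesis using b h(1)[of n] by simp
  qed
  ultimately have "(\<lambda>n. norm (q n z - fder f z b)) \<longlonglongrightarrow> 0" by simp
  then show ?thesis by (simp add: tendsto_norm_zero_iff LIM_zero_iff)
 qed
 have "(\<lambda>n. LINT z|lborel. q n z) \<longlonglongrightarrow> (LINT z|lborel. fder f z b)"
 proof (rule integral_dominated_convergence)
  show "(\<lambda>z. fder f z b) \<in> borel_measurable lborel" using borel_measurable_continuous_onI[OF cont] by simp
  show "integrable lborel (\<lambda>z. M * indicator (cball 0 (\<bar>r\<bar> + norm b)) z)"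
   using borel_integrable_compact[OF compact_cball continuous_on_const, of 0 "\<bar>r\<bar> + norm b" M] by (simp add: mult.commute)
 qed (use lim qb qm in auto)
 then show ?thesis unfolding q0 by (simp add: LIMSEQ_const_iff)
qed

lemma smooth_on_ext:
 fixes W :: "complex^'m::finite => 'n::finite alt"
 assumes "open U" "sfield U W" "\<And>v. smooth_on U (\<lambda>z. a z v)"
 shows "sfield U (\<lambda>z. ext (a z) (W z))"
 unfolding sfield_def
proof
 fix vs show "smooth_on U (\<lambda>z. ext (a z) (W z) vs)"
  using assms(2)
 proof (induction vs arbitrary: W)
  case (Cons v vs)
  then show ?case
   unfolding ext.simps sfield_def by (intro smooth_on_diff smooth_on_mult assms) (auto simp: sfield_def)
 qed simp
qed

context herm
begin

lemma pointwise_inner_zero: "(\<And>c. u c x = (\<lambda>_. 0)) ==> pin u v x = 0"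
 unfolding pointwise_inner_def by (simp add: Let_def)

lemma continuous_pointwise_inner:
 assumes u: "sf u" and v: "sf v"
 shows "continuous_on (carrier A) (pin u v)"
 unfolding carrier_def
proof (rule continuous_on_open_UN)
 fix c assume c: "c \<in> A"
 have "continuous_on (im c) (\<lambda>z. innG (rp c \<omega> z) (rp c u z) (rp c v z))"
  by (rule smooth_on_imp_continuous_on[OF metric_field.smooth_innG[OF mf[OF c] smooth_alt[OF u] smooth_sfield[OF u c] smooth_alt[OF v] smooth_sfield[OF v c]]])
 from continuous_on_compose2[OF this chart_cont[OF c] order_refl]
 have "continuous_on (fst c) (\<lambda>x. innG (rp c \<omega> (snd c x)) (rp c u (snd c x)) (rp c v (snd c x)))" .
 then show "continuous_on (fst c) (pin u v)"
  by (rule continuous_on_cong[THEN iffD1, rotated 2])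
   (simp_all add: pointwise_inner_innG[OF c _ smooth_is_form[OF u] smooth_is_form[OF v]] chart_inv_chart[OF c])
qed (rule chart_open)

text \<open>Test forms supported inside one chart. They separate smooth forms, and every test form
  is a finite sum of them, so integration by parts can be done in coordinates.\<close>

definition ctest :: "('a, 'n) chart => ('a, 'n) form => bool" where
 "ctest c u \<longleftrightarrow> sf u \<and> (\<exists>K. compact K \<and> K \<subseteq> fst c \<and> (\<forall>c' x. x \<notin> K --> u c' x = (\<lambda>_. 0)))"

abbreviation l2 :: "('a, 'n) form => ('a, 'n) form => complex" where "l2 \<equiv> l2_inner A \<omega>"

lemma l2_chart:
 assumes c: "c \<in> A" and u: "sf u" "compact K" "K \<subseteq> fst c" "\<And>c' x. x \<notin> K ==> u c' x = (\<lambda>_. 0)" and v: "sf v"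
 shows "integrable (volume_measure A \<omega>) (pin u v)"
  and "l2 u v = (LINT z|lborel. indicator (snd c ` K) z *\<^sub>R (dens c z *\<^sub>R pin u v (chart_inv c z)))"
proof -
 have z: "pin u v x = 0" if "x \<notin> K" for x by (rule pointwise_inner_zero, rule u(4)[OF that])
 note ci = chart_integral[OF c continuous_pointwise_inner[OF u(1) v] u(2,3) z]
 show "integrable (volume_measure A \<omega>) (pin u v)" by (rule ci(1))
 show "l2 u v = (LINT z|lborel. indicator (snd c ` K) z *\<^sub>R (dens c z *\<^sub>R pin u v (chart_inv c z)))"
  unfolding l2_inner_def by (rule ci(2))
qed

lemma l2_ctest_integrable: "c \<in> A ==> ctest c u ==> sf v ==> integrable (volume_measure A \<omega>) (pin u v)"
 unfolding ctest_def using l2_chart(1) by blast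

text \<open>Both operators are local, and off a closed set the form vanishes on a whole
  neighbourhood.\<close>

lemma D_support:
 assumes K: "closed K" "\<And>c x. x \<notin> K ==> u c x = (\<lambda>_. 0)" and u: "sf u" and x: "x \<notin> K"
 shows "D_eta \<eta> u c x = (\<lambda>_. 0)" "Dbar_minus_eta \<eta> u c x = (\<lambda>_. 0)"
proof -
 have *: "D_eta \<eta>' u' c x = (\<lambda>_. 0)" if e: "eta_atlas A \<eta>'" and u': "sf u'" "\<And>c x. x \<notin> K ==> u' c x = (\<lambda>_. 0)" for \<eta>' u'
 proof (cases "c \<in> A \<and> x \<in> fst c")
  case True
  then have c: "c \<in> A" "x \<in> fst c" by auto
  have "open (snd c ` (fst c \<inter> - K))" by (rule overlap_open[OF c(1)]) (use K(1) in auto)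
  moreover have "snd c x \<in> snd c ` (fst c \<inter> - K)" using c x by auto
  moreover have "rp c u' z = (\<lambda>_. 0)" if z: "z \<in> snd c ` (fst c \<inter> - K)" for z
  proof -
   obtain y where "y \<in> fst c" "y \<notin> K" "z = snd c y" using z by blast
   then show ?thesis by (simp add: chart_inv_chart[OF c(1)] u'(2))
  qed
  ultimately have "dl (\<lambda>z. thp (of_real (1 / \<eta>' (chart_inv c z))) (rp c u' z)) (snd c x) = dl (\<lambda>z vs. 0) (snd c x)"
   by (intro dl_cong) (auto simp: thp_zero)
  then show ?thesis unfolding eta_atlas.D_Dl[OF e c] Dl_def by (intro HOL.ext) (simp add: dl_zero thp_zero)
 next
  case False
  then show ?thesis using form_out[OF smooth_is_form[OF eta_atlas.smooth_D[OF e u'(1)]]] by blast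
 qed
 from *[OF eta_atlas_axioms u K(2)] show "D_eta \<eta> u c x = (\<lambda>_. 0)" .
 have "D_eta (\<lambda>x. - \<eta> x) (conj_form u) c x = (\<lambda>_. 0)"
  by (rule *[OF minus smooth_conj[OF u]]) (simp add: conj_form_def K(2))
 then show "Dbar_minus_eta \<eta> u c x = (\<lambda>_. 0)"
  unfolding Dbar_minus_eta_def conj_op_def by (simp add: conj_form_def)
qed

text \<open>Integrates the divergence identity over the coordinate space. The components of the
  field are extended by zero; the extension stays continuously differentiable because the chart
  image and the complement of the support are an open cover.\<close>

lemma l2_Dbar_chart:
 assumes c: "c \<in> A" and u: "ctest c u" and v: "sf v"
 shows "l2 (Dbar_minus_eta \<eta> u) v = l2 u (Dbs v)"
proof -
 obtain K where K: "compact K" "K \<subseteq> fst c" "\<And>c' x. x \<notin> K ==> u c' x = (\<lambda>_. 0)" and su: "sf u"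
  using u unfolding ctest_def by blast
 interpret m: metric_field "im c" "rp c \<omega>" by (rule mf[OF c])
 let ?S = "snd c ` K" and ?G = "\<lambda>b z. ext (tw2 (of_real (e c z)) (xb b)) (rp c u z)"
 define f where "f = (\<lambda>b z. of_real (dens c z) * innG (rp c \<omega> z) (?G b z) (rp c v z))"
 define F where "F = (\<lambda>b z. if z \<in> im c then f b z else 0)"
 have S: "compact ?S" "?S \<subseteq> im c"
  using K chart_cont[OF c] by (auto intro: compact_continuous_image continuous_on_subset)
 have So: "open (- ?S)" using compact_imp_closed[OF S(1)] by auto
 note io = im_open[OF c]
 have lin: "linear (tw2 s (xb b))" for s and b :: "complex^'n" by (rule m.linear_tw(2)[OF linear_xb])
 have sG: "sfield (im c) (?G b)" for b
 proof (rule smooth_on_ext[OF io smooth_sfield[OF su c]])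
  fix w
  have "smooth_on (im c) (\<lambda>z. ((1 - of_real (e c z)) * xb b w - \<i> * (1 + of_real (e c z)) * xb b (cJ w)) / 2)"
   by (intro smooth_on_divide smooth_on_diff smooth_on_mult smooth_on_add smooth_on_const smooth_on_of_real[OF io e_smooth[OF c]] io) simp
  then show "smooth_on (im c) (\<lambda>z. tw2 (of_real (e c z)) (xb b) w)" unfolding tw2_def .
 qed
 have aG: "alternating (?G b z)" for b z by (rule alt_ext[OF smooth_alt[OF su] lin])
 have sf: "smooth_on (im c) (f b)" for b
  unfolding f_def dens_def
  by (intro smooth_on_mult io smooth_on_of_real m.smooth_rho m.smooth_innG aG sG smooth_alt[OF v] smooth_sfield[OF v c])
 have F_out: "F b z = 0" if "z \<notin> ?S" for b z
 proof (cases "z \<in> im c")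
  case True
  then have "chart_inv c z \<notin> K" using that chart_chart_inv[OF c] by (metis image_eqI)
  then show ?thesis by (simp add: F_def f_def K(3) ext_zero[abs_def] innG_def inn_def)
 qed (simp add: F_def)
 have F1: "fder (F b) z = fder (f b) z" if "z \<in> im c" for b z
  by (rule frechet_derivative_cong_open[OF io that]) (simp add: F_def)
 have F2: "fder (F b) z = (\<lambda>_. 0)" if "z \<notin> ?S" for b z
  using frechet_derivative_cong_open[OF So, of z "F b" "\<lambda>_. 0"] F_out that by (simp add: frechet_derivative_const)
 have Fd: "F b differentiable (at z)" for b z
 proof (cases "z \<in> im c")
  case True
  then show ?thesis using smooth_on_imp_differentiable[OF sf True]
   by (subst differentiable_cong_open[OF io True]) (auto simp: F_def)
 next
  case False
  then have "z \<in> - ?S" using S by auto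
  then show ?thesis by (subst differentiable_cong_open[OF So, where g = "\<lambda>_. 0"]) (auto simp: F_out)
 qed
 have Fc: "continuous_on UNIV (\<lambda>z. fder (F b) z b')" for b b'
 proof -
  have "continuous_on (im c) (\<lambda>z. fder (F b) z b')"
   using smooth_on_imp_continuous_on[OF smooth_on_fder[OF sf]] by (rule continuous_on_cong[THEN iffD1, rotated 2]) (simp_all add: F1)
  moreover have "continuous_on (- ?S) (\<lambda>z. fder (F b) z b')"
   by (rule continuous_on_cong[THEN iffD1, OF refl _ continuous_on_const[of _ 0]]) (simp add: F2)
  ultimately have "continuous_on (im c \<union> - ?S) (\<lambda>z. fder (F b) z b')" by (intro continuous_on_open_Un io So)
  moreover have "im c \<union> - ?S = UNIV" using S by auto
  ultimately show ?thesis by simp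
 qed
 have Fi: "integrable lborel (\<lambda>z. fder (F b) z b)" for b
 proof -
  have "(\<lambda>z. indicator ?S z *\<^sub>R fder (F b) z b) = (\<lambda>z. fder (F b) z b)" using F2 by (auto simp: indicator_def)
  then show ?thesis using borel_integrable_compact[OF S(1) continuous_on_subset[OF Fc subset_UNIV], of b b] by simp
 qed
 have 0: "(LINT z|lborel. (\<Sum>b\<in>Basis. fder (F b) z b)) = 0"
  by (subst Bochner_Integration.integral_sum) (auto intro!: sum.neutral Fi integral_fder_eq_0[OF Fd Fc S(1) F_out])
 let ?p = "\<lambda>z. pin (Dbar_minus_eta \<eta> u) v (chart_inv c z)" and ?q = "\<lambda>z. pin u (Dbs v) (chart_inv c z)"
 have pt: "(\<Sum>b\<in>Basis. fder (F b) z b) = indicator ?S z *\<^sub>R (dens c z *\<^sub>R ?p z) - indicator ?S z *\<^sub>R (dens c z *\<^sub>R ?q z)" for z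
 proof (cases "z \<in> ?S")
  case True
  then have z: "z \<in> im c" using S by blast
  define x where "x = chart_inv c z"
  have x: "x \<in> fst c" "snd c x = z" using chart_inv_in[OF c z] chart_chart_inv[OF c z] by (auto simp: x_def)
  obtain fs where fs: "frame c x fs" using ex_frame[OF c x(1)] by blast
  have "(\<Sum>b\<in>Basis. fder (F b) z b) = (\<Sum>b\<in>Basis. fder (f b) z b)" by (simp add: F1[OF z])
  also have "\<dots> = of_real (rho (rp c \<omega> z)) * (inn fs (Dbl (e c) (rp c u) z) (rp c v z) - inn fs (rp c u z) (m.MM (e c) (set fs) (rp c v) z))"
   unfolding f_def dens_def
   by (rule m.divergence_identity[OF z _ _ smooth_alt[OF su] sfield_dfield[OF smooth_sfield[OF su c] z] smooth_alt[OF v]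
      sfield_dfield[OF smooth_sfield[OF v c] z] e_diff[OF c z] e_nz[OF c z]])
    (use fs in \<open>auto simp: x_def\<close>)
  also have "\<dots> = dens c z *\<^sub>R (?p z - ?q z)"
   unfolding x_def[symmetric] pointwise_inner_frame[OF c x(1) fs smooth_is_form[OF smooth_Dbar[OF su]] smooth_is_form[OF v]]
    pointwise_inner_frame[OF c x(1) fs smooth_is_form[OF su] smooth_is_form[OF smooth_ops(4)[OF v]]]
    Dbs_MM[OF c x(1) fs v] Dbar_Dbl[OF c x(1)] x(2) dens_def by (simp add: scaleR_complex)
  finally show ?thesis using True by (simp add: scaleR_diff_right)
 next
  case False
  then show ?thesis by (simp add: F2)
 qed
 have sup: "Dbar_minus_eta \<eta> u c' x = (\<lambda>_. 0)" if "x \<notin> K" for c' x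
  by (rule D_support(2)[OF compact_imp_closed[OF K(1)] K(3) su that])
 have int: "integrable lborel (\<lambda>z. indicator ?S z *\<^sub>R (dens c z *\<^sub>R pin a b (chart_inv c z)))"
  if ab: "sf a" "sf b" for a b
 proof (rule borel_integrable_compact[OF S(1)])
  have "continuous_on (im c) (\<lambda>z. dens c z *\<^sub>R pin a b (chart_inv c z))"
   by (intro continuous_on_scaleR dens_cont c continuous_on_compose2[OF continuous_pointwise_inner[OF ab] chart_inv_cont[OF c]])
    (use chart_inv_in[OF c] chart_subset[OF c] in auto)
  then show "continuous_on ?S (\<lambda>z. dens c z *\<^sub>R pin a b (chart_inv c z))"
   by (rule continuous_on_subset) (rule S(2))
 qed
 have "l2 (Dbar_minus_eta \<eta> u) v = (LINT z|lborel. indicator ?S z *\<^sub>R (dens c z *\<^sub>R ?p z))"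
  by (rule l2_chart(2)[OF c smooth_Dbar[OF su] K(1,2) _ v]) (rule sup)
 moreover have "l2 u (Dbs v) = (LINT z|lborel. indicator ?S z *\<^sub>R (dens c z *\<^sub>R ?q z))"
  by (rule l2_chart(2)[OF c su K(1,2) _ smooth_ops(4)[OF v]]) (rule K(3))
 ultimately have "l2 (Dbar_minus_eta \<eta> u) v - l2 u (Dbs v) =
   (LINT z|lborel. indicator ?S z *\<^sub>R (dens c z *\<^sub>R ?p z) - indicator ?S z *\<^sub>R (dens c z *\<^sub>R ?q z))"
  by (simp only: Bochner_Integration.integral_diff int smooth_Dbar[OF su] smooth_ops(4)[OF v] su v)
 then show ?thesis using 0 unfolding pt by simp
qed

end

section \<open>Formal adjoints\<close>

lemma dl_add:
 assumes "dfield W z" "dfield W' z"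
 shows "dl (\<lambda>y vs. W y vs + W' y vs) z = (\<lambda>vs. dl W z vs + dl W' z vs)"
proof -
 have "fder (\<lambda>y. W y l + W' y l) z v = fder (\<lambda>y. W y l) z v + fder (\<lambda>y. W' y l) z v" for l v
  by (rule fder_eqI[OF has_derivative_add]) (use assms fder_works in blast)+
 then show ?thesis unfolding dl_def by (simp add: distrib_left sum.distrib)
qed

lemma dl_scale:
 assumes "dfield W z"
 shows "dl (\<lambda>y vs. a * W y vs) z = (\<lambda>vs. a * dl W z vs)"
proof -
 have "fder (\<lambda>y. a * W y l) z v = a * fder (\<lambda>y. W y l) z v" for l v
  by (rule fder_eqI[OF bounded_linear.has_derivative[OF bounded_linear_mult_right]]) (use assms fder_works in blast)
 then show ?thesis unfolding dl_def by (simp add: sum_distrib_left mult_ac)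
qed

section \<open>Linear operators on smooth forms, bump functions and cutoffs\<close>

context atlas
begin

text \<open>Linearity is asked on smooth forms only, since \<open>frechet_derivative\<close>
  respects sums where the functions are differentiable.\<close>

definition lin :: "('a, 'n) operator => bool" where
 "lin P \<longleftrightarrow> (\<forall>u. sf u --> sf (P u)) \<and>
  (\<forall>u v. sf u --> sf v --> P (u + v) = P u + P v) \<and>
  (\<forall>a u. sf u --> P (\<lambda>c x vs. a * u c x vs) = (\<lambda>c x vs. a * P u c x vs))"

lemma rp_dfield:
 assumes u: "sf u" and x: "x \<in> fst c"
 shows "dfield (rp c u) (snd c x)"
proof (cases "c \<in> A")
 case True
 have "snd c x \<in> im c" using x by blast
 then show ?thesis by (rule sfield_dfield[OF smooth_sfield[OF u True]])
next
 case False
 then have "u c y = (\<lambda>_. 0)" for y using form_out[OF smooth_is_form[OF u]] by blast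
 then show ?thesis by simp
qed

lemma lin_ext_d: "lin ext_d"
 unfolding lin_def
proof (intro conjI allI impI)
 show "sf (ext_d u)" if "sf u" for u by (rule smooth_ext_d[OF that])
 show "ext_d (u + v) = ext_d u + ext_d v" if "sf u" "sf v" for u v
  by (intro HOL.ext) (simp add: ext_d_dl plus_fun_def dl_add rp_dfield that)
 show "ext_d (\<lambda>c x vs. a * u c x vs) = (\<lambda>c x vs. a * ext_d u c x vs)" if "sf u" for a u
  by (intro HOL.ext) (simp add: ext_d_dl dl_scale rp_dfield that)
qed

lemma lin_theta: "smooth_fun A \<sigma> ==> lin (theta \<sigma>)"
 unfolding lin_def by (auto simp: smooth_theta) (auto simp: theta_thp plus_fun_def thp_add thp_scale intro!: HOL.ext)

lemma lin_comp: "lin P ==> lin Q ==> lin (P \<circ> Q)"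
 unfolding lin_def by simp

lemma lin_wedge: "sf \<psi> ==> lin (wedge_op \<psi>)"
 unfolding lin_def
 by (auto simp: smooth_wedge) (auto simp: wedge_op_def plus_fun_def alt_wedge_add_right alt_wedge_scale_right intro!: HOL.ext)

lemma conj_conj [simp]: "conj_form (conj_form u) = u" by (simp add: conj_form_def)

lemma lin_conj: "lin P ==> lin (conj_op P)"
proof -
 assume P: "lin P"
 have a: "conj_form (u + v) = conj_form u + conj_form v" for u v :: "('a, 'n) form" by (simp add: conj_form_def fun_eq_iff)
 have s: "conj_form (\<lambda>c x vs. a * u c x vs) = (\<lambda>c x vs. cnj a * conj_form u c x vs)" for a and u :: "('a, 'n) form"
  by (simp add: conj_form_def)
 show ?thesis using P unfolding lin_def conj_op_def a s by (simp add: smooth_conj a s)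
qed

definition bmp :: "('a, 'n) chart => complex^'n => real => 'a => real" where
 "bmp c z r y = (if y \<in> fst c then bump z r (snd c y) else 0)"

context
 fixes c z r
 assumes c: "c \<in> A" and r: "0 < r" "cball z r \<subseteq> im c"
begin

lemma bmp_support: "compact (chart_inv c ` cball z r)" "chart_inv c ` cball z r \<subseteq> fst c"
  "y \<notin> chart_inv c ` cball z r ==> bmp c z r y = 0"
proof -
 show "compact (chart_inv c ` cball z r)"
  by (rule compact_continuous_image[OF continuous_on_subset[OF chart_inv_cont[OF c] r(2)] compact_cball])
 show "chart_inv c ` cball z r \<subseteq> fst c" using r(2) chart_inv_in[OF c] by blast
 assume y: "y \<notin> chart_inv c ` cball z r"
 show "bmp c z r y = 0"
 proof (cases "y \<in> fst c")
  case True
  then have "snd c y \<notin> cball z r" using y chart_inv_chart[OF c True] by (metis image_eqI)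
  then show ?thesis by (simp add: bmp_def bump_eq_0_iff[OF r(1)] dist_commute[of _ z])
 qed (simp add: bmp_def)
qed

lemma bmp_pos_iff: "0 < bmp c z r y \<longleftrightarrow> y \<in> fst c \<and> dist (snd c y) z < r"
 by (simp add: bmp_def bump_pos_iff[OF r(1)])

text \<open>Near a point outside the chart domain the function is zero on the complement of its
  compact support, an open set because the space is Hausdorff. Inside the domain it is a bump
  composed with a transition map.\<close>

lemma smooth_bmp: "smooth_fun A (bmp c z r)"
 unfolding smooth_fun_def
proof (intro ballI smooth_on_local)
 fix c' y assume c': "c' \<in> A" and y: "y \<in> im c'"
 let ?K = "chart_inv c ` cball z r" and ?f = "bmp c z r \<circ> chart_inv c'"
 have in_K: "snd c' ` (fst c' \<inter> B) \<subseteq> im c'" for B by auto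
 show "\<exists>T. open T \<and> y \<in> T \<and> smooth_on (im c' \<inter> T) ?f"
 proof (cases "chart_inv c' y \<in> fst c")
  case True
  let ?T = "snd c' ` (fst c' \<inter> fst c)"
  have o: "open ?T" by (rule overlap[OF c' c])
  have "smooth_on ?T (\<lambda>y. bump z r (transition c' c y))"
   by (rule smooth_on_compose[OF o open_UNIV holomorphic_map_smooth_on[OF o transition_holo[OF c' c]] smooth_on_bump]) auto
  then have "smooth_on ?T ?f"
   by (rule smooth_on_cong[OF o, THEN iffD1, rotated]) (use chart_inv_chart[OF c'] in \<open>auto simp: bmp_def transition_def\<close>)
  moreover have "y \<in> ?T" 
   by (rule image_eqI[where x = "chart_inv c' y"]) (use True chart_inv_in[OF c' y] chart_chart_inv[OF c' y] in auto)
  moreover have "im c' \<inter> ?T = ?T" by auto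
  ultimately show ?thesis using o by (intro exI[of _ ?T] conjI) (simp_all only:)
 next
  case False
  let ?T = "snd c' ` (fst c' \<inter> - ?K)"
  have o: "open ?T" by (rule overlap_open[OF c']) (use compact_imp_closed[OF bmp_support(1)] in auto)
  have "smooth_on ?T (\<lambda>_. 0 :: real)" by simp
  then have "smooth_on ?T ?f"
   by (rule smooth_on_cong[OF o, THEN iffD1, rotated]) (use chart_inv_chart[OF c'] bmp_support(3) in auto)
  moreover have "y \<in> ?T"
   by (rule image_eqI[where x = "chart_inv c' y"]) (use False bmp_support(2) chart_inv_in[OF c' y] chart_chart_inv[OF c' y] in auto)
  moreover have "im c' \<inter> ?T = ?T" by auto
  ultimately show ?thesis using o by (intro exI[of _ ?T] conjI) (simp_all only:)
 qed
qed

end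

lemma ex_chart_ball:
 assumes "x \<in> carrier A"
 obtains c r where "c \<in> A" "x \<in> fst c" "0 < r" "cball (snd c x) r \<subseteq> im c"
proof -
 obtain c where c: "c \<in> A" "x \<in> fst c" using assms by (auto simp: carrier_def)
 then have "snd c x \<in> im c" by blast
 then obtain r where "0 < r" "cball (snd c x) r \<subseteq> im c" using im_open[OF c(1)] open_contains_cball by blast
 then show ?thesis using that c by blast
qed

text \<open>The quotient is smooth where \<Phi> is nonzero, in particular near \<open>K\<close>, and
  the product is zero on the open complement of \<open>K\<close>; these two regions cover the
  chart.\<close>

lemma smooth_cutoff:
 assumes u: "sf u" and f: "smooth_fun A \<phi>" "smooth_fun A \<Phi>"
  and K: "closed K" "\<And>c x. x \<notin> K ==> u c x = (\<lambda>_. 0)" "\<And>x. x \<in> K ==> \<Phi> x \<noteq> 0"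
 shows "sf (\<lambda>c x vs. of_real (\<phi> x / \<Phi> x) * u c x vs)"
proof (rule smooth_formI)
 show "is_form A (\<lambda>c x vs. of_real (\<phi> x / \<Phi> x) * u c x vs)"
  by (rule is_form_pointwise[OF smooth_is_form[OF u]]) (simp_all add: alt_scale del: of_real_divide)
 fix c assume c: "c \<in> A"
 note io = im_open[OF c]
 have s: "smooth_on (im c) (\<lambda>z. \<phi> (chart_inv c z))" "smooth_on (im c) (\<lambda>z. \<Phi> (chart_inv c z))"
  using f c by (auto simp: smooth_fun_def o_def)
 show "sfield (im c) (rp c (\<lambda>c x vs. of_real (\<phi> x / \<Phi> x) * u c x vs))"
  unfolding sfield_def
 proof (intro allI smooth_on_local)
  fix vs z assume z: "z \<in> im c"
  let ?f = "\<lambda>y. of_real (\<phi> (chart_inv c y) / \<Phi> (chart_inv c y)) * u c (chart_inv c y) vs"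
  show "\<exists>T. open T \<and> z \<in> T \<and> smooth_on (im c \<inter> T) ?f"
  proof (cases "chart_inv c z \<in> K")
   case True
   let ?T = "im c \<inter> (\<lambda>z. \<Phi> (chart_inv c z)) -` (- {0})"
   have o: "open ?T"
    using continuous_on_open_vimage[OF io, of "\<lambda>z. \<Phi> (chart_inv c z)"] smooth_on_imp_continuous_on[OF s(2)]
    by (metis Int_commute closed_singleton open_Compl)
   have "smooth_on ?T (\<lambda>y. complex_of_real (\<phi> (chart_inv c y) / \<Phi> (chart_inv c y)))"
    by (rule smooth_on_of_real[OF o smooth_on_divide[OF o smooth_on_subset[OF s(1)] smooth_on_subset[OF s(2)]]]) auto
   moreover have "smooth_on ?T (\<lambda>y. u c (chart_inv c y) vs)"
    using smooth_sfield[OF u c] unfolding sfield_def by (blast intro: smooth_on_subset)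
   ultimately have "smooth_on ?T ?f" by (rule smooth_on_mult[OF o])
   moreover have "z \<in> ?T" using z K(3) True by simp
   moreover have "im c \<inter> ?T = ?T" by auto
   ultimately show ?thesis using o by (intro exI[of _ ?T] conjI) (simp_all only:)
  next
   case False
   let ?T = "snd c ` (fst c \<inter> - K)"
   have o: "open ?T" by (rule overlap_open[OF c]) (use K(1) in auto)
   have "smooth_on ?T (\<lambda>_. 0 :: complex)" by simp
   then have "smooth_on ?T ?f"
    by (rule smooth_on_cong[OF o, THEN iffD1, rotated]) (elim imageE IntE, simp add: chart_inv_chart[OF c] K(2))
   moreover have "z \<in> ?T" 
    by (rule image_eqI[where x = "chart_inv c z"]) (use False chart_inv_in[OF c z] chart_chart_inv[OF c z] in auto)
   moreover have "im c \<inter> ?T = ?T" by auto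
   ultimately show ?thesis using o by (intro exI[of _ ?T] conjI) (simp_all only:)
  qed
 qed
qed

end

context herm
begin

lemma lin_D: "lin (D_eta \<eta>)" and lin_Dbar: "lin (Dbar_minus_eta \<eta>)"
proof -
 have D: "lin (D_eta \<eta>')" if "eta_atlas A \<eta>'" for \<eta>'
  unfolding D_eta_def
  by (intro lin_comp lin_theta lin_ext_d eta_atlas.\<eta>_smooth[OF that] eta_atlas.smooth_inverse_eta[OF that])
 show "lin (D_eta \<eta>)" by (rule D[OF eta_atlas_axioms])
 show "lin (Dbar_minus_eta \<eta>)" unfolding Dbar_minus_eta_def by (rule lin_conj[OF D[OF minus]])
qed

text \<open>A partition of unity for one form: finitely many bumps cover its support, and dividing
  by their sum is harmless because that sum is positive there.\<close>

lemma test_decomposition: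
 assumes u: "sf u" "compact_support A u"
 obtains I :: "'a set" and w where "finite I" "\<And>i. i \<in> I ==> \<exists>c\<in>A. ctest c (w i)" "u = (\<Sum>i\<in>I. w i)"
proof -
 obtain K where K: "compact K" "K \<subseteq> carrier A" "\<And>c x. x \<notin> K ==> u c x = (\<lambda>_. 0)"
  using u(2) unfolding compact_support_def by blast
 have "\<forall>x\<in>K. \<exists>c r. c \<in> A \<and> x \<in> fst c \<and> 0 < r \<and> cball (snd c x) r \<subseteq> im c"
  using K(2) ex_chart_ball by (metis subsetD)
 then obtain ch r where cr: "\<And>x. x \<in> K ==> ch x \<in> A" "\<And>x. x \<in> K ==> x \<in> fst (ch x)" "\<And>x. x \<in> K ==> 0 < r x"
   "\<And>x. x \<in> K ==> cball (snd (ch x) x) (r x) \<subseteq> im (ch x)"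
  by metis
 define \<phi> where "\<phi> = (\<lambda>x. bmp (ch x) (snd (ch x) x) (r x))"
 have p: "0 < \<phi> x y \<longleftrightarrow> y \<in> fst (ch x) \<and> dist (snd (ch x) y) (snd (ch x) x) < r x" if "x \<in> K" for x y
  unfolding \<phi>_def by (rule bmp_pos_iff[OF cr(1,3,4)[OF that]])
 define O' where "O' = (\<lambda>x. fst (ch x) \<inter> snd (ch x) -` ball (snd (ch x) x) (r x))"
 have "open (O' x)" if "x \<in> K" for x
  unfolding O'_def using continuous_on_open_vimage[OF chart_open[OF cr(1)[OF that]]] chart_cont[OF cr(1)[OF that]] open_ball
  by (metis Int_commute)
 moreover have "K \<subseteq> (\<Union>x\<in>K. O' x)" using cr by (auto simp: O'_def)
 ultimately obtain I where I: "I \<subseteq> K" "finite I" "K \<subseteq> (\<Union>x\<in>I. O' x)"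
  by (rule compactE_image[OF K(1)])
 define \<Phi> where "\<Phi> = (\<lambda>y. \<Sum>i\<in>I. \<phi> i y)"
 have nn: "0 \<le> \<phi> i y" for i y unfolding \<phi>_def bmp_def by (simp add: bump_nonneg)
 have \<Phi>: "\<Phi> y \<noteq> 0" if y: "y \<in> K" for y
 proof -
  obtain i where i: "i \<in> I" "y \<in> O' i" using I(3) y by auto
  then have "0 < \<phi> i y" using p[of i y] I(1) by (auto simp: O'_def dist_commute)
  then have "0 < \<Phi> y" unfolding \<Phi>_def using i(1) by (intro sum_pos2[OF I(2)]) (auto simp: nn)
  then show ?thesis by simp
 qed
 have s\<phi>: "smooth_fun A (\<phi> i)" if "i \<in> K" for i unfolding \<phi>_def by (rule smooth_bmp[OF cr(1,3,4)[OF that]])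
 have s\<Phi>: "smooth_fun A \<Phi>"
  using s\<phi> I(1) unfolding smooth_fun_def \<Phi>_def o_def by (auto intro!: smooth_on_sum im_open)
 define w where "w = (\<lambda>i c x vs. of_real (\<phi> i x / \<Phi> x) * u c x vs)"
 have "ctest (ch i) (w i)" if i: "i \<in> K" for i
  unfolding ctest_def
 proof (intro conjI exI allI impI)
  show "sf (w i)" unfolding w_def by (rule smooth_cutoff[OF u(1) s\<phi>[OF i] s\<Phi> compact_imp_closed[OF K(1)] K(3) \<Phi>])
  note b = bmp_support[OF cr(1,3,4)[OF i]]
  show "compact (chart_inv (ch i) ` cball (snd (ch i) i) (r i))" "chart_inv (ch i) ` cball (snd (ch i) i) (r i) \<subseteq> fst (ch i)"
   by (rule b)+
  show "w i c' x = (\<lambda>_. 0)" if "x \<notin> chart_inv (ch i) ` cball (snd (ch i) i) (r i)" for c' x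
   using b(3)[OF that] by (simp add: w_def \<phi>_def)
 qed
 moreover have "u = (\<Sum>i\<in>I. w i)"
 proof (intro HOL.ext)
  fix c x vs
  have s: "(\<Sum>i\<in>J. w i) c x vs = (\<Sum>i\<in>J. w i c x vs)" for J by (induction J rule: infinite_finite_induct) auto
  show "u c x vs = (\<Sum>i\<in>I. w i) c x vs"
  proof (cases "x \<in> K")
   case True
   have "(\<Sum>i\<in>I. w i c x vs) = of_real (\<Sum>i\<in>I. \<phi> i x / \<Phi> x) * u c x vs"
    unfolding w_def by (simp only: sum_distrib_right of_real_sum)
   also have "(\<Sum>i\<in>I. \<phi> i x / \<Phi> x) = 1" using \<Phi>[OF True] unfolding sum_divide_distrib[symmetric] by (simp add: \<Phi>_def)
   finally show ?thesis by (simp add: s)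
  next
   case False
   have "w i c x vs = 0" for i using K(3)[OF False] by (simp add: w_def)
   then show ?thesis by (simp add: s K(3)[OF False])
  qed
 qed
 ultimately show ?thesis using that[of I w] I(1,2) cr(1) by blast
qed

lemma pointwise_inner_add: "pin (u + u') v x = pin u v x + pin u' v x"
 unfolding pointwise_inner_def by (simp add: Let_def distrib_right sum.distrib)

lemma pointwise_inner_diff_right: "pin u (v - v') x = pin u v x - pin u v' x"
 unfolding pointwise_inner_def by (simp add: Let_def right_diff_distrib sum_subtractf)

lemma l2_add:
 assumes "integrable (volume_measure A \<omega>) (pin u v)" "integrable (volume_measure A \<omega>) (pin u' v)"
 shows "l2 (u + u') v = l2 u v + l2 u' v" "integrable (volume_measure A \<omega>) (pin (u + u') v)"
 using assms unfolding l2_inner_def by (simp_all add: pointwise_inner_add[abs_def])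

lemma l2_diff_right:
 assumes "c \<in> A" "ctest c u" "sf v" "sf v'"
 shows "l2 u (v - v') = l2 u v - l2 u v'"
 using l2_ctest_integrable[OF assms(1,2)] assms(3,4) unfolding l2_inner_def by (simp add: pointwise_inner_diff_right[abs_def])

lemma ctest_Dbar: "ctest c u ==> ctest c (Dbar_minus_eta \<eta> u)"
 unfolding ctest_def using D_support(2) compact_imp_closed smooth_Dbar by metis

theorem l2_Dbar:
 assumes u: "sf u" "compact_support A u" and v: "sf v"
 shows "l2 (Dbar_minus_eta \<eta> u) v = l2 u (Dbs v)"
proof -
 obtain I :: "'a set" and w where I: "finite I" "\<And>i. i \<in> I ==> \<exists>c\<in>A. ctest c (w i)" and uw: "u = (\<Sum>i\<in>I. w i)"
  using test_decomposition[OF u] by metis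
 \<comment> \<open>Integrability is part of the induction claim, as the integral is additive on
   integrable functions.\<close>
 let ?P = "\<lambda>u. sf u \<and> integrable (volume_measure A \<omega>) (pin u (Dbs v)) \<and>
  integrable (volume_measure A \<omega>) (pin (Dbar_minus_eta \<eta> u) v) \<and> l2 (Dbar_minus_eta \<eta> u) v = l2 u (Dbs v)"
 have ct: "?P u" if "c \<in> A" "ctest c u" for c u
  using that l2_Dbar_chart[OF that v] l2_ctest_integrable[OF that smooth_ops(4)[OF v]] l2_ctest_integrable[OF that(1) ctest_Dbar[OF that(2)] v]
  unfolding ctest_def by blast
 have "?P (\<Sum>i\<in>I. w i)"
  using I
 proof (induction I rule: finite_induct)
  case empty
  have z: "pin 0 v = (\<lambda>_. 0)" for v
   by (rule HOL.ext, rule pointwise_inner_zero) (simp add: zero_fun_def)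
  have s0: "sf (0 :: ('a, 'n) form)"
   using smooth_cscale[OF smooth_\<omega>, of 0] by (simp add: zero_fun_def)
  have "Dbar_minus_eta \<eta> (\<lambda>c x vs. 0 * \<omega> c x vs) = (\<lambda>c x vs. 0 * Dbar_minus_eta \<eta> \<omega> c x vs)"
   using lin_Dbar smooth_\<omega> unfolding lin_def by blast
  then have D0: "Dbar_minus_eta \<eta> 0 = (0 :: ('a, 'n) form)" by (simp add: zero_fun_def)
  show ?case unfolding sum.empty D0 l2_inner_def z using s0 by (simp add: zero_fun_def)
 next
  case (insert i I)
  then obtain c where "c \<in> A" "ctest c (w i)" by blast
  note 1 = ct[OF this]
  have 2: "?P (\<Sum>i\<in>I. w i)" using insert by blast
  have D: "Dbar_minus_eta \<eta> (w i + (\<Sum>i\<in>I. w i)) = Dbar_minus_eta \<eta> (w i) + Dbar_minus_eta \<eta> (\<Sum>i\<in>I. w i)"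
   using lin_Dbar 1 2 unfolding lin_def by blast
  have e: "(\<Sum>i\<in>insert i I. w i) = w i + (\<Sum>i\<in>I. w i)" by (rule sum.insert[OF insert(1,2)])
  show ?case
   unfolding e D using 1 2 by (intro conjI smooth_add l2_add(2)) (simp_all only: l2_add(1))
 qed
 then show ?thesis unfolding uw by blast
qed

text \<open>Testing against a bump times the form itself makes the integrand nonnegative. If its
  integral vanishes, the open set where it is positive is negligible and therefore empty.\<close>

lemma smooth_form_eq_0:
 assumes w: "sf w" and 0: "\<And>c u. c \<in> A ==> ctest c u ==> l2 u w = 0"
 shows "w = (\<lambda>c x vs. 0)"
proof (intro HOL.ext)
 fix c x vs
 show "w c x vs = 0"
 proof (cases "c \<in> A \<and> x \<in> fst c")
  case True
  then have c: "c \<in> A" "x \<in> fst c" by auto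
  then have z: "snd c x \<in> im c" by blast
  then obtain r where r: "0 < r" "cball (snd c x) r \<subseteq> im c" using im_open[OF c(1)] open_contains_cball by blast
  let ?\<phi> = "bmp c (snd c x) r" and ?S = "snd c ` chart_inv c ` cball (snd c x) r"
  let ?u = "\<lambda>c' y vs. of_real (?\<phi> y) * w c' y vs"
  have su: "sf ?u"
   by (rule smooth_scale[OF w]) (use smooth_bmp[OF c(1) r] in \<open>auto simp: smooth_fun_def o_def intro!: smooth_on_of_real im_open\<close>)
  note b = bmp_support[OF c(1) r]
  have sup: "?u c' y = (\<lambda>_. 0)" if "y \<notin> chart_inv c ` cball (snd c x) r" for c' y by (simp add: b(3)[OF that])
  have ct: "ctest c ?u" unfolding ctest_def using su b(1,2) sup by blast
  define q where "q = (\<lambda>z. dens c z * (?\<phi> (chart_inv c z) * Re (pin w w (chart_inv c z))))"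
  have pw: "0 \<le> Re (pin w w y) \<and> pin w w y = of_real (Re (pin w w y)) \<and>
    (pin w w y = 0 --> w c y vs = 0)" if y: "y \<in> fst c" for y
  proof -
   obtain fs where fs: "frame c y fs" using ex_frame[OF c(1) y] by blast
   then have "dual_basis (set fs) (hpoint.g (\<omega> c y))" by (simp add: hframe.F_dual)
   then show ?thesis
    unfolding pointwise_inner_frame[OF c(1) y fs smooth_is_form[OF w] smooth_is_form[OF w]]
    using inn_self_nonneg[of fs "w c y"] inn_self_eq_0[OF _ _ smooth_alt[OF w], of fs _ c y vs] fs by (auto simp: complex_eq_iff)
  qed
  have inn_u: "pin ?u w y = of_real (?\<phi> y) * pin w w y" for y
   unfolding pointwise_inner_def by (simp add: Let_def sum_distrib_left mult_ac)
  have qc: "continuous_on (im c) q"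
   unfolding q_def using smooth_bmp[OF c(1) r] c(1)
   by (intro continuous_on_mult dens_cont smooth_on_imp_continuous_on[of "im c" "\<lambda>z. ?\<phi> (chart_inv c z)"] continuous_on_Re
     continuous_on_compose2[OF continuous_pointwise_inner[OF w w] chart_inv_cont[OF c(1)]])
    (use chart_inv_in[OF c(1)] chart_subset[OF c(1)] in \<open>auto simp: smooth_fun_def o_def\<close>)
  have S: "compact ?S" "?S \<subseteq> im c"
   using b(1,2) chart_cont[OF c(1)] by (auto intro: compact_continuous_image continuous_on_subset)
  have qi: "integrable lborel (\<lambda>z. indicator ?S z *\<^sub>R q z)"
   by (rule borel_integrable_compact[OF S(1) continuous_on_subset[OF qc S(2)]])
  have q0: "0 \<le> indicator ?S z *\<^sub>R q z" for z
  proof (cases "z \<in> ?S")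
   case True
   then have "z \<in> im c" using S(2) by blast
   then show ?thesis
    using dens_pos[OF c(1)] pw[OF chart_inv_in[OF c(1)]] by (auto simp: q_def bmp_def indicator_def less_imp_le bump_nonneg)
  qed simp
  have "0 = l2 ?u w" using 0[OF c(1) ct] by simp
  also have "\<dots> = (LINT z|lborel. indicator ?S z *\<^sub>R (dens c z *\<^sub>R pin ?u w (chart_inv c z)))"
   by (rule l2_chart(2)[OF c(1) su b(1,2) _ w]) (rule sup)
  also have "\<dots> = (LINT z|lborel. of_real (indicator ?S z *\<^sub>R q z))"
  proof (rule Bochner_Integration.integral_cong[OF refl])
   fix z
   show "indicator ?S z *\<^sub>R (dens c z *\<^sub>R pin ?u w (chart_inv c z)) = of_real (indicator ?S z *\<^sub>R q z)"
   proof (cases "z \<in> ?S")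
    case True
    then have "z \<in> im c" using S(2) by blast
    then have p: "pin w w (chart_inv c z) = of_real (Re (pin w w (chart_inv c z)))"
     using pw[OF chart_inv_in[OF c(1)]] by blast
    show ?thesis unfolding inn_u q_def by (subst p) (simp add: scaleR_complex)
   qed simp
  qed
  also have "\<dots> = of_real (LINT z|lborel. indicator ?S z *\<^sub>R q z)" by (rule integral_of_real[OF qi])
  finally have "(LINT z|lborel. indicator ?S z *\<^sub>R q z) = 0" by simp
  then have ae: "AE z in lborel. indicator ?S z *\<^sub>R q z = 0"
   using integral_nonneg_eq_0_iff_AE[OF qi] q0 by simp
  have Sb: "?S = cball (snd c x) r"
   using chart_chart_inv[OF c(1)] r(2) by (force simp: image_image)
  define B where "B = ball (snd c x) r \<inter> q -` {0<..}"
  have oB: "open B"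
  proof -
   have "continuous_on (ball (snd c x) r) q" using r(2) by (intro continuous_on_subset[OF qc]) auto
   then show ?thesis
    unfolding B_def using continuous_on_open_vimage[OF open_ball, of "snd c x" r q] by (metis Int_commute open_greaterThan)
  qed
  have "B \<in> null_sets lborel"
  proof -
   have "AE z in lborel. z \<notin> B" using ae by (rule AE_mp) (auto simp: B_def Sb)
   then show ?thesis using oB by (subst (asm) AE_iff_null_sets[symmetric]) auto
  qed
  then have "negligible B" using negligible_iff_null_sets null_sets_completionI by blast
  then have "B = {}" using open_not_negligible[OF oB] by blast
  then have "snd c x \<notin> B" by blast
  then have "q (snd c x) \<le> 0" using r(1) by (simp add: B_def not_less)
  moreover have "0 < dens c (snd c x)" "0 < ?\<phi> x" using dens_pos[OF c(1) z] bmp_pos_iff[OF c(1) r, of x] c r(1) by auto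
  ultimately have "Re (pin w w x) = 0"
   using pw[OF c(2)] unfolding q_def chart_inv_chart[OF c] by (auto simp: mult_le_0_iff)
  then show ?thesis using pw[OF c(2)] by (metis of_real_0)
 next
  case False
  then show ?thesis using form_out[OF smooth_is_form[OF w]] by metis
 qed
qed

lemma smooth_form_eqI:
 assumes "sf w" "sf w'" "\<And>c u. c \<in> A ==> ctest c u ==> l2 u w = l2 u w'"
 shows "w = w'"
proof -
 have "w - w' = (\<lambda>c x vs. 0)"
  by (rule smooth_form_eq_0[OF smooth_diff[OF assms(1,2)]]) (simp add: l2_diff_right assms)
 then show ?thesis by (simp add: fun_eq_iff)
qed

lemma ctest_test:
 assumes "c \<in> A" "ctest c u" shows "sf u" "compact_support A u"
 using assms chart_subset unfolding ctest_def compact_support_def by (blast, meson order_trans)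

text \<open>Discharges the definite description: any smooth form satisfying the adjoint relation is
  the only one, because test forms separate smooth forms.\<close>

lemma formal_adjoint_eqI:
 assumes w: "sf w" and adj: "\<And>u. sf u ==> compact_support A u ==> l2 (P u) v = l2 u w"
 shows "formal_adjoint A \<omega> P v = w"
 unfolding formal_adjoint_def
proof (rule the_equality)
 show "sf w \<and> (\<forall>u. sf u \<and> compact_support A u --> l2 (P u) v = l2 u w)" using assms by blast
 fix w' assume w': "sf w' \<and> (\<forall>u. sf u \<and> compact_support A u --> l2 (P u) v = l2 u w')"
 show "w' = w"
 proof (rule smooth_form_eqI)
  fix c u assume "c \<in> A" "ctest c u"
  note t = ctest_test[OF this]
  have "l2 (P u) v = l2 u w'" using w' t by blast
  then show "l2 u w' = l2 u w" using adj[OF t] by simp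
 qed (use w w' in auto)
qed

lemma l2_pointwise:
 assumes "sf u" "sf u'" "sf v" "sf v'"
  and e: "\<And>c x fs. c \<in> A ==> x \<in> fst c ==> frame c x fs ==> inn fs (u c x) (v c x) = inn fs (u' c x) (v' c x)"
 shows "l2 u v = l2 u' v'"
 unfolding l2_inner_def
proof (rule Bochner_Integration.integral_cong[OF refl])
 fix x assume "x \<in> space (volume_measure A \<omega>)"
 then have "x \<in> carrier A" using sets_eq_imp_space_eq[OF sets_volume] space_BM by auto
 then obtain c where c: "c \<in> A" "x \<in> fst c" by (auto simp: carrier_def)
 obtain fs where fs: "frame c x fs" using ex_frame[OF c] by blast
 show "pin u v x = pin u' v' x"
  unfolding pointwise_inner_frame[OF c fs smooth_is_form[OF assms(1)] smooth_is_form[OF assms(3)]]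
   pointwise_inner_frame[OF c fs smooth_is_form[OF assms(2)] smooth_is_form[OF assms(4)]] by (rule e[OF c fs])
qed

end

section \<open>The Bochner-Kodaira-Nakano identity\<close>

lemma alt_wedge_degree:
 "of_nat (length vs) * alt_wedge q p vs =
  alt_wedge (\<lambda>vs. of_nat (length vs) * q vs) p vs + alt_wedge q (\<lambda>vs. of_nat (length vs) * p vs) vs"
proof -
 have "length (nths vs I) + length (nths vs (- I)) = length vs" for I
 proof -
  have "{i. i < length vs \<and> i \<in> I} \<union> {i. i < length vs \<and> i \<in> - I} = {..<length vs}" by auto
  then show ?thesis unfolding length_nths by (subst card_Un_disjoint[symmetric]) auto
 qed
 then have l: "of_nat (length vs) = (of_nat (length (nths vs I)) + of_nat (length (nths vs (- I))) :: complex)" for I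
  by (metis of_nat_add)
 show ?thesis
  unfolding alt_wedge_def sum_distrib_left sum.distrib[symmetric]
 proof (rule sum.cong[OF refl])
  fix I
  let ?s = "(-1) ^ card {(i, j). i \<in> I \<and> j \<in> {..<length vs} - I \<and> j < i} :: complex"
  show "of_nat (length vs) * (?s * q (nths vs I) * p (nths vs (- I))) =
   ?s * (of_nat (length (nths vs I)) * q (nths vs I)) * p (nths vs (- I)) +
   ?s * q (nths vs I) * (of_nat (length (nths vs (- I))) * p (nths vs (- I)))"
   unfolding l[of I] by (simp only: algebra_simps)
 qed
qed

text \<open>Scalar multiplication under its own name, so that rewriting can pull scalars out of
  linear operators without unfolding forms.\<close>

definition sc :: "complex => ('a, 'n) form => ('a, 'n) form" where
 "sc a u = (\<lambda>c x vs. a * u c x vs)"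

context atlas
begin

lemma lin_smooth: "lin P ==> sf u ==> sf (P u)"
 and lin_add: "lin P ==> sf u ==> sf v ==> P (u + v) = P u + P v"
 and lin_sc: "lin P ==> sf u ==> P (sc a u) = sc a (P u)"
 unfolding lin_def sc_def by blast+

lemma smooth_sc: "sf u ==> sf (sc a u)"
 unfolding sc_def by (rule smooth_cscale)

lemma lin_diff: "lin P ==> sf u ==> sf v ==> P (u - v) = P u - P v"
proof -
 assume P: "lin P" and uv: "sf u" "sf v"
 have "u - v = u + sc (- 1) v" "P u - P v = P u + sc (- 1) (P v)" by (auto simp: sc_def fun_eq_iff)
 then show ?thesis using P uv by (simp only: lin_add lin_sc smooth_sc)
qed

lemmas lin_rules = lin_smooth lin_add lin_diff lin_sc

end

lemma thp_zero_degree: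
 assumes "\<And>vs. length vs \<noteq> k ==> q vs = 0" "length vs \<noteq> k"
 shows "thp s q vs = 0"
 unfolding thp_eq_sum_Pow using assms by simp

context eta_atlas
begin

lemma D_degree:
 fixes u :: "('a, 'n) form"
 assumes "\<And>c x vs. length vs \<noteq> k ==> u c x vs = 0" "length vs \<noteq> Suc k"
 shows "D_eta \<eta> u c x vs = 0"
proof -
 let ?W = "\<lambda>y. thp (of_real (1 / \<eta> (chart_inv c y))) (u c (chart_inv c y))"
 have "dl ?W z vs = 0" if "length vs \<noteq> Suc k" for vs z
 proof -
  have "(\<lambda>y. ?W y (take i vs @ drop (Suc i) vs)) = (\<lambda>_. 0)" if "i < length vs" for i
   using that \<open>length vs \<noteq> Suc k\<close> by (intro HOL.ext thp_zero_degree[where k = k] assms(1)) auto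
  then show ?thesis unfolding dl_def by (simp add: frechet_derivative_const)
 qed
 then show ?thesis
  unfolding D_eta_def o_def theta_thp ext_d_dl
  by (intro thp_zero_degree[where k = "Suc k"] assms(2)) (simp add: ext_d_dl del: of_real_divide)
qed

lemma D_wedge:
 assumes u: "sf u" and v: "sf v"
 shows "D_eta \<eta> (wedge_op u v) = wedge_op (D_eta \<eta> u) v + wedge_op (\<lambda>c x. sg (u c x)) (D_eta \<eta> v)"
proof (intro HOL.ext)
 fix c x vs
 show "D_eta \<eta> (wedge_op u v) c x vs = (wedge_op (D_eta \<eta> u) v + wedge_op (\<lambda>c x. sg (u c x)) (D_eta \<eta> v)) c x vs"
 proof (cases "c \<in> A \<and> x \<in> fst c")
  case True
  then have c: "c \<in> A" "x \<in> fst c" and z: "snd c x \<in> im c" by auto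
  then show ?thesis
   using Dl_alt_wedge[OF smooth_alt[OF u] sfield_dfield[OF smooth_sfield[OF u c(1)] z] smooth_alt[OF v]
     sfield_dfield[OF smooth_sfield[OF v c(1)] z] e_diff[OF c(1) z] e_nz[OF c(1) z], of vs]
   by (simp add: D_Dl[OF c] wedge_op_def chart_inv_chart[OF c])
 next
  case False
  then show ?thesis
   using form_out[OF smooth_is_form[OF smooth_D[OF smooth_wedge[OF u v]]]] form_out[OF smooth_is_form[OF v]]
    form_out[OF smooth_is_form[OF smooth_D[OF v]]]
   by (simp add: wedge_op_def alt_wedge_zero_right)
 qed
qed

end

section \<open>Commutators of the first-order operators with \<omega> and \<Lambda>\<close>

context herm
begin

definition Nn :: "('a, 'n) operator" where
 "Nn u = (\<lambda>c x vs. (of_nat CARD('n) - of_nat (length vs)) * u c x vs)"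

lemma smooth_Nn:
 assumes "sf u" shows "sf (Nn u)"
proof (rule smooth_formI)
 note u = smooth_form[OF assms]
 show "is_form A (Nn u)"
  unfolding Nn_def by (rule is_form_pointwise[OF u(1)]) (simp_all add: alt_degree[of _ "\<lambda>k. of_nat CARD('n) - of_nat k"])
 show "sfield (im c) (rp c (Nn u))" if "c \<in> A" for c
  using u(2)[OF that] unfolding sfield_def Nn_def by (auto intro: smooth_on_mult[OF im_open[OF that]])
qed

abbreviation W :: "('a, 'n) operator" where "W \<equiv> wedge_op \<omega>"
abbreviation D :: "('a, 'n) operator" where "D \<equiv> D_eta \<eta>"
abbreviation B :: "('a, 'n) operator" where "B \<equiv> Dbar_minus_eta \<eta>"
abbreviation G :: "('a, 'n) operator" where "G \<equiv> wedge_op \<gamma>"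
abbreviation H :: "('a, 'n) operator" where "H \<equiv> wedge_op \<gamma>'"

lemma lins: "lin Lh" "lin D" "lin B" "lin G" "lin H" "lin W" "lin Nn"
proof -
 show "lin Lh"
  unfolding lin_def
  by (auto simp: smooth_Lh)
   (auto simp: Lh_def LamG_def plus_fun_def sum.distrib add_divide_distrib sum_distrib_left intro!: HOL.ext)
 show "lin Nn"
  unfolding lin_def by (auto simp: smooth_Nn) (auto simp: Nn_def plus_fun_def algebra_simps intro!: HOL.ext)
qed (rule lin_D lin_Dbar lin_wedge smooth_D smooth_Dbar smooth_\<omega>)+

text \<open>Rules that expand composites of the operators on combinations of smooth forms into
  linear combinations of words; their side conditions are smoothness of the arguments.\<close>

lemmas word = lin_rules[OF lins(1)] lin_rules[OF lins(2)] lin_rules[OF lins(3)] lin_rules[OF lins(4)] lin_rules[OF lins(5)]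
 lin_rules[OF lins(6)] lin_rules[OF lins(7)] smooth_add smooth_diff smooth_sc

lemma \<gamma>_degree:
 assumes "length vs \<noteq> 3" shows "\<gamma> c x vs = 0" "\<gamma>' c x vs = 0"
proof -
 have \<omega>2: "\<omega> c x vs = 0" if "length vs \<noteq> 2" for c x vs
  using hpoint.w_deg[OF \<omega>_hp that] form_out[OF smooth_is_form[OF smooth_\<omega>]] by (cases "c \<in> A \<and> x \<in> fst c") auto
 show "\<gamma>' c x vs = 0" by (rule D_degree[where k = 2, OF \<omega>2]) (use assms in auto)
 have "D_eta (\<lambda>x. - \<eta> x) \<omega> c x vs = 0" by (rule eta_atlas.D_degree[OF minus, where k = 2, OF \<omega>2]) (use assms in auto)
 then show "\<gamma> c x vs = 0" unfolding Dbar_minus_eta_def conj_op_def \<omega>_real by (simp add: conj_form_def)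
qed

lemma sg_\<gamma>: "sg (\<gamma> c x) = (\<lambda>vs. - \<gamma> c x vs)"
proof
 fix vs show "sg (\<gamma> c x) vs = - \<gamma> c x vs" using \<gamma>_degree(1)[of vs c x] by (cases "length vs = 3") auto
qed

lemma sg_\<omega>: "sg (\<omega> c x) = \<omega> c x"
proof
 fix vs show "sg (\<omega> c x) vs = \<omega> c x vs"
  using hpoint.w_deg[OF \<omega>_hp, of c x vs] form_out[OF smooth_is_form[OF smooth_\<omega>], of c x]
  by (cases "c \<in> A \<and> x \<in> fst c"; cases "length vs = 2") auto
qed

text \<open>The sign in the antiderivation rule is that of the three-form \<gamma>, so the graded
  commutator of D and G is multiplication by D \<gamma>.\<close>

lemma D_G:
 assumes v: "sf v"
 shows "wedge_op (D_eta \<eta> \<gamma>) v = D (G v) + G (D v)"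
proof -
 have "wedge_op (\<lambda>c x. sg (\<gamma> c x)) (D v) = - G (D v)"
  unfolding sg_\<gamma> wedge_op_def fun_Compl_def using alt_wedge_scale_left[of "- 1"] by (intro HOL.ext) simp
 then show ?thesis using D_wedge[OF smooth_Dbar[OF smooth_\<omega>] v] by simp
qed

text \<open>The antiderivation rule for D at -\<eta> is conjugated; \<omega> is real, and its even
  degree removes the sign.\<close>

lemma B_W:
 assumes v: "sf v"
 shows "B (W v) = G v + W (B v)"
proof -
 have c: "conj_form (wedge_op a b) = wedge_op (conj_form a) (conj_form b)" for a b :: "('a, 'n) form"
  by (simp add: conj_form_def wedge_op_def alt_wedge_cnj)
 have a: "conj_form (a + b) = conj_form a + conj_form b" for a b :: "('a, 'n) form"
  by (simp add: conj_form_def fun_eq_iff)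
 have "D_eta (\<lambda>x. - \<eta> x) (wedge_op \<omega> (conj_form v)) =
   wedge_op (D_eta (\<lambda>x. - \<eta> x) \<omega>) (conj_form v) + wedge_op \<omega> (D_eta (\<lambda>x. - \<eta> x) (conj_form v))"
  using eta_atlas.D_wedge[OF minus smooth_\<omega> smooth_conj[OF v]] unfolding sg_\<omega> .
 then show ?thesis
  unfolding Dbar_minus_eta_def conj_op_def c \<omega>_real by (simp add: a c \<omega>_real)
qed

lemma pt_eqI:
 assumes "sf u" "sf v" "\<And>c x fs. c \<in> A ==> x \<in> fst c ==> frame c x fs ==> u c x = v c x"
 shows "u = v"
proof (intro HOL.ext)
 fix c x vs
 show "u c x vs = v c x vs"
  using ex_frame[of c x] assms(3)[of c x] form_out[OF smooth_is_form[OF assms(1)], of c x] form_out[OF smooth_is_form[OF assms(2)], of c x]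
  by (cases "c \<in> A \<and> x \<in> fst c") auto
qed

lemma L_W: "sf v ==> Lh (W v) = W (Lh v) + Nn v"
proof (rule pt_eqI)
 fix c x fs assume v: "sf v" and c: "c \<in> A" "x \<in> fst c" and fs: "frame c x fs"
 have "adL (set fs) (alt_wedge (\<omega> c x)) (v c x) vs = (of_nat CARD('n) - of_nat (length vs)) * v c x vs" for vs
  by (rule hframe.ad_w[OF conjunct1[OF fs] smooth_alt[OF v]])
 moreover have "Lh (W v) c x = Lam (set fs) (alt_wedge (\<omega> c x) (v c x))" "Lh v c x = Lam (set fs) (v c x)"
  using Lh_frame[OF fs smooth_is_form[OF smooth_wedge[OF smooth_\<omega> v]]] Lh_frame[OF fs smooth_is_form[OF v]] by (simp_all add: wedge_op_def)
 ultimately show "Lh (W v) c x = (W (Lh v) + Nn v) c x"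
  by (intro HOL.ext) (simp add: adL_def wedge_op_def Nn_def algebra_simps)
qed (simp_all add: word smooth_Nn)

lemma H_W: "sf v ==> H (W v) = W (H v)"
proof (rule pt_eqI)
 fix c x fs assume v: "sf v" and c: "c \<in> A" "x \<in> fst c" and fs: "frame c x fs"
 interpret hframe "\<omega> c x" "set fs" using fs by blast
 have ss: "(\<lambda>ws. (- 1) ^ length ws * ((- 1) ^ length ws * q ws)) = q" for q :: "'n alt"
  by (simp add: mult.assoc[symmetric] power_mult_distrib[symmetric])
 have w: "alt_wedge (\<omega> c x) q = (\<lambda>vs. 1 / 2 * (\<Sum>f\<in>set fs. ext (\<lambda>v. of_real (g f v)) (ext (\<lambda>v. \<omega> c x [f, v]) q) vs))" for q
  using wedge_two[OF w_alt w_deg] by simp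
 have e: "alt_wedge \<psi> (ext a p) = ext a (alt_wedge (sg \<psi>) p)" for \<psi> p :: "'n alt" and a
  by (rule HOL.ext) (rule alt_wedge_ext_right)
 show "H (W v) c x = W (H v) c x"
  unfolding wedge_op_def w by (intro HOL.ext) (simp only: alt_wedge_scale_right alt_wedge_sum_right e ss)
qed (simp_all add: word)

lemma N_H: "sf v ==> H (Nn v) = Nn (H v) + sc 3 (H v)"
proof -
 have "alt_wedge (\<lambda>vs. of_nat (length vs) * \<gamma>' c x vs) p = (\<lambda>vs. 3 * alt_wedge (\<gamma>' c x) p vs)" for c x p
 proof -
  have "(\<lambda>vs. of_nat (length vs) * \<gamma>' c x vs) = (\<lambda>vs. 3 * \<gamma>' c x vs)"
  proof
   fix vs show "of_nat (length vs) * \<gamma>' c x vs = 3 * \<gamma>' c x vs" using \<gamma>_degree(2)[of vs c x] by (cases "length vs = 3") auto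
  qed
  then show ?thesis by (simp add: alt_wedge_scale_left[abs_def])
 qed
 then show ?thesis
  using alt_wedge_degree[of _ "\<gamma>' _ _" "v _ _"]
  by (intro HOL.ext) (simp add: Nn_def wedge_op_def sc_def left_diff_distrib alt_wedge_diff_right alt_wedge_scale_right)
qed

lemma N_L: "sf v ==> Lh (Nn v) = Nn (Lh v) - sc 2 (Lh v)"
 by (intro HOL.ext)
  (simp only: Nn_def Lh_def LamG_def sc_def minus_apply length_Cons of_nat_Suc sum_distrib_left[symmetric], simp add: field_simps)

abbreviation tbs :: "('a, 'n) operator" where "tbs v \<equiv> sc (- \<i> / 2) (adh (adh H) v)"

lemma Gs_sc: "Gs v = sc (\<i> / 6) (adh (adh (adh H)) v)" by (simp add: Gs_def sc_def)

text \<open>\<open>W\<close>, \<open>Lh\<close> and \<open>Nn\<close> satisfy the relations of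
  sl(2), while \<open>H\<close> commutes with \<open>W\<close> and has weight -3 under
  \<open>Nn\<close>. The commutators of ad H, ad^2 H and ad^3 H with \<open>W\<close> then carry the
  coefficients -3, -4 and -3, and (i/6)(-3) = -i/2.\<close>

lemma Gs_W:
 assumes v: "sf v"
 shows "Gs (W v) - W (Gs v) = tbs v"
proof -
 have "adh (adh (adh H)) (W v) - W (adh (adh (adh H)) v) = sc (- 3) (adh (adh H) v)"
  unfolding adh_def by (simp only: word v L_W H_W N_H N_L) (simp add: sc_def fun_eq_iff algebra_simps)
 moreover have "Gs (W v) - W (Gs v) = sc (\<i> / 6) (adh (adh (adh H)) (W v) - W (adh (adh (adh H)) v))"
 proof -
  have "sf (adh (adh (adh H)) v)" by (intro smooth_adh lin_smooth[OF lins(5)] v; assumption)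
  then show ?thesis unfolding Gs_sc by (simp only: word v) (simp add: sc_def fun_eq_iff right_diff_distrib)
 qed
 ultimately show ?thesis by (simp add: sc_def)
qed

end

section \<open>The formal adjoints and the reduction to words in D, B, G and \<Lambda>\<close>

context herm
begin

lemma inn_Lh:
 assumes c: "c \<in> A" "x \<in> fst c" and fs: "frame c x fs" and u: "sf u"
 shows "inn fs (Lh u c x) (v c x) = inn fs (u c x) (W v c x)"
proof -
 have "inn fs (Lh u c x) (v c x) = cnj (inn fs (v c x) (Lh u c x))" by (simp add: inn_cnj)
 also have "\<dots> = cnj (inn fs (W v c x) (u c x))" unfolding inn_wedge_\<omega>[OF c fs u] ..
 finally show ?thesis by (simp add: inn_cnj)
qed

lemma Lambda_eq: "sf v ==> Lambda A \<omega> v = Lh v"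
 unfolding Lambda_def
 by (rule formal_adjoint_eqI[OF smooth_Lh], assumption, rule l2_pointwise)
  (auto intro: smooth_wedge smooth_\<omega> smooth_Lh inn_wedge_\<omega>)

lemma adjoint_G: "sf v ==> formal_adjoint A \<omega> G v = Gs v"
 by (rule formal_adjoint_eqI[OF smooth_ops(1)], assumption, rule l2_pointwise)
  (auto intro: smooth_wedge smooth_Dbar smooth_\<omega> smooth_ops inn_wedge_\<gamma>)

lemma adjoint_ps:
 assumes v: "sf v"
 shows "formal_adjoint A \<omega> (wedge_op (dbar_minus_eta \<eta> (form_of_fun A \<eta>))) v = bs v"
  "formal_adjoint A \<omega> (wedge_op (d_eta \<eta> (form_of_fun A \<eta>))) v = as v"
proof -
 note ops = smooth_ops(2,3)[OF v]
 show "formal_adjoint A \<omega> (wedge_op (dbar_minus_eta \<eta> (form_of_fun A \<eta>))) v = bs v"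
  unfolding psb_def[symmetric]
  by (rule formal_adjoint_eqI[OF ops(1)], rule l2_pointwise) (auto intro: smooth_wedge smooth_ps ops v inn_wedge_ps)
 show "formal_adjoint A \<omega> (wedge_op (d_eta \<eta> (form_of_fun A \<eta>))) v = as v"
  unfolding psa_def[symmetric]
  by (rule formal_adjoint_eqI[OF ops(2)], rule l2_pointwise) (auto intro: smooth_wedge smooth_ps ops v inn_wedge_ps)
qed

lemma adjoint_B: "sf v ==> formal_adjoint A \<omega> B v = Dbs v"
 by (rule formal_adjoint_eqI[OF smooth_ops(4)]) (auto intro: l2_Dbar)

lemma taubar_eq: "sf v ==> taubar_minus_eta A \<omega> \<eta> v = adh G v"
 by (simp add: taubar_minus_eta_def gcomm_def scale_op_def adh_def Lambda_eq word fun_eq_iff)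

lemma smooth_adhs: "sf v ==> sf (adh G v)" "sf v ==> sf (adh (adh H) v)"
 by (intro smooth_adh word(1) lin_smooth[OF lins(4)] lin_smooth[OF lins(5)]; assumption)+

text \<open>The adjoint of [\<Lambda>, G] is the commutator of the adjoint of G with \<omega> \<and>
  ., which \<open>Gs_W\<close> has evaluated.\<close>

lemma adjoint_taubar:
 assumes v: "sf v"
 shows "formal_adjoint A \<omega> (taubar_minus_eta A \<omega> \<eta>) v = tbs v"
proof (rule formal_adjoint_eqI)
 show "sf (tbs v)" by (intro smooth_sc smooth_adhs v)
 fix u assume u: "sf u"
 have "l2 (adh G u) v = l2 u (tbs v)"
 proof (rule l2_pointwise[OF smooth_adhs(1)[OF u] u v])
  show "sf (tbs v)" by (intro smooth_sc smooth_adhs v)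
  fix c x fs assume c: "c \<in> A" "x \<in> fst c" and fs: "frame c x fs"
  have "inn fs (adh G u c x) (v c x) = inn fs (Lh (G u) c x) (v c x) - inn fs (G (Lh u) c x) (v c x)"
   unfolding adh_def fun_diff_def by (rule inn_diff_left)
  also have "\<dots> = inn fs (u c x) (Gs (W v) c x) - inn fs (Lh u c x) (Gs v c x)"
   by (simp only: inn_Lh[OF c fs] inn_wedge_\<gamma>[OF c fs] word u v)
  also have "\<dots> = inn fs (u c x) (tbs v c x)"
   unfolding inn_Lh[OF c fs u] Gs_W[OF v, symmetric] fun_diff_def by (rule inn_diff_right[symmetric])
  finally show "inn fs (adh G u c x) (v c x) = inn fs (u c x) (tbs v c x)" .
 qed
 then show "l2 (taubar_minus_eta A \<omega> \<eta> u) v = l2 u (tbs v)" by (simp only: taubar_eq[OF u])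
qed

lemma conj_adh: "conj_form (adh P (conj_form v)) = adh (conj_op P) v"
proof -
 have "conj_form (Lh u) = Lh (conj_form u)" for u by (simp add: conj_form_def Lh_def LamG_def)
 then have l: "Lh (conj_form u) = conj_form (Lh u)" for u by simp
 have d: "conj_form (a - b) = conj_form a - conj_form b" for a b :: "('a, 'n) form" by (simp add: conj_form_def fun_eq_iff)
 show ?thesis unfolding adh_def conj_op_def d l ..
qed

lemma conj_wedge: "conj_op (wedge_op \<psi>) = wedge_op (conj_form \<psi>)"
 by (simp add: conj_op_def conj_form_def wedge_op_def fun_eq_iff alt_wedge_cnj)

text \<open>Conjugation turns i into -i and the three-form belonging to D at -\<eta> into \<gamma>.
  The sign of \<eta> enters the last term twice, through d\<eta> and through 1/\<eta>, so the term
  with n keeps its sign.\<close>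

lemma Ds_conj:
 shows "conj_form (herm.Dbs A (\<lambda>x. - \<eta> x) \<omega> (conj_form v)) = Ds v"
proof -
 interpret m: herm A "\<lambda>x. - \<eta> x" \<omega> by (rule minus_herm)
 have D: "conj_op (D_eta (\<lambda>x. - \<eta> x)) = B" by (simp add: Dbar_minus_eta_def)
 have g: "conj_op m.H = G"
  unfolding conj_wedge Dbar_minus_eta_def conj_op_def \<omega>_real ..
 have adh2: "conj_op (adh P) = adh (conj_op P)" for P
  by (rule HOL.ext) (simp add: conj_op_def[of "adh P"] conj_adh)
 have f: "form_of_fun A (\<lambda>x. - \<eta> x) = sc (- 1) (form_of_fun A \<eta>)"
  by (auto simp: form_of_fun_def sc_def fun_eq_iff)
 have df: "m.dfun = sc (- 1) dfun"
  unfolding m.dfun_def dfun_def f by (rule lin_sc[OF lin_ext_d smooth_form_of_eta])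
 have "m.psa = sc (- 1) (theta (\<lambda>x. - \<eta> x) dfun)"
  unfolding m.psa_theta df dfun_def by (rule lin_sc[OF lin_theta[OF m.\<eta>_smooth] smooth_ext_d[OF smooth_form_of_eta]])
 then have psa: "conj_form m.psa = sc (- 1) psb" by (simp add: psb_theta conj_form_def sc_def)
 have wm: "wedge_op (sc (- 1) \<psi>) = (\<lambda>u. sc (- 1) (wedge_op \<psi> u))" for \<psi> :: "('a, 'n) form"
  using alt_wedge_scale_left[of "- 1"] by (intro HOL.ext) (simp add: wedge_op_def sc_def)
 have am: "adh (\<lambda>u. sc (- 1) (P u)) u = sc (- 1) (adh P u)" for P u
  by (simp add: adh_def sc_def Lh_def LamG_def fun_eq_iff sum_negf)
 have "conj_form (m.bs (conj_form v)) = sc \<i> (conj_form (adh (wedge_op m.psa) (conj_form v)))"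
  by (simp add: m.bs_def conj_form_def sc_def)
 also have "\<dots> = sc (- 1) (as v)"
  unfolding conj_adh conj_wedge psa wm am by (simp add: as_def sc_def)
 finally have b: "conj_form (m.bs (conj_form v)) = sc (- 1) (as v)" .
 have "conj_form (m.Dbs (conj_form v)) = (\<lambda>c x vs. - \<i> * conj_form (adh (D_eta (\<lambda>x. - \<eta> x)) (conj_form v)) c x vs
   - \<i> / 2 * conj_form (adh (adh m.H) (conj_form v)) c x vs
   - of_nat CARD('n) * (1 / of_real (- \<eta> x) * conj_form (m.bs (conj_form v)) c x vs))"
  unfolding m.Dbs_def by (simp add: conj_form_def)
 then show ?thesis
  unfolding conj_adh adh2 D g b Ds_def by (simp add: sc_def)
qed

lemma adjoint_D:
 assumes v: "sf v"
 shows "formal_adjoint A \<omega> D v = Ds v"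
proof (rule formal_adjoint_eqI[OF smooth_ops(5)[OF v]])
 fix u assume u: "sf u" "compact_support A u"
 interpret m: herm A "\<lambda>x. - \<eta> x" \<omega> by (rule minus_herm)
 have l: "l2 (conj_form a) (conj_form b) = cnj (l2 a b)" for a b
 proof -
  have p: "pin (conj_form a) (conj_form b) = (\<lambda>x. cnj (pin a b x))"
   unfolding pointwise_inner_def by (simp add: Let_def conj_form_def)
  show ?thesis unfolding l2_inner_def p by (rule Bochner_Integration.integral_cnj)
 qed
 have "D u = conj_form (m.B (conj_form u))"
  unfolding Dbar_minus_eta_def conj_op_def by simp
 then have "l2 (D u) v = cnj (l2 (m.B (conj_form u)) (conj_form v))" using l[of "m.B (conj_form u)" "conj_form v"] by simp
 also have "l2 (m.B (conj_form u)) (conj_form v) = l2 (conj_form u) (m.Dbs (conj_form v))"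
 proof (rule m.l2_Dbar[OF smooth_conj[OF u(1)] _ smooth_conj[OF v]])
  show "compact_support A (conj_form u)" using u(2) unfolding compact_support_def conj_form_def by (metis complex_cnj_zero)
 qed
 also have "cnj \<dots> = l2 u (Ds v)" 
 proof -
  have "m.Dbs (conj_form v) = conj_form (Ds v)" using arg_cong[OF Ds_conj[of v], of conj_form] by simp
  then show ?thesis by (simp add: l)
 qed
 finally show "l2 (D u) v = l2 u (Ds v)" .
qed

text \<open>G is the commutator of B with \<omega> \<and> ., so its adjoint is the commutator of
  \<Lambda> with the adjoint of B. The two smooth forms are compared by testing.\<close>

lemma Gs_eq_adh_Dbs:
 assumes v: "sf v"
 shows "Gs v = adh Dbs v"
proof (rule smooth_form_eqI)
 show "sf (Gs v)" "sf (adh Dbs v)" by (intro smooth_ops smooth_adh v; assumption)+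
 fix c u assume c: "c \<in> A" and u: "ctest c u"
 note su = ctest_test[OF c u]
 have ctW: "ctest c (wedge_op \<psi> u)" if \<psi>: "sf \<psi>" and u: "ctest c u" for \<psi> u
 proof -
  obtain K where K: "sf u" "compact K" "K \<subseteq> fst c" "\<forall>c' x. x \<notin> K --> u c' x = (\<lambda>_. 0)"
   using u unfolding ctest_def by blast
  then have "\<forall>c' x. x \<notin> K --> wedge_op \<psi> u c' x = (\<lambda>_. 0)"
   by (simp add: wedge_op_def alt_wedge_zero_right[abs_def])
  then show ?thesis using smooth_wedge[OF \<psi> K(1)] K(2,3) unfolding ctest_def by blast
 qed
 note cW = ctW[OF smooth_\<omega> u] and cB = ctest_Dbar[OF u]
 have W: "l2 (W a) b = l2 a (Lh b)" if "sf a" "sf b" for a b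
  by (rule l2_pointwise) (auto intro: that word smooth_Lh inn_wedge_\<omega>)
 have "l2 u (adh Dbs v) = l2 u (Lh (Dbs v)) - l2 u (Dbs (Lh v))"
  unfolding adh_def by (rule l2_diff_right[OF c u]) (intro smooth_Lh smooth_ops v)+
 also have "\<dots> = l2 (B (W u)) v - l2 (W (B u)) v"
  using l2_Dbar[OF ctest_test[OF c cW] v] l2_Dbar[OF su smooth_Lh[OF v]]
  by (simp add: W su v word smooth_ops)
 also have "l2 (B (W u)) v = l2 (G u) v + l2 (W (B u)) v"
  unfolding B_W[OF su(1)]
  by (intro l2_add l2_ctest_integrable[OF c _ v] ctW smooth_\<omega> smooth_Dbar u cB)
 also have "l2 (G u) v = l2 u (Gs v)"
  by (rule l2_pointwise) (auto intro: su v word smooth_ops inn_wedge_\<gamma>)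
 finally show "l2 u (Gs v) = l2 u (adh Dbs v)" by simp
qed

definition rs :: "('a => complex) => ('a, 'n) form => ('a, 'n) form" where
 "rs f u = (\<lambda>c x vs. f x * u c x vs)"

abbreviation a' :: "('a, 'n) operator" where "a' v \<equiv> rs (\<lambda>x. 1 / of_real (\<eta> x)) (as v)"
abbreviation b' :: "('a, 'n) operator" where "b' v \<equiv> rs (\<lambda>x. 1 / of_real (\<eta> x)) (bs v)"

lemma smooth_ab: "sf v ==> sf (a' v)" "sf v ==> sf (b' v)"
proof -
 have \<eta>: "smooth_on (im c) (\<lambda>z. 1 / complex_of_real (\<eta> (chart_inv c z)))" if "c \<in> A" for c
  by (rule smooth_on_divide[OF im_open[OF that] smooth_on_const smooth_on_of_real[OF im_open[OF that] e_smooth[OF that]]])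
   (simp only: of_real_eq_0_iff not_False_eq_True e_nz[OF that])
 show "sf v ==> sf (a' v)" "sf v ==> sf (b' v)"
  unfolding rs_def by (intro smooth_scale[OF _ \<eta>] smooth_ops; assumption)+
qed

text \<open>\<open>bs\<close> is a contraction and contractions commute with \<Lambda>; so the term
  with n drops out of the commutator of \<Lambda> with \<open>Dbs\<close>.\<close>

lemma b'_Lh: "sf v ==> Lh (b' v) = b' (Lh v)"
proof -
 assume v: "sf v"
 have "Lh (bs v) = bs (Lh v)"
 proof (rule pt_eqI[OF smooth_Lh[OF smooth_ops(2)[OF v]] smooth_ops(2)[OF smooth_Lh[OF v]]])
  fix c x fs assume c: "c \<in> A" "x \<in> fst c" and fs: "frame c x fs"
  have b: "bs w c x = (\<lambda>vs. \<eta> x * cov (set fs) (\<lambda>y. cnj (bec (e c) (snd c x) y)) (w c x) vs)" if "sf w" for w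
   unfolding bs_def adh_ps(1)[OF c fs that] by (simp add: mult.assoc[symmetric])
  show "Lh (bs v) c x = bs (Lh v) c x"
   unfolding b[OF smooth_Lh[OF v]] Lh_frame[OF fs smooth_is_form[OF smooth_ops(2)[OF v]]] Lh_frame[OF fs smooth_is_form[OF v]] b[OF v]
   by (simp add: Lam_scale hframe.Lam_cov[OF conjunct1[OF fs] smooth_alt[OF v]])
 qed
 moreover have "Lh (rs f w) = rs f (Lh w)" for f w
  by (simp add: Lh_def LamG_def rs_def sum_distrib_left)
 ultimately show ?thesis by simp
qed

lemma Dbs_words:
 assumes v: "sf v"
 shows "Dbs v + tbs v = sc \<i> (Lh (D v) - D (Lh v)) - sc (of_nat CARD('n)) (b' v)"
  "Dbs v = sc \<i> (adh D v) - tbs v - sc (of_nat CARD('n)) (b' v)"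
 by (simp_all add: Dbs_def sc_def rs_def adh_def fun_eq_iff)

lemma Ds_words:
 assumes v: "sf v"
 shows "Ds v = sc (- \<i>) (Lh (B v) - B (Lh v)) - sc (\<i> / 2) (Lh (Lh (G v)) - sc 2 (Lh (G (Lh v))) + G (Lh (Lh v)))
  - sc (of_nat CARD('n)) (a' v)"
proof -
 have "adh (adh G) v = Lh (Lh (G v)) - sc 2 (Lh (G (Lh v))) + G (Lh (Lh v))"
  unfolding adh_def by (simp only: word v) (simp add: sc_def fun_eq_iff)
 then show ?thesis by (simp add: Ds_def sc_def rs_def adh_def[of B] fun_eq_iff)
qed

text \<open>Commuting \<Lambda> with the formula for \<open>Dbs\<close> gives Gs = i ad^2(D) + 3 Gs,
  because ad of the torsion term is (i/2) ad^3(H) = 3 Gs. Solving for \<open>Gs\<close> avoids a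
  direct computation of ad^2(D).\<close>

lemma Gs_words:
 assumes v: "sf v"
 shows "Gs v = sc (- \<i> / 2) (Lh (Lh (D v)) - sc 2 (Lh (D (Lh v))) + D (Lh (Lh v)))"
proof -
 have s: "sf (adh D u)" "sf (adh (adh H) u)" "sf (b' u)" if "sf u" for u
  by (intro smooth_adh smooth_adhs smooth_ab smooth_D that; assumption)+
 have "adh Dbs v = Lh (sc \<i> (adh D v) - tbs v - sc (of_nat CARD('n)) (b' v))
   - (sc \<i> (adh D (Lh v)) - tbs (Lh v) - sc (of_nat CARD('n)) (b' (Lh v)))"
  unfolding adh_def[of Dbs] Dbs_words(2)[OF v] Dbs_words(2)[OF smooth_Lh[OF v]] ..
 also have "\<dots> = sc \<i> (adh (adh D) v) + sc (\<i> / 2) (adh (adh (adh H)) v)"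
  unfolding adh_def[of "adh D"] adh_def[of "adh (adh H)"]
  by (simp only: word s v b'_Lh) (simp add: sc_def fun_eq_iff algebra_simps)
 also have "sc (\<i> / 2) (adh (adh (adh H)) v) = sc 3 (Gs v)" by (simp add: Gs_def sc_def)
 finally have e: "Gs v = sc \<i> (adh (adh D) v) + sc 3 (Gs v)" unfolding Gs_eq_adh_Dbs[OF v, symmetric] .
 have "Gs v c x vs = - \<i> / 2 * adh (adh D) v c x vs" for c x vs
 proof -
  have "Gs v c x vs = \<i> * adh (adh D) v c x vs + 3 * Gs v c x vs"
   using fun_cong[OF fun_cong[OF fun_cong[OF e, of c], of x], of vs] by (simp add: sc_def)
  moreover have "Gs v c x vs - (- \<i> / 2 * adh (adh D) v c x vs) = (\<i> * adh (adh D) v c x vs + 3 * Gs v c x vs - Gs v c x vs) / 2"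
   by (simp add: field_simps)
  ultimately show ?thesis by (simp add: eq_neg_iff_add_eq_0)
 qed
 then have "Gs v = sc (- \<i> / 2) (adh (adh D) v)" by (simp add: sc_def fun_eq_iff)
 also have "adh (adh D) v = Lh (Lh (D v)) - sc 2 (Lh (D (Lh v))) + D (Lh (Lh v))"
  unfolding adh_def by (simp only: word v) (simp add: sc_def fun_eq_iff)
 finally show ?thesis .
qed

end

theorem theorem3p8:
  fixes A :: "('a::{t2_space,second_countable_topology}, 'n::finite) chart set"
    and \<omega> :: "('a, 'n) form" and \<eta> :: "'a \<Rightarrow> real" and k :: nat and u :: "('a, 'n) form"
  assumes "hermitian_manifold A \<omega>"
    and "2 \<le> CARD('n)"
    and "smooth_fun A \<eta>"
    and "(\<forall>x\<in>carrier A. 0 < \<eta> x) \<or> (\<forall>x\<in>carrier A. \<eta> x < 0)"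
    and "k \<le> 2 * CARD('n)"
    and "smooth_form A u" and "has_degree k u"
  shows "Delta_eta A \<omega> \<eta> u =
    (gcomm 1 (-1) (Dbar_minus_eta \<eta> + taubar_minus_eta A \<omega> \<eta>)
        (formal_adjoint A \<omega> (Dbar_minus_eta \<eta>) + formal_adjoint A \<omega> (taubar_minus_eta A \<omega> \<eta>))
     + T_eta A \<omega> \<eta>
     + (\<lambda>_. \<i>) \<odot> gcomm 2 (-2) (gcomm 1 1 (D_eta \<eta>) (Dbar_minus_eta \<eta>)) (Lambda A \<omega>)
     + (\<lambda>_. of_nat CARD('n)) \<odot> gcomm 1 (-1) (Dbar_minus_eta \<eta> + taubar_minus_eta A \<omega> \<eta>)
        ((\<lambda>x. 1 / of_real (\<eta> x)) \<odot>
           formal_adjoint A \<omega> (wedge_op (dbar_minus_eta \<eta> (form_of_fun A \<eta>))))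
     - (\<lambda>_. of_nat CARD('n)) \<odot> gcomm 1 (-1) (D_eta \<eta>)
        ((\<lambda>x. 1 / of_real (\<eta> x)) \<odot>
           formal_adjoint A \<omega> (wedge_op (d_eta \<eta> (form_of_fun A \<eta>))))) u"
proof -
 interpret herm A \<eta> \<omega>
 proof unfold_locales
  show "complex_atlas A" using assms(1) by (simp add: hermitian_manifold_def)
  show "x \<in> carrier A ==> \<eta> x \<noteq> 0" for x using assms(4) by auto
 qed (use assms in auto)
 note u = assms(6)
 let ?n = "of_nat CARD('n) :: complex"
 let ?P = "\<lambda>v. B v + adh G v" and ?Q = "\<lambda>v. Dbs v + tbs v"
 \<comment> \<open>Everything is evaluated at a form: the formulas for \<Lambda> and the adjoints
   hold on smooth forms, so each intermediate value must first be known to be smooth.\<close>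
 have gc: "gcomm a b P Q v = P (Q v) - sc ((-1) powi (a * b)) (Q (P v))" for a b and P Q :: "('a, 'n) operator" and v
  by (simp add: gcomm_def scale_op_def sc_def)
 have so: "((\<lambda>_. s) \<odot> P) v = sc s (P v)" "(f \<odot> P) v = rs f (P v)" for s f and P :: "('a, 'n) operator" and v
  by (simp_all add: scale_op_def sc_def rs_def)
 have pw: "(-1::complex) powi (1 * -1) = -1" "(-1::complex) powi (1 * 1) = -1" "(-1::complex) powi (2 * -2) = 1"
  "(-1::complex) powi (-2 * 4) = 1" "(-1::complex) powi (-2 * 2) = 1" "(-1::complex) powi (3 * -3) = -1"
  by (simp_all add: power_int_minus)
 have tau: "(B + taubar_minus_eta A \<omega> \<eta>) v = ?P v" if "sf v" for v
  by (simp add: taubar_eq that)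
 have adj: "(formal_adjoint A \<omega> B + formal_adjoint A \<omega> (taubar_minus_eta A \<omega> \<eta>)) v = ?Q v" if "sf v" for v
  by (simp add: adjoint_B adjoint_taubar that)
 have sP: "sf (?P v)" "sf (?Q v)" if "sf v" for v
  by (intro smooth_add smooth_Dbar smooth_adhs smooth_ops smooth_sc that)+
 \<comment> \<open>Multiplication by D \<gamma>. Through \<open>D_G\<close> it expands into words in
   D and G, so second derivatives of \<omega> do not appear in the bookkeeping.\<close>
 define X where "X = wedge_op (D_eta \<eta> \<gamma>)"
 have sX: "sf (X v)" if "sf v" for v
  unfolding X_def by (intro smooth_wedge smooth_D smooth_Dbar smooth_\<omega> that)
 have Xw: "X v = D (G v) + G (D v)" if "sf v" for v
  unfolding X_def by (rule D_G[OF that])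
 have sG: "sf (G v)" "sf (D v)" "sf (B v)" "sf (Lh v)" if "sf v" for v
  using that by (simp_all only: word)
 note s = sP sX sG smooth_ops smooth_ab smooth_add smooth_diff smooth_sc u
 have l: "Delta_eta A \<omega> \<eta> u = D (Ds u) + Ds (D u)"
  by (simp add: Delta_eta_def adjoint_D s)
 have r1: "gcomm 1 (-1) (B + taubar_minus_eta A \<omega> \<eta>) (formal_adjoint A \<omega> B + formal_adjoint A \<omega> (taubar_minus_eta A \<omega> \<eta>)) u =
   ?P (?Q u) + ?Q (?P u)"
  unfolding gc pw adj[OF u] tau[OF u] tau[OF sP(2)[OF u]] adj[OF sP(1)[OF u]] by (simp add: sc_def fun_eq_iff)
 have g1: "gcomm (-2) 4 (Lambda A \<omega>) X v = Lh (X v) - X (Lh v)" if "sf v" for v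
  unfolding gc pw Lambda_eq[OF that] Lambda_eq[OF sX[OF that]] by (simp add: sc_def fun_eq_iff)
 have r2: "T_eta A \<omega> \<eta> u = sc (- \<i> / 2) (Lh (Lh (X u) - X (Lh u)) - (Lh (X (Lh u)) - X (Lh (Lh u)))) - (G (Gs u) + Gs (G u))"
 proof -
  have "gcomm (-2) 2 (Lambda A \<omega>) (gcomm (-2) 4 (Lambda A \<omega>) X) u = Lh (Lh (X u) - X (Lh u)) - (Lh (X (Lh u)) - X (Lh (Lh u)))"
   unfolding gc[of _ _ "Lambda A \<omega>" "gcomm (-2) 4 (Lambda A \<omega>) X"] pw Lambda_eq[OF u] g1[OF u] g1[OF smooth_Lh[OF u]]
   by (subst Lambda_eq) (simp_all add: s sc_def fun_eq_iff)
  moreover have "gcomm 3 (-3) G (formal_adjoint A \<omega> G) u = G (Gs u) + Gs (G u)"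
   unfolding gc pw adjoint_G[OF u] adjoint_G[OF sG(1)[OF u]] by (simp add: sc_def fun_eq_iff)
  ultimately show ?thesis unfolding T_eta_def X_def by (simp add: so(1))
 qed
 have r3: "gcomm 2 (-2) (gcomm 1 1 D B) (Lambda A \<omega>) u = D (B (Lh u)) + B (D (Lh u)) - Lh (D (B u) + B (D u))"
 proof -
  have g: "gcomm 1 1 D B v = D (B v) + B (D v)" for v
   unfolding gc pw by (simp add: sc_def fun_eq_iff)
  show ?thesis
   unfolding gc[of _ _ _ "Lambda A \<omega>"] pw g Lambda_eq[OF u] by (subst Lambda_eq) (simp_all add: s sc_def fun_eq_iff)
 qed
 let ?i = "\<lambda>x. 1 / complex_of_real (\<eta> x)"
 have r4: "gcomm 1 (-1) (B + taubar_minus_eta A \<omega> \<eta>) (?i \<odot> formal_adjoint A \<omega> (wedge_op (dbar_minus_eta \<eta> (form_of_fun A \<eta>)))) u =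
   ?P (b' u) + b' (?P u)"
  unfolding gc pw so adjoint_ps(1)[OF u] tau[OF u] tau[OF smooth_ab(2)[OF u]] adjoint_ps(1)[OF sP(1)[OF u]] by (simp add: sc_def fun_eq_iff)
 have r5: "gcomm 1 (-1) D (?i \<odot> formal_adjoint A \<omega> (wedge_op (d_eta \<eta> (form_of_fun A \<eta>)))) u = D (a' u) + a' (D u)"
  unfolding gc pw so adjoint_ps(2)[OF u] adjoint_ps(2)[OF sG(2)[OF u]] by (simp add: sc_def fun_eq_iff)
 \<comment> \<open>Jacobi in expanded form: ad^2[D, G] has end terms [ad^2 D, G] and [D, ad^2 G] and
   mixed term 2 [ad D, ad G]. The mixed term cancels against the torsion added to B, the first end
   term against [G, Gs], and the second is the torsion part of \<open>Ds\<close>. What remains is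
   ad[D, B] = [ad D, B] + [D, ad B]; the terms with b cancel and those with a match.\<close>
 have words: "D (Ds u) + Ds (D u) = ?P (?Q u) + ?Q (?P u)
   + (sc (- \<i> / 2) (Lh (Lh (X u) - X (Lh u)) - (Lh (X (Lh u)) - X (Lh (Lh u)))) - (G (Gs u) + Gs (G u)))
   + sc \<i> (D (B (Lh u)) + B (D (Lh u)) - Lh (D (B u) + B (D u)))
   + sc ?n (?P (b' u) + b' (?P u)) - sc ?n (D (a' u) + a' (D u))"
  unfolding Dbs_words(1)[OF u] Dbs_words(1)[OF sP(1)[OF u]]
  unfolding adh_def[of G]
  by (simp only: Ds_words Gs_words Xw word s) (simp add: sc_def fun_eq_iff algebra_simps)
 show ?thesis
  unfolding l words by (simp add: r1 r2 r3 r4 r5 so(1))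
qed

end
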